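(* Let $f:N\to N'$ be a CR mapping between connected open subsets $N,N'$ of $M$. Then there exist a mapping $\psi$ of the form $$\psi(z,z^{n+1})=\big(B_1z_{\sigma(1)},\dots,B_{s-1}z_{\sigma(s-1)},\,B_sz_s+b_s,\;b^{n+1}+z^{n+1}+2i(B_sz_s\cdot\bar b_s)\big),$$ where $\sigma$ is a permutation of $\{1,\dots,s-1\}$ with $m_{\sigma(j)}=m_j$ and $n_{\sigma(j)}=n_j$ for all $j=1,\dots,s-1$, $B_j\in U(n_j)$ are unitary matrices ($j=1,\dots,s$), $b_s\in\mathbb{C}^{n_s}$, and $b^{n+1}=t_1+i|b_s|^2$ with $t_1\in\mathbb{R}$; a number $r>0$; and $a=(a_s,a^{n+1})=(a_s,t_0+i|a_s|^2)\in\mathbb{C}^{n_s}\times\mathbb{C}$ with $t_0\in\mathbb{R}$, such that on $N$ $$f=\psi\circ\delta_r\circ J\circ\phi_a ,$$ where $J$ is either the inversion $I$ or the identity map. Here $$\phi_a(z_1,\dots,z_s,z^{n+1})=(z_1,\dots,z_{s-1},z_s+a_s,\;z^{n+1}+a^{n+1}+2i z_s\cdot\bar a_s),$$ $$\delta_r(z_1,\dots,z_s,z^{n+1})=(r^{1/m_1}z_1,\dots,r^{1/m_{s-1}}z_{s-1},rz_s,r^2z^{n+1}),$$ $$I(z_1,\dots,z_s,z^{n+1})=\Big(\frac{z_1}{(z^{n+1})^{1/m_1}},\dots,\frac{z_{s-1}}{(z^{n+1})^{1/m_{s-1}}},\frac{z_s}{z^{n+1}},-\frac1{z^{n+1}}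\Big).$$
   Context: Fix an integer $s\ge1$ and integers $m_j\ge2$, $n_j\ge2$ for $1\le j\le s-1$, and $n_s\ge0$; put $m_s=1$ and $n=n_1+\cdots+n_s$, and assume $n\ge2$. Write $z=(z_1,\dots,z_s)\in\mathbb{C}^{n_1}\times\cdots\times\mathbb{C}^{n_s}=\mathbb{C}^n$ (if $n_s=0$ the block $z_s$ is absent, as are $B_s,a_s,b_s$ and all terms containing them, so that $a^{n+1}$ and $b^{n+1}$ are real), and $p(z,\bar z)=|z_1|^{2m_1}+\cdots+|z_{s-1}|^{2m_{s-1}}+|z_s|^2$. Let $$M_0=\{(z,z^{n+1})\in\mathbb{C}^{n+1}:\mathrm{Im}(z^{n+1})=p(z,\bar z)\},\qquad M=\Big\{(z,z^{n+1})\in M_0:\prod_{j=1}^{s-1}|z_j|\ne0\Big\}.$$ $M$ is a strictly pseudoconvex real hypersurface. $T^{1,0}M$ denotes the holomorphic tangent bundle. On $M$ fix the contact form $\vartheta=\tfrac12(dz^{n+1}+d\bar z^{n+1})-i\sum_{\alpha=1}^n\big(\tfrac{\partial p}{\partial z^\alpha}dz^\alpha-\tfrac{\partial p}{\partial\bar z^\alpha}d\bar z^\alpha\big)$, where $z^\alpha$ is the $\alpha$-th coordinate of $z\in\mathbb{C}^n$. A CR mapping $f:N\to N'$ between open subsets of $M$ is a diffeomorphism such that $f^*\vartheta=\lambda\vartheta$ for some function $\lambda>0$ on $N$ and the tangent map $f_*$ preserves the complex structure (i.e. $f_*T^{1,0}N=T^{1,0}N'$). For vectors $v,w\in\mathbb{C}^d$,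 $v\cdot\bar w=\sum_\alpha v^\alpha\overline{w^\alpha}$. The roots $(z^{n+1})^{1/m_j}$ are principal branches (when $s\ge2$ one has $\mathrm{Im}\,z^{n+1}>0$ on $M$). *)

theory Defs
  imports "HOL-Analysis.Analysis" "HOL-Combinatorics.Permutations"
begin

(* The ambient space C^n x C is (complex^'n) \<times> complex.  The splitting
   C^n = C^(n_1) \<times> ... \<times> C^(n_s) is given by a labelling e :: 'n \<Rightarrow> nat \<times> nat of the
   coordinates, bijective onto {(j,k). 1 \<le> j \<le> s, k < n j}: the coordinate i with
   e i = (j,k) is the k-th coordinate (counted from 0) of the block z_j.  Vectors of C^d and
   d \<times> d matrices, with d varying, are functions on nat of which only the values at
   indices < d matter. *)

type_synonym 'n amb = "(complex^'n) \<times> complex"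

definition blk :: "('n::finite \<Rightarrow> nat \<times> nat) \<Rightarrow> complex^'n \<Rightarrow> nat \<Rightarrow> (nat \<Rightarrow> complex)"
  where "blk e z j = (\<lambda>k. z $ inv e (j, k))"

definition of_blks :: "('n::finite \<Rightarrow> nat \<times> nat) \<Rightarrow> (nat \<Rightarrow> nat \<Rightarrow> complex) \<Rightarrow> complex^'n"
  where "of_blks e F = (\<chi> i. F (fst (e i)) (snd (e i)))"

definition cnorm :: "nat \<Rightarrow> (nat \<Rightarrow> complex) \<Rightarrow> real"
  where "cnorm d v = L2_set (\<lambda>k. cmod (v k)) {..<d}"

definition cdot :: "nat \<Rightarrow> (nat \<Rightarrow> complex) \<Rightarrow> (nat \<Rightarrow> complex) \<Rightarrow> complex"
  where "cdot d v w = (\<Sum>k<d. v k * cnj (w k))"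

definition mat_vec :: "nat \<Rightarrow> (nat \<Rightarrow> nat \<Rightarrow> complex) \<Rightarrow> (nat \<Rightarrow> complex) \<Rightarrow> (nat \<Rightarrow> complex)"
  where "mat_vec d B v = (\<lambda>k. \<Sum>l<d. B k l * v l)"

definition is_unitary :: "nat \<Rightarrow> (nat \<Rightarrow> nat \<Rightarrow> complex) \<Rightarrow> bool"
  where "is_unitary d B \<longleftrightarrow>
    (\<forall>k<d. \<forall>l<d. (\<Sum>i<d. cnj (B i k) * B i l) = (if k = l then 1 else 0))"

definition pfun ::
    "nat \<Rightarrow> (nat \<Rightarrow> nat) \<Rightarrow> (nat \<Rightarrow> nat) \<Rightarrow> ('n::finite \<Rightarrow> nat \<times> nat) \<Rightarrow> complex^'n \<Rightarrow> real"
  where "pfun s m n e z =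
    (\<Sum>j\<in>{1..<s}. cnorm (n j) (blk e z j) ^ (2 * m j)) + (cnorm (n s) (blk e z s))\<^sup>2"

definition M0 ::
    "nat \<Rightarrow> (nat \<Rightarrow> nat) \<Rightarrow> (nat \<Rightarrow> nat) \<Rightarrow> ('n::finite \<Rightarrow> nat \<times> nat) \<Rightarrow> 'n amb set"
  where "M0 s m n e = {(z, w). Im w = pfun s m n e z}"

definition hypM ::
    "nat \<Rightarrow> (nat \<Rightarrow> nat) \<Rightarrow> (nat \<Rightarrow> nat) \<Rightarrow> ('n::finite \<Rightarrow> nat \<times> nat) \<Rightarrow> 'n amb set"
  where "hypM s m n e =
    {(z, w). (z, w) \<in> M0 s m n e \<and> (\<Prod>j\<in>{1..<s}. cnorm (n j) (blk e z j)) \<noteq> 0}"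

(* Real tangent space of M at a point x of M: the kernel of the differential of the defining
   function Im z^(n+1) - p. *)
definition tangent ::
    "nat \<Rightarrow> (nat \<Rightarrow> nat) \<Rightarrow> (nat \<Rightarrow> nat) \<Rightarrow> ('n::finite \<Rightarrow> nat \<times> nat) \<Rightarrow> 'n amb \<Rightarrow> 'n amb set"
  where "tangent s m n e x =
    {X. frechet_derivative (\<lambda>(z, w). Im w - pfun s m n e z) (at x) X = 0}"

definition iJ :: "('n::finite) amb \<Rightarrow> 'n amb"
  where "iJ X = (\<i> *s fst X, \<i> * snd X)"

(* The fibre of T^{1,0}M at x.  A vector u + \<i> v of the complexified tangent space is the pair
   (u, v) of real tangent vectors; it is of type (1,0) iff v = - iJ u
   (e.g. d/dz = (1/2) (d/dx - \<i> d/dy)). *)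
definition T10 ::
    "nat \<Rightarrow> (nat \<Rightarrow> nat) \<Rightarrow> (nat \<Rightarrow> nat) \<Rightarrow> ('n::finite \<Rightarrow> nat \<times> nat) \<Rightarrow> 'n amb
      \<Rightarrow> ('n amb \<times> 'n amb) set"
  where "T10 s m n e x =
    {(u, v). u \<in> tangent s m n e x \<and> v \<in> tangent s m n e x \<and> v = - iJ u}"

definition d_dz :: "(complex^'n \<Rightarrow> real) \<Rightarrow> complex^'n \<Rightarrow> 'n::finite \<Rightarrow> complex"
  where "d_dz p z \<alpha> =
    (complex_of_real (frechet_derivative p (at z) (axis \<alpha> 1))
      - \<i> * complex_of_real (frechet_derivative p (at z) (axis \<alpha> \<i>))) / 2"

definition d_dzbar :: "(complex^'n \<Rightarrow> real) \<Rightarrow> complex^'n \<Rightarrow> 'n::finite \<Rightarrow> complex"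
  where "d_dzbar p z \<alpha> =
    (complex_of_real (frechet_derivative p (at z) (axis \<alpha> 1))
      + \<i> * complex_of_real (frechet_derivative p (at z) (axis \<alpha> \<i>))) / 2"

(* The contact form at x, evaluated on a real tangent vector X (the value is real). *)
definition theta ::
    "nat \<Rightarrow> (nat \<Rightarrow> nat) \<Rightarrow> (nat \<Rightarrow> nat) \<Rightarrow> ('n::finite \<Rightarrow> nat \<times> nat) \<Rightarrow> 'n amb \<Rightarrow> 'n amb \<Rightarrow> complex"
  where "theta s m n e x X =
    (snd X + cnj (snd X)) / 2
      - \<i> * (\<Sum>\<alpha>\<in>UNIV. d_dz (pfun s m n e) (fst x) \<alpha> * (fst X $ \<alpha>)
                    - d_dzbar (pfun s m n e) (fst x) \<alpha> * cnj (fst X $ \<alpha>))"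

(* C^k on an open set U of a finite-dimensional space. *)
primrec Ck_on ::
    "nat \<Rightarrow> ('a::euclidean_space \<Rightarrow> 'b::real_normed_vector) \<Rightarrow> 'a set \<Rightarrow> bool"
  where
    "Ck_on 0 f U \<longleftrightarrow> continuous_on U f"
  | "Ck_on (Suc k) f U \<longleftrightarrow>
      (\<forall>x\<in>U. f differentiable (at x)) \<and> (\<forall>v. Ck_on k (\<lambda>x. frechet_derivative f (at x) v) U)"

(* Smoothness on a subset N of the ambient space: locally the restriction of a smooth map. *)
definition smooth_map_on :: "('a::euclidean_space \<Rightarrow> 'b::real_normed_vector) \<Rightarrow> 'a set \<Rightarrow> bool"
  where "smooth_map_on f N \<longleftrightarrow>
    (\<forall>x\<in>N. \<exists>U g. open U \<and> x \<in> U \<and> (\<forall>k. Ck_on k g U) \<and> (\<forall>y\<in>N \<inter> U. g y = f y))"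

definition diffeo :: "('a::euclidean_space \<Rightarrow> 'a) \<Rightarrow> 'a set \<Rightarrow> 'a set \<Rightarrow> bool"
  where "diffeo f N N' \<longleftrightarrow>
    bij_betw f N N' \<and> smooth_map_on f N \<and> smooth_map_on (inv_into N f) N'"

(* For N open in M and f smooth on N, the derivative within N is determined exactly on the
   tangent vectors of M, where it is the tangent map of f; pushfwd is only applied to those. *)
definition pushfwd :: "('a::euclidean_space \<Rightarrow> 'a) \<Rightarrow> 'a set \<Rightarrow> 'a \<Rightarrow> 'a \<Rightarrow> 'a"
  where "pushfwd f N x = frechet_derivative f (at x within N)"

definition CR_mapping ::
    "nat \<Rightarrow> (nat \<Rightarrow> nat) \<Rightarrow> (nat \<Rightarrow> nat) \<Rightarrow> ('n::finite \<Rightarrow> nat \<times> nat)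
      \<Rightarrow> 'n amb set \<Rightarrow> 'n amb set \<Rightarrow> ('n amb \<Rightarrow> 'n amb) \<Rightarrow> bool"
  where "CR_mapping s m n e N N' f \<longleftrightarrow>
    diffeo f N N' \<and>
    (\<exists>lam :: 'n amb \<Rightarrow> real. \<forall>x\<in>N. lam x > 0 \<and>
       (\<forall>X\<in>tangent s m n e x.
          theta s m n e (f x) (pushfwd f N x X) = complex_of_real (lam x) * theta s m n e x X)) \<and>
    (\<forall>x\<in>N. (\<lambda>(u, v). (pushfwd f N x u, pushfwd f N x v)) ` T10 s m n e x = T10 s m n e (f x))"

(* t + \<i> |v|^2, the last component of a and b *)
definition last_comp :: "nat \<Rightarrow> real \<Rightarrow> (nat \<Rightarrow> complex) \<Rightarrow> complex"
  where "last_comp d t v = complex_of_real t + \<i> * complex_of_real ((cnorm d v)\<^sup>2)"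

definition psi_map ::
    "nat \<Rightarrow> (nat \<Rightarrow> nat) \<Rightarrow> ('n::finite \<Rightarrow> nat \<times> nat) \<Rightarrow> (nat \<Rightarrow> nat)
      \<Rightarrow> (nat \<Rightarrow> nat \<Rightarrow> nat \<Rightarrow> complex) \<Rightarrow> (nat \<Rightarrow> complex) \<Rightarrow> real \<Rightarrow> 'n amb \<Rightarrow> 'n amb"
  where "psi_map s n e \<sigma> B b t = (\<lambda>(z, w).
    (of_blks e (\<lambda>j k. if j = s then mat_vec (n s) (B s) (blk e z s) k + b k
                       else mat_vec (n j) (B j) (blk e z (\<sigma> j)) k),
     last_comp (n s) t b + w + 2 * \<i> * cdot (n s) (mat_vec (n s) (B s) (blk e z s)) b))"

definition phi_map ::
    "nat \<Rightarrow> (nat \<Rightarrow> nat) \<Rightarrow> ('n::finite \<Rightarrow> nat \<times> nat) \<Rightarrow> (nat \<Rightarrow> complex) \<Rightarrow> real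
      \<Rightarrow> 'n amb \<Rightarrow> 'n amb"
  where "phi_map s n e a t = (\<lambda>(z, w).
    (of_blks e (\<lambda>j k. if j = s then blk e z s k + a k else blk e z j k),
     w + last_comp (n s) t a + 2 * \<i> * cdot (n s) (blk e z s) a))"

definition delta_map ::
    "nat \<Rightarrow> (nat \<Rightarrow> nat) \<Rightarrow> ('n::finite \<Rightarrow> nat \<times> nat) \<Rightarrow> real \<Rightarrow> 'n amb \<Rightarrow> 'n amb"
  where "delta_map s m e r = (\<lambda>(z, w).
    (of_blks e (\<lambda>j k. if j = s then complex_of_real r * blk e z s k
                       else complex_of_real (r powr (1 / real (m j))) * blk e z j k),
     complex_of_real (r\<^sup>2) * w))"

(* Complex powr is the principal branch. *)
definition inversion ::
    "nat \<Rightarrow> (nat \<Rightarrow> nat) \<Rightarrow> ('n::finite \<Rightarrow> nat \<times> nat) \<Rightarrow> 'n amb \<Rightarrow> 'n amb"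
  where "inversion s m e = (\<lambda>(z, w).
    (of_blks e (\<lambda>j k. if j = s then blk e z s k / w
                       else blk e z j k / w powr complex_of_real (1 / real (m j))),
     - (1 / w)))"

end

theory Submission
  imports Defs
begin

text \<open>Parametrize \<open>M\<close> by \<open>q = (z, u)\<close> with \<open>w = u + i p(z)\<close> as last coordinate, and let \<open>Z\<close>, \<open>Zb\<close>, \<open>T = d/du\<close> be the
  induced frame. The components \<open>F\<close>, \<open>G\<close> of a CR map are annihilated by \<open>Zb\<close> and satisfy \<open>G - cnj G = 2 i p(F)\<close>.
  Differentiating this identity shows in turn that \<open>F\<close> is conformal for the Levi forms with factor \<open>lam\<close>, that its
  second derivatives satisfy a projective equation for the connection of the Kaehler potential \<open>p\<close>, and that the
  curvatures of \<open>p\<close> at \<open>z\<close> and at \<open>F\<close> are related modulo the Levi form. On Levi-orthogonal vectors the last relation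
  equates two sums of squares over the curved blocks (those with \<open>m j \<ge> 2\<close>), so \<open>F\<close> carries each curved block \<open>k\<close> to a
  block \<open>\<tau> k\<close> with the same exponent, and the summands of \<open>p\<close> satisfy \<open>p\<^sub>\<tau>\<^sub>k(F) = lam p\<^sub>k(z)\<close>. Then either \<open>lam\<close> is
  constant, or \<open>lam = r\<^sup>2 / |om|\<^sup>2\<close> for a CR function \<open>om\<close> with \<open>T om = 1\<close>, which turns out to be \<open>w \<circ> \<phi>\<^sub>a\<close>. With
  \<open>om = 1\<close> in the first case, \<open>om F\<^sub>s\<close> and \<open>om G\<close> are affine in \<open>(z\<^sub>s, w)\<close> and \<open>om powr (1 / m k) F\<^sub>\<tau>\<^sub>k\<close> is a multiple of a
  unitary image of \<open>z\<^sub>k\<close>; the equation of \<open>M\<close> determines the coefficients.\<close>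

section \<open>Smooth functions on open sets\<close>

text \<open>The map is only smooth and is given on an open piece of a real hypersurface, so all
  information is drawn from its CR equations by differentiating along the frame. The potential
  |z|^(2m) is flat in the Euler direction z: its curvature sees only the vectors of the block
  orthogonal to z. Hence the Euler directions of all curved blocks are merged with the flat block
  into one complementary summand, and n_j >= 2 keeps every curved summand nonzero. The curvature
  relation is usable only on Levi-orthogonal pairs, and such pairs reveal only sums of two block
  curvatures. Three summands determine each of them; with exactly two, an exchange of the curved
  block with the complement passes the test and has to be excluded on the diagonal. The condition n
  >= 2 supplies a nonzero vector Levi-orthogonal to a given one, which separates the trace parts of
  differentiated identities. The principal roots cause no trouble: in the inversion case Im om is a
  positive multiple of the Levi norm of the image of \<open>T\<close>, so om stays off the
  slit.\<close>

lemma Ck_on_cong: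
  assumes "open U" "\<And>x. x \<in> U \<Longrightarrow> f x = g x"
  shows "Ck_on k f U \<longleftrightarrow> Ck_on k g U"
  using assms(2)
proof (induction k arbitrary: f g)
  case 0
  then show ?case using continuous_on_cong by auto
next
  case (Suc k)
  have d: "f differentiable (at x) \<longleftrightarrow> g differentiable (at x)" if "x \<in> U" for x
  proof
    show "g differentiable (at x)" if "f differentiable (at x)"
      using that has_derivative_transform_within_open[of f _ x UNIV U g] Suc.prems assms(1) \<open>x \<in> U\<close>
      by (auto simp: differentiable_def)
    show "f differentiable (at x)" if "g differentiable (at x)"
      using that has_derivative_transform_within_open[of g _ x UNIV U f] Suc.prems assms(1) \<open>x \<in> U\<close>
      by (auto simp: differentiable_def)
  qed
  have e: "frechet_derivative f (at x) v = frechet_derivative g (at x) v" if "x \<in> U" "f differentiable (at x)" for x v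
    using frechet_derivative_transform_within_open[of f x U g] that Suc.prems assms(1) by metis
  have "Ck_on k (\<lambda>x. frechet_derivative f (at x) v) U \<longleftrightarrow> Ck_on k (\<lambda>x. frechet_derivative g (at x) v) U"
    if "\<forall>x\<in>U. f differentiable (at x)" for v
    by (rule Suc.IH) (use e that in blast)
  then show ?case using d by auto
qed

lemma Ck_on_subset: "Ck_on k f U \<Longrightarrow> V \<subseteq> U \<Longrightarrow> Ck_on k f V"
proof (induction k arbitrary: f)
  case (Suc k)
  then show ?case by (metis Ck_on.simps(2) subsetD)
qed (simp add: continuous_on_subset)

lemma Ck_on_Suc_imp: "Ck_on (Suc k) f U \<Longrightarrow> Ck_on k f U"
proof (induction k arbitrary: f)
  case 0
  then have "f differentiable (at x within U)" if "x \<in> U" for x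
    using differentiable_at_withinI that by force
  then show ?case by (simp add: differentiable_imp_continuous_on differentiable_on_def)
next
  case (Suc k)
  then have "Ck_on k (\<lambda>x. frechet_derivative f (at x) v) U" for v by (metis Ck_on.simps(2))
  then show ?case using Suc.prems by (metis Ck_on.simps(2))
qed

lemma Ck_on_Suc_has_derivative:
  "Ck_on (Suc k) f U \<Longrightarrow> x \<in> U \<Longrightarrow> (f has_derivative frechet_derivative f (at x)) (at x)"
  using frechet_derivative_works by auto

lemma Ck_on_const: "Ck_on k (\<lambda>x. c) U"
  by (induction k arbitrary: c) (auto simp: frechet_derivative_const)

lemma Ck_on_bounded_linear:
  assumes "bounded_linear L" shows "Ck_on k L U"
proof (cases k)
  case 0
  then show ?thesis using assms linear_continuous_on by auto
next
  case (Suc k')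
  have "frechet_derivative L (at x) = L" for x
    using assms by (metis bounded_linear_imp_has_derivative frechet_derivative_at)
  then show ?thesis using Suc assms by (simp add: Ck_on_const bounded_linear_imp_differentiable)
qed

lemma Ck_on_linear_comp:
  assumes "open U" "bounded_linear L" "Ck_on k f U"
  shows "Ck_on k (\<lambda>x. L (f x)) U"
  using assms(3)
proof (induction k arbitrary: f)
  case 0
  then show ?case using assms(2) bounded_linear.continuous_on by auto
next
  case (Suc k)
  have d: "f differentiable at x" if "x \<in> U" for x using Suc.prems that by auto
  have e: "((\<lambda>x. L (f x)) has_derivative (\<lambda>v. L (frechet_derivative f (at x) v))) (at x)" if "x \<in> U" for x
    by (intro bounded_linear.has_derivative[OF assms(2)] Ck_on_Suc_has_derivative[of k _ U] Suc.prems that)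
  have e': "frechet_derivative (\<lambda>x. L (f x)) (at x) v = L (frechet_derivative f (at x) v)" if "x \<in> U" for x v
    by (simp add: frechet_derivative_at[OF e[OF that], symmetric])
  have "Ck_on k (\<lambda>x. frechet_derivative (\<lambda>x. L (f x)) (at x) v) U" for v
    using Suc Ck_on_cong[OF assms(1) e'] by auto
  then show ?case using e by (auto simp: differentiable_def)
qed

lemma Ck_on_add:
  assumes "open U" "Ck_on k f U" "Ck_on k g U"
  shows "Ck_on k (\<lambda>x. f x + g x) U"
  using assms(2,3)
proof (induction k arbitrary: f g)
  case 0
  then show ?case by (auto intro: continuous_intros)
next
  case (Suc k)
  have e: "((\<lambda>x. f x + g x) has_derivative (\<lambda>v. frechet_derivative f (at x) v + frechet_derivative g (at x) v)) (at x)" if "x \<in> U" for x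
    by (intro has_derivative_add Ck_on_Suc_has_derivative[of k _ U] Suc.prems that)
  have e': "frechet_derivative (\<lambda>x. f x + g x) (at x) v = frechet_derivative f (at x) v + frechet_derivative g (at x) v" if "x \<in> U" for x v
    by (simp add: frechet_derivative_at[OF e[OF that], symmetric])
  have "Ck_on k (\<lambda>x. frechet_derivative (\<lambda>x. f x + g x) (at x) v) U" for v
    using Suc Ck_on_cong[OF assms(1) e'] by auto
  then show ?case using e by (auto simp: differentiable_def)
qed

lemma Ck_on_bilinear:
  assumes "open U" "bounded_bilinear P" "Ck_on k f U" "Ck_on k g U"
  shows "Ck_on k (\<lambda>x. P (f x) (g x)) U"
  using assms(3,4)
proof (induction k arbitrary: f g)
  case 0
  then show ?case using assms(2) bounded_bilinear.continuous_on by auto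
next
  case (Suc k)
  have e: "((\<lambda>x. P (f x) (g x)) has_derivative
      (\<lambda>v. P (f x) (frechet_derivative g (at x) v) + P (frechet_derivative f (at x) v) (g x))) (at x)" if "x \<in> U" for x
    by (intro bounded_bilinear.FDERIV[OF assms(2)] Ck_on_Suc_has_derivative[of k _ U] Suc.prems that)
  have e': "frechet_derivative (\<lambda>x. P (f x) (g x)) (at x) v
      = P (f x) (frechet_derivative g (at x) v) + P (frechet_derivative f (at x) v) (g x)" if "x \<in> U" for x v
    by (simp add: frechet_derivative_at[OF e[OF that], symmetric])
  have "Ck_on k (\<lambda>x. P (f x) (frechet_derivative g (at x) v) + P (frechet_derivative f (at x) v) (g x)) U" for v
    using Suc.prems Ck_on_Suc_imp[OF Suc.prems(1)] Ck_on_Suc_imp[OF Suc.prems(2)]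
    by (intro Ck_on_add assms(1) Suc.IH) auto
  then have "Ck_on k (\<lambda>x. frechet_derivative (\<lambda>x. P (f x) (g x)) (at x) v) U" for v
    using Ck_on_cong[OF assms(1) e'] by auto
  then show ?case using e by (auto simp: differentiable_def)
qed

lemma Ck_on_sum:
  assumes "open U" "\<And>i. i \<in> I \<Longrightarrow> Ck_on k (f i) U"
  shows "Ck_on k (\<lambda>x. \<Sum>i\<in>I. f i x) U"
  using assms(2)
  by (induction I rule: infinite_finite_induct) (auto simp: Ck_on_const intro: Ck_on_add assms(1))

lemma Ck_on_compose:
  fixes g :: "'b::euclidean_space \<Rightarrow> 'c::real_normed_vector" and h :: "'a::euclidean_space \<Rightarrow> 'b"
  assumes "open U" "open V" "Ck_on k h U" "Ck_on k g V" "h ` U \<subseteq> V"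
  shows "Ck_on k (\<lambda>x. g (h x)) U"
  using assms(3,4)
proof (induction k arbitrary: g)
  case 0
  then show ?case using assms(5) continuous_on_compose2 by auto
next
  case (Suc k)
  let ?Dg = "\<lambda>y. frechet_derivative g (at y)" and ?Dh = "\<lambda>x. frechet_derivative h (at x)"
  have dg: "(g has_derivative ?Dg (h x)) (at (h x))" if "x \<in> U" for x
    using Ck_on_Suc_has_derivative[OF Suc.prems(2)] assms(5) that by blast
  have dh: "(h has_derivative ?Dh x) (at x)" if "x \<in> U" for x
    using Ck_on_Suc_has_derivative[OF Suc.prems(1)] that by blast
  have e: "((\<lambda>x. g (h x)) has_derivative (\<lambda>v. ?Dg (h x) (?Dh x v))) (at x)" if "x \<in> U" for x
    using diff_chain_at[OF dh dg] that by (simp add: o_def)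
  \<comment> \<open>\<open>Ck_on\<close> differentiates along fixed directions, whereas
    \<open>?Dh x v\<close> moves with x. Expanding it in the basis leaves scalar factors times
    derivatives of g along fixed vectors.\<close>
  have rep: "?Dg (h x) (?Dh x v) = (\<Sum>b\<in>Basis. (?Dh x v \<bullet> b) *\<^sub>R ?Dg (h x) b)" if "x \<in> U" for x v
  proof -
    interpret bounded_linear "?Dg (h x)" using dg[OF that] has_derivative_bounded_linear by blast
    have "?Dg (h x) (\<Sum>b\<in>Basis. (?Dh x v \<bullet> b) *\<^sub>R b) = (\<Sum>b\<in>Basis. (?Dh x v \<bullet> b) *\<^sub>R ?Dg (h x) b)"
      by (simp add: sum scaleR)
    then show ?thesis by (simp add: euclidean_representation)
  qed
  have e': "frechet_derivative (\<lambda>x. g (h x)) (at x) v = (\<Sum>b\<in>Basis. (?Dh x v \<bullet> b) *\<^sub>R ?Dg (h x) b)" if "x \<in> U" for x v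
    using rep[OF that] by (simp add: frechet_derivative_at[OF e[OF that], symmetric])
  have "Ck_on k (\<lambda>x. \<Sum>b\<in>Basis. (?Dh x v \<bullet> b) *\<^sub>R ?Dg (h x) b) U" for v
  proof (intro Ck_on_sum assms(1) Ck_on_bilinear[OF assms(1) bounded_bilinear_scaleR])
    fix b :: 'b
    show "Ck_on k (\<lambda>x. ?Dh x v \<bullet> b) U"
      using Ck_on_linear_comp[OF assms(1) bounded_linear_inner_left[of b]] Suc.prems(1) by auto
    show "Ck_on k (\<lambda>x. ?Dg (h x) b) U"
      using Suc.IH[of "\<lambda>y. ?Dg y b"] Suc.prems Ck_on_Suc_imp by auto
  qed
  then have "Ck_on k (\<lambda>x. frechet_derivative (\<lambda>x. g (h x)) (at x) v) U" for v
    using Ck_on_cong[OF assms(1) e'] by auto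
  then show ?case using e by (auto simp: differentiable_def)
qed

lemma Ck_on_inverse:
  fixes f :: "'a::euclidean_space \<Rightarrow> complex"
  assumes "open U" "Ck_on k f U" "\<And>x. x \<in> U \<Longrightarrow> f x \<noteq> 0"
  shows "Ck_on k (\<lambda>x. inverse (f x)) U"
  using assms(2)
proof (induction k)
  case 0
  then show ?case using assms(3) by (auto intro: continuous_intros)
next
  case (Suc k)
  have e: "((\<lambda>x. inverse (f x)) has_derivative (\<lambda>v. - (inverse (f x) * frechet_derivative f (at x) v * inverse (f x)))) (at x)" if "x \<in> U" for x
    by (intro Deriv.has_derivative_inverse assms(3) Ck_on_Suc_has_derivative[of k _ U] Suc.prems that)
  have e': "frechet_derivative (\<lambda>x. inverse (f x)) (at x) v = - (inverse (f x) * frechet_derivative f (at x) v * inverse (f x))" if "x \<in> U" for x v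
    by (simp add: frechet_derivative_at[OF e[OF that], symmetric])
  have i: "Ck_on k (\<lambda>x. inverse (f x)) U" using Suc Ck_on_Suc_imp by blast
  have "Ck_on k (\<lambda>x. - (inverse (f x) * frechet_derivative f (at x) v * inverse (f x))) U" for v
    by (rule Ck_on_linear_comp[OF assms(1) bounded_linear_minus[OF bounded_linear_ident]])
      (use i Suc.prems in \<open>auto intro!: Ck_on_bilinear[OF assms(1) bounded_bilinear_mult]\<close>)
  then have "Ck_on k (\<lambda>x. frechet_derivative (\<lambda>x. inverse (f x)) (at x) v) U" for v
    using Ck_on_cong[OF assms(1) e'] by auto
  then show ?case using e by (auto simp: differentiable_def)
qed

lemma Ck_on_powr:
  fixes f :: "'a::euclidean_space \<Rightarrow> complex"
  assumes "open U" "Ck_on k f U" "\<And>x. x \<in> U \<Longrightarrow> f x \<notin> \<real>\<^sub>\<le>\<^sub>0"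
  shows "Ck_on k (\<lambda>x. f x powr a) U"
  using assms(2)
\<comment> \<open>The exponent is generalized because differentiation replaces a by a - 1.\<close>
proof (induction k arbitrary: a)
  case 0
  have "isCont (\<lambda>z. z powr a) (f x)" if "x \<in> U" for x
    using assms(3)[OF that] field_differentiable_imp_continuous_at has_field_derivative_powr
      field_differentiable_def by blast
  then have "continuous_on (f ` U) (\<lambda>z. z powr a)"
    by (auto intro: continuous_at_imp_continuous_on)
  then show ?case using 0 continuous_on_compose2[of "f ` U" "\<lambda>z. z powr a" U f] by simp
next
  case (Suc k)
  have e: "((\<lambda>x. f x powr a) has_derivative (\<lambda>v. a * f x powr (a - 1) * frechet_derivative f (at x) v)) (at x)" if "x \<in> U" for x
  proof -
    have "((\<lambda>z. z powr a) has_field_derivative a * f x powr (a - 1)) (at (f x))"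
      using assms(3)[OF that] by (auto intro!: derivative_eq_intros)
    moreover have "(f has_derivative frechet_derivative f (at x)) (at x)"
      by (rule Ck_on_Suc_has_derivative[OF Suc.prems that])
    ultimately show ?thesis
      using diff_chain_at[of f _ x "\<lambda>z. z powr a"] unfolding has_field_derivative_def by (simp add: o_def)
  qed
  have e': "frechet_derivative (\<lambda>x. f x powr a) (at x) v = a * f x powr (a - 1) * frechet_derivative f (at x) v" if "x \<in> U" for x v
    by (simp add: frechet_derivative_at[OF e[OF that], symmetric])
  have i: "Ck_on k (\<lambda>x. f x powr (a-1)) U" using Suc Ck_on_Suc_imp by blast
  have "Ck_on k (\<lambda>x. a * f x powr (a - 1) * frechet_derivative f (at x) v) U" for v
    using i Suc.prems by (auto intro!: Ck_on_bilinear[OF assms(1) bounded_bilinear_mult] Ck_on_const)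
  then have "Ck_on k (\<lambda>x. frechet_derivative (\<lambda>x. f x powr a) (at x) v) U" for v
    using Ck_on_cong[OF assms(1) e'] by auto
  then show ?case using e by (auto simp: differentiable_def)
qed

text \<open>Clairaut: the second difference quotient is evaluated by the mean value theorem in both orders.\<close>

lemma second_difference:
  fixes g :: "'a::euclidean_space \<Rightarrow> real"
  assumes "t > 0" "\<And>a b. a \<in> {0..t} \<Longrightarrow> b \<in> {0..t} \<Longrightarrow> x + a *\<^sub>R v + b *\<^sub>R w \<in> U"
    and d: "\<And>y. y \<in> U \<Longrightarrow> g differentiable (at y)"
    and d2: "\<And>y. y \<in> U \<Longrightarrow> (\<lambda>y. frechet_derivative g (at y) v) differentiable (at y)"
  obtains a b where "a \<in> {0..t}" "b \<in> {0..t}"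
    "g (x + t *\<^sub>R v + t *\<^sub>R w) - g (x + t *\<^sub>R v) - g (x + t *\<^sub>R w) + g x
      = t * t * frechet_derivative (\<lambda>y. frechet_derivative g (at y) v) (at (x + a *\<^sub>R v + b *\<^sub>R w)) w"
proof -
  let ?G = "\<lambda>y. frechet_derivative g (at y) v"
  let ?f = "\<lambda>a. g (x + a *\<^sub>R v + t *\<^sub>R w) - g (x + a *\<^sub>R v)"
  have lin: "frechet_derivative h (at y) (c *\<^sub>R v') = c * frechet_derivative h (at y) v'"
    if "h differentiable at y" for h :: "'a \<Rightarrow> real" and y v' c
    using linear_frechet_derivative[OF that] by (simp add: linear_cmul)
  have df: "(?f has_derivative (\<lambda>c. c * (?G (x + a *\<^sub>R v + t *\<^sub>R w) - ?G (x + a *\<^sub>R v)))) (at a)"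
    if "a \<in> {0..t}" for a
  proof -
    have 1: "((\<lambda>a. g (x + a *\<^sub>R v + b *\<^sub>R w)) has_derivative (\<lambda>c. c * ?G (x + a *\<^sub>R v + b *\<^sub>R w))) (at a)"
      if "b \<in> {0..t}" for b
    proof -
      have "(g has_derivative frechet_derivative g (at (x + a *\<^sub>R v + b *\<^sub>R w))) (at (x + a *\<^sub>R v + b *\<^sub>R w))"
        using d assms(2) \<open>a \<in> _\<close> that frechet_derivative_works by blast
      moreover have "((\<lambda>a. x + a *\<^sub>R v + b *\<^sub>R w) has_derivative (\<lambda>c. c *\<^sub>R v)) (at a)"
        by (auto intro!: derivative_eq_intros)
      ultimately have "((\<lambda>a. g (x + a *\<^sub>R v + b *\<^sub>R w)) has_derivative (\<lambda>c. frechet_derivative g (at (x + a *\<^sub>R v + b *\<^sub>R w)) (c *\<^sub>R v))) (at a)"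
        using diff_chain_at[of "\<lambda>a. x + a *\<^sub>R v + b *\<^sub>R w" _ a g] by (simp add: o_def)
      then show ?thesis using lin[OF d] assms(2) \<open>a \<in> _\<close> that by simp
    qed
    show ?thesis using has_derivative_diff[OF 1[of t] 1[of 0]] assms(1) by (simp add: algebra_simps)
  qed
  obtain a where a: "a \<in> {0<..<t}" "?f t - ?f 0 = (t - 0) * (?G (x + a *\<^sub>R v + t *\<^sub>R w) - ?G (x + a *\<^sub>R v))"
    using mvt_simple[of 0 t ?f "\<lambda>a c. c * (?G (x + a *\<^sub>R v + t *\<^sub>R w) - ?G (x + a *\<^sub>R v))"] assms(1)
      has_derivative_at_withinI[OF df] by fastforce
  let ?h = "\<lambda>b. ?G (x + a *\<^sub>R v + b *\<^sub>R w)"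
  have dh: "(?h has_derivative (\<lambda>c. c * frechet_derivative ?G (at (x + a *\<^sub>R v + b *\<^sub>R w)) w)) (at b)"
    if "b \<in> {0..t}" for b
  proof -
    have in': "x + a *\<^sub>R v + b *\<^sub>R w \<in> U" using assms(2) a(1) that by auto
    have "(?G has_derivative frechet_derivative ?G (at (x + a *\<^sub>R v + b *\<^sub>R w))) (at (x + a *\<^sub>R v + b *\<^sub>R w))"
      using d2[OF in'] frechet_derivative_works by blast
    moreover have "((\<lambda>b. x + a *\<^sub>R v + b *\<^sub>R w) has_derivative (\<lambda>c. c *\<^sub>R w)) (at b)"
      by (auto intro!: derivative_eq_intros)
    ultimately have "(?h has_derivative (\<lambda>c. frechet_derivative ?G (at (x + a *\<^sub>R v + b *\<^sub>R w)) (c *\<^sub>R w))) (at b)"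
      using diff_chain_at[of "\<lambda>b. x + a *\<^sub>R v + b *\<^sub>R w" _ b ?G] by (simp add: o_def)
    then show ?thesis using lin[OF d2[OF in']] by simp
  qed
  obtain b where b: "b \<in> {0<..<t}" "?h t - ?h 0 = (t - 0) * frechet_derivative ?G (at (x + a *\<^sub>R v + b *\<^sub>R w)) w"
    using mvt_simple[of 0 t ?h "\<lambda>b c. c * frechet_derivative ?G (at (x + a *\<^sub>R v + b *\<^sub>R w)) w"] assms(1)
      has_derivative_at_withinI[OF dh] by fastforce
  show ?thesis
    by (rule that[of a b]) (use a b in \<open>auto simp: algebra_simps\<close>)
qed

lemma symmetric_second_derivative_real:
  fixes g :: "'a::euclidean_space \<Rightarrow> real"
  assumes "open U" "Ck_on 2 g U" "x \<in> U"
  shows "frechet_derivative (\<lambda>y. frechet_derivative g (at y) v) (at x) w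
       = frechet_derivative (\<lambda>y. frechet_derivative g (at y) w) (at x) v" (is "?A v w x = ?A w v x")
proof (rule ccontr)
  assume ne: "?A v w x \<noteq> ?A w v x"
  \<comment> \<open>Half the gap: each mixed derivative will be within e of its value at x, at the
    two points where the mean value theorem makes them equal.\<close>
  define e where "e = \<bar>?A v w x - ?A w v x\<bar> / 2"
  have e: "e > 0" using ne by (simp add: e_def)
  have d: "g differentiable (at y)" if "y \<in> U" for y
    using assms(2) that by (simp add: numeral_2_eq_2)
  have d2: "(\<lambda>y. frechet_derivative g (at y) u) differentiable (at y)" if "y \<in> U" for y u
    using assms(2) that by (simp add: numeral_2_eq_2)
  have c: "continuous_on U (?A u u')" for u u' using assms(2) by (simp add: numeral_2_eq_2)
  have nh: "\<exists>d>0. ball x d \<subseteq> U \<and> (\<forall>y\<in>ball x d. \<bar>?A u u' y - ?A u u' x\<bar> < e)" for u u'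
  proof -
    obtain d1 where d1: "d1 > 0" "\<forall>y\<in>U. dist y x < d1 \<longrightarrow> dist (?A u u' y) (?A u u' x) < e"
      using c assms(3) e unfolding continuous_on_iff by blast
    obtain d2 where d2: "d2 > 0" "ball x d2 \<subseteq> U" using assms(1,3) openE by blast
    show ?thesis
      by (rule exI[of _ "min d1 d2"]) (use d1 d2 in \<open>auto simp: dist_commute dist_real_def subset_iff\<close>)
  qed
  obtain r1 where r1: "r1 > 0" "ball x r1 \<subseteq> U" "\<forall>y\<in>ball x r1. \<bar>?A v w y - ?A v w x\<bar> < e"
    using nh[of v w] by blast
  obtain r2 where r2: "r2 > 0" "ball x r2 \<subseteq> U" "\<forall>y\<in>ball x r2. \<bar>?A w v y - ?A w v x\<bar> < e"
    using nh[of w v] by blast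
  define r where "r = min r1 r2"
  \<comment> \<open>Small enough for the parallelogram spanned by t v and t w to stay in the ball of
    radius r.\<close>
  define t where "t = r / (2 * (norm v + norm w + 1))"
  have n: "norm v + norm w + 1 > 0" by (simp add: add_nonneg_pos)
  have t: "t > 0" using r1 r2 n by (simp add: t_def r_def)
  have tin: "x + a *\<^sub>R v + b *\<^sub>R w \<in> ball x r" if "a \<in> {0..t}" "b \<in> {0..t}" for a b
  proof -
    have "norm (a *\<^sub>R v + b *\<^sub>R w) \<le> a * norm v + b * norm w"
      using norm_triangle_ineq[of "a *\<^sub>R v" "b *\<^sub>R w"] that by simp
    also have "\<dots> \<le> t * norm v + t * norm w" using that by (intro add_mono mult_right_mono) auto
    also have "\<dots> < t * (norm v + norm w + 1)" using t by (simp add: algebra_simps)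
    also have "\<dots> = r / 2" unfolding t_def using n by (simp add: field_simps)
    finally have "norm (a *\<^sub>R v + b *\<^sub>R w) < r" using r1 r2 by (simp add: r_def min_def split: if_splits)
    moreover have "dist x (x + a *\<^sub>R v + b *\<^sub>R w) = norm (a *\<^sub>R v + b *\<^sub>R w)"
      by (metis add.assoc add_diff_cancel_left' dist_commute dist_norm)
    ultimately show ?thesis by simp
  qed
  have tin': "x + a *\<^sub>R w + b *\<^sub>R v \<in> ball x r" if "a \<in> {0..t}" "b \<in> {0..t}" for a b
    using tin[OF that(2,1)] by (simp add: algebra_simps)
  have inU: "ball x r \<subseteq> U" using r1 by (auto simp: r_def)
  have tU: "x + a *\<^sub>R v + b *\<^sub>R w \<in> U" "x + a *\<^sub>R w + b *\<^sub>R v \<in> U" if "a \<in> {0..t}" "b \<in> {0..t}" for a b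
    using tin tin' inU that by blast+
  obtain a b where ab: "a \<in> {0..t}" "b \<in> {0..t}"
    "g (x + t *\<^sub>R v + t *\<^sub>R w) - g (x + t *\<^sub>R v) - g (x + t *\<^sub>R w) + g x = t * t * ?A v w (x + a *\<^sub>R v + b *\<^sub>R w)"
    by (rule second_difference[OF t tU(1) d d2])
  obtain a' b' where ab': "a' \<in> {0..t}" "b' \<in> {0..t}"
    "g (x + t *\<^sub>R w + t *\<^sub>R v) - g (x + t *\<^sub>R w) - g (x + t *\<^sub>R v) + g x = t * t * ?A w v (x + a' *\<^sub>R w + b' *\<^sub>R v)"
    by (rule second_difference[OF t tU(2) d d2])
  have "x + t *\<^sub>R w + t *\<^sub>R v = x + t *\<^sub>R v + t *\<^sub>R w" by (simp add: algebra_simps)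
  then have "t * t * ?A v w (x + a *\<^sub>R v + b *\<^sub>R w) = t * t * ?A w v (x + a' *\<^sub>R w + b' *\<^sub>R v)"
    using ab(3) ab'(3) by (simp add: algebra_simps)
  then have "?A v w (x + a *\<^sub>R v + b *\<^sub>R w) = ?A w v (x + a' *\<^sub>R w + b' *\<^sub>R v)" using t by simp
  moreover have "\<bar>?A v w (x + a *\<^sub>R v + b *\<^sub>R w) - ?A v w x\<bar> < e"
    using r1(3) tin[OF ab(1,2)] by (auto simp: r_def)
  moreover have "\<bar>?A w v (x + a' *\<^sub>R w + b' *\<^sub>R v) - ?A w v x\<bar> < e"
    using r2(3) tin'[OF ab'(1,2)] by (auto simp: r_def)
  ultimately have "\<bar>?A v w x - ?A w v x\<bar> < e + e" by linarith
  then show False by (simp add: e_def)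
qed

section \<open>Complex directional derivatives on the parametrized hypersurface\<close>

definition sm :: "'a::euclidean_space set \<Rightarrow> ('a \<Rightarrow> 'b::real_normed_vector) \<Rightarrow> bool"
  where "sm W f \<longleftrightarrow> (\<forall>k. Ck_on k f W)"

definition ddir :: "'a::real_normed_vector \<Rightarrow> ('a \<Rightarrow> 'b::real_normed_vector) \<Rightarrow> 'a \<Rightarrow> 'b"
  where "ddir v f q = frechet_derivative f (at q) v"

lemma sm_has_derivative: "sm W f \<Longrightarrow> q \<in> W \<Longrightarrow> (f has_derivative (\<lambda>v. ddir v f q)) (at q)"
  unfolding sm_def ddir_def using Ck_on_Suc_has_derivative[of 0 f W q] by metis

lemma sm_ddir: "sm W f \<Longrightarrow> sm W (ddir v f)"
  unfolding sm_def ddir_def by (metis Ck_on.simps(2))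

lemma ddir_eqI: "(f has_derivative f') (at q) \<Longrightarrow> ddir v f q = f' v"
  unfolding ddir_def using frechet_derivative_at by metis

text \<open>A complex number is determined by its real functionals Re and Im, which commute with
  \<open>ddir\<close>; the real case therefore suffices.\<close>

lemma ddir_commute:
  fixes f :: "'a::euclidean_space \<Rightarrow> complex"
  assumes "open W" "sm W f" "q \<in> W"
  shows "ddir v (ddir w f) q = ddir w (ddir v f) q"
proof -
  have *: "L (ddir v (ddir w f) q) = ddir v (ddir w (\<lambda>q. L (f q))) q" if L: "bounded_linear L"
    for v w and L :: "complex \<Rightarrow> real"
  proof -
    have 1: "ddir w (\<lambda>q. L (f q)) q = L (ddir w f q)" if "q \<in> W" for q
      using ddir_eqI[OF bounded_linear.has_derivative[OF L sm_has_derivative[OF assms(2) that]]] by simp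
    have 2: "((\<lambda>q. L (ddir w f q)) has_derivative (\<lambda>v. L (ddir v (ddir w f) q))) (at q)"
      using bounded_linear.has_derivative[OF L sm_has_derivative[OF sm_ddir[OF assms(2)] assms(3)]] by simp
    have "(ddir w (\<lambda>q. L (f q)) has_derivative (\<lambda>v. L (ddir v (ddir w f) q))) (at q)"
      by (rule has_derivative_transform_within_open[OF 2 assms(1,3)]) (simp add: 1)
    then show ?thesis using ddir_eqI by metis
  qed
  have "ddir v (ddir w (\<lambda>q. L (f q))) q = ddir w (ddir v (\<lambda>q. L (f q))) q" if L: "bounded_linear L"
    for L :: "complex \<Rightarrow> real"
    unfolding ddir_def
    by (rule symmetric_second_derivative_real[OF assms(1) _ assms(3)])
      (use Ck_on_linear_comp[OF assms(1) L] assms(2) in \<open>simp add: sm_def\<close>)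
  then show ?thesis
    using *[OF bounded_linear_Re] *[OF bounded_linear_Im] bounded_linear_Re bounded_linear_Im
    by (metis complex_eq_iff)
qed

section \<open>Block inner products and abstract derivations\<close>

definition ip :: "('n::finite \<Rightarrow> nat) \<Rightarrow> nat \<Rightarrow> complex^'n \<Rightarrow> complex^'n \<Rightarrow> complex"
  where "ip bl j X Y = (\<Sum>\<mu> | bl \<mu> = j. X $ \<mu> * cnj (Y $ \<mu>))"

definition vd :: "(('q \<Rightarrow> complex) \<Rightarrow> 'q \<Rightarrow> complex) \<Rightarrow> ('q \<Rightarrow> complex^'n) \<Rightarrow> 'q \<Rightarrow> complex^'n::finite"
  where "vd \<delta> F q = (\<chi> \<mu>. \<delta> (\<lambda>q. F q $ \<mu>) q)"

lemma vd_nth [simp]: "vd \<delta> F q $ \<mu> = \<delta> (\<lambda>q. F q $ \<mu>) q"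
  by (simp add: vd_def)

definition smv :: "'a::euclidean_space set \<Rightarrow> ('a \<Rightarrow> complex^'n::finite) \<Rightarrow> bool"
  where "smv W F \<longleftrightarrow> (\<forall>\<mu>. sm W (\<lambda>q. F q $ \<mu>))"

locale opn =
  fixes W :: "'a::euclidean_space set"
  assumes open_W: "open W"
begin

lemma sm_const [simp, intro]: "sm W (\<lambda>_. c)"
  by (simp add: sm_def Ck_on_const)

lemma sm_linear: "bounded_linear L \<Longrightarrow> sm W L"
  by (simp add: sm_def Ck_on_bounded_linear)

lemma sm_linear_comp: "bounded_linear L \<Longrightarrow> sm W f \<Longrightarrow> sm W (\<lambda>q. L (f q))"
  by (simp add: sm_def Ck_on_linear_comp open_W)

lemma sm_add [simp, intro]: "sm W f \<Longrightarrow> sm W g \<Longrightarrow> sm W (\<lambda>q. f q + g q)"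
  by (simp add: sm_def Ck_on_add open_W)

lemma sm_mult [simp, intro]:
  fixes f g :: "_ \<Rightarrow> complex"
  shows "sm W f \<Longrightarrow> sm W g \<Longrightarrow> sm W (\<lambda>q. f q * g q)"
  by (auto simp: sm_def intro: Ck_on_bilinear[OF open_W bounded_bilinear_mult])

lemma sm_cnj [simp, intro]: "sm W f \<Longrightarrow> sm W (\<lambda>q. cnj (f q))"
  using sm_linear_comp bounded_linear_cnj by blast

lemma sm_uminus [simp, intro]: "sm W f \<Longrightarrow> sm W (\<lambda>q. - f q)"
  using sm_linear_comp[OF bounded_linear_minus[OF bounded_linear_ident]] by blast

lemma sm_diff [simp, intro]: "sm W f \<Longrightarrow> sm W g \<Longrightarrow> sm W (\<lambda>q. f q - g q)"
  using sm_add[of f "\<lambda>q. - g q"] by simp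

lemma sm_sum [simp, intro]: "(\<And>i. i \<in> I \<Longrightarrow> sm W (f i)) \<Longrightarrow> sm W (\<lambda>q. \<Sum>i\<in>I. f i q)"
  by (simp add: sm_def Ck_on_sum open_W)

lemma sm_power [simp, intro]:
  fixes f :: "_ \<Rightarrow> complex"
  shows "sm W f \<Longrightarrow> sm W (\<lambda>q. f q ^ k)"
  by (induction k) auto

lemma sm_inverse [intro]:
  fixes f :: "_ \<Rightarrow> complex"
  shows "sm W f \<Longrightarrow> (\<And>q. q \<in> W \<Longrightarrow> f q \<noteq> 0) \<Longrightarrow> sm W (\<lambda>q. inverse (f q))"
  by (simp add: sm_def Ck_on_inverse open_W)

lemma sm_divide [intro]:
  fixes f :: "_ \<Rightarrow> complex"
  shows "sm W f \<Longrightarrow> sm W g \<Longrightarrow> (\<And>q. q \<in> W \<Longrightarrow> g q \<noteq> 0) \<Longrightarrow> sm W (\<lambda>q. f q / g q)"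
  unfolding divide_inverse using sm_inverse sm_mult by auto

lemma ddir_cong:
  assumes "\<And>q. q \<in> W \<Longrightarrow> f q = g q" "q \<in> W" "sm W f"
  shows "ddir v f q = ddir v g q"
  using has_derivative_transform_within_open[OF sm_has_derivative[OF assms(3,2)] open_W assms(2), of g] assms(1)
    ddir_eqI by metis

lemma smv_const [simp]: "smv W (\<lambda>_. x)"
  by (simp add: smv_def)

text \<open>A derivation with its complex conjugate. Real fields \<open>ddir v\<close> are paired
  with themselves and \<open>Z x\<close> with \<open>Zb x\<close>, so every differentiation rule for
  the potential is proved once for all of them. The last clause makes the values off W
  irrelevant.\<close>

definition derpair :: "(('a \<Rightarrow> complex) \<Rightarrow> 'a \<Rightarrow> complex) \<Rightarrow> (('a \<Rightarrow> complex) \<Rightarrow> 'a \<Rightarrow> complex) \<Rightarrow> bool"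
  where "derpair \<delta> \<delta>' \<longleftrightarrow>
    (\<forall>f. sm W f \<longrightarrow> sm W (\<delta> f) \<and> sm W (\<delta>' f)) \<and>
    (\<forall>f g. \<forall>q\<in>W. sm W f \<and> sm W g \<longrightarrow>
        \<delta> (\<lambda>q. f q + g q) q = \<delta> f q + \<delta> g q \<and>
        \<delta> (\<lambda>q. f q * g q) q = \<delta> f q * g q + f q * \<delta> g q) \<and>
    (\<forall>c. \<forall>q\<in>W. \<delta> (\<lambda>_. c) q = 0) \<and>
    (\<forall>f. \<forall>q\<in>W. sm W f \<longrightarrow> \<delta> (\<lambda>q. cnj (f q)) q = cnj (\<delta>' f q)) \<and>
    (\<forall>f g. \<forall>q\<in>W. sm W f \<and> (\<forall>q\<in>W. f q = g q) \<longrightarrow> \<delta> f q = \<delta> g q)"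

context
  fixes \<delta> \<delta>' assumes dp: "derpair \<delta> \<delta>'"
begin

lemma d_sm: "sm W f \<Longrightarrow> sm W (\<delta> f)" and d_sm': "sm W f \<Longrightarrow> sm W (\<delta>' f)"
  using dp by (auto simp: derpair_def)

lemma d_const: "q \<in> W \<Longrightarrow> \<delta> (\<lambda>_. c) q = 0"
  using dp by (auto simp: derpair_def)

lemma d_add: "q \<in> W \<Longrightarrow> sm W f \<Longrightarrow> sm W g \<Longrightarrow> \<delta> (\<lambda>q. f q + g q) q = \<delta> f q + \<delta> g q"
  using dp by (auto simp: derpair_def)

lemma d_mult: "q \<in> W \<Longrightarrow> sm W f \<Longrightarrow> sm W g \<Longrightarrow> \<delta> (\<lambda>q. f q * g q) q = \<delta> f q * g q + f q * \<delta> g q"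
  using dp by (auto simp: derpair_def)

lemma d_cnj: "q \<in> W \<Longrightarrow> sm W f \<Longrightarrow> \<delta> (\<lambda>q. cnj (f q)) q = cnj (\<delta>' f q)"
  using dp by (auto simp: derpair_def)

lemma d_cong: "q \<in> W \<Longrightarrow> sm W f \<Longrightarrow> (\<And>q. q \<in> W \<Longrightarrow> f q = g q) \<Longrightarrow> \<delta> f q = \<delta> g q"
  using dp by (auto simp: derpair_def)

lemma d_cmult: "q \<in> W \<Longrightarrow> sm W f \<Longrightarrow> \<delta> (\<lambda>q. c * f q) q = c * \<delta> f q"
  using d_mult[of q "\<lambda>_. c" f] d_const by simp

lemma d_uminus: "q \<in> W \<Longrightarrow> sm W f \<Longrightarrow> \<delta> (\<lambda>q. - f q) q = - \<delta> f q"
  using d_cmult[of q f "-1"] by simp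

lemma d_diff: "q \<in> W \<Longrightarrow> sm W f \<Longrightarrow> sm W g \<Longrightarrow> \<delta> (\<lambda>q. f q - g q) q = \<delta> f q - \<delta> g q"
  using d_add[of q f "\<lambda>q. - g q"] d_uminus[of q g] by simp

lemma d_sum: "q \<in> W \<Longrightarrow> (\<And>i. i \<in> I \<Longrightarrow> sm W (f i)) \<Longrightarrow> \<delta> (\<lambda>q. \<Sum>i\<in>I. f i q) q = (\<Sum>i\<in>I. \<delta> (f i) q)"
  by (induction I rule: infinite_finite_induct) (auto simp: d_const d_add)

lemma d_power: "q \<in> W \<Longrightarrow> sm W f \<Longrightarrow> \<delta> (\<lambda>q. f q ^ k) q = of_nat k * f q ^ (k - 1) * \<delta> f q"
proof (induction k)
  case (Suc k)
  then show ?case by (cases k) (auto simp: d_mult d_const algebra_simps)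
qed (simp add: d_const)

lemma d_inverse:
  assumes "q \<in> W" "sm W f" "\<And>q. q \<in> W \<Longrightarrow> f q \<noteq> 0"
  shows "\<delta> (\<lambda>q. inverse (f q)) q = - \<delta> f q / (f q)\<^sup>2"
proof -
  have s: "sm W (\<lambda>q. inverse (f q))" using assms by auto
  have "\<delta> (\<lambda>q. f q * inverse (f q)) q = \<delta> (\<lambda>_. 1) q"
    by (rule d_cong) (use assms s in auto)
  then have *: "\<delta> f q * inverse (f q) + f q * \<delta> (\<lambda>q. inverse (f q)) q = 0"
    using d_mult[OF assms(1,2) s] d_const[OF assms(1)] by simp
  have "f q \<noteq> 0" using assms by blast
  then have "\<delta> (\<lambda>q. inverse (f q)) q = inverse (f q) * (f q * \<delta> (\<lambda>q. inverse (f q)) q)" by simp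
  also have "f q * \<delta> (\<lambda>q. inverse (f q)) q = - (\<delta> f q * inverse (f q))" using * by (simp add: add_eq_0_iff)
  finally show ?thesis by (simp add: divide_inverse power2_eq_square)
qed

lemma d_divide:
  assumes "q \<in> W" "sm W f" "sm W g" "\<And>q. q \<in> W \<Longrightarrow> g q \<noteq> 0"
  shows "\<delta> (\<lambda>q. f q / g q) q = (\<delta> f q * g q - f q * \<delta> g q) / (g q)\<^sup>2"
proof -
  have "g q \<noteq> 0" using assms by blast
  moreover have "\<delta> (\<lambda>q. f q / g q) q = \<delta> f q * inverse (g q) + f q * (- \<delta> g q / (g q)\<^sup>2)"
    unfolding divide_inverse[of "f _"]
    using d_mult[OF assms(1,2) sm_inverse[OF assms(3,4)]] d_inverse[OF assms(1,3,4)] by simp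
  ultimately show ?thesis by (simp add: field_simps power2_eq_square)
qed

lemma vd_const: "q \<in> W \<Longrightarrow> vd \<delta> (\<lambda>_. x) q = 0"
  by (simp add: vec_eq_iff d_const)

lemma sm_ip: "smv W U \<Longrightarrow> smv W V \<Longrightarrow> sm W (\<lambda>q. ip bl j (U q) (V q))"
  unfolding ip_def smv_def by auto

lemma d_ip:
  assumes "q \<in> W" "smv W U" "smv W V"
  shows "\<delta> (\<lambda>q. ip bl j (U q) (V q)) q = ip bl j (vd \<delta> U q) (V q) + ip bl j (U q) (vd \<delta>' V q)"
  using assms unfolding ip_def smv_def
  by (simp add: d_sum d_mult d_cnj sum.distrib)

end

end

lemma ip_add_left: "ip bl j (X + X') Y = ip bl j X Y + ip bl j X' Y"
  and ip_add_right: "ip bl j X (Y + Y') = ip bl j X Y + ip bl j X Y'"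
  and ip_diff_left: "ip bl j (X - X') Y = ip bl j X Y - ip bl j X' Y"
  and ip_diff_right: "ip bl j X (Y - Y') = ip bl j X Y - ip bl j X Y'"
  and ip_scale_left: "ip bl j (a *s X) Y = a * ip bl j X Y"
  and ip_scale_right: "ip bl j X (a *s Y) = cnj a * ip bl j X Y"
  and ip_zero_left [simp]: "ip bl j 0 Y = 0"
  and ip_zero_right [simp]: "ip bl j X 0 = 0"
  by (auto simp: ip_def algebra_simps sum.distrib sum_subtractf sum_distrib_left)

lemma ip_cnj: "cnj (ip bl j X Y) = ip bl j Y X"
  by (simp add: ip_def mult.commute)

lemma ip_self_real: "ip bl j X X = of_real (\<Sum>\<mu> | bl \<mu> = j. (cmod (X $ \<mu>))\<^sup>2)"
  by (simp add: ip_def complex_norm_square[symmetric])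

section \<open>The potential of the hypersurface and its derivatives\<close>

locale blocks =
  fixes bl :: "'n::finite \<Rightarrow> nat" and s :: nat and m :: "nat \<Rightarrow> nat"
begin

abbreviation ipb :: "nat \<Rightarrow> complex^'n \<Rightarrow> complex^'n \<Rightarrow> complex" where "ipb \<equiv> ip bl"

text \<open>\<open>cc j k\<close> is the \<open>k\<close>-th derivative of \<open>t \<mapsto> t ^ m j\<close>.\<close>

definition cc :: "nat \<Rightarrow> nat \<Rightarrow> complex \<Rightarrow> complex"
  where "cc j k t = (\<Prod>i<k. of_nat (m j) - of_nat i) * t ^ (m j - k)"

text \<open>\<open>pd\<close>, \<open>A2\<close>, \<open>h\<close>, \<open>C\<close>, \<open>Cb\<close> and \<open>K\<close> are the derivatives of the potential \<open>p\<close> at the base point \<open>Z\<close> of types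
  (1,0), (2,0), (1,1), (2,1), (1,2) and (2,2); \<open>h\<close> is the Levi form.\<close>

definition pp :: "complex^'n \<Rightarrow> complex"
  where "pp Z = (\<Sum>j\<in>{1..s}. cc j 0 (ipb j Z Z))"

definition pd :: "complex^'n \<Rightarrow> complex^'n \<Rightarrow> complex"
  where "pd Z X = (\<Sum>j\<in>{1..s}. cc j 1 (ipb j Z Z) * ipb j X Z)"

definition A2 :: "complex^'n \<Rightarrow> complex^'n \<Rightarrow> complex^'n \<Rightarrow> complex"
  where "A2 Z X Y = (\<Sum>j\<in>{1..s}. cc j 2 (ipb j Z Z) * ipb j X Z * ipb j Y Z)"

definition h :: "complex^'n \<Rightarrow> complex^'n \<Rightarrow> complex^'n \<Rightarrow> complex"
  where "h Z X Y = (\<Sum>j\<in>{1..s}. cc j 1 (ipb j Z Z) * ipb j X Y + cc j 2 (ipb j Z Z) * ipb j X Z * ipb j Z Y)"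

definition C :: "complex^'n \<Rightarrow> complex^'n \<Rightarrow> complex^'n \<Rightarrow> complex^'n \<Rightarrow> complex"
  where "C Z A X Y = (\<Sum>j\<in>{1..s}. cc j 2 (ipb j Z Z) * (ipb j A Z * ipb j X Y + ipb j X Z * ipb j A Y)
     + cc j 3 (ipb j Z Z) * ipb j A Z * ipb j X Z * ipb j Z Y)"

definition Cb :: "complex^'n \<Rightarrow> complex^'n \<Rightarrow> complex^'n \<Rightarrow> complex^'n \<Rightarrow> complex"
  where "Cb Z X Y B = (\<Sum>j\<in>{1..s}. cc j 2 (ipb j Z Z) * (ipb j Z B * ipb j X Y + ipb j X B * ipb j Z Y)
     + cc j 3 (ipb j Z Z) * ipb j Z B * ipb j X Z * ipb j Z Y)"

definition K :: "complex^'n \<Rightarrow> complex^'n \<Rightarrow> complex^'n \<Rightarrow> complex^'n \<Rightarrow> complex^'n \<Rightarrow> complex"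
  where "K Z A X Y B = (\<Sum>j\<in>{1..s}. cc j 2 (ipb j Z Z) * (ipb j A B * ipb j X Y + ipb j X B * ipb j A Y)
     + cc j 3 (ipb j Z Z) * (ipb j Z B * (ipb j A Z * ipb j X Y + ipb j X Z * ipb j A Y)
         + ipb j A B * ipb j X Z * ipb j Z Y + ipb j A Z * ipb j X B * ipb j Z Y)
     + cc j 4 (ipb j Z Z) * ipb j Z B * ipb j A Z * ipb j X Z * ipb j Z Y)"

lemma cc_cnj: "cnj (cc j k t) = cc j k (cnj t)"
  by (simp add: cc_def)

lemma cc_self_real [simp]: "cnj (cc j k (ipb j Z Z)) = cc j k (ipb j Z Z)"
  by (simp add: cc_cnj ip_cnj)

lemma h_cnj: "cnj (h Z X Y) = h Z Y X"
  by (simp add: h_def ip_cnj mult.commute mult.left_commute)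

lemma C_cnj: "cnj (C Z A X Y) = Cb Z Y X A"
  by (simp add: C_def Cb_def ip_cnj algebra_simps)

lemma C_sym: "C Z A X Y = C Z X A Y"
  by (simp add: C_def algebra_simps)

lemma Cb_sym: "Cb Z X A B = Cb Z X B A"
  by (simp add: Cb_def algebra_simps)

lemma A2_sym: "A2 Z X Y = A2 Z Y X"
  by (simp add: A2_def algebra_simps)

lemma pp_cnj [simp]: "cnj (pp Z) = pp Z"
  by (simp add: pp_def)

lemma pd_add: "pd Z (X + X') = pd Z X + pd Z X'"
  and pd_scale: "pd Z (a *s X) = a * pd Z X"
  and pd_zero [simp]: "pd Z 0 = 0"
  by (auto simp: pd_def ip_add_left ip_scale_left algebra_simps sum.distrib sum_distrib_left)

lemma h_add_left: "h Z (X + X') Y = h Z X Y + h Z X' Y"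
  and h_add_right: "h Z X (Y + Y') = h Z X Y + h Z X Y'"
  and h_diff_left: "h Z (X - X') Y = h Z X Y - h Z X' Y"
  and h_diff_right: "h Z X (Y - Y') = h Z X Y - h Z X Y'"
  and h_scale_left: "h Z (a *s X) Y = a * h Z X Y"
  and h_scale_right: "h Z X (a *s Y) = cnj a * h Z X Y"
  and h_zero_left [simp]: "h Z 0 Y = 0"
  and h_zero_right [simp]: "h Z X 0 = 0"
  unfolding h_def by (simp_all add: ip_add_left ip_scale_left ip_add_right ip_scale_right ip_diff_left ip_diff_right
      algebra_simps sum.distrib sum_distrib_left sum_subtractf)

lemma C_scale1: "C Z (a *s A) X Y = a * C Z A X Y"
  and C_zero1 [simp]: "C Z 0 X Y = 0"
  and C_zero2 [simp]: "C Z A 0 Y = 0"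
  and C_zero3 [simp]: "C Z A X 0 = 0"
  and Cb_zero1 [simp]: "Cb Z 0 X Y = 0"
  and Cb_zero2 [simp]: "Cb Z A 0 Y = 0"
  and Cb_zero3 [simp]: "Cb Z A X 0 = 0"
  and A2_zero1 [simp]: "A2 Z 0 X = 0"
  and A2_zero2 [simp]: "A2 Z X 0 = 0"
  unfolding C_def Cb_def A2_def by (simp_all add: ip_scale_left ip_scale_right algebra_simps sum_distrib_left)

end

locale cr_dom = blocks bl s m + opn W
  for bl :: "'n::finite \<Rightarrow> nat" and s m and W :: "((complex^'n) \<times> real) set"
begin

context
  fixes \<delta> \<delta>' assumes dp: "derpair \<delta> \<delta>'"
begin

lemma sm_cc [simp]: "sm W t \<Longrightarrow> sm W (\<lambda>q. cc j k (t q))"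
  unfolding cc_def by simp

text \<open>For k > m j the exponent \<open>m j - k\<close> truncates to 0, but the falling
  factorial then contains the factor 0, so the rule holds for every k.\<close>

lemma d_cc: "q \<in> W \<Longrightarrow> sm W t \<Longrightarrow> \<delta> (\<lambda>q. cc j k (t q)) q = cc j (Suc k) (t q) * \<delta> t q"
proof -
  assume q: "q \<in> W" and t: "sm W t"
  have "\<delta> (\<lambda>q. cc j k (t q)) q = (\<Prod>i<k. of_nat (m j) - of_nat i) * (of_nat (m j - k) * t q ^ (m j - k - 1) * \<delta> t q)"
    unfolding cc_def using q t by (simp add: d_cmult[OF dp] d_power[OF dp])
  moreover have "(\<Prod>i<k. of_nat (m j) - of_nat i) * of_nat (m j - k) = (\<Prod>i<Suc k. of_nat (m j) - (of_nat i :: complex))"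
  proof (cases "k \<le> m j")
    case True
    then show ?thesis by (simp add: of_nat_diff)
  next
    case False
    then have "(\<Prod>i<k. of_nat (m j) - (of_nat i::complex)) = 0"
      by (intro prod_zero) (auto intro!: bexI[of _ "m j"])
    then show ?thesis by simp
  qed
  ultimately show ?thesis unfolding cc_def by (metis (no_types, lifting) diff_Suc_eq_diff_pred diff_diff_left mult.assoc plus_1_eq_Suc add.commute)
qed

lemma sm_forms:
  "smv W F \<Longrightarrow> sm W (\<lambda>q. pp (F q))"
  "smv W F \<Longrightarrow> smv W U \<Longrightarrow> sm W (\<lambda>q. pd (F q) (U q))"
  "smv W F \<Longrightarrow> smv W U \<Longrightarrow> smv W V \<Longrightarrow> sm W (\<lambda>q. h (F q) (U q) (V q))"
  "smv W F \<Longrightarrow> smv W U \<Longrightarrow> smv W V \<Longrightarrow> smv W A \<Longrightarrow> sm W (\<lambda>q. C (F q) (A q) (U q) (V q))"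
  "smv W F \<Longrightarrow> smv W U \<Longrightarrow> smv W V \<Longrightarrow> smv W A \<Longrightarrow> sm W (\<lambda>q. Cb (F q) (A q) (U q) (V q))"
  unfolding pp_def pd_def h_def C_def Cb_def by (auto intro!: sm_sum sm_add sm_mult sm_cc sm_ip[OF dp])

lemma d_pp:
  assumes "q \<in> W" "smv W F"
  shows "\<delta> (\<lambda>q. pp (F q)) q = pd (F q) (vd \<delta> F q) + cnj (pd (F q) (vd \<delta>' F q))"
proof -
  have "\<delta> (\<lambda>q. pp (F q)) q = (\<Sum>j\<in>{1..s}. cc j 1 (ipb j (F q) (F q)) * (ipb j (vd \<delta> F q) (F q) + ipb j (F q) (vd \<delta>' F q)))"
    using assms unfolding pp_def by (simp add: d_sum[OF dp] d_cc sm_ip[OF dp] d_ip[OF dp] del: vd_nth)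
  then show ?thesis by (simp add: pd_def sum.distrib ip_cnj algebra_simps)
qed

lemma d_pd:
  assumes "q \<in> W" "smv W F" "smv W U"
  shows "\<delta> (\<lambda>q. pd (F q) (U q)) q = pd (F q) (vd \<delta> U q) + h (F q) (U q) (vd \<delta>' F q) + A2 (F q) (vd \<delta> F q) (U q)"
  using assms unfolding pd_def h_def A2_def
  by (simp add: d_sum[OF dp] d_mult[OF dp] d_cc sm_ip[OF dp] d_ip[OF dp] numeral_2_eq_2 algebra_simps flip: sum.distrib)

lemma d_h:
  assumes "q \<in> W" "smv W F" "smv W U" "smv W V"
  shows "\<delta> (\<lambda>q. h (F q) (U q) (V q)) q = h (F q) (vd \<delta> U q) (V q) + h (F q) (U q) (vd \<delta>' V q)
    + C (F q) (vd \<delta> F q) (U q) (V q) + Cb (F q) (U q) (V q) (vd \<delta>' F q)"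
  using assms unfolding C_def h_def Cb_def
  by (simp add: d_sum[OF dp] d_mult[OF dp] d_add[OF dp] d_cc sm_ip[OF dp] d_ip[OF dp] numeral_2_eq_2 numeral_3_eq_3
      algebra_simps flip: sum.distrib)

text \<open>The premise \<open>vd \<delta> F q = 0\<close> suppresses the derivative of type (3,1).
  For \<delta> = \<open>Zb x\<close> it is the CR equation, of a CR map F or of the coordinate map
  \<open>fst\<close>.\<close>

lemma d_C:
  assumes "q \<in> W" "smv W F" "smv W U" "smv W V" "smv W A" "vd \<delta> F q = 0"
  shows "\<delta> (\<lambda>q. C (F q) (A q) (U q) (V q)) q = C (F q) (vd \<delta> A q) (U q) (V q) + C (F q) (A q) (vd \<delta> U q) (V q)
    + C (F q) (A q) (U q) (vd \<delta>' V q) + K (F q) (A q) (U q) (V q) (vd \<delta>' F q)"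
proof -
  let ?i = "\<lambda>j X Y. ipb j (X q) (Y q)" and ?c = "\<lambda>j k. cc j k (ipb j (F q) (F q))"
  let ?A' = "vd \<delta> A" and ?U' = "vd \<delta> U" and ?V' = "vd \<delta>' V" and ?B = "vd \<delta>' F"
  note sms = sm_ip[OF dp assms(2)] sm_ip[OF dp assms(3)] sm_ip[OF dp assms(5)] assms(2-5)
  have 1: "\<delta> (\<lambda>q. ipb j (A q) (F q)) q = ?i j ?A' F + ?i j A ?B"
    "\<delta> (\<lambda>q. ipb j (U q) (F q)) q = ?i j ?U' F + ?i j U ?B"
    "\<delta> (\<lambda>q. ipb j (A q) (V q)) q = ?i j ?A' V + ?i j A ?V'"
    "\<delta> (\<lambda>q. ipb j (U q) (V q)) q = ?i j ?U' V + ?i j U ?V'"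
    "\<delta> (\<lambda>q. ipb j (F q) (V q)) q = ?i j F ?V'"
    "\<delta> (\<lambda>q. cc j k (ipb j (F q) (F q))) q = ?c j (Suc k) * ?i j F ?B" for j k
    using assms by (simp_all add: d_ip[OF dp] d_cc sms del: vd_nth)
  have "\<delta> (\<lambda>q. C (F q) (A q) (U q) (V q)) q = (\<Sum>j\<in>{1..s}.
      ?c j 3 * ?i j F ?B * (?i j A F * ?i j U V + ?i j U F * ?i j A V)
      + ?c j 2 * ((?i j ?A' F + ?i j A ?B) * ?i j U V + ?i j A F * (?i j ?U' V + ?i j U ?V')
                 + (?i j ?U' F + ?i j U ?B) * ?i j A V + ?i j U F * (?i j ?A' V + ?i j A ?V'))
      + (?c j 4 * ?i j F ?B * ?i j A F * ?i j U F * ?i j F V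
        + ?c j 3 * ((?i j ?A' F + ?i j A ?B) * ?i j U F * ?i j F V + ?i j A F * (?i j ?U' F + ?i j U ?B) * ?i j F V
          + ?i j A F * ?i j U F * ?i j F ?V')))"
    unfolding C_def using assms(1)
    by (simp add: d_sum[OF dp] d_mult[OF dp] d_add[OF dp] sms 1 del: vd_nth)
      (intro sum.cong refl, simp add: algebra_simps)
  also have "\<dots> = C (F q) (?A' q) (U q) (V q) + C (F q) (A q) (?U' q) (V q)
    + C (F q) (A q) (U q) (?V' q) + K (F q) (A q) (U q) (V q) (?B q)"
    unfolding C_def K_def sum.distrib[symmetric] by (intro sum.cong refl) algebra
  finally show ?thesis .
qed

end

section \<open>The CR frame and its commutators\<close>

abbreviation T :: "((complex^'n) \<times> real \<Rightarrow> complex) \<Rightarrow> (complex^'n) \<times> real \<Rightarrow> complex"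
  where "T \<equiv> ddir (0, 1)"

text \<open>The lift of d/dz along the constant vector x to the graph of p; the \<open>T\<close>
  part is chosen so that the conjugate field annihilates u + i p. CR functions are those killed by
  every \<open>Zb x\<close>.\<close>

definition Z :: "complex^'n \<Rightarrow> ((complex^'n) \<times> real \<Rightarrow> complex) \<Rightarrow> (complex^'n) \<times> real \<Rightarrow> complex"
  where "Z x f q = (ddir (x, 0) f q - \<i> * ddir (\<i> *s x, 0) f q) / 2 + \<i> * pd (fst q) x * T f q"

definition Zb :: "complex^'n \<Rightarrow> ((complex^'n) \<times> real \<Rightarrow> complex) \<Rightarrow> (complex^'n) \<times> real \<Rightarrow> complex"
  where "Zb x f q = (ddir (x, 0) f q + \<i> * ddir (\<i> *s x, 0) f q) / 2 - \<i> * cnj (pd (fst q) x) * T f q"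

lemma derpair_ddir: "derpair (ddir v) (ddir v)"
proof -
  have 1: "ddir v (\<lambda>q. f q + g q) q = ddir v f q + ddir v g q"
    and 2: "ddir v (\<lambda>q. f q * g q) q = ddir v f q * g q + f q * ddir v g q"
    and 3: "ddir v (\<lambda>q. cnj (f q)) q = cnj (ddir v f q)"
    if "sm W f" "sm W g" "q \<in> W" for f g :: "_ \<Rightarrow> complex" and q
  proof -
    note df = sm_has_derivative[OF that(1,3)] and dg = sm_has_derivative[OF that(2,3)]
    show "ddir v (\<lambda>q. f q + g q) q = ddir v f q + ddir v g q"
      using ddir_eqI[OF has_derivative_add[OF df dg]] by simp
    show "ddir v (\<lambda>q. f q * g q) q = ddir v f q * g q + f q * ddir v g q"
      using ddir_eqI[OF has_derivative_mult[OF df dg]] by simp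
    show "ddir v (\<lambda>q. cnj (f q)) q = cnj (ddir v f q)"
      using ddir_eqI[OF bounded_linear.has_derivative[OF bounded_linear_cnj df]] by simp
  qed
  have 4: "ddir v (\<lambda>_. c) q = 0" for c :: complex and q
    using ddir_eqI[OF has_derivative_const] by blast
  have 5: "ddir v f q = ddir v g q" if "sm W f" "\<forall>q\<in>W. f q = g q" "q \<in> W" for f g :: "_ \<Rightarrow> complex" and q
    using ddir_cong[of f g q v] that by blast
  show ?thesis
    unfolding derpair_def
    by (intro conjI allI ballI impI) (simp_all add: 1 2 3 4 sm_ddir, metis 5)
qed

lemma sm_lin_fst: "smv W fst"
proof -
  have "bounded_linear (\<lambda>q::(complex^'n) \<times> real. fst q $ \<mu>)" for \<mu>
    by (rule bounded_linear_compose[OF bounded_linear_vec_nth bounded_linear_fst])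
  then show ?thesis by (simp add: smv_def sm_linear)
qed

lemma sm_pd_fst: "sm W (\<lambda>q. pd (fst q) x)"
  using sm_forms(2)[OF derpair_ddir sm_lin_fst smv_const] .

lemma derpair_Z: "derpair (Z x) (Zb x)" and derpair_Zb: "derpair (Zb x) (Z x)"
proof -
  have s: "sm W (Z x f)" "sm W (Zb x f)" if "sm W f" for f
    unfolding Z_def[abs_def] Zb_def[abs_def] divide_inverse
    by (intro sm_add sm_diff sm_mult sm_cnj sm_pd_fst sm_ddir sm_const that)+
  note d = derpair_ddir[unfolded derpair_def]
  have c: "Z x f q = Z x g q" "Zb x f q = Zb x g q" if "sm W f" "\<forall>q\<in>W. f q = g q" "q \<in> W" for f g q
    using ddir_cong[of f g q] that unfolding Z_def Zb_def by auto
  show "derpair (Z x) (Zb x)" "derpair (Zb x) (Z x)"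
    unfolding derpair_def using s c
    by (auto simp: Z_def Zb_def d_add[OF derpair_ddir] d_mult[OF derpair_ddir] d_const[OF derpair_ddir]
       d_cnj[OF derpair_ddir] field_simps)
qed

lemma Z_fst: "q \<in> W \<Longrightarrow> vd (Z x) fst q = x"
  and Zb_fst: "q \<in> W \<Longrightarrow> vd (Zb x) fst q = 0"
  and T_fst: "q \<in> W \<Longrightarrow> vd T fst q = 0"
proof -
  have "ddir v (\<lambda>q. fst q $ \<mu>) q = fst v $ \<mu>" for v \<mu> and q :: "(complex^'n) \<times> real"
    by (rule ddir_eqI) (auto intro!: derivative_eq_intros bounded_linear_imp_has_derivative
        bounded_linear_compose[OF bounded_linear_vec_nth bounded_linear_fst, unfolded o_def])
  then show "vd (Z x) fst q = x" "vd (Zb x) fst q = 0" "vd T fst q = 0"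
    by (auto simp: vec_eq_iff Z_def Zb_def)
qed

lemma Z_add: "q \<in> W \<Longrightarrow> sm W f \<Longrightarrow> Z (x + y) f q = Z x f q + Z y f q"
  and Z_scale: "q \<in> W \<Longrightarrow> sm W f \<Longrightarrow> Z (a *s x) f q = a * Z x f q"
  and Zb_add: "q \<in> W \<Longrightarrow> sm W f \<Longrightarrow> Zb (x + y) f q = Zb x f q + Zb y f q"
  and Zb_scale: "q \<in> W \<Longrightarrow> sm W f \<Longrightarrow> Zb (a *s x) f q = cnj a * Zb x f q"
proof -
  assume q: "q \<in> W" and f: "sm W f"
  interpret l: bounded_linear "\<lambda>v. ddir v f q"
    using sm_has_derivative[OF f q] has_derivative_bounded_linear by blast
  have a: "ddir (x + y, 0) f q = ddir (x, 0) f q + ddir (y, 0) f q" for x y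
    using l.add[of "(x, 0)" "(y, 0)"] by simp
  have sc: "ddir (a *s x, 0) f q = of_real (Re a) * ddir (x, 0) f q + of_real (Im a) * ddir (\<i> *s x, 0) f q" for a x
  proof -
    have "a *s x = Re a *\<^sub>R x + Im a *\<^sub>R (\<i> *s x)"
      by (auto simp: vec_eq_iff complex_eq_iff)
    then have e1: "(a *s x, 0) = Re a *\<^sub>R (x, 0) + Im a *\<^sub>R (\<i> *s x, 0)" by simp
    show ?thesis unfolding e1 by (simp only: l.add l.scaleR scaleR_conv_of_real)
  qed
  have i: "\<i> *s (a *s x) = (\<i> * a) *s x" for a x by (simp add: vec_eq_iff)
  have e: "a = of_real (Re a) + \<i> * of_real (Im a)" for a using complex_eq by simp
  show "Z (x + y) f q = Z x f q + Z y f q" "Zb (x + y) f q = Zb x f q + Zb y f q"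
    by (auto simp: Z_def Zb_def a pd_add vector_add_ldistrib field_simps)
  \<comment> \<open>R and I stand for the real and imaginary part of the scalar a, A and B for the
    derivatives along x and \<open>\<i> *s x\<close>; b is a or its conjugate.\<close>
  have alg: "b = R + \<i> * I \<Longrightarrow> ((R * A + I * B) - \<i> * (- I * A + R * B)) / 2 + \<i> * (b * P) * t
      = b * ((A - \<i> * B) / 2 + \<i> * P * t)"
    "b = R - \<i> * I \<Longrightarrow> ((R * A + I * B) + \<i> * (- I * A + R * B)) / 2 - \<i> * (b * P) * t
      = b * ((A + \<i> * B) / 2 - \<i> * P * t)" for b R I A B P t :: complex
    by (auto simp: field_simps)
  have c: "cnj a = of_real (Re a) - \<i> * of_real (Im a)"
    by (simp add: complex_eq_iff)
  show "Z (a *s x) f q = a * Z x f q"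
    unfolding Z_def i sc[of a x] sc[of "\<i> * a" x] pd_scale Re_i_times Im_i_times of_real_minus
    by (rule alg(1)[OF e])
  show "Zb (a *s x) f q = cnj a * Zb x f q"
    unfolding Zb_def i sc[of a x] sc[of "\<i> * a" x] pd_scale complex_cnj_mult Re_i_times Im_i_times of_real_minus
    by (rule alg(2)[OF c])
qed

lemma sm_Z [simp]: "sm W f \<Longrightarrow> sm W (Z x f)"
  and sm_Zb [simp]: "sm W f \<Longrightarrow> sm W (Zb x f)"
  and sm_T [simp]: "sm W f \<Longrightarrow> sm W (ddir v f)"
  using d_sm[OF derpair_Z] d_sm[OF derpair_Zb] sm_ddir by auto

lemma smv_Z [simp]: "smv W F \<Longrightarrow> smv W (vd (Z x) F)"
  and smv_Zb [simp]: "smv W F \<Longrightarrow> smv W (vd (Zb x) F)"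
  and smv_T [simp]: "smv W F \<Longrightarrow> smv W (vd (ddir v) F)"
  by (auto simp: smv_def)

lemmas sms = sm_add sm_diff sm_mult sm_uminus sm_const sm_cnj sm_Z sm_Zb sm_T sm_pd_fst

lemma T_pd_fst: "q \<in> W \<Longrightarrow> T (\<lambda>q. pd (fst q) x) q = 0"
  and Z_pd_fst: "q \<in> W \<Longrightarrow> Z y (\<lambda>q. pd (fst q) x) q = A2 (fst q) y x"
  and Zb_pd_fst: "q \<in> W \<Longrightarrow> Zb y (\<lambda>q. pd (fst q) x) q = h (fst q) x y"
  using d_pd[OF derpair_ddir _ sm_lin_fst smv_const] d_pd[OF derpair_Z _ sm_lin_fst smv_const]
    d_pd[OF derpair_Zb _ sm_lin_fst smv_const]
  by (auto simp: T_fst Z_fst Zb_fst vd_const[OF derpair_ddir] vd_const[OF derpair_Z] vd_const[OF derpair_Zb])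

context
  fixes f :: "(complex^'n) \<times> real \<Rightarrow> complex" and q
  assumes q: "q \<in> W" and f: "sm W f"
begin

lemma T_Z: "T (Z x f) q = Z x (T f) q" and T_Zb: "T (Zb x f) q = Zb x (T f) q"
proof -
  note dr = d_add[OF derpair_ddir q] d_diff[OF derpair_ddir q] d_mult[OF derpair_ddir q] d_const[OF derpair_ddir q]
    d_cnj[OF derpair_ddir q] T_pd_fst[OF q]
    ddir_commute[OF open_W f q, of "(0,1)" "(x,0)"] ddir_commute[OF open_W f q, of "(0,1)" "(\<i> *s x,0)"]
  show "T (Z x f) q = Z x (T f) q" "T (Zb x f) q = Zb x (T f) q"
    unfolding Z_def[abs_def] Zb_def[abs_def] divide_inverse
    by (simp_all only: dr sms f mult_zero_left mult_zero_right add_0_left add_0_right diff_zero complex_cnj_zero)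
qed

lemma Z_Z: "Z x (Z y f) q = Z y (Z x f) q"
proof -
  have 1: "Z x (Z y f) q = (Z x (ddir (y, 0) f) q - \<i> * Z x (ddir (\<i> *s y, 0) f) q) / 2
     + \<i> * (A2 (fst q) x y * T f q + pd (fst q) y * Z x (T f) q)" for x y
    unfolding Z_def[of y, abs_def] divide_inverse
    by (simp only: f sms d_add[OF derpair_Z q] d_diff[OF derpair_Z q] d_mult[OF derpair_Z q] d_const[OF derpair_Z q]
       Z_pd_fst[OF q]  ,
      simp add: algebra_simps)
  note c = ddir_commute[OF open_W f q, of "(x, 0)" "(y, 0)"] ddir_commute[OF open_W f q, of "(x, 0)" "(\<i> *s y, 0)"]
    ddir_commute[OF open_W f q, of "(\<i> *s x, 0)" "(y, 0)"] ddir_commute[OF open_W f q, of "(\<i> *s x, 0)" "(\<i> *s y, 0)"]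
    ddir_commute[OF open_W f q, of "(x, 0)" "(0, 1)"] ddir_commute[OF open_W f q, of "(\<i> *s x, 0)" "(0, 1)"]
    ddir_commute[OF open_W f q, of "(y, 0)" "(0, 1)"] ddir_commute[OF open_W f q, of "(\<i> *s y, 0)" "(0, 1)"]
  show ?thesis
    unfolding 1 unfolding Z_def c A2_sym[of _ y x] by (simp add: field_simps)
qed

lemma Zb_Zb: "Zb x (Zb y f) q = Zb y (Zb x f) q"
proof -
  have 1: "Zb x (Zb y f) q = (Zb x (ddir (y, 0) f) q + \<i> * Zb x (ddir (\<i> *s y, 0) f) q) / 2
     - \<i> * (cnj (A2 (fst q) x y) * T f q + cnj (pd (fst q) y) * Zb x (T f) q)" for x y
    unfolding Zb_def[of y, abs_def] divide_inverse
    by (simp only: f sms d_add[OF derpair_Zb q] d_diff[OF derpair_Zb q] d_mult[OF derpair_Zb q] d_const[OF derpair_Zb q]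
       d_cnj[OF derpair_Zb q] Z_pd_fst[OF q]  ,
      simp add: algebra_simps)
  note c = ddir_commute[OF open_W f q, of "(x, 0)" "(y, 0)"] ddir_commute[OF open_W f q, of "(x, 0)" "(\<i> *s y, 0)"]
    ddir_commute[OF open_W f q, of "(\<i> *s x, 0)" "(y, 0)"] ddir_commute[OF open_W f q, of "(\<i> *s x, 0)" "(\<i> *s y, 0)"]
    ddir_commute[OF open_W f q, of "(x, 0)" "(0, 1)"] ddir_commute[OF open_W f q, of "(\<i> *s x, 0)" "(0, 1)"]
    ddir_commute[OF open_W f q, of "(y, 0)" "(0, 1)"] ddir_commute[OF open_W f q, of "(\<i> *s y, 0)" "(0, 1)"]
  show ?thesis
    unfolding 1 unfolding Zb_def c A2_sym[of _ y x] by (simp add: field_simps)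
qed

text \<open>The only nonzero commutator of the frame. The Levi form appears because each of the two
  fields differentiates the \<open>T\<close> coefficient of the other, contributing i h each
  time.\<close>

lemma Zb_Z: "Zb y (Z x f) q = Z x (Zb y f) q + 2 * \<i> * h (fst q) x y * T f q"
proof -
  have 1: "Z x (Zb y f) q = (Z x (ddir (y, 0) f) q + \<i> * Z x (ddir (\<i> *s y, 0) f) q) / 2
     - \<i> * (h (fst q) x y * T f q + cnj (pd (fst q) y) * Z x (T f) q)"
    unfolding Zb_def[of y, abs_def] divide_inverse
    by (simp only: f sms d_add[OF derpair_Z q] d_diff[OF derpair_Z q] d_mult[OF derpair_Z q] d_const[OF derpair_Z q]
       d_cnj[OF derpair_Z q] Zb_pd_fst[OF q]  h_cnj ,
      simp add: algebra_simps)
  have 2: "Zb y (Z x f) q = (Zb y (ddir (x, 0) f) q - \<i> * Zb y (ddir (\<i> *s x, 0) f) q) / 2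
     + \<i> * (h (fst q) x y * T f q + pd (fst q) x * Zb y (T f) q)"
    unfolding Z_def[of x, abs_def] divide_inverse
    by (simp only: f sms d_add[OF derpair_Zb q] d_diff[OF derpair_Zb q] d_mult[OF derpair_Zb q] d_const[OF derpair_Zb q]
       Zb_pd_fst[OF q]  ,
      simp add: algebra_simps)
  note c = ddir_commute[OF open_W f q, of "(x, 0)" "(y, 0)"] ddir_commute[OF open_W f q, of "(x, 0)" "(\<i> *s y, 0)"]
    ddir_commute[OF open_W f q, of "(\<i> *s x, 0)" "(y, 0)"] ddir_commute[OF open_W f q, of "(\<i> *s x, 0)" "(\<i> *s y, 0)"]
    ddir_commute[OF open_W f q, of "(x, 0)" "(0, 1)"] ddir_commute[OF open_W f q, of "(\<i> *s x, 0)" "(0, 1)"]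
    ddir_commute[OF open_W f q, of "(y, 0)" "(0, 1)"] ddir_commute[OF open_W f q, of "(\<i> *s y, 0)" "(0, 1)"]
  show ?thesis
    unfolding 1 2 unfolding Z_def Zb_def c by (simp add: field_simps)
qed

end

text \<open>\<open>Z\<close>, \<open>Zb\<close> and \<open>T\<close> span the complexified tangent
  space, so the full derivative vanishes.\<close>

lemma zero_derivs_const:
  assumes "connected W" "sm W f" "\<And>q x. q \<in> W \<Longrightarrow> Z x f q = 0" "\<And>q x. q \<in> W \<Longrightarrow> Zb x f q = 0"
    "\<And>q. q \<in> W \<Longrightarrow> T f q = 0" "q \<in> W" "q' \<in> W"
  shows "f q = f q'"
proof -
  have "ddir v f q = 0" if q: "q \<in> W" for q v
  proof -
    interpret l: bounded_linear "\<lambda>v. ddir v f q"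
      using sm_has_derivative[OF assms(2) q] has_derivative_bounded_linear by blast
    obtain x t where v: "v = (x, t)" by (cases v)
    have "v = (x, 0) + t *\<^sub>R (0, 1)" using v by simp
    then have "ddir v f q = ddir (x, 0) f q + t *\<^sub>R T f q" using l.add l.scaleR by metis
    moreover have "ddir (x, 0) f q = 0"
      using assms(3)[OF q, of x] assms(4)[OF q, of x] assms(5)[OF q] by (auto simp: Z_def Zb_def)
    ultimately show ?thesis using assms(5)[OF q] by simp
  qed
  then have "(f has_derivative (\<lambda>v. 0)) (at q within W)" if "q \<in> W" for q
    using has_derivative_at_withinI[OF sm_has_derivative[OF assms(2) that]] that by simp
  then show ?thesis
    using has_derivative_zero_unique_connected[OF open_W assms(1)] assms(6,7) at_within_open[OF _ open_W] by metis
qed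

end

section \<open>The equations satisfied by a CR map\<close>

context blocks
begin

definition nondeg :: "complex^'n \<Rightarrow> bool"
  where "nondeg Z \<longleftrightarrow> (\<forall>j\<in>{1..<s}. ipb j Z Z \<noteq> 0)"

end

locale cr_blocks = blocks bl s m
  for bl :: "'n::finite \<Rightarrow> nat" and s m +
  assumes s_pos: "1 \<le> s" and m_s: "m s = 1" and m_ge: "\<And>j. j \<in> {1..<s} \<Longrightarrow> 2 \<le> m j"
    and bl_in: "\<And>\<mu>. bl \<mu> \<in> {1..s}"
    and card_blk: "\<And>j. j \<in> {1..<s} \<Longrightarrow> 2 \<le> card {\<mu>. bl \<mu> = j}"
    and card_n: "2 \<le> CARD('n)"
begin

lemma m_pos: "j \<in> {1..s} \<Longrightarrow> 1 \<le> m j"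
  using m_s m_ge[of j] by (cases "j = s") auto

lemma ip_self_nonneg: "ipb j X X = of_real (Re (ipb j X X))" "0 \<le> Re (ipb j X X)"
  unfolding ip_self_real by (auto simp: sum_nonneg)

lemma ip_self_pos:
  assumes "X \<noteq> 0" obtains j where "j \<in> {1..s}" "0 < Re (ipb j X X)"
proof -
  obtain \<mu> where "X $ \<mu> \<noteq> 0" using assms by (metis vec_eq_iff zero_index)
  then have "0 < Re (ipb (bl \<mu>) X X)"
    unfolding ip_self_real by (auto intro!: sum_pos2[of _ \<mu>])
  then show ?thesis using that bl_in by blast
qed

lemma h_self_term:
  "cc j 1 (ipb j Z Z) * ipb j X X + cc j 2 (ipb j Z Z) * ipb j X Z * ipb j Z X
   = of_real (m j * Re (ipb j Z Z) ^ (m j - 1) * Re (ipb j X X)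
       + m j * (m j - 1) * Re (ipb j Z Z) ^ (m j - 2) * (cmod (ipb j X Z))\<^sup>2)"
proof -
  define r where "r = Re (ipb j Z Z)"
  define x where "x = Re (ipb j X X)"
  have r: "ipb j Z Z = of_real r" and x: "ipb j X X = of_real x"
    unfolding r_def x_def by (rule ip_self_nonneg)+
  have y: "ipb j X Z * ipb j Z X = of_real ((cmod (ipb j X Z))\<^sup>2)"
    by (metis complex_norm_square ip_cnj)
  have "(\<Prod>i<2. of_nat (m j) - (of_nat i :: complex)) = of_real (m j * (m j - 1))"
    by (cases "m j") (auto simp: numeral_2_eq_2 algebra_simps)
  then show ?thesis
    by (simp add: r x cc_def mult.assoc[of _ "ipb j X Z"] y)
qed

text \<open>Strict pseudoconvexity. The Euler term of each block is nonnegative, and the other term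
  is positive on a block where X does not vanish: there |z_j| is nonzero, or the block is the flat
  one, where the exponent m s - 1 is 0 and z_s may vanish.\<close>

lemma h_pos:
  assumes "nondeg Z" "X \<noteq> 0"
  shows "0 < Re (h Z X X)"
proof -
  let ?t = "\<lambda>j. m j * Re (ipb j Z Z) ^ (m j - 1) * Re (ipb j X X)
       + m j * (m j - 1) * Re (ipb j Z Z) ^ (m j - 2) * (cmod (ipb j X Z))\<^sup>2"
  have 1: "Re (h Z X X) = (\<Sum>j\<in>{1..s}. ?t j)"
    unfolding h_def h_self_term by simp
  have 2: "0 \<le> ?t j" for j
    using ip_self_nonneg(2) by simp
  obtain j where j: "j \<in> {1..s}" "0 < Re (ipb j X X)" using ip_self_pos assms by blast
  have "0 < Re (ipb j Z Z) ^ (m j - 1)"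
  proof (cases "j = s")
    case False
    then have "ipb j Z Z \<noteq> 0" using assms j by (auto simp: nondeg_def)
    then have "0 < Re (ipb j Z Z)" using ip_self_nonneg[of j Z]
      by (metis of_real_0 order_le_less)
    then show ?thesis by simp
  qed (simp add: m_s)
  then have "0 < ?t j"
    using j m_pos[OF j(1)] ip_self_nonneg(2) by (intro add_pos_nonneg) auto
  then show ?thesis unfolding 1 using 2 j by (intro sum_pos2[of _ j]) auto
qed

lemma h_self_nonzero: "nondeg Z \<Longrightarrow> X \<noteq> 0 \<Longrightarrow> h Z X X \<noteq> 0"
  using h_pos by fastforce

text \<open>Two coordinates suffice to kill one linear functional. Testing identities on such y
  removes one of two terms proportional to the Levi form and so isolates the coefficient of the
  other.\<close>

lemma ex_orthogonal: "\<exists>y. y \<noteq> 0 \<and> h Z x y = 0 \<and> h Z y x = 0"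
proof -
  define g where "g \<mu> = h Z (axis \<mu> 1) x" for \<mu>
  obtain a b :: 'n where ab: "a \<noteq> b"
    using obtain_subset_with_card_n[OF card_n] card_2_iff by metis
  have "\<exists>y. y \<noteq> 0 \<and> h Z y x = 0"
  proof (cases "g a = 0")
    case True
    then show ?thesis by (intro exI[of _ "axis a 1"]) (simp add: g_def axis_eq_0_iff)
  next
    case False
    let ?y = "g b *s axis a 1 - g a *s axis b 1"
    have "?y $ b \<noteq> 0" using ab False by (simp add: axis_def)
    then have "?y \<noteq> 0" by (metis zero_index)
    moreover have "h Z ?y x = 0" by (simp add: h_diff_left h_scale_left flip: g_def)
    ultimately show ?thesis by blast
  qed
  then show ?thesis using h_cnj by (metis complex_cnj_zero)
qed

end

text \<open>F and G are the z- and w-components of the map in the parametrization. Only the real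
  part of the contact factor is assumed positive; that the factor is real follows from the equation
  of the hypersurface.\<close>

locale cr_map = cr_blocks bl s m + cr_dom bl s m W
  for bl :: "'n::finite \<Rightarrow> nat" and s m and W :: "((complex^'n) \<times> real) set" +
  fixes F :: "(complex^'n) \<times> real \<Rightarrow> complex^'n" and G :: "(complex^'n) \<times> real \<Rightarrow> complex"
  assumes conn_W: "connected W"
    and smv_F: "smv W F" and sm_G: "sm W G"
    and CR_F: "\<And>q x. q \<in> W \<Longrightarrow> vd (Zb x) F q = 0"
    and CR_G: "\<And>q x. q \<in> W \<Longrightarrow> Zb x G q = 0"
    and im_G: "\<And>q. q \<in> W \<Longrightarrow> G q = cnj (G q) + 2 * \<i> * pp (F q)"
    and nondeg_z: "\<And>q. q \<in> W \<Longrightarrow> nondeg (fst q)"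
    and nondeg_F: "\<And>q. q \<in> W \<Longrightarrow> nondeg (F q)"
    and lam_Re_pos: "\<And>q. q \<in> W \<Longrightarrow> 0 < Re (T G q - 2 * \<i> * pd (F q) (vd T F q))"
begin

abbreviation A :: "(complex^'n) \<Rightarrow> (complex^'n) \<times> real \<Rightarrow> complex^'n" where "A x \<equiv> vd (Z x) F"
abbreviation TF :: "(complex^'n) \<times> real \<Rightarrow> complex^'n" where "TF \<equiv> vd T F"

text \<open>The contact form at F evaluated on the image of \<open>T\<close>; it turns out to be the
  conformal factor of the Levi forms.\<close>

definition lam :: "(complex^'n) \<times> real \<Rightarrow> complex"
  where "lam q = T G q - 2 * \<i> * pd (F q) (TF q)"

lemma smv_A [simp]: "smv W (A x)" and smv_TF [simp]: "smv W TF" and smv_F' [simp]: "smv W F"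
  and smv_fst [simp]: "smv W fst" and sm_G' [simp]: "sm W G"
  by (simp_all add: smv_F sm_lin_fst sm_G)

lemma sm_F_nth [simp]: "sm W (\<lambda>q. F q $ \<mu>)"
  using smv_F by (simp add: smv_def)

lemma sm_fm [simp]:
  "smv W P \<Longrightarrow> sm W (\<lambda>q. pp (P q))"
  "smv W P \<Longrightarrow> smv W U \<Longrightarrow> sm W (\<lambda>q. pd (P q) (U q))"
  "smv W P \<Longrightarrow> smv W U \<Longrightarrow> smv W V \<Longrightarrow> sm W (\<lambda>q. h (P q) (U q) (V q))"
  "smv W P \<Longrightarrow> smv W U \<Longrightarrow> smv W V \<Longrightarrow> smv W X \<Longrightarrow> sm W (\<lambda>q. C (P q) (X q) (U q) (V q))"
  "smv W P \<Longrightarrow> smv W U \<Longrightarrow> smv W V \<Longrightarrow> smv W X \<Longrightarrow> sm W (\<lambda>q. Cb (P q) (X q) (U q) (V q))"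
  using sm_forms[OF derpair_ddir] by auto

lemma sm_lam [simp]: "sm W lam"
  unfolding lam_def[abs_def] by simp

lemma sm_h_z [simp]: "sm W (\<lambda>q. h (fst q) x y)" "sm W (\<lambda>q. C (fst q) x y w)"
  using sm_fm(3)[of fst "\<lambda>_. x" "\<lambda>_. y"] sm_fm(4)[of fst "\<lambda>_. y" "\<lambda>_. w" "\<lambda>_. x"] by simp_all

lemma vd_const' [simp]: "q \<in> W \<Longrightarrow> vd (Z x) (\<lambda>_. y) q = 0" "q \<in> W \<Longrightarrow> vd (Zb x) (\<lambda>_. y) q = 0"
   "q \<in> W \<Longrightarrow> vd (ddir v) (\<lambda>_. y) q = 0"
  by (simp_all add: vd_const[OF derpair_Z] vd_const[OF derpair_Zb] vd_const[OF derpair_ddir])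

lemma Z_h_z: "q \<in> W \<Longrightarrow> Z w (\<lambda>q. h (fst q) x y) q = C (fst q) w x y"
  and Zb_h_z: "q \<in> W \<Longrightarrow> Zb w (\<lambda>q. h (fst q) x y) q = Cb (fst q) x y w"
  and Zb_C_z: "q \<in> W \<Longrightarrow> Zb w (\<lambda>q. C (fst q) v x y) q = K (fst q) v x y w"
  using d_h[OF derpair_Z _ smv_fst smv_const smv_const, of q w x y]
    d_h[OF derpair_Zb _ smv_fst smv_const smv_const, of q w x y]
    d_C[OF derpair_Zb _ smv_fst smv_const smv_const smv_const, of q w v x y]
  by (simp_all add: Z_fst Zb_fst T_fst)

lemma CR_comm:
  assumes "q \<in> W" "sm W f" "\<And>q x. q \<in> W \<Longrightarrow> Zb x f q = 0"
  shows "Zb y (Z x f) q = 2 * \<i> * h (fst q) x y * T f q" "Zb y (T f) q = 0"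
proof -
  have "Z x (Zb y f) q = Z x (\<lambda>_. 0) q" "T (Zb y f) q = T (\<lambda>_. 0) q"
    by (rule d_cong[OF derpair_Z] d_cong[OF derpair_ddir]; simp add: assms)+
  then show "Zb y (Z x f) q = 2 * \<i> * h (fst q) x y * T f q" "Zb y (T f) q = 0"
    using Zb_Z[OF assms(1,2)] T_Zb[OF assms(1,2)] d_const[OF derpair_Z assms(1)] d_const[OF derpair_ddir assms(1)] by auto
qed

lemma CR_F_nth: "q \<in> W \<Longrightarrow> Zb x (\<lambda>q. F q $ \<mu>) q = 0"
  using CR_F by (metis vd_nth zero_index)

lemma Zb_A: "q \<in> W \<Longrightarrow> vd (Zb y) (A x) q = (2 * \<i> * h (fst q) x y) *s TF q"
  and Zb_TF: "q \<in> W \<Longrightarrow> vd (Zb y) TF q = 0"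
  by (simp_all add: vec_eq_iff CR_comm CR_F_nth)

lemma A_add: "q \<in> W \<Longrightarrow> A (x + y) q = A x q + A y q"
  and A_scale: "q \<in> W \<Longrightarrow> A (a *s x) q = a *s A x q"
  by (simp_all add: vec_eq_iff Z_add Z_scale)

lemma Z_G: "q \<in> W \<Longrightarrow> Z x G q = 2 * \<i> * pd (F q) (A x q)"
proof -
  assume q: "q \<in> W"
  have "Z x G q = Z x (\<lambda>q. cnj (G q) + 2 * \<i> * pp (F q)) q"
    by (rule d_cong[OF derpair_Z q]) (use im_G in auto)
  also have "\<dots> = cnj (Zb x G q) + 2 * \<i> * (pd (F q) (A x q) + cnj (pd (F q) (vd (Zb x) F q)))"
    by (simp add: d_add[OF derpair_Z q] d_cmult[OF derpair_Z q] d_cnj[OF derpair_Z q] d_pp[OF derpair_Z q])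
  finally show ?thesis using q CR_F CR_G by simp
qed

text \<open>\<open>Zb y (Z x G)\<close> is computed twice: by the commutator, and by differentiating
  \<open>Z_G\<close>. As F is CR, \<open>Zb y\<close> acts on A x through the commutator alone, so
  both results contain the derivatives along \<open>T\<close> that make up lam.\<close>

lemma levi:
  assumes q: "q \<in> W"
  shows "h (F q) (A x q) (A y q) = lam q * h (fst q) x y"
proof -
  have "2 * \<i> * h (fst q) x y * T G q = Zb y (Z x G) q"
    using CR_comm(1)[OF q sm_G CR_G] by simp
  also have "\<dots> = Zb y (\<lambda>q. 2 * \<i> * pd (F q) (A x q)) q"
    by (rule d_cong[OF derpair_Zb q]) (use Z_G in auto)
  also have "\<dots> = 2 * \<i> * (pd (F q) ((2 * \<i> * h (fst q) x y) *s TF q) + h (F q) (A x q) (A y q))"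
    by (simp add: d_cmult[OF derpair_Zb q] d_pd[OF derpair_Zb q] CR_F[OF q] Zb_A[OF q])
  finally have "2 * \<i> * (h (fst q) x y * T G q) = 2 * \<i> * (2 * \<i> * h (fst q) x y * pd (F q) (TF q) + h (F q) (A x q) (A y q))"
    by (simp only: pd_scale mult.assoc)
  then have "h (fst q) x y * T G q = 2 * \<i> * h (fst q) x y * pd (F q) (TF q) + h (F q) (A x q) (A y q)"
    by (subst (asm) mult_left_cancel) simp_all
  then show ?thesis by (simp add: lam_def algebra_simps)
qed

lemma lam_cnj [simp]: "q \<in> W \<Longrightarrow> cnj (lam q) = lam q"
proof -
  assume q: "q \<in> W"
  have "T G q = T (\<lambda>q. cnj (G q) + 2 * \<i> * pp (F q)) q"
    by (rule d_cong[OF derpair_ddir q]) (use im_G in auto)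
  also have "\<dots> = cnj (T G q) + 2 * \<i> * (pd (F q) (TF q) + cnj (pd (F q) (TF q)))"
    by (simp add: d_add[OF derpair_ddir q] d_cmult[OF derpair_ddir q] d_cnj[OF derpair_ddir q] d_pp[OF derpair_ddir q])
  finally show ?thesis by (simp add: lam_def algebra_simps)
qed

lemma lam_pos: "q \<in> W \<Longrightarrow> 0 < Re (lam q)" and lam_nonzero [simp]: "q \<in> W \<Longrightarrow> lam q \<noteq> 0"
  and lam_real: "q \<in> W \<Longrightarrow> lam q = of_real (Re (lam q))"
  using lam_Re_pos[of q] lam_cnj[of q] by (auto simp: lam_def complex_eq_iff)

lemma Zb_lam: "q \<in> W \<Longrightarrow> Zb x lam q = cnj (Z x lam q)"
proof -
  assume q: "q \<in> W"
  have "Zb x lam q = Zb x (\<lambda>q. cnj (lam q)) q" by (rule d_cong[OF derpair_Zb q]) simp_all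
  then show ?thesis using d_cnj[OF derpair_Zb q] by simp
qed

lemma T_lam_cnj: "q \<in> W \<Longrightarrow> cnj (T lam q) = T lam q"
proof -
  assume q: "q \<in> W"
  have "T lam q = T (\<lambda>q. cnj (lam q)) q" by (rule d_cong[OF derpair_ddir q]) simp_all
  also have "\<dots> = cnj (T lam q)" by (rule d_cnj[OF derpair_ddir q sm_lam])
  finally show ?thesis by simp
qed

lemma A_inj: "q \<in> W \<Longrightarrow> A x q = 0 \<Longrightarrow> x = 0"
  using levi[of q x x] h_self_nonzero[OF nondeg_z, of q x] by auto

lemma A_surj:
  assumes q: "q \<in> W" obtains x where "A x q = y"
proof -
  have l: "linear (\<lambda>x. A x q)"
  proof (rule linearI)
    fix r :: real and x :: "complex^'n"
    have "r *\<^sub>R x = of_real r *s x" "r *\<^sub>R A x q = of_real r *s A x q"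
      by (auto simp: vec_eq_iff complex_eq_iff)
    then show "A (r *\<^sub>R x) q = r *\<^sub>R A x q" using A_scale[OF q] by simp
  qed (simp add: A_add[OF q])
  have "inj (\<lambda>x. A x q)"
    using linear_injective_0[OF l] A_inj[OF q] by blast
  from linear_injective_imp_surjective[OF l this] obtain x where "y = A x q"
    unfolding surj_def by blast
  then show ?thesis using that by simp
qed

text \<open>Differentiate \<open>levi\<close> along \<open>Z w\<close>; the left side is symmetric
  in w and x. Exchanging them for w = y with y orthogonal to x equates the coefficients of h y y,
  which identifies the (1,0) derivative of lam.\<close>

lemma tau:
  assumes q: "q \<in> W"
  shows "Z x lam q = 2 * \<i> * h (F q) (A x q) (TF q)"
    and levi_deriv: "h (F q) (vd (Z w) (A x) q) (A y q) + C (F q) (A w q) (A x q) (A y q)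
       = lam q * C (fst q) w x y + Z w lam q * h (fst q) x y + Z x lam q * h (fst q) w y"
proof -
  have *: "h (F q) (vd (Z w) (A x) q) (A y q) + C (F q) (A w q) (A x q) (A y q)
       = lam q * C (fst q) w x y + Z w lam q * h (fst q) x y + 2 * \<i> * h (F q) (A x q) (TF q) * h (fst q) w y" for w x y
  proof -
    have "Z w (\<lambda>q. h (F q) (A x q) (A y q)) q = Z w (\<lambda>q. lam q * h (fst q) x y) q"
      by (rule d_cong[OF derpair_Z q]) (use levi in auto)
    then show ?thesis
      by (simp add: d_mult[OF derpair_Z q] d_h[OF derpair_Z q] CR_F[OF q] Zb_A[OF q] Z_h_z[OF q] h_scale_right
         h_cnj algebra_simps del: vd_nth)
  qed
  have sym: "vd (Z w) (A x) q = vd (Z x) (A w) q" for w x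
    by (simp add: vec_eq_iff Z_Z[OF q])
  have t: "Z x lam q = 2 * \<i> * h (F q) (A x q) (TF q)" for x
  proof -
    obtain y where y: "y \<noteq> 0" "h (fst q) x y = 0" "h (fst q) y x = 0" using ex_orthogonal by blast
    have "Z x lam q * h (fst q) y y = 2 * \<i> * h (F q) (A x q) (TF q) * h (fst q) y y"
      using *[of x y y] *[of y x y] sym[of x y] C_sym[of "F q" "A x q"] C_sym[of "fst q" x] y by auto
    then show ?thesis using h_self_nonzero[OF nondeg_z[OF q] y(1)] by simp
  qed
  show "Z x lam q = 2 * \<i> * h (F q) (A x q) (TF q)" by (rule t)
  show "h (F q) (vd (Z w) (A x) q) (A y q) + C (F q) (A w q) (A x q) (A y q)
       = lam q * C (fst q) w x y + Z w lam q * h (fst q) x y + Z x lam q * h (fst q) w y"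
    using *[of w x y] t[of x] by simp
qed

end

section \<open>The curvature identity\<close>

context blocks
begin

text \<open>\<open>Gam\<close> is the (2,0)-connection of the Kaehler potential \<open>p\<close>; the factor \<open>m j - 1\<close> kills the junk
  division by \<open>ipb s Z Z\<close>, which may vanish.\<close>

definition Gam :: "complex^'n \<Rightarrow> complex^'n \<Rightarrow> complex^'n \<Rightarrow> complex^'n"
  where "Gam Z X Y = (\<chi> \<mu>. (of_nat (m (bl \<mu>)) - 1) / ipb (bl \<mu>) Z Z *
     (ipb (bl \<mu>) X Z * Y $ \<mu> + ipb (bl \<mu>) Y Z * X $ \<mu>
      - ipb (bl \<mu>) X Z * ipb (bl \<mu>) Y Z / ipb (bl \<mu>) Z Z * Z $ \<mu>))"

text \<open>The Levi form of block j on the parts transverse to Z: the component along the Euler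
  direction is split off.\<close>

definition eta :: "nat \<Rightarrow> complex^'n \<Rightarrow> complex^'n \<Rightarrow> complex^'n \<Rightarrow> complex"
  where "eta j Z X Y = cc j 1 (ipb j Z Z) * (ipb j X Y - ipb j X Z * ipb j Z Y / ipb j Z Z)"

definition cf :: "nat \<Rightarrow> complex^'n \<Rightarrow> complex"
  where "cf j Z = (of_nat (m j) - 1) / (of_nat (m j) * ipb j Z Z ^ m j)"

text \<open>Up to sign the curvature of the Kaehler metric with potential p, with X in both
  holomorphic and Y in both antiholomorphic slots; hence squares of eta instead of squared
  moduli.\<close>

definition RR :: "complex^'n \<Rightarrow> complex^'n \<Rightarrow> complex^'n \<Rightarrow> complex"
  where "RR Z X Y = (\<Sum>j\<in>{1..<s}. 2 * cf j Z * (eta j Z X Y)\<^sup>2)"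

lemma cc_Suc: "cc j (Suc k) t * t = (of_nat (m j) - of_nat k) * cc j k t"
proof (cases "k < m j")
  case True
  then have "t ^ (m j - Suc k) * t = t ^ (m j - k)"
    by (metis Suc_diff_Suc power_Suc2)
  then show ?thesis by (simp add: cc_def mult.assoc)
next
  case False
  then have "(\<Prod>i<Suc k. of_nat (m j) - (of_nat i::complex)) = 0"
    by (intro prod_zero) (auto intro!: bexI[of _ "m j"])
  then have "cc j (Suc k) t = 0" unfolding cc_def by (simp only: mult_zero_left)
  moreover have "(of_nat (m j) - of_nat k) * cc j k t = 0"
  proof (cases "k = m j")
    case f: False
    then have "(\<Prod>i<k. of_nat (m j) - (of_nat i::complex)) = 0"
      using False by (intro prod_zero) (auto intro!: bexI[of _ "m j"])
    then show ?thesis by (simp add: cc_def)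
  qed simp
  ultimately show ?thesis by simp
qed

lemma ip_Gam: "ipb j (Gam Z X Y) V = (of_nat (m j) - 1) / ipb j Z Z *
     (ipb j X Z * ipb j Y V + ipb j Y Z * ipb j X V - ipb j X Z * ipb j Y Z / ipb j Z Z * ipb j Z V)"
proof -
  let ?a = "(of_nat (m j) - 1) / ipb j Z Z"
  have "ipb j (Gam Z X Y) V = (\<Sum>\<mu> | bl \<mu> = j. ?a *
     (ipb j X Z * Y $ \<mu> + ipb j Y Z * X $ \<mu> - ipb j X Z * ipb j Y Z / ipb j Z Z * Z $ \<mu>) * cnj (V $ \<mu>))"
    unfolding ip_def[of bl j "Gam Z X Y"] by (intro sum.cong refl) (auto simp: Gam_def)
  also have "\<dots> = ?a * ((\<Sum>\<mu> | bl \<mu> = j. ipb j X Z * (Y $ \<mu> * cnj (V $ \<mu>)) + ipb j Y Z * (X $ \<mu> * cnj (V $ \<mu>))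
      - ipb j X Z * ipb j Y Z / ipb j Z Z * (Z $ \<mu> * cnj (V $ \<mu>))))"
    unfolding sum_distrib_left by (intro sum.cong refl) (simp only: algebra_simps)
  also have "\<dots> = ?a * (ipb j X Z * ipb j Y V + ipb j Y Z * ipb j X V - ipb j X Z * ipb j Y Z / ipb j Z Z * ipb j Z V)"
    unfolding sum.distrib sum_subtractf sum_distrib_left[symmetric] ip_def[of bl j Y V] ip_def[of bl j X V] ip_def[of bl j Z V] ..
  finally show ?thesis .
qed

end

context cr_blocks
begin

lemma blk_cases:
  assumes "nondeg Z" "j \<in> {1..s}"
  obtains "m j = 1" | "ipb j Z Z \<noteq> 0"
  using assms m_s unfolding nondeg_def by (metis atLeastAtMost_iff atLeastLessThan_iff order_le_less)

text \<open>The homogeneity relations \<open>cc_Suc\<close> in quotient form. On a block of exponent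
  1 the quotients by t cause no harm: d is 0 and all coefficients from order two on are 0.\<close>

lemma cc_rel:
  assumes "nondeg Z" "j \<in> {1..s}"
  defines "t \<equiv> ipb j Z Z" and "d \<equiv> of_nat (m j) - 1"
  shows "cc j 1 t * (d / t) = cc j 2 t" "cc j 2 t * ((d - 1) / t) = cc j 3 t" "cc j 3 t * ((d - 2) / t) = cc j 4 t"
proof -
  have n: "Suc 1 = 2" "Suc 2 = 3" "Suc 3 = 4" by simp_all
  have 0: "m j = 1 \<Longrightarrow> cc j 2 t = 0 \<and> cc j 3 t = 0 \<and> cc j 4 t = 0"
    by (simp add: cc_def numeral_2_eq_2 numeral_3_eq_3 numeral_eq_Suc)
  have "cc j 1 t * (d / t) = cc j 2 t \<and> cc j 2 t * ((d - 1) / t) = cc j 3 t \<and> cc j 3 t * ((d - 2) / t) = cc j 4 t"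
    using assms(1,2)
  proof (cases rule: blk_cases)
    case 1
    then show ?thesis using 0 by (simp add: d_def)
  next
    case 2
    then show ?thesis
      using cc_Suc[of j 1 t] cc_Suc[of j 2 t] cc_Suc[of j 3 t] unfolding n
      by (simp add: d_def t_def field_simps)
  qed
  then show "cc j 1 t * (d / t) = cc j 2 t" "cc j 2 t * ((d - 1) / t) = cc j 3 t" "cc j 3 t * ((d - 2) / t) = cc j 4 t"
    by auto
qed

text \<open>This is what makes \<open>Gam\<close> the Chern connection of the Levi metric: it is C
  with the last slot raised by h.\<close>

lemma h_Gam:
  assumes "nondeg Z" shows "h Z (Gam Z X Y) V = C Z X Y V"
  unfolding h_def C_def
proof (rule sum.cong[OF refl])
  fix j assume j: "j \<in> {1..s}"
  define t where "t = ipb j Z Z"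
  define d :: complex where "d = of_nat (m j) - 1"
  note r = cc_rel[OF assms j, folded t_def d_def]
  let ?a = "ipb j X Z" and ?b = "ipb j Y Z" and ?V = "ipb j Z V"
  have z: "d * (?a * ?b + ?b * ?a - ?a * ?b / t * t) / t = d / t * (?a * ?b)"
    using assms j by (cases rule: blk_cases) (auto simp: t_def d_def field_simps)
  have 1: "ipb j (Gam Z X Y) Z = d / t * (?a * ?b)"
    unfolding ip_Gam using z by (simp add: t_def[symmetric] d_def[symmetric] mult.commute)
  have "cc j 1 t * ipb j (Gam Z X Y) V + cc j 2 t * ipb j (Gam Z X Y) Z * ?V
     = (cc j 1 t * (d / t)) * (?a * ipb j Y V + ?b * ipb j X V) - (cc j 1 t * (d / t)) * (?a * ?b / t * ?V) + cc j 2 t * (d / t) * ?a * ?b * ?V"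
    unfolding 1 unfolding ip_Gam t_def[symmetric] d_def[symmetric] by (simp add: algebra_simps)
  also have "\<dots> = cc j 2 t * (?a * ipb j Y V + ?b * ipb j X V) + (cc j 2 t * ((d - 1) / t)) * ?a * ?b * ?V"
    unfolding r(1) by (simp add: algebra_simps diff_divide_distrib)
  finally show "cc j 1 t * ipb j (Gam Z X Y) V + cc j 2 t * ipb j (Gam Z X Y) Z * ?V
     = cc j 2 t * (?a * ipb j Y V + ?b * ipb j X V) + cc j 3 t * ?a * ?b * ?V"
    unfolding r(2) by simp
qed

lemma h_Gam': "nondeg Z \<Longrightarrow> h Z V (Gam Z X Y) = Cb Z V X Y"
  using h_Gam[of Z X Y V] h_cnj[of Z "Gam Z X Y" V] C_cnj[of Z X Y V] Cb_sym by metis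

text \<open>The computation is blockwise. By \<open>cc_rel\<close> the derivatives of orders three
  and four reduce to the second one, and the terms assemble into the square of the pairing of the
  transverse parts.\<close>

lemma curvature:
  assumes "nondeg Z" shows "K Z X X Y Y - h Z (Gam Z X X) (Gam Z Y Y) = RR Z X Y"
proof -
  have RR: "RR Z X Y = (\<Sum>j\<in>{1..s}. 2 * cf j Z * (eta j Z X Y)\<^sup>2)"
  proof -
    have "{1..s} = insert s {1..<s}" using s_pos by auto
    then show ?thesis unfolding RR_def by (simp add: cf_def m_s)
  qed
  show ?thesis
    unfolding h_Gam[OF assms] RR unfolding K_def C_def sum_subtractf[symmetric]
  proof (rule sum.cong[OF refl])
    fix j assume j: "j \<in> {1..s}"
    define t where "t = ipb j Z Z"
    define d :: complex where "d = of_nat (m j) - 1"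
    note r = cc_rel[OF assms j, folded t_def d_def]
    define a b g where "a = ipb j X Z" and "b = ipb j Z Y" and "g = ipb j X Y"
    have X: "ipb j X (Gam Z Y Y) = d / t * (2 * b * g - b * b / t * a)"
    proof -
      have "ipb j X (Gam Z Y Y) = cnj (ipb j (Gam Z Y Y) X)" by (simp add: ip_cnj)
      then show ?thesis unfolding ip_Gam by (simp add: ip_cnj a_def b_def g_def d_def t_def)
    qed
    have Z: "ipb j Z (Gam Z Y Y) = d / t * (b * b)"
    proof -
      have "ipb j Z (Gam Z Y Y) = cnj (ipb j (Gam Z Y Y) Z)" by (simp add: ip_cnj)
      also have "\<dots> = d / t * (2 * b * b - b * b / t * t)" unfolding ip_Gam by (simp add: ip_cnj a_def b_def g_def d_def t_def)
      also have "\<dots> = d / t * (b * b)"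
        using assms j by (cases rule: blk_cases) (auto simp: t_def d_def field_simps)
      finally show ?thesis .
    qed
    have e: "2 * cf j Z * (eta j Z X Y)\<^sup>2 = 2 * cc j 2 t * (g - a * b / t)\<^sup>2"
      using assms j
    proof (cases rule: blk_cases)
      case 1
      then show ?thesis by (simp add: cf_def cc_def numeral_2_eq_2)
    next
      case 2
      have n: "Suc 0 = 1" "Suc 1 = 2" by simp_all
      have m0: "(of_nat (m j) :: complex) \<noteq> 0" using m_pos[OF j] by simp
      have c0: "t ^ m j = cc j 0 t" by (simp add: cc_def)
      have t0: "t \<noteq> 0" using 2 by (simp add: t_def)
      have c1: "cc j 1 t = of_nat (m j) * cc j 0 t / t" and c2: "cc j 2 t = d * cc j 1 t / t"
        using cc_Suc[of j 0 t] cc_Suc[of j 1 t] t0 unfolding n by (simp_all add: d_def field_simps)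
      have c00: "cc j 0 t \<noteq> 0" using t0 by (simp add: cc_def)
      have "2 * cf j Z * (eta j Z X Y)\<^sup>2 = 2 * (d / (of_nat (m j) * cc j 0 t)) * (cc j 1 t)\<^sup>2 * (g - a * b / t)\<^sup>2"
        by (simp add: cf_def eta_def d_def[symmetric] t_def[symmetric] c0 a_def b_def g_def power_mult_distrib)
      also have "2 * (d / (of_nat (m j) * cc j 0 t)) * (cc j 1 t)\<^sup>2 = 2 * cc j 2 t"
        unfolding c2 c1 using c00 m0 t0 by (simp add: field_simps power2_eq_square)
      finally show ?thesis .
    qed
    have "cc j 2 t * (g * g + g * g)
        + cc j 3 t * (b * (a * g + a * g) + g * a * b + a * g * b) + cc j 4 t * b * a * a * b
      - (cc j 2 t * (a * (d / t * (2 * b * g - b * b / t * a)) + a * (d / t * (2 * b * g - b * b / t * a)))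
         + cc j 3 t * a * a * (d / t * (b * b))) = 2 * cc j 2 t * (g - a * b / t)\<^sup>2"
    \<comment> \<open>t vanishes only on a block of exponent 1, where the coefficients of orders two
      to four are 0.\<close>
    proof (cases "t = 0")
      case True
      then have "m j = 1" using blk_cases[OF assms j] by (auto simp: t_def)
      then have "cc j 2 t = 0 \<and> cc j 3 t = 0 \<and> cc j 4 t = 0"
        by (simp add: cc_def numeral_2_eq_2 numeral_3_eq_3 numeral_eq_Suc)
      then show ?thesis by simp
    next
      case False
      then show ?thesis
        unfolding r(3)[symmetric] unfolding r(2)[symmetric] by (simp add: field_simps power2_eq_square)
    qed
    then show "cc j 2 (ipb j Z Z) * (ipb j X Y * ipb j X Y + ipb j X Y * ipb j X Y) +
          cc j 3 (ipb j Z Z) * (ipb j Z Y * (ipb j X Z * ipb j X Y + ipb j X Z * ipb j X Y)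
            + ipb j X Y * ipb j X Z * ipb j Z Y + ipb j X Z * ipb j X Y * ipb j Z Y) +
          cc j 4 (ipb j Z Z) * ipb j Z Y * ipb j X Z * ipb j X Z * ipb j Z Y -
          (cc j 2 (ipb j Z Z) * (ipb j X Z * ipb j X (Gam Z Y Y) + ipb j X Z * ipb j X (Gam Z Y Y)) +
            cc j 3 (ipb j Z Z) * ipb j X Z * ipb j X Z * ipb j Z (Gam Z Y Y)) = 2 * cf j Z * (eta j Z X Y)\<^sup>2"
      unfolding e X Z t_def[symmetric] a_def[symmetric] b_def[symmetric] g_def[symmetric] .
  qed
qed

end

section \<open>The projective equation and the curvature relation\<close>

context cr_map
begin

text \<open>Paired with any A w both sides agree, by \<open>levi_deriv\<close>. Since A is onto, w
  can be chosen with A w equal to their difference, and positivity of h finishes. The two terms with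
  derivatives of lam are those of a projective change of connection.\<close>

lemma projective:
  assumes q: "q \<in> W"
  shows "vd (Z x) (A y) q + Gam (F q) (A x q) (A y q)
     = A (Gam (fst q) x y) q + (Z x lam q / lam q) *s A y q + (Z y lam q / lam q) *s A x q" (is "?L = ?R")
proof -
  obtain w where w: "A w q = ?L - ?R" using A_surj[OF q] .
  have "h (F q) ?L (A w q) = h (F q) ?R (A w q)"
    using levi_deriv[OF q, of x y w] h_Gam[OF nondeg_F[OF q]] h_Gam[OF nondeg_z[OF q]]
    by (simp add: h_add_left h_scale_left levi[OF q] q algebra_simps del: vd_nth)
  then have "h (F q) (?L - ?R) (?L - ?R) = 0" unfolding w by (simp add: h_diff_left)
  then show ?thesis using h_self_nonzero[OF nondeg_F[OF q], of "?L - ?R"] by auto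
qed

definition nTF :: "(complex^'n) \<times> real \<Rightarrow> complex" where "nTF q = h (F q) (TF q) (TF q)"

lemma h_TF_A: "q \<in> W \<Longrightarrow> h (F q) (TF q) (A y q) = - Zb y lam q / (2 * \<i>)"
  using tau[of q y] Zb_lam[of q y] by (simp add: flip: h_cnj[of "F q" "TF q"])

lemma Z_TF_A:
  assumes q: "q \<in> W"
  shows "h (F q) (vd (Z x) TF q) (A y q) + C (F q) (TF q) (A x q) (A y q)
     = - Z x (Zb y lam) q / (2 * \<i>) + 2 * \<i> * h (fst q) x y * nTF q"
proof -
  have "Z x (\<lambda>q. h (F q) (TF q) (A y q)) q = Z x (\<lambda>q. (- 1 / (2 * \<i>)) * Zb y lam q) q"
    by (rule d_cong[OF derpair_Z q]) (use h_TF_A in \<open>auto simp del: vd_nth\<close>)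
  also have "\<dots> = (- 1 / (2 * \<i>)) * Z x (Zb y lam) q"
    by (rule d_cmult[OF derpair_Z q]) simp
  finally show ?thesis
    by (simp add: d_h[OF derpair_Z q] CR_F[OF q] Zb_A[OF q] h_scale_right
         h_cnj nTF_def C_sym[of "F q" "A x q"] algebra_simps del: vd_nth)
qed

text \<open>\<open>Zb y\<close> is applied to \<open>levi_deriv\<close> with x in both holomorphic
  slots. Replacing the second derivatives of F through \<open>projective\<close> turns the fourth
  derivatives of p into curvatures; everything else carries the factor h x y.\<close>

lemma curvature_identity:
  assumes q: "q \<in> W"
  shows "RR (F q) (A x q) (A y q) = lam q * RR (fst q) x y + h (fst q) x y *
    (2 * Zb y (Z x lam) q + 2 * Z x (Zb y lam) q - 4 * Z x lam q * Zb y lam q / lam q + 8 * h (fst q) x y * nTF q)"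
proof -
  let ?z = "fst q"
  define hh where "hh = h ?z x y"
  define X Y where "X = A x q" and "Y = A y q"
  define XX YY where "XX = vd (Z x) (A x) q" and "YY = vd (Z y) (A y) q"
  define L Lx Ly where "L = lam q" and "Lx = Z x lam q" and "Ly = Zb y lam q"
  have L0: "L \<noteq> 0" using q by (simp add: L_def)
  \<comment> \<open>\<open>Zb y\<close> moves past two copies of \<open>Z x\<close>, and each
    passage leaves a derivative along \<open>T\<close> with coefficient 2 i h; hence 4 i.\<close>
  have ZbXX: "vd (Zb y) (vd (Z x) (A x)) q = (2 * \<i> * C ?z x x y) *s TF q + (4 * \<i> * hh) *s vd (Z x) TF q"
  proof -
    have "Zb y (\<lambda>q. vd (Z x) (A x) q $ \<mu>) q = 2 * \<i> * C ?z x x y * TF q $ \<mu> + 4 * \<i> * hh * vd (Z x) TF q $ \<mu>" for \<mu>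
    proof -
      let ?f = "\<lambda>q. F q $ \<mu>"
      have 1: "Zb y (\<lambda>q. vd (Z x) (A x) q $ \<mu>) q = Zb y (Z x (Z x ?f)) q" by simp
      have 2: "Zb y (Z x (Z x ?f)) q = Z x (Zb y (Z x ?f)) q + 2 * \<i> * hh * T (Z x ?f) q"
        unfolding hh_def by (rule Zb_Z[OF q]) simp
      have "Z x (Zb y (Z x ?f)) q = Z x (\<lambda>q. 2 * \<i> * (h (fst q) x y * T ?f q)) q"
        by (rule d_cong[OF derpair_Z q]) (simp_all add: CR_comm CR_F_nth mult.assoc)
      also have "\<dots> = 2 * \<i> * (C ?z x x y * T ?f q + hh * Z x (T ?f) q)"
        by (simp add: d_cmult[OF derpair_Z q] d_mult[OF derpair_Z q] Z_h_z[OF q] hh_def)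
      finally show ?thesis unfolding 1 2 using T_Z[OF q, of ?f x] by (simp add: algebra_simps)
    qed
    then show ?thesis by (simp add: vec_eq_iff)
  qed
  have "Zb y (\<lambda>q. h (F q) (vd (Z x) (A x) q) (A y q) + C (F q) (A x q) (A x q) (A y q)) q
      = Zb y (\<lambda>q. lam q * C (fst q) x x y + 2 * (Z x lam q * h (fst q) x y)) q"
    by (rule d_cong[OF derpair_Zb q]) (use levi_deriv in \<open>auto simp: algebra_simps simp del: vd_nth\<close>)
  then have E1: "h (F q) (vd (Zb y) (vd (Z x) (A x)) q) Y + h (F q) XX YY + Cb (F q) XX Y Y
      + (2 * C (F q) ((2 * \<i> * hh) *s TF q) X Y + C (F q) X X YY + K (F q) X X Y Y)
      = Ly * C ?z x x y + L * K ?z x x y y + 2 * (Zb y (Z x lam) q * hh + Lx * Cb ?z x y y)"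
    by (simp add: d_add[OF derpair_Zb q] d_cmult[OF derpair_Zb q] d_mult[OF derpair_Zb q] d_h[OF derpair_Zb q] d_C[OF derpair_Zb q]
        CR_F[OF q] Zb_A[OF q] Zb_h_z[OF q] Zb_C_z[OF q] C_sym[of "F q" "A x q" "_ *s TF q"] hh_def X_def Y_def XX_def YY_def L_def Lx_def Ly_def
        algebra_simps del: vd_nth)
  have E2: "h (F q) (vd (Zb y) (vd (Z x) (A x)) q) Y = - Ly * C ?z x x y + 4 * \<i> * hh * h (F q) (vd (Z x) TF q) Y"
  proof -
    have "h (F q) (TF q) Y = - Ly / (2 * \<i>)" unfolding Y_def Ly_def by (rule h_TF_A[OF q])
    then have "2 * \<i> * h (F q) (TF q) Y = 2 * \<i> * (- Ly / (2 * \<i>))" by (rule arg_cong)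
    then have "2 * \<i> * h (F q) (TF q) Y = - Ly"
      by (simp only: nonzero_mult_divide_mult_cancel_left times_divide_eq_right) simp
    moreover have "2 * \<i> * C ?z x x y * h (F q) (TF q) Y = C ?z x x y * (2 * \<i> * h (F q) (TF q) Y)"
      by (simp only: mult_ac)
    ultimately show ?thesis unfolding ZbXX h_add_left h_scale_left by simp
  qed
  have E3: "h (F q) (vd (Z x) TF q) Y = - Z x (Zb y lam) q / (2 * \<i>) + 2 * \<i> * hh * nTF q - C (F q) (TF q) X Y"
    using Z_TF_A[OF q, of x y] by (simp add: X_def Y_def hh_def algebra_simps del: vd_nth)
  \<comment> \<open>The covariant second derivatives of F, that is, second derivatives plus the
    connection at F, in the form given by \<open>projective\<close>. With them the connection terms
    cancel except for the one completing K to the curvature.\<close>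
  define P Q where "P = A (Gam ?z x x + (2 * Lx / L) *s x) q" and "Q = A (Gam ?z y y + (2 * cnj Ly / L) *s y) q"
  define GX GY where "GX = Gam (F q) X X" and "GY = Gam (F q) Y Y"
  have cLy: "cnj Ly = Z y lam q" using Zb_lam[OF q] by (simp add: Ly_def)
  have P: "XX = P - GX"
    using projective[OF q, of x x]
    by (simp add: P_def GX_def XX_def X_def A_add[OF q] A_scale[OF q] L_def Lx_def vec_eq_iff field_simps)
  have Q: "YY = Q - GY"
    using projective[OF q, of y y]
    by (simp add: Q_def GY_def YY_def Y_def A_add[OF q] A_scale[OF q] L_def cLy vec_eq_iff field_simps)
  note nF = nondeg_F[OF q] and nz = nondeg_z[OF q]
  have E4: "h (F q) XX YY + Cb (F q) XX Y Y + C (F q) X X YY + K (F q) X X Y Y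
      = h (F q) P Q + RR (F q) X Y"
  proof -
    have "Cb (F q) XX Y Y = h (F q) XX GY" "C (F q) X X YY = h (F q) GX YY"
      unfolding GX_def GY_def by (simp_all add: h_Gam[OF nF] h_Gam'[OF nF])
    moreover have "K (F q) X X Y Y = RR (F q) X Y + h (F q) GX GY"
      unfolding GX_def GY_def curvature[OF nF, symmetric] by simp
    ultimately show ?thesis unfolding P Q by (simp add: h_diff_left h_diff_right)
  qed
  have cL: "cnj L = L" using q by (simp add: L_def)
  have E5: "h (F q) P Q = L * (K ?z x x y y - RR ?z x y) + 2 * Lx * Cb ?z x y y + 2 * Ly * C ?z x x y + 4 * Lx * Ly / L * hh"
    unfolding P_def Q_def levi[OF q] curvature[OF nz, symmetric] using L0
    by (simp add: h_add_left h_add_right h_scale_left h_scale_right h_Gam[OF nz] h_Gam'[OF nz] cL hh_def[symmetric] L_def[symmetric] field_simps)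
  have "RR (F q) X Y = L * RR ?z x y + hh * (2 * Zb y (Z x lam) q - 4 * Lx * Ly / L)
      - 4 * \<i> * hh * (h (F q) (vd (Z x) TF q) Y + C (F q) (TF q) X Y)"
  proof -
    have lin: "R = L * RZ + hh * (2 * ZZ - 4 * Lx * Ly / L) - 4 * \<i> * hh * (th + tC)"
      if "ZX + a + b + (2 * ((2 * \<i> * hh) * tC) + c + k) = Ly * Cz + L * Kz + 2 * (ZZ * hh + Lx * Cbz)"
        "ZX = - Ly * Cz + 4 * \<i> * hh * th" "a + b + c + k = pq + R"
        "pq = L * (Kz - RZ) + 2 * Lx * Cbz + 2 * Ly * Cz + 4 * Lx * Ly / L * hh"
      for R RZ ZZ th tC ZX a b c k Cz Kz Cbz pq :: complex
    proof -
      define D where "D = Lx * Ly / L"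
      have "4 * Lx * Ly / L = 4 * D" by (simp add: D_def)
      then show ?thesis using that by (simp only:) algebra
    qed
    show ?thesis by (rule lin[OF E1[unfolded C_scale1] E2 E4 E5])
  qed
  also have "h (F q) (vd (Z x) TF q) Y + C (F q) (TF q) X Y = - Z x (Zb y lam) q / (2 * \<i>) + 2 * \<i> * hh * nTF q"
    using E3 by simp
  also have "L * RR ?z x y + hh * (2 * Zb y (Z x lam) q - 4 * Lx * Ly / L) - 4 * \<i> * hh * (- Z x (Zb y lam) q / (2 * \<i>) + 2 * \<i> * hh * nTF q)
     = L * RR ?z x y + hh * (2 * Zb y (Z x lam) q + 2 * Z x (Zb y lam) q - 4 * Lx * Ly / L + 8 * hh * nTF q)"
    by (simp add: field_simps)
  finally show ?thesis by (simp only: X_def Y_def L_def Lx_def Ly_def hh_def)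
qed

end

section \<open>Matching of orthogonal decompositions\<close>

locale herm =
  fixes B :: "complex^'n::finite \<Rightarrow> complex^'n \<Rightarrow> complex"
  assumes B_add: "B (x + x') y = B x y + B x' y"
    and B_scale: "B (a *s x) y = a * B x y"
    and B_cnj: "cnj (B x y) = B y x"
    and B_pos: "x \<noteq> 0 \<Longrightarrow> 0 < Re (B x x)"
begin

lemma B_add_right: "B x (y + y') = B x y + B x y'"
  by (metis B_add B_cnj complex_cnj_add)

lemma B_scale_right: "B x (a *s y) = cnj a * B x y"
  by (metis B_cnj B_scale complex_cnj_mult)

lemma B_zero [simp]: "B 0 y = 0" "B x 0 = 0"
  using B_scale[of 0 0 y] B_scale_right[of x 0 0] by simp_all

lemma B_diff_right: "B x (y - y') = B x y - B x y'"
  using B_add_right[of x "y - y'" y'] by (simp add: algebra_simps)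

lemma B_self: "B x x = of_real (Re (B x x))"
  using B_cnj[of x x] by (metis Reals_cnj_iff of_real_Re)

end

text \<open>An orthogonal decomposition given by self-adjoint projections, none of them zero. It is
  used twice for the same form: with the decomposition at z and with the pullback of the one at
  F.\<close>

locale odec = herm B for B :: "complex^'n::finite \<Rightarrow> complex^'n \<Rightarrow> complex" +
  fixes J :: "nat set" and P :: "nat \<Rightarrow> complex^'n \<Rightarrow> complex^'n"
  assumes fin_J: "finite J"
    and P_add: "k \<in> J \<Longrightarrow> P k (x + y) = P k x + P k y"
    and P_scale: "k \<in> J \<Longrightarrow> P k (a *s x) = a *s P k x"
    and P_P: "j \<in> J \<Longrightarrow> k \<in> J \<Longrightarrow> P j (P k x) = (if j = k then P k x else 0)"
    and P_sum: "(\<Sum>k\<in>J. P k x) = x"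
    and P_herm: "k \<in> J \<Longrightarrow> B (P k x) y = B x (P k y)"
    and P_ex: "k \<in> J \<Longrightarrow> \<exists>x. P k x \<noteq> 0"
begin

lemma P_zero: "k \<in> J \<Longrightarrow> P k 0 = 0"
  using P_scale[of k 0 0] by simp

lemma P_sum': "finite I \<Longrightarrow> k \<in> J \<Longrightarrow> P k (\<Sum>i\<in>I. f i) = (\<Sum>i\<in>I. P k (f i))"
  by (induction I rule: finite_induct) (auto simp: P_zero P_add)

lemma P_unit: "k \<in> J \<Longrightarrow> \<exists>x. P k x = x \<and> B x x = 1"
proof -
  assume k: "k \<in> J"
  obtain x where x: "P k x \<noteq> 0" using P_ex[OF k] by blast
  define y where "y = P k x"
  define a where "a = Re (B y y)"
  have a: "0 < a" using B_pos[OF x] by (simp add: a_def y_def)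
  have Ba: "B y y = of_real a" unfolding a_def by (rule B_self)
  let ?z = "of_real (1 / sqrt a) *s y"
  have "B ?z ?z = of_real (1 / sqrt a * (1 / sqrt a * a))"
    by (simp only: B_scale B_scale_right Ba complex_cnj_complex_of_real of_real_mult)
  also have "1 / sqrt a * (1 / sqrt a * a) = 1" using a by (simp add: real_div_sqrt field_simps)
  also have "complex_of_real 1 = 1" by simp
  finally have "B ?z ?z = 1" .
  moreover have "P k ?z = ?z" using P_scale[OF k] P_P[OF k k] by (simp add: y_def)
  ultimately show ?thesis by blast
qed

lemma P_orth: "j \<in> J \<Longrightarrow> k \<in> J \<Longrightarrow> j \<noteq> k \<Longrightarrow> P j x = x \<Longrightarrow> P k y = y \<Longrightarrow> B x y = 0"
  using P_herm[of j x y] P_P[of j k y] by simp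

end

text \<open>For x in a summand of P and y orthogonal to x the right side vanishes, while two nonzero
  Q-components of x would make the left side positive for a suitable y. So each summand of P lies in
  the union of the summands of Q, hence in a single one. The weights are then compared on sums and
  differences of unit vectors, which only yields sums of two weights.\<close>

lemma block_matching:
  fixes c d :: "nat \<Rightarrow> real"
  assumes "odec B J P" "odec B J Q" "s \<in> J"
    and c: "\<And>k. k \<in> J \<Longrightarrow> k \<noteq> s \<Longrightarrow> 0 < c k" "c s = 0"
    and d: "\<And>k. k \<in> J \<Longrightarrow> k \<noteq> s \<Longrightarrow> 0 < d k" "d s = 0"
    and key: "\<And>x y. B x y = 0 \<Longrightarrow>
       (\<Sum>k\<in>J. of_real (d k) * (B (Q k x) y)\<^sup>2) = (\<Sum>k\<in>J. of_real (c k) * (B (P k x) y)\<^sup>2)"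
  obtains \<tau> where "bij_betw \<tau> J J" "\<And>k x. k \<in> J \<Longrightarrow> Q (\<tau> k) x = P k x"
    "\<And>k l. k \<in> J \<Longrightarrow> l \<in> J \<Longrightarrow> k \<noteq> l \<Longrightarrow> d (\<tau> k) + d (\<tau> l) = c k + c l"
proof -
  interpret P: odec B J P by fact
  interpret Q: odec B J Q by fact
  have uni: "\<exists>i\<in>J. Q i x = x" if k: "k \<in> J" and x: "P k x = x" "x \<noteq> 0" for k x
  proof -
    have Px: "P j x = (if j = k then x else 0)" if "j \<in> J" for j
      using P.P_P[OF that k, of x] x by simp
    have two: False if ab: "a \<in> J" "b \<in> J" "a \<noteq> b" "Q a x \<noteq> 0" "Q b x \<noteq> 0" for a b
    proof -
      define \<alpha> \<beta> where "\<alpha> = B (Q a x) (Q a x)" and "\<beta> = B (Q b x) (Q b x)"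
      have \<alpha>: "\<alpha> \<noteq> 0" "cnj \<alpha> = \<alpha>" and \<beta>: "\<beta> \<noteq> 0" "cnj \<beta> = \<beta>"
        using P.B_pos[OF ab(4)] P.B_pos[OF ab(5)] by (auto simp: \<alpha>_def \<beta>_def P.B_cnj)
      \<comment> \<open>y pairs to 1 with \<open>Q a x\<close> and to -1 with \<open>Q b x\<close>.
        Thus it is orthogonal to x, while the squares add up to d a + d b, which is positive because
        at most one weight is 0.\<close>
      define y where "y = (1 / \<alpha>) *s Q a x - (1 / \<beta>) *s Q b x"
      have BQ: "B (Q j x) (Q i x) = (if i = j then B (Q j x) (Q j x) else 0)" if "i \<in> J" "j \<in> J" for i j
        using Q.P_orth[OF that(2,1), of "Q j x" "Q i x"] Q.P_P that by auto
      have By: "B (Q j x) y = (if j = a then 1 else if j = b then - 1 else 0)" if "j \<in> J" for j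
        unfolding y_def P.B_diff_right P.B_scale_right using BQ[OF ab(1) that] BQ[OF ab(2) that] ab \<alpha> \<beta>
        by (auto simp: \<alpha>_def \<beta>_def)
      have "B x y = (\<Sum>j\<in>J. B (Q j x) y)"
      proof -
        have "B (\<Sum>j\<in>I. Q j x) y = (\<Sum>j\<in>I. B (Q j x) y)" if "finite I" for I
          using that by (induction I rule: finite_induct) (auto simp: P.B_add)
        then show ?thesis using Q.P_sum[of x] Q.fin_J by metis
      qed
      also have "\<dots> = (\<Sum>j\<in>J. (if j = a then 1 else 0) - (if j = b then 1 else 0))"
        using By ab by (intro sum.cong) auto
      also have "\<dots> = 0" unfolding sum_subtractf using ab Q.fin_J by (simp add: sum.delta)
      finally have xy: "B x y = 0" .
      have "(\<Sum>j\<in>J. of_real (c j) * (B (P j x) y)\<^sup>2) = (0::complex)"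
        using Px xy by (intro sum.neutral) auto
      then have "(\<Sum>j\<in>J. of_real (d j) * (B (Q j x) y)\<^sup>2) = (0::complex)" using key[OF xy] by simp
      moreover have "(\<Sum>j\<in>J. of_real (d j) * (B (Q j x) y)\<^sup>2)
          = (\<Sum>j\<in>J. (if j = a then of_real (d j) else 0) + (if j = b then of_real (d j) else (0::complex)))"
        using By ab by (intro sum.cong) auto
      moreover have "\<dots> = of_real (d a + d b)"
        unfolding sum.distrib using ab Q.fin_J by (simp add: sum.delta)
      ultimately have "d a + d b = 0" by (metis of_real_eq_0_iff)
      moreover have "0 \<le> d a" "0 \<le> d b" "0 < d a \<or> 0 < d b"
        using d ab by (metis order_le_less)+
      ultimately show False by linarith
    qed
    obtain i where i: "i \<in> J" "Q i x \<noteq> 0"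
      using Q.P_sum[of x] x(2) by (metis (no_types, lifting) sum.neutral)
    have "(\<Sum>j\<in>J. Q j x) = (\<Sum>j\<in>J. if j = i then Q i x else 0)"
      using two i by (intro sum.cong) auto
    then have "Q i x = x" using Q.P_sum[of x] i Q.fin_J by (simp add: sum.delta)
    then show ?thesis using i by blast
  qed
  define e where "e k = (SOME x. P k x = x \<and> B x x = 1)" for k
  have e: "P k (e k) = e k" "B (e k) (e k) = 1" "e k \<noteq> 0" if "k \<in> J" for k
  proof -
    have *: "P k (e k) = e k \<and> B (e k) (e k) = 1" unfolding e_def by (rule someI_ex[OF P.P_unit[OF that]])
    then show "P k (e k) = e k" "B (e k) (e k) = 1" "e k \<noteq> 0" by auto
  qed
  define \<tau> where "\<tau> k = (SOME i. i \<in> J \<and> Q i (e k) = e k)" for k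
  have \<tau>: "\<tau> k \<in> J" "Q (\<tau> k) (e k) = e k" if "k \<in> J" for k
  proof -
    have "\<exists>i. i \<in> J \<and> Q i (e k) = e k" using uni[OF that e(1,3)[OF that]] by blast
    from someI_ex[OF this] show "\<tau> k \<in> J" "Q (\<tau> k) (e k) = e k" unfolding \<tau>_def by auto
  qed
  \<comment> \<open>If x and \<open>e k\<close> were in different summands of Q, their sum would be
    in none.\<close>
  have all: "Q (\<tau> k) x = x" if k: "k \<in> J" and x: "P k x = x" for k x
  proof (rule ccontr)
    assume ne: "Q (\<tau> k) x \<noteq> x"
    then have x0: "x \<noteq> 0" using Q.P_zero \<tau> k by metis
    obtain i where i: "i \<in> J" "Q i x = x" using uni[OF k x x0] by blast
    have it: "i \<noteq> \<tau> k" using i ne by blast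
    have Qx: "Q l x = (if l = i then x else 0)" if "l \<in> J" for l
      using Q.P_P[OF that i(1), of x] i by simp
    have Qe: "Q l (e k) = (if l = \<tau> k then e k else 0)" if "l \<in> J" for l
      using Q.P_P[OF that \<tau>(1)[OF k], of "e k"] \<tau>[OF k] by simp
    have "x + e k \<noteq> 0"
    proof
      assume "x + e k = 0"
      then have "Q i (x + e k) = 0" using Q.P_zero[OF i(1)] by simp
      then show False using Q.P_add[OF i(1)] Qx[OF i(1)] Qe[OF i(1)] it x0 by simp
    qed
    moreover have "P k (x + e k) = x + e k" using P.P_add[OF k] x e[OF k] by simp
    ultimately obtain l where l: "l \<in> J" "Q l (x + e k) = x + e k" using uni[OF k] by blast
    then have "(if l = i then x else 0) + (if l = \<tau> k then e k else 0) = x + e k"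
      using Q.P_add[OF l(1)] Qx[OF l(1)] Qe[OF l(1)] by simp
    then show False using it x0 e(3)[OF k] \<open>x + e k \<noteq> 0\<close> by (auto split: if_splits)
  qed
  \<comment> \<open>The sum and the difference of two orthogonal unit vectors are orthogonal, so the
    hypothesis applies to them.\<close>
  have pair: "(\<Sum>j\<in>J. of_real (d j) * (B (Q j (e k + e l)) (e k - e l))\<^sup>2) = (of_real (c k + c l)::complex)"
    if kl: "k \<in> J" "l \<in> J" "k \<noteq> l" for k l
  proof -
    have o: "B (e k) (e l) = 0" "B (e l) (e k) = 0"
      using P.P_orth kl e by (metis)+
    have "B (e k + e l) (e k - e l) = 0"
      by (simp add: P.B_add P.B_diff_right o e kl)
    from key[OF this] have "(\<Sum>j\<in>J. of_real (d j) * (B (Q j (e k + e l)) (e k - e l))\<^sup>2)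
       = (\<Sum>j\<in>J. of_real (c j) * (B (P j (e k + e l)) (e k - e l))\<^sup>2)" .
    also have "\<dots> = (\<Sum>j\<in>J. (if j = k then of_real (c j) else 0) + (if j = l then of_real (c j) else (0::complex)))"
    proof (intro sum.cong refl)
      fix j assume j: "j \<in> J"
      have "P j (e k + e l) = (if j = k then e k else 0) + (if j = l then e l else 0)"
        using P.P_add[OF j] P.P_P[OF j, of k "e k"] P.P_P[OF j, of l "e l"] kl e by simp
      then show "of_real (c j) * (B (P j (e k + e l)) (e k - e l))\<^sup>2
         = (if j = k then of_real (c j) else 0) + (if j = l then of_real (c j) else (0::complex))"
        using kl by (auto simp: P.B_diff_right o e)
    qed
    also have "\<dots> = of_real (c k + c l)" unfolding sum.distrib using kl P.fin_J by (simp add: sum.delta)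
    finally show ?thesis .
  qed
  \<comment> \<open>If two summands had the same image, the left side would vanish on the pair
    above, although c k + c l > 0.\<close>
  have inj: "inj_on \<tau> J"
  proof (rule inj_onI, rule ccontr)
    fix k l assume kl: "k \<in> J" "l \<in> J" "\<tau> k = \<tau> l" "k \<noteq> l"
    have Qe: "Q j (e k + e l) = (if j = \<tau> k then e k + e l else 0)" if j: "j \<in> J" for j
    proof -
      have "Q (\<tau> k) (e l) = e l" using \<tau>(2)[OF kl(2)] kl(3) by simp
      then show ?thesis
        using Q.P_add[OF j] Q.P_P[OF j \<tau>(1)[OF kl(1)], of "e k"] Q.P_P[OF j \<tau>(1)[OF kl(1)], of "e l"] \<tau>(2)[OF kl(1)] by simp
    qed
    have o: "B (e k) (e l) = 0" "B (e l) (e k) = 0"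
      using P.P_orth kl e by (metis)+
    have "B (e k + e l) (e k - e l) = 0"
      by (simp add: P.B_add P.B_diff_right o e kl)
    then have "(\<Sum>j\<in>J. of_real (d j) * (B (Q j (e k + e l)) (e k - e l))\<^sup>2) = (0::complex)"
      using Qe by (intro sum.neutral) auto
    then have "c k + c l = 0" using pair[OF kl(1,2,4)] by (metis of_real_eq_0_iff)
    moreover have "0 \<le> c k" "0 \<le> c l" "0 < c k \<or> 0 < c l"
      using c kl by (metis order_le_less)+
    ultimately show False by linarith
  qed
  have "\<tau> ` J = J" using endo_inj_surj[OF P.fin_J _ inj] \<tau> by blast
  then have bij: "bij_betw \<tau> J J" using inj by (simp add: bij_betw_def)
  have QP: "Q (\<tau> k) x = P k x" if k: "k \<in> J" for k x
  proof -
    have "Q (\<tau> k) x = Q (\<tau> k) (\<Sum>l\<in>J. P l x)" using P.P_sum by simp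
    also have "\<dots> = (\<Sum>l\<in>J. Q (\<tau> k) (P l x))" by (rule Q.P_sum'[OF P.fin_J \<tau>(1)[OF k]])
    also have "\<dots> = (\<Sum>l\<in>J. if l = k then P k x else 0)"
    proof (intro sum.cong refl)
      fix l assume l: "l \<in> J"
      have "Q (\<tau> l) (P l x) = P l x" using all[OF l] P.P_P[OF l l] by simp
      then have "Q (\<tau> k) (P l x) = (if \<tau> k = \<tau> l then P l x else 0)"
        using Q.P_P[OF \<tau>(1)[OF k] \<tau>(1)[OF l], of "P l x"] by simp
      then show "Q (\<tau> k) (P l x) = (if l = k then P k x else 0)"
        using inj k l by (auto simp: inj_on_def)
    qed
    finally show ?thesis using k P.fin_J by (simp add: sum.delta)
  qed
  have "d (\<tau> k) + d (\<tau> l) = c k + c l" if kl: "k \<in> J" "l \<in> J" "k \<noteq> l" for k l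
  proof -
    have tkl: "\<tau> k \<noteq> \<tau> l" using inj kl by (auto simp: inj_on_def)
    have o: "B (e k) (e l) = 0" "B (e l) (e k) = 0"
      using P.P_orth kl e by (metis)+
    have "(\<Sum>j\<in>J. of_real (d j) * (B (Q j (e k + e l)) (e k - e l))\<^sup>2)
      = (\<Sum>j\<in>J. (if j = \<tau> k then of_real (d j) else 0) + (if j = \<tau> l then of_real (d j) else (0::complex)))"
    proof (intro sum.cong refl)
      fix j assume j: "j \<in> J"
      have "Q j (e k + e l) = (if j = \<tau> k then e k else 0) + (if j = \<tau> l then e l else 0)"
        using Q.P_add[OF j] Q.P_P[OF j \<tau>(1)[OF kl(1)], of "e k"] Q.P_P[OF j \<tau>(1)[OF kl(2)], of "e l"] \<tau>(2)[OF kl(1)] \<tau>(2)[OF kl(2)] tkl by simp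
      then show "of_real (d j) * (B (Q j (e k + e l)) (e k - e l))\<^sup>2
         = (if j = \<tau> k then of_real (d j) else 0) + (if j = \<tau> l then of_real (d j) else (0::complex))"
        using kl tkl by (auto simp: P.B_diff_right o e)
    qed
    also have "\<dots> = of_real (d (\<tau> k) + d (\<tau> l))"
      unfolding sum.distrib using kl P.fin_J \<tau> by (simp add: sum.delta)
    finally show ?thesis using pair[OF kl] by (metis of_real_eq_iff)
  qed
  then show ?thesis using that bij QP by blast
qed

section \<open>Preservation of the block structure\<close>

context blocks
begin

text \<open>For \<open>j < s\<close> the projection onto the vectors of block \<open>j\<close> orthogonal to \<open>Z\<close>; \<open>PJ s\<close> is the
  complementary projection, onto the Euler directions and the flat block.\<close>

definition PJ :: "nat \<Rightarrow> complex^'n \<Rightarrow> complex^'n \<Rightarrow> complex^'n"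
  where "PJ j Z X = (\<chi> \<mu>. if j < s then (if bl \<mu> = j then X $ \<mu> - ipb j X Z / ipb j Z Z * Z $ \<mu> else 0)
     else (if bl \<mu> < s then ipb (bl \<mu>) X Z / ipb (bl \<mu>) Z Z * Z $ \<mu> else X $ \<mu>))"

lemma ip_PJ:
  assumes "j < s"
  shows "ipb k (PJ j Z X) V = (if k = j then ipb j X V - ipb j X Z / ipb j Z Z * ipb j Z V else 0)"
proof (cases "k = j")
  case True
  have "ipb j (PJ j Z X) V = (\<Sum>\<mu> | bl \<mu> = j. X $ \<mu> * cnj (V $ \<mu>) - ipb j X Z / ipb j Z Z * (Z $ \<mu> * cnj (V $ \<mu>)))"
    unfolding ip_def[of bl j "PJ j Z X"] using assms by (intro sum.cong refl) (auto simp: PJ_def algebra_simps)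
  then show ?thesis using True
    unfolding sum_subtractf sum_distrib_left[symmetric] ip_def[of bl j X V] ip_def[of bl j Z V] by simp
next
  case False
  then show ?thesis unfolding ip_def[of bl k "PJ j Z X"] using assms by (auto simp: PJ_def intro!: sum.neutral)
qed

text \<open>The projected vector has no component along Z, so the second-order term of h drops out
  and only the first survives.\<close>

lemma h_PJ:
  assumes "j \<in> {1..<s}"
  shows "h Z (PJ j Z X) Y = eta j Z X Y"
proof -
  have j: "j < s" "j \<in> {1..s}" using assms by auto
  have 0: "ipb j X Z - ipb j X Z / ipb j Z Z * ipb j Z Z = 0" if "ipb j Z Z \<noteq> 0" using that by simp
  \<comment> \<open>If the block of Z is zero the quotient takes the default value 0, but then every
    product with Z in that block is 0 as well.\<close>
  have z: "cc j 2 (ipb j Z Z) * (ipb j X Z - ipb j X Z / ipb j Z Z * ipb j Z Z) * ipb j Z Y = 0"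
  proof (cases "ipb j Z Z = 0")
    case True
    have "Re (ipb j Z Z) = (\<Sum>\<mu> | bl \<mu> = j. (cmod (Z $ \<mu>))\<^sup>2)" unfolding ip_self_real by simp
    then have "Z $ \<mu> = 0" if "bl \<mu> = j" for \<mu>
      using True that by (simp add: sum_nonneg_eq_0_iff)
    then have "ipb j X Z = 0" by (simp add: ip_def)
    then show ?thesis by simp
  qed simp
  have "h Z (PJ j Z X) Y = (\<Sum>k\<in>{1..s}. if k = j then eta j Z X Y else 0)"
    unfolding h_def ip_PJ[OF j(1)] using z by (intro sum.cong refl) (auto simp: eta_def)
  then show ?thesis using j by (simp add: sum.delta)
qed

lemma eta_cnj: "cnj (eta j Z X Y) = eta j Z Y X"
  by (simp add: eta_def ip_cnj)

lemma PJ_add: "PJ j Z (X + Y) = PJ j Z X + PJ j Z Y"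
  and PJ_scale: "PJ j Z (a *s X) = a *s PJ j Z X"
  by (auto simp: PJ_def vec_eq_iff ip_add_left ip_scale_left algebra_simps add_divide_distrib)

end

context cr_blocks
begin

lemma PJ_sum: "(\<Sum>j\<in>{1..s}. PJ j Z X) = X"
proof -
  have "(\<Sum>j\<in>{1..s}. PJ j Z X) $ \<mu> = X $ \<mu>" for \<mu>
  proof -
    let ?b = "bl \<mu>" and ?v = "ipb (bl \<mu>) X Z / ipb (bl \<mu>) Z Z * Z $ \<mu>"
    have b: "?b \<in> {1..s}" by (rule bl_in)
    have "(\<Sum>j\<in>{1..s}. PJ j Z X) $ \<mu> = (\<Sum>j\<in>{1..s}. (if j = s then (if ?b < s then ?v else X $ \<mu>) else 0)
         + (if j = ?b then (if ?b < s then X $ \<mu> - ?v else 0) else 0))"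
      unfolding sum_component by (intro sum.cong refl) (auto simp: PJ_def)
    also have "\<dots> = X $ \<mu>"
      unfolding sum.distrib using b s_pos by (auto simp: sum.delta)
    finally show ?thesis .
  qed
  then show ?thesis by (simp add: vec_eq_iff)
qed

lemma PJ_s_Z:
  assumes "nondeg Z" shows "PJ s Z Z = Z"
proof -
  have "ipb (bl \<mu>) Z Z \<noteq> 0" if "bl \<mu> < s" for \<mu>
    using assms bl_in[of \<mu>] that by (auto simp: nondeg_def)
  then show ?thesis by (simp add: PJ_def vec_eq_iff)
qed

text \<open>The projection with index s is the identity minus the others, so its properties follow
  from theirs. A block with two coordinates contains a nonzero vector orthogonal to Z. The
  complement is the whole space if s = 1 and otherwise contains Z, so it is nonzero even when n_s =
  0.\<close>

lemma odec_PJ: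
  assumes Z: "nondeg Z"
  shows "odec (h Z) {1..s} (\<lambda>j. PJ j Z)"
proof (unfold_locales)
  have small: "PJ j Z (PJ k Z X) = (if j = k then PJ k Z X else 0)" if "j < s" "k < s" "j \<in> {1..s}" for j k X
  proof -
    have "ipb j Z Z \<noteq> 0" using Z that by (auto simp: nondeg_def)
    then have "ipb j (PJ k Z X) Z = 0" unfolding ip_PJ[OF that(2)] by auto
    then show ?thesis using that by (auto simp: PJ_def[of j] vec_eq_iff) (auto simp: PJ_def)
  qed
  have split: "(\<Sum>j\<in>{1..s}. f j) = f s + (\<Sum>j\<in>{1..<s}. f j)" for f :: "nat \<Rightarrow> 'x::comm_monoid_add"
  proof -
    have "{1..s} = insert s {1..<s}" using s_pos by auto
    then show ?thesis by simp
  qed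
  have Ps: "PJ s Z X = X - (\<Sum>j\<in>{1..<s}. PJ j Z X)" for X
    using PJ_sum[of Z X] unfolding split by (simp add: algebra_simps)
  have PJ0: "PJ j Z 0 = 0" for j using PJ_scale[of j Z 0 0] by simp
  have PJd: "PJ j Z (X - Y) = PJ j Z X - PJ j Z Y" for j X Y
    using PJ_add[of j Z "X - Y" Y] by (simp add: algebra_simps)
  have PJs: "PJ j Z (\<Sum>i\<in>I. f i) = (\<Sum>i\<in>I. PJ j Z (f i))" if "finite I" for j I and f :: "nat \<Rightarrow> _"
    using that by (induction I rule: finite_induct) (auto simp: PJ0 PJ_add)
  show "PJ j Z (PJ k Z X) = (if j = k then PJ k Z X else 0)" if jk: "j \<in> {1..s}" "k \<in> {1..s}" for j k X
  proof -
    have js: "PJ j Z (PJ s Z X) = 0" if "j < s" "j \<in> {1..s}" for j X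
    proof -
      have "PJ j Z (PJ s Z X) = PJ j Z X - (\<Sum>i\<in>{1..<s}. PJ j Z (PJ i Z X))"
        unfolding Ps PJd by (simp add: PJs)
      also have "(\<Sum>i\<in>{1..<s}. PJ j Z (PJ i Z X)) = (\<Sum>i\<in>{1..<s}. if i = j then PJ j Z X else 0)"
        using that small by (intro sum.cong) auto
      also have "\<dots> = PJ j Z X" using that by (simp add: sum.delta)
      finally show ?thesis by simp
    qed
    have sk: "PJ s Z (PJ k Z X) = 0" if "k < s" "k \<in> {1..s}" for k X
    proof -
      have "(\<Sum>i\<in>{1..<s}. PJ i Z (PJ k Z X)) = (\<Sum>i\<in>{1..<s}. if i = k then PJ k Z X else 0)"
        using that small by (intro sum.cong) auto
      then show ?thesis unfolding Ps[of "PJ k Z X"] using that by (simp add: sum.delta)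
    qed
    have ss: "PJ s Z (PJ s Z X) = PJ s Z X"
      unfolding Ps[of "PJ s Z X"] using js by (simp add: sum.neutral)
    show ?thesis using small js sk ss jk by (cases "j = s"; cases "k = s") auto
  qed
  have hh: "h Z (PJ k Z X) Y = h Z X (PJ k Z Y)" if "k \<in> {1..<s}" for k X Y
  proof -
    have "h Z X (PJ k Z Y) = cnj (h Z (PJ k Z Y) X)" by (simp add: h_cnj)
    then show ?thesis unfolding h_PJ[OF that] eta_cnj by simp
  qed
  show "h Z (PJ k Z X) Y = h Z X (PJ k Z Y)" if "k \<in> {1..s}" for k X Y
  proof (cases "k = s")
    case True
    have h_sum: "h Z (\<Sum>i\<in>I. f i) Y = (\<Sum>i\<in>I. h Z (f i) Y)" "h Z Y (\<Sum>i\<in>I. f i) = (\<Sum>i\<in>I. h Z Y (f i))"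
      if "finite I" for I :: "nat set" and f Y
      using that by (induction I rule: finite_induct) (auto simp: h_add_left h_add_right)
    show ?thesis unfolding True Ps h_diff_left h_diff_right using hh by (simp add: h_sum)
  qed (use that hh in auto)
  show "\<exists>X. PJ k Z X \<noteq> 0" if k: "k \<in> {1..s}" for k
  proof (cases "k = s")
    case False
    then have ks: "k \<in> {1..<s}" using k by auto
    obtain a b where ab: "a \<noteq> b" "bl a = k" "bl b = k"
    proof -
      obtain S where S: "S \<subseteq> {\<mu>. bl \<mu> = k}" "card S = 2"
        by (rule obtain_subset_with_card_n[OF card_blk[OF ks]])
      then obtain a b where ab: "S = {a, b}" "a \<noteq> b" using card_2_iff by metis
      then have "bl a = k" "bl b = k" using S(1) by auto
      then show ?thesis using that ab(2) by metis
    qed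
    have ax: "ipb k (axis c 1) Z = cnj (Z $ c)" if "bl c = k" for c
    proof -
      have "ipb k (axis c 1) Z = (\<Sum>\<mu> | bl \<mu> = k. if \<mu> = c then cnj (Z $ \<mu>) else 0)"
        unfolding ip_def by (intro sum.cong refl) (auto simp: axis_def)
      then show ?thesis using that by (simp add: sum.delta)
    qed
    obtain X where X: "X \<noteq> 0" "ipb k X Z = 0" "\<forall>\<mu>. bl \<mu> \<noteq> k \<longrightarrow> X $ \<mu> = 0"
    proof (cases "Z $ a = 0")
      case True
      have "axis a (1::complex) \<noteq> 0" by (simp add: axis_eq_0_iff)
      moreover have "ipb k (axis a 1) Z = 0" using True ax[OF ab(2)] by simp
      moreover have "\<forall>\<mu>. bl \<mu> \<noteq> k \<longrightarrow> axis a (1::complex) $ \<mu> = 0" using ab by (auto simp: axis_def)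
      ultimately show ?thesis by (rule that)
    next
      case f: False
      let ?X = "cnj (Z $ b) *s axis a 1 - cnj (Z $ a) *s axis b 1"
      have "?X $ b \<noteq> 0" using f ab by (simp add: axis_def)
      then have "?X \<noteq> 0" by (metis zero_index)
      then show ?thesis
      proof (rule that)
        show "ipb k ?X Z = 0" by (simp add: ip_diff_left ip_scale_left ax ab)
        show "\<forall>\<mu>. bl \<mu> \<noteq> k \<longrightarrow> ?X $ \<mu> = 0" using ab by (auto simp: axis_def)
      qed
    qed
    have "PJ k Z X = X" using X ks by (auto simp: PJ_def vec_eq_iff)
    then show ?thesis using X by metis
  next
    case True
    show ?thesis
    proof (cases "s = 1")
      case True
      have "bl \<mu> = s" for \<mu> using True bl_in[of \<mu>] by simp
      then have "PJ s Z X = X" for X by (simp add: PJ_def vec_eq_iff)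
      then show ?thesis using \<open>k = s\<close> by (metis axis_eq_0_iff zero_neq_one)
    next
      case False
      then have "1 \<in> {1..<s}" using s_pos by auto
      then have "ipb 1 Z Z \<noteq> 0" using Z unfolding nondeg_def by blast
      then have "Z \<noteq> 0" by (metis ip_zero_left)
      then show ?thesis using PJ_s_Z[OF Z] \<open>k = s\<close> by metis
    qed
  qed
qed (use PJ_add PJ_scale PJ_sum h_add_left h_scale_left h_cnj h_pos[OF Z] in auto)

lemma cf_pos:
  assumes "nondeg Z" "j \<in> {1..<s}"
  shows "cf j Z = of_real (Re (cf j Z))" "0 < Re (cf j Z)"
proof -
  obtain r where r: "ipb j Z Z = of_real r" "0 < r"
    using ip_self_nonneg[of j Z] assms unfolding nondeg_def by (metis of_real_0 order_le_less)
  have e: "cf j Z = of_real ((real (m j) - 1) / (real (m j) * r ^ m j))"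
    unfolding cf_def r by simp
  show "cf j Z = of_real (Re (cf j Z))" unfolding e by simp
  show "0 < Re (cf j Z)" unfolding e using m_ge[OF assms(2)] r(2) by simp
qed

lemma cf_s [simp]: "cf s Z = 0"
  by (simp add: cf_def m_s)

lemma RR_full: "RR Z X Y = (\<Sum>j\<in>{1..s}. 2 * cf j Z * (h Z (PJ j Z X) Y)\<^sup>2)"
proof -
  have "{1..s} = insert s {1..<s}" using s_pos by auto
  then show ?thesis unfolding RR_def using h_PJ by (auto intro!: sum.cong)
qed

end

section \<open>Matching the blocks at a point and along W\<close>

context cr_map
begin

definition ainv :: "(complex^'n) \<times> real \<Rightarrow> complex^'n \<Rightarrow> complex^'n"
  where "ainv q y = (SOME x. A x q = y)"

lemma A_ainv: "q \<in> W \<Longrightarrow> A (ainv q y) q = y"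
  unfolding ainv_def by (rule someI_ex) (metis A_surj)

lemma A_eq: "q \<in> W \<Longrightarrow> A x q = A y q \<Longrightarrow> x = y"
  using A_inj[of q "x - y"] A_add[of q "x - y" y] by simp

text \<open>A is a bijection multiplying the Levi form by lam, so projections pulled back through it
  stay self-adjoint.\<close>

lemma odec_pull:
  assumes q: "q \<in> W"
  shows "odec (h (fst q)) {1..s} (\<lambda>j x. ainv q (PJ j (F q) (A x q)))"
proof -
  interpret Z: odec "h (fst q)" "{1..s}" "\<lambda>j. PJ j (fst q)" by (rule odec_PJ[OF nondeg_z[OF q]])
  interpret Y: odec "h (F q)" "{1..s}" "\<lambda>j. PJ j (F q)" by (rule odec_PJ[OF nondeg_F[OF q]])
  note Ai = A_ainv[OF q] and Ae = A_eq[OF q] and Aa = A_add[OF q] and As = A_scale[OF q]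
  have A0: "A 0 q = 0" using As[of 0 0] by simp
  show ?thesis
  proof (unfold_locales, goal_cases)
    case (2 k x y)
    show ?case by (rule Ae) (simp only: Ai Aa PJ_add)
  next
    case (3 k a x)
    show ?case by (rule Ae) (simp only: Ai As PJ_scale)
  next
    case (4 j k x)
    show ?case by (rule Ae) (use Y.P_P[OF 4] A0 in \<open>simp add: Ai\<close>)
  next
    case (5 x)
    have "A (\<Sum>i\<in>I. f i) q = (\<Sum>i\<in>I. A (f i) q)" if "finite I" for I and f :: "nat \<Rightarrow> _"
      using that by (induction I rule: finite_induct) (auto simp: A0 Aa)
    then have "A (\<Sum>k\<in>{1..s}. ainv q (PJ k (F q) (A x q))) q = (\<Sum>k\<in>{1..s}. PJ k (F q) (A x q))"
      by (simp add: Ai)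
    then show ?case using Ae PJ_sum by metis
  next
    case (6 k x y)
    have "lam q * h (fst q) (ainv q (PJ k (F q) (A x q))) y = lam q * h (fst q) x (ainv q (PJ k (F q) (A y q)))"
      unfolding levi[OF q, symmetric] Ai by (rule Y.P_herm[OF 6])
    then show ?case using q by simp
  next
    case (7 k)
    obtain y where "PJ k (F q) y \<noteq> 0" using Y.P_ex[OF 7] by blast
    then show ?case using Ai A0 by metis
  qed simp
qed

text \<open>On orthogonal pairs the last term of \<open>curvature_identity\<close> disappears. What
  remains, divided by 2 lam, is the hypothesis of \<open>block_matching\<close> with weights cf at z
  and lam times cf at F, both 0 at index s.\<close>

lemma matching:
  assumes q: "q \<in> W"
  obtains \<tau> where "bij_betw \<tau> {1..s} {1..s}" "\<And>k x. k \<in> {1..s} \<Longrightarrow> PJ (\<tau> k) (F q) (A x q) = A (PJ k (fst q) x) q"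
    "\<And>k l. k \<in> {1..s} \<Longrightarrow> l \<in> {1..s} \<Longrightarrow> k \<noteq> l \<Longrightarrow>
       lam q * cf (\<tau> k) (F q) + lam q * cf (\<tau> l) (F q) = cf k (fst q) + cf l (fst q)"
proof -
  let ?c = "\<lambda>k. Re (cf k (fst q))" and ?d = "\<lambda>k. Re (lam q * cf k (F q))"
  let ?Q = "\<lambda>j x. ainv q (PJ j (F q) (A x q))"
  note nz = nondeg_z[OF q] and nF = nondeg_F[OF q]
  have dr: "lam q * cf k (F q) = of_real (?d k)" and cr: "cf k (fst q) = of_real (?c k)" if "k \<in> {1..s}" for k
  proof -
    have "cf k (fst q) = of_real (?c k) \<and> cf k (F q) = of_real (Re (cf k (F q)))"
      using cf_pos[OF nz] cf_pos[OF nF] that by (cases "k = s") auto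
    then show "lam q * cf k (F q) = of_real (?d k)" "cf k (fst q) = of_real (?c k)"
      using lam_real[OF q] by (metis Re_complex_of_real of_real_mult)+
  qed
  have dpos: "0 < ?d k" if k: "k \<in> {1..<s}" for k
  proof -
    have "lam q * cf k (F q) = of_real (Re (lam q) * Re (cf k (F q)))"
      using lam_real[OF q] cf_pos(1)[OF nF k] by (metis of_real_mult)
    then show ?thesis using lam_pos[OF q] cf_pos(2)[OF nF k] by simp
  qed
  have key: "(\<Sum>k\<in>{1..s}. of_real (?d k) * (h (fst q) (?Q k x) y)\<^sup>2)
       = (\<Sum>k\<in>{1..s}. of_real (?c k) * (h (fst q) (PJ k (fst q) x) y)\<^sup>2)" if xy: "h (fst q) x y = 0" for x y
  proof -
    have "2 * lam q * (\<Sum>k\<in>{1..s}. of_real (?d k) * (h (fst q) (?Q k x) y)\<^sup>2) = RR (F q) (A x q) (A y q)"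
      unfolding RR_full sum_distrib_left
    proof (intro sum.cong refl)
      fix k assume k: "k \<in> {1..s}"
      have "h (F q) (PJ k (F q) (A x q)) (A y q) = lam q * h (fst q) (?Q k x) y"
        unfolding levi[OF q, symmetric] A_ainv[OF q] ..
      then show "2 * lam q * (of_real (?d k) * (h (fst q) (?Q k x) y)\<^sup>2)
        = 2 * cf k (F q) * (h (F q) (PJ k (F q) (A x q)) (A y q))\<^sup>2"
        unfolding dr[OF k, symmetric] by (simp add: power2_eq_square)
    qed
    also have "\<dots> = lam q * RR (fst q) x y"
      using curvature_identity[OF q, of x y] xy by simp
    also have "\<dots> = 2 * lam q * (\<Sum>k\<in>{1..s}. of_real (?c k) * (h (fst q) (PJ k (fst q) x) y)\<^sup>2)"
      unfolding RR_full sum_distrib_left using cr by (intro sum.cong refl) (simp add: mult.assoc)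
    finally show ?thesis using q by simp
  qed
  have s: "s \<in> {1..s}" using s_pos by simp
  have c0: "0 < ?c k" "0 < ?d k" if "k \<in> {1..s}" "k \<noteq> s" for k
    using that dpos[of k] cf_pos(2)[OF nz, of k] by auto
  obtain \<tau> where t: "bij_betw \<tau> {1..s} {1..s}" "\<And>k x. k \<in> {1..s} \<Longrightarrow> ?Q (\<tau> k) x = PJ k (fst q) x"
    "\<And>k l. k \<in> {1..s} \<Longrightarrow> l \<in> {1..s} \<Longrightarrow> k \<noteq> l \<Longrightarrow> ?d (\<tau> k) + ?d (\<tau> l) = ?c k + ?c l"
    by (rule block_matching[OF odec_PJ[OF nz] odec_pull[OF q] s, of ?c ?d, OF c0(1) _ c0(2) _ key]) (assumption | simp)+
  show ?thesis
  proof (rule that[OF t(1)])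
    show "PJ (\<tau> k) (F q) (A x q) = A (PJ k (fst q) x) q" if "k \<in> {1..s}" for k x
      using t(2)[OF that, of x] A_ainv[OF q] by metis
    show "lam q * cf (\<tau> k) (F q) + lam q * cf (\<tau> l) (F q) = cf k (fst q) + cf l (fst q)"
      if kl: "k \<in> {1..s}" "l \<in> {1..s}" "k \<noteq> l" for k l
    proof -
      have tt: "\<tau> k \<in> {1..s}" "\<tau> l \<in> {1..s}" using bij_betwE[OF t(1)] kl by blast+
      have "complex_of_real (?d (\<tau> k) + ?d (\<tau> l)) = of_real (?c k + ?c l)" by (rule arg_cong[OF t(3)[OF kl]])
      then show ?thesis
        unfolding of_real_add dr[OF tt(1), symmetric] dr[OF tt(2), symmetric] cr[OF kl(1), symmetric] cr[OF kl(2), symmetric] .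
    qed
  qed
qed

end

context cr_blocks
begin

lemma split_s: "(\<Sum>j\<in>{1..s}. f j) = f s + (\<Sum>j\<in>{1..<s}. f j)" for f :: "nat \<Rightarrow> 'x::comm_monoid_add"
proof -
  have "{1..s} = insert s {1..<s}" using s_pos by auto
  then show ?thesis by simp
qed

lemma h_sum_left: "h Z (\<Sum>i\<in>I. f i) Y = (\<Sum>i\<in>I. h Z (f i) Y)"
  by (induction I rule: infinite_finite_induct) (auto simp: h_add_left)

lemma h_PJ_s: "h Z (PJ s Z X) Y = h Z X Y - (\<Sum>j\<in>{1..<s}. eta j Z X Y)"
proof -
  have "h Z X Y = h Z (\<Sum>j\<in>{1..s}. PJ j Z X) Y" by (simp only: PJ_sum)
  also have "\<dots> = (\<Sum>j\<in>{1..s}. h Z (PJ j Z X) Y)" by (rule h_sum_left)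
  also have "\<dots> = h Z (PJ s Z X) Y + (\<Sum>j\<in>{1..<s}. h Z (PJ j Z X) Y)" by (rule split_s)
  also have "(\<Sum>j\<in>{1..<s}. h Z (PJ j Z X) Y) = (\<Sum>j\<in>{1..<s}. eta j Z X Y)"
    by (intro sum.cong refl h_PJ)
  finally show ?thesis by simp
qed

lemma eta_div:
  assumes "ipb j Z Z \<noteq> 0" "1 \<le> m j"
  shows "eta j Z X Y / ipb j Z Z ^ m j = of_nat (m j) * (ipb j X Y / ipb j Z Z - ipb j X Z * ipb j Z Y / (ipb j Z Z)\<^sup>2)"
proof -
  obtain n where n: "m j = Suc n" using assms(2) by (cases "m j") auto
  then have "cc j 1 (ipb j Z Z) = of_nat (m j) * ipb j Z Z ^ n" by (simp add: cc_def)
  then show ?thesis using assms(1) by (simp add: eta_def n field_simps power2_eq_square)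
qed

end

context cr_map
begin

lemma t_nonzero [simp]:
  "q \<in> W \<Longrightarrow> j \<in> {1..<s} \<Longrightarrow> ipb j (fst q) (fst q) \<noteq> 0"
  "q \<in> W \<Longrightarrow> j \<in> {1..<s} \<Longrightarrow> ipb j (F q) (F q) \<noteq> 0"
  using nondeg_z nondeg_F unfolding nondeg_def by blast+

lemma sm_ip0 [simp]: "smv W U \<Longrightarrow> smv W V \<Longrightarrow> sm W (\<lambda>q. ipb j (U q) (V q))"
  by (rule sm_ip[OF derpair_ddir])

lemma sm_h_PJ:
  assumes "smv W P" "\<And>q. q \<in> W \<Longrightarrow> nondeg (P q)" "smv W U" "smv W V" "j \<in> {1..s}"
  shows "sm W (\<lambda>q. h (P q) (PJ j (P q) (U q)) (V q))"
proof -
  have e: "sm W (\<lambda>q. eta j (P q) (U q) (V q))" if "j \<in> {1..<s}" for j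
    unfolding eta_def using assms that
    by (intro sm_mult sm_diff sm_divide sm_cc[OF derpair_ddir] sm_ip0) (auto simp: nondeg_def)
  show ?thesis
  proof (cases "j = s")
    case True
    then show ?thesis unfolding True h_PJ_s using e assms by (intro sm_diff sm_sum sm_fm) auto
  next
    case False
    then show ?thesis using e h_PJ assms(5) by auto
  qed
qed

lemma global_matching:
  obtains \<tau> where "bij_betw \<tau> {1..s} {1..s}"
    "\<And>q k x. q \<in> W \<Longrightarrow> k \<in> {1..s} \<Longrightarrow> PJ (\<tau> k) (F q) (A x q) = A (PJ k (fst q) x) q"
    "\<And>q k l. q \<in> W \<Longrightarrow> k \<in> {1..s} \<Longrightarrow> l \<in> {1..s} \<Longrightarrow> k \<noteq> l \<Longrightarrow>
       lam q * cf (\<tau> k) (F q) + lam q * cf (\<tau> l) (F q) = cf k (fst q) + cf l (fst q)"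
proof (cases "W = {}")
  case True
  then show ?thesis using that[of id] by auto
next
  case False
  then obtain q0 where q0: "q0 \<in> W" by blast
  define good where "good q \<tau> \<longleftrightarrow> bij_betw \<tau> {1..s} {1..s} \<and>
    (\<forall>k\<in>{1..s}. \<forall>x. PJ (\<tau> k) (F q) (A x q) = A (PJ k (fst q) x) q) \<and>
    (\<forall>k\<in>{1..s}. \<forall>l\<in>{1..s}. k \<noteq> l \<longrightarrow>
       lam q * cf (\<tau> k) (F q) + lam q * cf (\<tau> l) (F q) = cf k (fst q) + cf l (fst q))" for q \<tau>
  define tq where "tq q = (SOME \<tau>. good q \<tau>)" for q
  have tq: "good q (tq q)" if q: "q \<in> W" for q
  proof -
    obtain \<tau> where "good q \<tau>" using matching[OF q] unfolding good_def by metis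
    then show ?thesis unfolding tq_def using someI[of "good q" \<tau>] by blast
  qed
  \<comment> \<open>E k j x vanishes at q for all x exactly when j is the index matched with k at q.
    By continuity a wrong index stays wrong nearby, so the matching is locally constant, hence
    constant on the connected set W.\<close>
  define E where "E k j x q = h (F q) (PJ j (F q) (A x q)) (A x q) - lam q * h (fst q) (PJ k (fst q) x) x" for k j x q
  have cE: "continuous_on W (E k j x)" if "k \<in> {1..s}" "j \<in> {1..s}" for k j x
  proof -
    have "sm W (E k j x)" unfolding E_def[abs_def] using that nondeg_z nondeg_F
      by (intro sm_diff sm_mult sm_lam sm_h_PJ sm_h_PJ[where P=fst and U="\<lambda>_. x" and V="\<lambda>_. x"]) auto
    then show ?thesis unfolding sm_def by (metis Ck_on.simps(1))
  qed
  have E0: "E k (tq q k) x q = 0" if "q \<in> W" "k \<in> {1..s}" for q k x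
    using tq[OF that(1)] that unfolding E_def good_def by (simp add: levi)
  have E1: "\<exists>x. E k j x q \<noteq> 0" if q: "q \<in> W" and k: "k \<in> {1..s}" and j: "j \<in> {1..s}" "j \<noteq> tq q k" for q k j
  proof -
    interpret Y: odec "h (F q)" "{1..s}" "\<lambda>j. PJ j (F q)" by (rule odec_PJ[OF nondeg_F[OF q]])
    obtain y where y: "PJ j (F q) y = y" "h (F q) y y = 1" using Y.P_unit[OF j(1)] by blast
    obtain x where x: "A x q = y" using A_surj[OF q] .
    have tk: "tq q k \<in> {1..s}" using tq[OF q] k unfolding good_def by (metis bij_betwE)
    have "lam q * h (fst q) (PJ k (fst q) x) x = h (F q) (PJ (tq q k) (F q) y) y"
      using tq[OF q] k unfolding good_def levi[OF q, symmetric] x[symmetric] by simp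
    also have "\<dots> = 0" using Y.P_P[OF tk j(1), of y] j(2) y(1) by simp
    finally have "E k j x q = 1 - 0" by (simp only: E_def x y)
    then show ?thesis by (intro exI[of _ x]) simp
  qed
  have const: "tq q k = tq q' k" if k: "k \<in> {1..s}" and "q \<in> W" "q' \<in> W" for k q q'
  proof (rule connected_local_const[OF conn_W that(2,3), of "\<lambda>q. tq q k"], intro ballI)
    fix q assume q: "q \<in> W"
    have "eventually (\<lambda>q'. tq q' k \<noteq> j) (at q within W)" if j: "j \<in> {1..s} - {tq q k}" for j
    proof -
      obtain x where x: "E k j x q \<noteq> 0" using E1[OF q k] j by blast
      have "(E k j x \<longlongrightarrow> E k j x q) (at q within W)"
        using cE[OF k, of j x] j q by (simp add: continuous_on_def)
      then have "eventually (\<lambda>q'. E k j x q' \<noteq> 0) (at q within W)"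
        using x tendsto_imp_eventually_ne by blast
      moreover have "eventually (\<lambda>q'. q' \<in> W) (at q within W)"
        by (simp add: eventually_at_filter)
      ultimately show ?thesis
        by eventually_elim (use E0[OF _ k] in metis)
    qed
    then have "eventually (\<lambda>q'. \<forall>j\<in>{1..s} - {tq q k}. tq q' k \<noteq> j) (at q within W)"
      by (simp add: eventually_ball_finite_distrib)
    moreover have "eventually (\<lambda>q'. q' \<in> W) (at q within W)"
      by (simp add: eventually_at_filter)
    ultimately show "eventually (\<lambda>q'. tq q k = tq q' k) (at q within W)"
    proof eventually_elim
      case (elim q')
      have "tq q' k \<in> {1..s}" using tq[OF elim(2)] k unfolding good_def by (metis bij_betwE)
      then show ?case using elim(1) by auto
    qed
  qed
  show ?thesis
  proof (rule that[of "tq q0"])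
    show "bij_betw (tq q0) {1..s} {1..s}" using tq[OF q0] by (simp add: good_def)
    show "PJ (tq q0 k) (F q) (A x q) = A (PJ k (fst q) x) q" if "q \<in> W" "k \<in> {1..s}" for q k x
      using tq[OF that(1)] const[OF that(2) q0 that(1)] that(2) unfolding good_def by simp
    show "lam q * cf (tq q0 k) (F q) + lam q * cf (tq q0 l) (F q) = cf k (fst q) + cf l (fst q)"
      if "q \<in> W" "k \<in> {1..s}" "l \<in> {1..s}" "k \<noteq> l" for q k l
      using tq[OF that(1)] const[OF that(2) q0 that(1)] const[OF that(3) q0 that(1)] that unfolding good_def by simp
  qed
qed

text \<open>The (1,0) part of the logarithmic derivative of lam, which is the form occurring in
  \<open>projective\<close>.\<close>

definition mu :: "complex^'n \<Rightarrow> (complex^'n) \<times> real \<Rightarrow> complex"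
  where "mu x q = Z x lam q / lam q"

lemma sm_mu [simp]: "sm W (mu x)"
  unfolding mu_def[abs_def] by (intro sm_divide) auto

lemma Zb_mu: "q \<in> W \<Longrightarrow> Zb y (mu x) q = (Zb y (Z x lam) q - Z x lam q * Zb y lam q / lam q) / lam q"
  unfolding mu_def[abs_def] by (subst d_divide[OF derpair_Zb]) (auto simp: field_simps power2_eq_square)

lemma Z_Zb_lam_cnj: "q \<in> W \<Longrightarrow> Z x (Zb y lam) q = cnj (Zb x (Z y lam) q)"
proof -
  assume q: "q \<in> W"
  have "Z x (Zb y lam) q = Z x (\<lambda>q. cnj (Z y lam q)) q"
    by (rule d_cong[OF derpair_Z q]) (simp_all add: Zb_lam)
  then show ?thesis using d_cnj[OF derpair_Z q sm_Z[OF sm_lam]] by simp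
qed

text \<open>For y = x the second derivatives of lam and the product of its first derivatives combine
  into the real part of \<open>Zb x (mu x)\<close>.\<close>

lemma curvature_diag:
  assumes q: "q \<in> W"
  shows "RR (F q) (A x q) (A x q) = lam q * RR (fst q) x x + h (fst q) x x *
    (2 * lam q * (Zb x (mu x) q + cnj (Zb x (mu x) q)) + 8 * h (fst q) x x * nTF q)"
proof -
  have "2 * lam q * (Zb x (mu x) q + cnj (Zb x (mu x) q)) =
    2 * Zb x (Z x lam) q + 2 * Z x (Zb x lam) q - 4 * Z x lam q * Zb x lam q / lam q"
    unfolding Zb_mu[OF q] Z_Zb_lam_cnj[OF q] using q by (simp add: Zb_lam field_simps)
  then show ?thesis unfolding curvature_identity[OF q] by simp
qed

lemma nTF_real: "cnj (nTF q) = nTF q"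
  by (simp add: nTF_def h_cnj)

lemma log_derivative:
  assumes j: "j \<in> {1..<s}" and k: "k \<in> {1..<s}"
    and e: "\<And>q. q \<in> W \<Longrightarrow> ipb j (F q) (F q) ^ m j = \<kappa> * (lam q * ipb k (fst q) (fst q) ^ m k)"
    and q: "q \<in> W"
  shows "mu x q = of_nat (m j) * (ipb j (A x q) (F q) / ipb j (F q) (F q)) - of_nat (m k) * (ipb k x (fst q) / ipb k (fst q) (fst q))"
proof -
  let ?t' = "ipb j (F q) (F q)" and ?t = "ipb k (fst q) (fst q)"
  have "Z x (\<lambda>q. ipb j (F q) (F q) ^ m j) q = Z x (\<lambda>q. \<kappa> * (lam q * ipb k (fst q) (fst q) ^ m k)) q"
    by (rule d_cong[OF derpair_Z q]) (use e in auto)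
  then have E: "of_nat (m j) * ?t' ^ (m j - 1) * ipb j (A x q) (F q)
     = \<kappa> * (Z x lam q * ?t ^ m k + lam q * (of_nat (m k) * ?t ^ (m k - 1) * ipb k x (fst q)))"
    using q by (simp add: d_power[OF derpair_Z] d_cmult[OF derpair_Z] d_mult[OF derpair_Z] d_ip[OF derpair_Z]
        CR_F Z_fst Zb_fst del: vd_nth)
  have t: "?t' \<noteq> 0" "?t \<noteq> 0" using q j k by auto
  have p: "?t' ^ (m j - 1) = ?t' ^ m j / ?t'" "?t ^ (m k - 1) = ?t ^ m k / ?t"
    using t m_ge[OF j] m_ge[OF k] by (auto simp: power_diff)
  define X where "X = \<kappa> * (lam q * ?t ^ m k)"
  have X: "?t' ^ m j = X" using e[OF q] by (simp add: X_def)
  then have X0: "X \<noteq> 0" using t(1) by (metis power_not_zero)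
  have "X * (of_nat (m j) * (ipb j (A x q) (F q) / ?t')) = X * (mu x q + of_nat (m k) * (ipb k x (fst q) / ?t))"
    using E q unfolding p X by (simp add: mu_def X_def field_simps)
  from mult_left_cancel[OF X0, THEN iffD1, OF this] show ?thesis by simp
qed

text \<open>The mixed second derivative of m log t is eta / t^m, by \<open>eta_div\<close>. At F
  there is an additional term with TF, since A x itself is not annihilated by
  \<open>Zb y\<close>.\<close>

lemma Zb_mu_blocks:
  assumes j: "j \<in> {1..<s}" and k: "k \<in> {1..<s}"
    and e: "\<And>q. q \<in> W \<Longrightarrow> ipb j (F q) (F q) ^ m j = \<kappa> * (lam q * ipb k (fst q) (fst q) ^ m k)"
    and q: "q \<in> W"
  shows "Zb y (mu x) q = of_nat (m j) * (2 * \<i> * h (fst q) x y * ipb j (TF q) (F q) / ipb j (F q) (F q))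
     + eta j (F q) (A x q) (A y q) / ipb j (F q) (F q) ^ m j - eta k (fst q) x y / ipb k (fst q) (fst q) ^ m k"
proof -
  let ?t' = "ipb j (F q) (F q)" and ?t = "ipb k (fst q) (fst q)"
  have sk: "sm W (\<lambda>q. ipb k x (fst q))" using sm_ip0[of "\<lambda>_. x" fst] by simp
  have s1: "sm W (\<lambda>q. ipb j (A x q) (F q) / ipb j (F q) (F q))" using j by (intro sm_divide) auto
  have s2: "sm W (\<lambda>q. ipb k x (fst q) / ipb k (fst q) (fst q))" using k sk by (intro sm_divide) auto
  have d1: "Zb y (\<lambda>q. ipb j (A x q) (F q) / ipb j (F q) (F q)) q
      = ((2 * \<i> * h (fst q) x y * ipb j (TF q) (F q) + ipb j (A x q) (A y q)) * ?t' - ipb j (A x q) (F q) * ipb j (F q) (A y q)) / ?t'\<^sup>2"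
    using q j by (subst d_divide[OF derpair_Zb]) (auto simp: d_ip[OF derpair_Zb] CR_F Zb_A ip_scale_left simp del: vd_nth)
  have d2: "Zb y (\<lambda>q. ipb k x (fst q) / ipb k (fst q) (fst q)) q
      = (ipb k x y * ?t - ipb k x (fst q) * ipb k (fst q) y) / ?t\<^sup>2"
    using q k sk d_ip[OF derpair_Zb q smv_const[of x] smv_fst]
    by (subst d_divide[OF derpair_Zb]) (auto simp: d_ip[OF derpair_Zb] Zb_fst Z_fst simp del: vd_nth)
  have "Zb y (mu x) q = Zb y (\<lambda>q. of_nat (m j) * (ipb j (A x q) (F q) / ipb j (F q) (F q)) - of_nat (m k) * (ipb k x (fst q) / ipb k (fst q) (fst q))) q"
    by (rule d_cong[OF derpair_Zb q]) (simp_all add: log_derivative[OF j k e])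
  also have "\<dots> = of_nat (m j) * (((2 * \<i> * h (fst q) x y * ipb j (TF q) (F q) + ipb j (A x q) (A y q)) * ?t' - ipb j (A x q) (F q) * ipb j (F q) (A y q)) / ?t'\<^sup>2)
     - of_nat (m k) * ((ipb k x y * ?t - ipb k x (fst q) * ipb k (fst q) y) / ?t\<^sup>2)"
    using s1 s2 unfolding d1[symmetric] d2[symmetric] by (simp only: d_diff[OF derpair_Zb q] d_cmult[OF derpair_Zb q] sm_mult sm_const)
  also have "\<dots> = of_nat (m j) * (2 * \<i> * h (fst q) x y * ipb j (TF q) (F q) / ?t')
     + eta j (F q) (A x q) (A y q) / ?t' ^ m j - eta k (fst q) x y / ?t ^ m k"
    using j k q m_ge[OF j] m_ge[OF k] by (simp add: eta_div field_simps power2_eq_square)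
  finally show ?thesis .
qed

text \<open>Only denominators are cleared. The point is that \<kappa> is a constant built from the
  two exponents, equal to 1 exactly when they agree.\<close>

lemma kappa:
  assumes q: "q \<in> W" and j: "j \<in> {1..<s}" and k: "k \<in> {1..<s}"
    and e: "lam q * cf j (F q) = cf k (fst q)"
  defines "\<kappa> \<equiv> ((of_nat (m j) - 1) * of_nat (m k)) / (of_nat (m j) * (of_nat (m k) - 1)) :: complex"
  shows "ipb j (F q) (F q) ^ m j = \<kappa> * (lam q * ipb k (fst q) (fst q) ^ m k)"
proof -
  have "(of_nat (m k) - 1 :: complex) \<noteq> 0" "(of_nat (m j) :: complex) \<noteq> 0" "(of_nat (m k) :: complex) \<noteq> 0"
    using m_ge[OF j] m_ge[OF k] by (auto simp: of_nat_eq_1_iff)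
  moreover have "ipb j (F q) (F q) ^ m j \<noteq> 0" "ipb k (fst q) (fst q) ^ m k \<noteq> 0" using q j k by simp_all
  ultimately show ?thesis using e unfolding cf_def \<kappa>_def by (simp add: field_simps)
qed

lemma ex_horizontal:
  assumes "q \<in> W" "k \<in> {1..s}"
  obtains x where "PJ k (fst q) x = x" "h (fst q) x x = 1"
  using odec.P_unit[OF odec_PJ[OF nondeg_z[OF assms(1)]] assms(2)] by blast

text \<open>The diagonal of the curvature identity, with \<open>\<lambda>\<close> expressed through matched blocks, compares two
  quadratic forms; it forces the matched exponents to agree and excludes that a block is matched with
  the complementary directions.\<close>

lemma exponents_agree:
  assumes q: "q \<in> W" and j: "j \<in> {1..<s}" and k: "k \<in> {1..<s}"
    and e: "\<And>q. q \<in> W \<Longrightarrow> lam q * cf j (F q) = cf k (fst q)"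
    and m: "\<And>x. PJ j (F q) (A x q) = A (PJ k (fst q) x) q"
    and RR: "\<And>x. RR (F q) (A x q) (A x q) = lam q * RR (fst q) x x"
  shows "m j = m k"
proof -
  define \<kappa> where "\<kappa> = ((of_nat (m j) - 1) * of_nat (m k)) / (of_nat (m j) * (of_nat (m k) - 1) :: complex)"
  have kap: "ipb j (F q) (F q) ^ m j = \<kappa> * (lam q * ipb k (fst q) (fst q) ^ m k)" if "q \<in> W" for q
    using kappa[OF that j k e[OF that]] by (simp add: \<kappa>_def)
  let ?z = "fst q" and ?t = "ipb k (fst q) (fst q)" and ?t' = "ipb j (F q) (F q)"
  have t: "?t' \<noteq> 0" "?t \<noteq> 0" using q j k by auto
  have \<kappa>0: "\<kappa> \<noteq> 0" using kap[OF q] t by (metis mult_zero_left power_not_zero)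
  have et: "eta j (F q) (A x q) (A x q) = lam q * eta k ?z x x" for x
    unfolding h_PJ[OF j, symmetric] h_PJ[OF k, symmetric] m levi[OF q] ..
  have ek: "cnj (eta k ?z x x) = eta k ?z x x" for x by (rule eta_cnj)
  have tt: "cnj (?t ^ m k) = ?t ^ m k" by (simp add: ip_cnj)
  define \<gamma> where "\<gamma> = 2 * \<i> * of_nat (m j) * ipb j (TF q) (F q) / ?t'"
  have kr: "cnj \<kappa> = \<kappa>" by (simp add: \<kappa>_def)
  have N: "Zb x (mu x) q = h ?z x x * \<gamma> + (1 / \<kappa> - 1) * (eta k ?z x x / ?t ^ m k)" for x
    unfolding Zb_mu_blocks[of j k \<kappa> q x x, OF j k kap q, simplified] et kap[OF q] using t \<kappa>0 q by (simp add: \<gamma>_def field_simps)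
  have S: "2 * lam q * (Zb x (mu x) q + cnj (Zb x (mu x) q)) + 8 * h ?z x x * nTF q = 0" if "h ?z x x = 1" for x
    using curvature_diag[OF q, of x] RR[of x] that by simp
  define \<beta> where "\<beta> = 2 * lam q * (\<gamma> + cnj \<gamma>) + 8 * nTF q"
  have S': "\<beta> + 4 * lam q * ((1 / \<kappa> - 1) * (eta k ?z x x / ?t ^ m k)) = 0" if x: "h ?z x x = 1" for x
    using S[OF x] unfolding N x by (simp add: \<beta>_def kr ek ip_cnj algebra_simps)
  have s1: "s \<in> {1..s}" "k \<in> {1..s}" "k \<noteq> s" using s_pos k by auto
  interpret Z: odec "h ?z" "{1..s}" "\<lambda>j. PJ j ?z" by (rule odec_PJ[OF nondeg_z[OF q]])
  \<comment> \<open>A unit vector of the complement has eta = 0 and shows \<beta> = 0; a unit vector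
    of block k has eta = 1 and then shows that 1 / \<kappa> - 1 vanishes.\<close>
  obtain x where x: "PJ s ?z x = x" "h ?z x x = 1" using ex_horizontal[OF q s1(1)] .
  have "eta k ?z x x = 0" unfolding h_PJ[OF k, symmetric] using Z.P_P[OF s1(2,1), of x] s1(3) x(1) by simp
  then have "\<beta> = 0" using S'[OF x(2)] by simp
  obtain y where y: "PJ k ?z y = y" "h ?z y y = 1" using ex_horizontal[OF q s1(2)] .
  have "eta k ?z y y = 1" unfolding h_PJ[OF k, symmetric] using y by simp
  then have "1 / \<kappa> - 1 = 0" using S'[OF y(2)] \<open>\<beta> = 0\<close> q t by simp
  then have "\<kappa> = 1" using \<kappa>0 by (simp add: field_simps)
  moreover have "(of_nat (m k) - 1 :: complex) \<noteq> 0" "(of_nat (m j) :: complex) \<noteq> 0"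
    using m_ge[OF j] m_ge[OF k] by (auto simp: of_nat_eq_1_iff)
  ultimately have "(of_nat (m j) - 1) * of_nat (m k) = (of_nat (m j) * (of_nat (m k) - 1) :: complex)"
    unfolding \<kappa>_def by (simp add: field_simps)
  then have "(of_nat (m j) :: complex) = of_nat (m k)" by (simp add: algebra_simps)
  then show ?thesis by simp
qed

text \<open>With two summands the sum of the two weights is symmetric under their exchange, so
  \<open>matching\<close> cannot rule the exchange out; the value of the curvature constant
  does.\<close>

lemma no_swap:
  assumes q: "q \<in> W" and s2: "s = 2"
    and e: "\<And>q. q \<in> W \<Longrightarrow> lam q * cf 1 (F q) = cf 1 (fst q)"
    and m: "\<And>x. PJ 1 (F q) (A x q) = A (PJ 2 (fst q) x) q"
  shows False
proof -
  have j: "1 \<in> {1..<s}" using s2 by simp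
  have m1: "(of_nat (m 1) :: complex) \<noteq> 0" "(of_nat (m 1) - 1 :: complex) \<noteq> 0"
    using m_ge[OF j] by (auto simp: of_nat_eq_1_iff)
  have kap: "ipb 1 (F q) (F q) ^ m 1 = 1 * (lam q * ipb 1 (fst q) (fst q) ^ m 1)" if "q \<in> W" for q
    using kappa[OF that j j e[OF that]] m1 by simp
  let ?z = "fst q" and ?t = "ipb 1 (fst q) (fst q)" and ?t' = "ipb 1 (F q) (F q)"
  have t: "?t' \<noteq> 0" "?t \<noteq> 0" using q j by auto
  have et: "eta 1 (F q) (A x q) (A x q) = lam q * h ?z (PJ 2 ?z x) x" for x
    unfolding h_PJ[OF j, symmetric] m levi[OF q] ..
  interpret Z: odec "h ?z" "{1..s}" "\<lambda>j. PJ j ?z" by (rule odec_PJ[OF nondeg_z[OF q]])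
  define \<gamma> where "\<gamma> = 2 * \<i> * of_nat (m 1) * ipb 1 (TF q) (F q) / ?t'"
  have N0: "Zb x (mu x) q = of_nat (m 1) * (2 * \<i> * h ?z x x * ipb 1 (TF q) (F q) / ?t')
     + eta 1 (F q) (A x q) (A x q) / ?t' ^ m 1 - eta 1 ?z x x / ?t ^ m 1" for x
    by (rule Zb_mu_blocks[OF j j kap q])
  have N: "Zb x (mu x) q = h ?z x x * \<gamma> + (h ?z (PJ 2 ?z x) x - h ?z (PJ 1 ?z x) x) / ?t ^ m 1" for x
    unfolding N0 et h_PJ[OF j] kap[OF q] using t q
    by (simp add: \<gamma>_def field_simps)
  define c where "c = cf 1 ?z"
  have s12: "{1..s} = {1, 2}" "{1..<s} = {1}" using s2 by auto
  have R1: "RR ?z x x = 2 * c * (h ?z (PJ 1 ?z x) x)\<^sup>2" for x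
    unfolding RR_def s12 c_def h_PJ[OF j] by simp
  have R2: "RR (F q) (A x q) (A x q) = 2 * c * lam q * (h ?z (PJ 2 ?z x) x)\<^sup>2" for x
  proof -
    have "RR (F q) (A x q) (A x q) = 2 * cf 1 (F q) * (lam q * h ?z (PJ 2 ?z x) x)\<^sup>2"
      unfolding RR_def s12 et[symmetric] by simp
    then show ?thesis unfolding c_def e[OF q, symmetric] by (simp add: power2_eq_square)
  qed
  define \<beta> where "\<beta> = 2 * lam q * (\<gamma> + cnj \<gamma>) + 8 * nTF q"
  have main: "2 * c * lam q * (h ?z (PJ 2 ?z x) x)\<^sup>2 = 2 * c * lam q * (h ?z (PJ 1 ?z x) x)\<^sup>2
     + \<beta> + 4 * lam q * ((h ?z (PJ 2 ?z x) x - h ?z (PJ 1 ?z x) x) / ?t ^ m 1)"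
    if x: "h ?z x x = 1" "h ?z (PJ 1 ?z x) x = of_real u" "h ?z (PJ 2 ?z x) x = of_real v" for x u v
    using curvature_diag[OF q, of x] unfolding R1 R2 N x
    by (simp add: \<beta>_def ip_cnj algebra_simps diff_divide_distrib)
  have in12: "1 \<in> {1..s}" "2 \<in> {1..s}" using s2 by auto
  obtain x where x: "PJ 1 ?z x = x" "h ?z x x = 1" using ex_horizontal[OF q in12(1)] .
  have x2: "PJ 2 ?z x = 0" using Z.P_P[OF in12(2,1), of x] x(1) by simp
  obtain y where y: "PJ 2 ?z y = y" "h ?z y y = 1" using ex_horizontal[OF q in12(2)] .
  have y1: "PJ 1 ?z y = 0" using Z.P_P[OF in12(1,2), of y] y(1) by simp
  \<comment> \<open>Unit vectors of block 1 and of the complement give two equations. Eliminating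
    \<beta> yields c = 2 / t^m, whereas c = (m - 1) / (m t^m) by definition, so m would be
    -1.\<close>
  have e1: "0 = 2 * c * lam q + \<beta> - 4 * lam q / ?t ^ m 1"
    using main[OF x(2), of 1 0] x x2 by simp
  have e2: "2 * c * lam q = \<beta> + 4 * lam q / ?t ^ m 1"
    using main[OF y(2), of 0 1] y y1 by simp
  have "4 * (c * lam q) = 2 * D" if "0 = 2 * c * lam q + \<beta> - D" "2 * c * lam q = \<beta> + D" for D
    using that by algebra
  from this[OF e1 e2] have "lam q * (4 * c) = lam q * (8 / ?t ^ m 1)" by (simp add: mult_ac)
  from mult_left_cancel[OF lam_nonzero[OF q], THEN iffD1, OF this] have "4 * c = 4 * (2 / ?t ^ m 1)" by simp
  from mult_left_cancel[of 4, THEN iffD1, OF _ this] have "c = 2 / ?t ^ m 1" by simp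
  moreover have "of_nat (m 1) * (c * X) = of_nat (m 1) - 1" if "X = ?t ^ m 1" "X \<noteq> 0" for X
    using that m1 by (simp add: c_def cf_def)
  ultimately have "of_nat (m 1) * 2 = (of_nat (m 1) - 1 :: complex)" using t(2) by auto
  then have "of_nat (m 1) + (1::complex) = 0" by (simp add: algebra_simps)
  then have "of_nat (m 1 + 1) = (0::complex)" by (simp only: of_nat_add of_nat_1)
  then show False by (simp only: of_nat_eq_0_iff)
qed

lemma matched_blocks:
  obtains \<tau> where "bij_betw \<tau> {1..<s} {1..<s}" "\<tau> s = s" "\<And>k. k \<in> {1..<s} \<Longrightarrow> m (\<tau> k) = m k"
    "\<And>q k x. q \<in> W \<Longrightarrow> k \<in> {1..s} \<Longrightarrow> PJ (\<tau> k) (F q) (A x q) = A (PJ k (fst q) x) q"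
    "\<And>q k. q \<in> W \<Longrightarrow> k \<in> {1..<s} \<Longrightarrow>
       ipb (\<tau> k) (F q) (F q) ^ m k = lam q * ipb k (fst q) (fst q) ^ m k"
    "\<And>q x. q \<in> W \<Longrightarrow> RR (F q) (A x q) (A x q) = lam q * RR (fst q) x x"
proof (cases "W = {}")
  case True
  then show ?thesis using that[of id] by auto
next
  case False
  then obtain q0 where q0: "q0 \<in> W" by blast
  obtain \<tau> where bij: "bij_betw \<tau> {1..s} {1..s}"
    and m: "\<And>q k x. q \<in> W \<Longrightarrow> k \<in> {1..s} \<Longrightarrow> PJ (\<tau> k) (F q) (A x q) = A (PJ k (fst q) x) q"
    and pr: "\<And>q k l. q \<in> W \<Longrightarrow> k \<in> {1..s} \<Longrightarrow> l \<in> {1..s} \<Longrightarrow> k \<noteq> l \<Longrightarrow>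
       lam q * cf (\<tau> k) (F q) + lam q * cf (\<tau> l) (F q) = cf k (fst q) + cf l (fst q)"
    by (rule global_matching) blast
  have tin: "\<tau> k \<in> {1..s}" if "k \<in> {1..s}" for k using bij_betwE[OF bij] that by blast
  have tinj: "\<tau> k \<noteq> \<tau> l" if "k \<in> {1..s}" "l \<in> {1..s}" "k \<noteq> l" for k l
    using inj_onD[OF bij_betw_imp_inj_on[OF bij]] that by metis
  have eqs: "lam q * cf (\<tau> k) (F q) = cf k (fst q)" if q: "q \<in> W" and k: "k \<in> {1..s}" for q k
  proof -
    \<comment> \<open>Single weights are recovered from sums of pairs if three indices exist. For s
      = 2 the weight at s is 0, so the one available sum decides unless the matching is the
      swap.\<close>
    consider "s = 1" | "s = 2" "\<tau> s = s" | "s = 2" "\<tau> s \<noteq> s" | "s \<ge> 3" using s_pos by linarith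
    then show ?thesis
    proof cases
      case 1
      then have "k = s" "\<tau> k = s" using k tin[OF k] by auto
      then show ?thesis by simp
    next
      case 2
      have in12: "1 \<in> {1..s}" "s \<in> {1..s}" "1 \<noteq> s" using 2 by auto
      have "k = s \<or> k = 1" using k 2 by auto
      moreover have "lam q * cf (\<tau> 1) (F q) + lam q * cf (\<tau> s) (F q) = cf 1 (fst q) + cf s (fst q)"
        by (rule pr[OF q in12])
      ultimately show ?thesis using 2(2) by auto
    next
      case 3
      have in12: "1 \<in> {1..s}" "2 \<in> {1..s}" "(1::nat) \<noteq> 2" using 3 by auto
      have t2: "\<tau> 2 = 1" using tin[OF in12(2)] 3 by auto
      have t1: "\<tau> 1 = 2" using tin[OF in12(1)] tinj[OF in12] t2 3(1) by auto
      have "lam q * cf 1 (F q) = cf 1 (fst q)" if "q \<in> W" for q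
        using pr[OF that in12] cf_s 3(1) unfolding t1 t2 by auto
      then have False using no_swap[OF q0 3(1)] m[OF q0 in12(2)] unfolding t2 by blast
      then show ?thesis ..
    next
      case 4
      have "\<exists>a\<in>{1..s}. \<exists>b\<in>{1..s}. a \<noteq> b \<and> a \<noteq> k \<and> b \<noteq> k"
      proof -
        consider "k = 1" | "k = 2" | "k \<noteq> 1" "k \<noteq> 2" by blast
        then show ?thesis
        proof cases
          case 1 then show ?thesis using 4 by (intro bexI[of _ 2] bexI[of _ 3]) auto
        next
          case 2 then show ?thesis using 4 by (intro bexI[of _ 1] bexI[of _ 3]) auto
        next
          case 3 then show ?thesis using 4 by (intro bexI[of _ 1] bexI[of _ 2]) auto
        qed
      qed
      then obtain a b where ab: "a \<in> {1..s}" "b \<in> {1..s}" "a \<noteq> b" "k \<noteq> a" "k \<noteq> b" by metis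
      have "x = x'" if "x + y = x' + y'" "x + z = x' + z'" "y + z = y' + z'" for x y z x' y' z' :: complex
      proof -
        have "2 * x = (x + y) + (x + z) - (y + z)" by simp
        also have "\<dots> = 2 * x'" unfolding that by simp
        finally show ?thesis by simp
      qed
      from this[OF pr[OF q k ab(1,4)] pr[OF q k ab(2,5)] pr[OF q ab(1,2,3)]] show ?thesis .
    qed
  qed
  have ss: "s \<in> {1..s}" using s_pos by simp
  have ts: "\<tau> s = s"
  proof (rule ccontr)
    assume "\<tau> s \<noteq> s"
    then have "\<tau> s \<in> {1..<s}" using tin[OF ss] by auto
    then have "cf (\<tau> s) (F q0) \<noteq> 0" using cf_pos(2)[OF nondeg_F[OF q0]] by fastforce
    then show False using eqs[OF q0 ss] q0 by simp
  qed
  have sub: "k \<in> {1..s}" if "k \<in> {1..<s}" for k using that by auto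
  have tin': "\<tau> k \<in> {1..<s}" if "k \<in> {1..<s}" for k
    using tin[OF sub[OF that]] tinj[OF sub[OF that] ss] that ts by auto
  have bij': "bij_betw \<tau> {1..<s} {1..<s}"
  proof -
    have "inj_on \<tau> {1..<s}" by (rule inj_on_subset[OF bij_betw_imp_inj_on[OF bij]]) auto
    moreover have "\<tau> ` {1..<s} = {1..<s}" using endo_inj_surj[of "{1..<s}" \<tau>] tin' calculation by blast
    ultimately show ?thesis by (simp add: bij_betw_def)
  qed
  have RR: "RR (F q) (A x q) (A x q) = lam q * RR (fst q) x x" if q: "q \<in> W" for q x
  proof -
    have "RR (F q) (A x q) (A x q) = (\<Sum>k\<in>{1..s}. 2 * cf (\<tau> k) (F q) * (h (F q) (PJ (\<tau> k) (F q) (A x q)) (A x q))\<^sup>2)"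
      unfolding RR_full by (rule sum.reindex_bij_betw[OF bij, symmetric])
    also have "\<dots> = (\<Sum>k\<in>{1..s}. lam q * (2 * cf k (fst q) * (h (fst q) (PJ k (fst q) x) x)\<^sup>2))"
    proof (intro sum.cong refl)
      fix k assume k: "k \<in> {1..s}"
      show "2 * cf (\<tau> k) (F q) * (h (F q) (PJ (\<tau> k) (F q) (A x q)) (A x q))\<^sup>2
         = lam q * (2 * cf k (fst q) * (h (fst q) (PJ k (fst q) x) x)\<^sup>2)"
        unfolding m[OF q k] levi[OF q] eqs[OF q k, symmetric] by (simp add: power2_eq_square)
    qed
    finally show ?thesis unfolding RR_full sum_distrib_left .
  qed
  have mm: "m (\<tau> k) = m k" if k: "k \<in> {1..<s}" for k
    by (rule exponents_agree[OF q0 tin'[OF k] k eqs[OF _ sub[OF k]] m[OF q0 sub[OF k]] RR[OF q0]])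
  have pw: "ipb (\<tau> k) (F q) (F q) ^ m k = lam q * ipb k (fst q) (fst q) ^ m k" if q: "q \<in> W" and k: "k \<in> {1..<s}" for q k
  proof -
    have "(of_nat (m k) - 1 :: complex) \<noteq> 0" "(of_nat (m k) :: complex) \<noteq> 0"
      using m_ge[OF k] by (auto simp: of_nat_eq_1_iff)
    then show ?thesis using kappa[OF q tin'[OF k] k eqs[OF q sub[OF k]]] unfolding mm[OF k] by simp
  qed
  show ?thesis by (rule that[OF bij' ts mm m pw RR])
qed

text \<open>The factor that will relate \<open>Zb y (mu x)\<close> to the Levi form. Its imaginary
  part comes from the commutator of \<open>Z\<close> and \<open>Zb\<close>, its real part from the
  diagonal of the curvature relation.\<close>

definition rho :: "(complex^'n) \<times> real \<Rightarrow> complex"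
  where "rho q = \<i> * T lam q / lam q - 2 * nTF q / lam q"

lemma Zb_mu_rho:
  assumes q: "q \<in> W"
  shows "Zb y (mu x) q = rho q * h (fst q) x y"
proof -
  let ?z = "fst q"
  define N where "N x y = Zb y (mu x) q" for x y
  have herm: "N x y - cnj (N y x) = 2 * \<i> * h ?z x y * T lam q / lam q" for x y
  proof -
    have "lam q * (N x y - cnj (N y x)) = Zb y (Z x lam) q - Z x (Zb y lam) q"
      unfolding N_def Zb_mu[OF q] Z_Zb_lam_cnj[OF q] using q by (simp add: Zb_lam field_simps)
    also have "\<dots> = lam q * (2 * \<i> * h ?z x y * T lam q / lam q)" using Zb_Z[OF q sm_lam, of y x] q by simp
    finally show ?thesis using q by (simp only: mult_left_cancel[OF lam_nonzero])
  qed
  have diag: "N x x = rho q * h ?z x x" for x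
  proof (cases "x = 0")
    case True
    have "N 0 0 = 0"
      unfolding N_def using Zb_scale[OF q sm_mu, of 0 0 0] by simp
    then show ?thesis using True by simp
  next
    case False
    have h0: "h ?z x x \<noteq> 0" using h_self_nonzero[OF nondeg_z[OF q] False] .
    obtain \<tau> where "\<And>q x. q \<in> W \<Longrightarrow> RR (F q) (A x q) (A x q) = lam q * RR (fst q) x x"
      using matched_blocks by metis
    then have "2 * lam q * (N x x + cnj (N x x)) + 8 * h ?z x x * nTF q = 0"
      using curvature_diag[OF q, of x] h0 q unfolding N_def by simp
    then have "N x x + cnj (N x x) = - 4 * h ?z x x * nTF q / lam q"
      using q by (simp add: field_simps) algebra
    moreover have "2 * N x x = (N x x + cnj (N x x)) + (N x x - cnj (N x x))" by simp
    ultimately have "2 * N x x = - 4 * h ?z x x * nTF q / lam q + 2 * \<i> * h ?z x x * T lam q / lam q"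
      using herm by presburger
    also have "\<dots> = 2 * (rho q * h ?z x x)" using q by (simp add: rho_def field_simps)
    finally show ?thesis by simp
  qed
  have mu_add: "mu (x + y) p = mu x p + mu y p" and mu_scale: "mu (a *s x) p = a * mu x p" if "p \<in> W" for x y a p
    using that by (simp_all add: mu_def Z_add Z_scale add_divide_distrib)
  have N_add: "N (x + x') y = N x y + N x' y" for x x' y
  proof -
    have "N (x + x') y = Zb y (\<lambda>q. mu x q + mu x' q) q"
      unfolding N_def by (rule d_cong[OF derpair_Zb q]) (simp_all add: mu_add)
    then show ?thesis by (simp add: N_def d_add[OF derpair_Zb q])
  qed
  have N_scale: "N (a *s x) y = a * N x y" for a x y
  proof -
    have "N (a *s x) y = Zb y (\<lambda>q. a * mu x q) q"
      unfolding N_def by (rule d_cong[OF derpair_Zb q]) (simp_all add: mu_scale)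
    then show ?thesis by (simp add: N_def d_cmult[OF derpair_Zb q])
  qed
  have N_add': "N x (y + y') = N x y + N x y'" and N_scale': "N x (a *s y) = cnj a * N x y" for x y y' a
    by (simp_all add: N_def Zb_add[OF q] Zb_scale[OF q])
  \<comment> \<open>A sesquilinear form that vanishes on the diagonal is zero: polarize with x + y
    and again with y replaced by \<open>\<i> *s y\<close>.\<close>
  define D where "D x y = N x y - rho q * h ?z x y" for x y
  have D0: "D x x = 0" for x by (simp add: D_def diag)
  have D_add: "D (x + x') y = D x y + D x' y" "D x (y + y') = D x y + D x y'"
    and D_scale: "D (a *s x) y = a * D x y" "D x (a *s y) = cnj a * D x y" for x x' y y' a
    by (simp_all add: D_def N_add N_add' N_scale N_scale' h_add_left h_add_right h_scale_left h_scale_right algebra_simps)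
  have e1: "D x y + D y x = 0" for x y using D0[of "x + y"] D0[of x] D0[of y] by (simp add: D_add add.commute)
  have "D x (\<i> *s y) + D (\<i> *s y) x = 0" by (rule e1)
  then have "D y x = D x y" by (simp add: D_scale)
  then have "D x y = 0" using e1[of x y] by simp
  then show ?thesis by (simp add: D_def N_def)
qed

end

section \<open>The conformal factor\<close>

context cr_map
begin

lemma sm_nTF [simp]: "sm W nTF"
  unfolding nTF_def[abs_def] by simp

lemma sm_rho [simp]: "sm W rho"
  unfolding rho_def[abs_def] by (intro sm_diff sm_divide sm_mult) auto

text \<open>\<open>Zb x\<close> and \<open>Zb y\<close> commute on mu y. For y orthogonal to x the
  two Cb terms agree by symmetry, and only the term with \<open>Zb x rho\<close> and the factor h y
  y is left.\<close>

lemma Zb_rho: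
  assumes q: "q \<in> W"
  shows "Zb x rho q = 0"
proof -
  obtain y where y: "y \<noteq> 0" "h (fst q) x y = 0" "h (fst q) y x = 0" using ex_orthogonal by blast
  have e: "Zb w (Zb v (mu y)) q = Zb w rho q * h (fst q) y v + rho q * Cb (fst q) y v w" for w v
  proof -
    have "Zb w (Zb v (mu y)) q = Zb w (\<lambda>q. rho q * h (fst q) y v) q"
      by (rule d_cong[OF derpair_Zb q]) (simp_all add: Zb_mu_rho)
    then show ?thesis by (simp add: d_mult[OF derpair_Zb q] Zb_h_z[OF q])
  qed
  have "Zb x rho q * h (fst q) y y = 0"
    using e[of x y] e[of y x] Zb_Zb[OF q sm_mu, of x y] y Cb_sym[of "fst q" y x y] by simp
  then show ?thesis using h_self_nonzero[OF nondeg_z[OF q] y(1)] by simp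
qed

lemma rho_real_part: "q \<in> W \<Longrightarrow> rho q + cnj (rho q) = - 4 * nTF q / lam q"
  and rho_imag_part: "q \<in> W \<Longrightarrow> rho q - cnj (rho q) = 2 * \<i> * T lam q / lam q"
  by (simp_all add: rho_def nTF_real T_lam_cnj)

lemma Z_lam: "q \<in> W \<Longrightarrow> Z x lam q = lam q * mu x q"
  by (simp add: mu_def)

lemma Z_nTF:
  assumes q: "q \<in> W"
  shows "Z x nTF q = mu x q * (cnj (rho q) * lam q / 4 + 2 * nTF q)"
proof -
  \<comment> \<open>y represents TF in the source, so \<open>tau\<close> and \<open>levi\<close>
    express the Levi products with TF through derivatives of lam.\<close>
  obtain y where y: "A y q = TF q" using A_surj[OF q] .
  have 1: "Z x nTF q = - Z x (Zb y lam) q / (2 * \<i>) + 2 * \<i> * h (fst q) x y * nTF q"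
  proof -
    have "Z x nTF q = h (F q) (vd (Z x) TF q) (TF q) + C (F q) (A x q) (TF q) (TF q)"
      unfolding nTF_def[abs_def] by (simp add: d_h[OF derpair_Z q] CR_F[OF q] Zb_TF[OF q] del: vd_nth)
    then show ?thesis using Z_TF_A[OF q, of x y] unfolding y C_sym[of "F q" "TF q"] by simp
  qed
  have 2: "Z y lam q = 2 * \<i> * nTF q" using tau(1)[OF q, of y] unfolding y nTF_def .
  have 3: "lam q * h (fst q) x y = Z x lam q / (2 * \<i>)"
    using levi[OF q, of x y] tau(1)[OF q, of x] unfolding y by simp
  have "Zb x (Z y lam) q = lam q * (rho q * h (fst q) y x) + Z y lam q * Zb x lam q / lam q"
    using Zb_mu[OF q, of x y] Zb_mu_rho[OF q, of x y] q by (simp add: field_simps)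
  then have "Z x (Zb y lam) q = cnj (rho q) * (lam q * h (fst q) x y) - 2 * \<i> * nTF q * Z x lam q / lam q"
    unfolding Z_Zb_lam_cnj[OF q] using q by (simp add: 2 Zb_lam h_cnj nTF_real mult_ac)
  then have 4: "Z x (Zb y lam) q = cnj (rho q) * (lam q * mu x q / (2 * \<i>)) - 2 * \<i> * nTF q * mu x q"
    unfolding 3 Z_lam[OF q] using q by simp
  have "lam q * h (fst q) x y = lam q * (mu x q / (2 * \<i>))" unfolding 3 Z_lam[OF q] by simp
  from mult_left_cancel[OF lam_nonzero[OF q], THEN iffD1, OF this] have 5: "h (fst q) x y = mu x q / (2 * \<i>)" .
  have i: "x / (2 * \<i>) = - \<i> * x / 2" for x by (simp add: field_simps)
  show ?thesis unfolding 1 4 5 i by (simp add: field_simps)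
qed

lemma Z_rho:
  assumes q: "q \<in> W"
  shows "Z x rho q = rho q * mu x q"
proof -
  have "Z x (\<lambda>q. rho q + cnj (rho q)) q = Z x (\<lambda>q. - 4 * nTF q / lam q) q"
    by (rule d_cong[OF derpair_Z q]) (simp_all add: rho_real_part)
  moreover have "Z x (\<lambda>q. rho q + cnj (rho q)) q = Z x rho q"
    by (simp add: d_add[OF derpair_Z q] d_cnj[OF derpair_Z q] Zb_rho[OF q])
  moreover have "Z x (\<lambda>q. - 4 * nTF q / lam q) q = (- 4 * Z x nTF q * lam q - (- 4 * nTF q) * Z x lam q) / (lam q)\<^sup>2"
    by (subst d_divide[OF derpair_Z q]) (simp_all add: d_cmult[OF derpair_Z q] d_uminus[OF derpair_Z q])
  moreover have "\<dots> = mu x q * (- cnj (rho q) - 4 * nTF q / lam q)"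
    unfolding Z_nTF[OF q] Z_lam[OF q] using q by (simp add: field_simps power2_eq_square)
  moreover have "- cnj (rho q) - 4 * nTF q / lam q = - cnj (rho q) + (rho q + cnj (rho q))"
    unfolding rho_real_part[OF q] by simp
  ultimately show ?thesis by (simp add: mult.commute)
qed

lemma ex_h_nonzero: "q \<in> W \<Longrightarrow> \<exists>x. h (fst q) x x \<noteq> 0"
  using h_self_nonzero[OF nondeg_z] by (metis axis_eq_0_iff zero_neq_one)

text \<open>The commutator relation for the CR function rho. It is a Riccati equation: where rho is
  nonzero, -2 i / rho has derivative 1 along \<open>T\<close>.\<close>

lemma T_rho:
  assumes q: "q \<in> W"
  shows "2 * \<i> * T rho q = rho q * rho q"
proof -
  obtain x where x: "h (fst q) x x \<noteq> 0" using ex_h_nonzero[OF q] by blast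
  have "2 * \<i> * h (fst q) x x * T rho q = Zb x (Z x rho) q"
    using CR_comm(1)[OF q sm_rho Zb_rho] by simp
  also have "\<dots> = Zb x (\<lambda>q. rho q * mu x q) q"
    by (rule d_cong[OF derpair_Zb q]) (simp_all add: Z_rho)
  also have "\<dots> = rho q * (rho q * h (fst q) x x)"
    by (simp add: d_mult[OF derpair_Zb q] Zb_rho[OF q] Zb_mu_rho[OF q])
  finally have "h (fst q) x x * (2 * \<i> * T rho q) = h (fst q) x x * (rho q * rho q)" by (simp add: mult_ac)
  from mult_left_cancel[OF x, THEN iffD1, OF this] show ?thesis .
qed

text \<open>Each field multiplies \<open>rho * cnj rho\<close> and lam by the same factor: mu x for
  \<open>Z x\<close>, its conjugate for \<open>Zb x\<close>, and (rho - cnj rho) / (2 i) for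
  \<open>T\<close>.\<close>

lemma rho_norm_const:
  assumes "q \<in> W" "q' \<in> W"
  shows "rho q * cnj (rho q) / lam q = rho q' * cnj (rho q') / lam q'"
proof (rule zero_derivs_const[OF conn_W _ _ _ _ assms])
  show "sm W (\<lambda>q. rho q * cnj (rho q) / lam q)" by (intro sm_divide) auto
  fix q assume q: "q \<in> W"
  show "Z x (\<lambda>q. rho q * cnj (rho q) / lam q) q = 0" for x
    using q by (subst d_divide[OF derpair_Z q])
      (simp_all add: d_mult[OF derpair_Z q] d_cnj[OF derpair_Z q] Zb_rho Z_rho Z_lam)
  show "Zb x (\<lambda>q. rho q * cnj (rho q) / lam q) q = 0" for x
    using q by (subst d_divide[OF derpair_Zb q])
      (simp_all add: d_mult[OF derpair_Zb q] d_cnj[OF derpair_Zb q] Zb_rho Z_rho Z_lam Zb_lam)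
  have 1: "T rho q = rho q * rho q / (2 * \<i>)" unfolding T_rho[OF q, symmetric] by simp
  have 2: "T lam q = lam q * (rho q - cnj (rho q)) / (2 * \<i>)" using rho_imag_part[OF q] q by (simp add: field_simps)
  have "cnj (T rho q) = - (cnj (rho q) * cnj (rho q)) / (2 * \<i>)" unfolding 1 by (simp add: field_simps)
  then show "T (\<lambda>q. rho q * cnj (rho q) / lam q) q = 0"
    using q by (subst d_divide[OF derpair_ddir q])
      (simp_all add: d_mult[OF derpair_ddir q] d_cnj[OF derpair_ddir q] 1 2 field_simps)
qed

lemma nTF_pos: "q \<in> W \<Longrightarrow> TF q \<noteq> 0 \<Longrightarrow> 0 < Re (nTF q)"
  unfolding nTF_def using h_pos[OF nondeg_F] by blast

text \<open>om is the future denominator of the map. The value \<epsilon> = 1 stands for the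
  inversion and \<epsilon> = 0 with om = 1 for the affine case, so that most computations serve
  both.\<close>

definition gauge :: "((complex^'n) \<times> real \<Rightarrow> complex) \<Rightarrow> complex \<Rightarrow> real \<Rightarrow> bool"
  where "gauge om \<epsilon> r \<longleftrightarrow> sm W om \<and> 0 < r \<and> (\<epsilon> = 1 \<or> (\<epsilon> = 0 \<and> om = (\<lambda>_. 1))) \<and>
    (\<forall>q\<in>W. om q \<noteq> 0 \<and> T om q = \<epsilon> \<and> lam q * (om q * cnj (om q)) = of_real (r\<^sup>2) \<and>
      rho q = - 2 * \<i> * \<epsilon> / om q \<and> (\<forall>x. Zb x om q = 0 \<and> Z x om q = - om q * mu x q))"

text \<open>\<open>|rho|\<^sup>2 / lam\<close> is constant, so \<open>rho\<close> vanishes nowhere (and \<open>om = -2 i / rho\<close> is an affine CR function)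
  or everywhere (and \<open>lam\<close> is constant).\<close>

lemma ex_gauge: "\<exists>om \<epsilon> r. gauge om \<epsilon> r"
proof (cases "W = {}")
  case True
  then show ?thesis
    unfolding gauge_def by (intro exI[of _ "\<lambda>_. 1"] exI[of _ 1] exI[of _ "1::real"]) (use True sm_const[of 1] in auto)
next
  case False
  then obtain q0 where q0: "q0 \<in> W" by blast
  define K where "K = rho q0 * cnj (rho q0) / lam q0"
  have K: "rho q * cnj (rho q) = K * lam q" if "q \<in> W" for q
    using rho_norm_const[OF that q0] that by (simp add: K_def[symmetric] field_simps)
  have K_def': "K = of_real ((cmod (rho q0))\<^sup>2 / Re (lam q0))"
    unfolding K_def using lam_real[OF q0] by (metis complex_norm_square of_real_divide)
  show ?thesis
  proof (cases "K = 0")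
    case True
    have r0: "rho q = 0" if "q \<in> W" for q using K[OF that] True by simp
    \<comment> \<open>The real part of rho is a multiple of the Levi norm of TF, so rho = 0 forces
      TF = 0, and by \<open>tau\<close> the derivatives of lam vanish too.\<close>
    have TF0: "TF q = 0" if "q \<in> W" for q
    proof (rule ccontr)
      assume "TF q \<noteq> 0"
      then have "0 < Re (nTF q)" using nTF_pos that by blast
      moreover have "nTF q = 0" using rho_real_part[OF that] r0[OF that] that by simp
      ultimately show False by simp
    qed
    have Tl: "T lam q = 0" if "q \<in> W" for q using rho_imag_part[OF that] r0[OF that] that by simp
    have Zl: "Z x lam q = 0" if "q \<in> W" for q x using tau(1)[OF that] TF0[OF that] by simp
    have lc: "lam q = lam q0" if "q \<in> W" for q
      by (rule zero_derivs_const[OF conn_W sm_lam _ _ _ that q0]) (simp_all add: Zl Tl Zb_lam)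
    have "gauge (\<lambda>_. 1) 0 (sqrt (Re (lam q0)))"
      unfolding gauge_def using lam_pos[OF q0] lam_real[OF q0]
      by (auto simp: d_const[OF derpair_Z] d_const[OF derpair_Zb] d_const[OF derpair_ddir] r0 mu_def Zl lc)
    then show ?thesis by blast
  next
    case False
    have rn: "rho q \<noteq> 0" if "q \<in> W" for q using K[OF that] False that by auto
    define om where "om q = (- 2 * \<i>) / rho q" for q
    \<comment> \<open>This is 4 / K, the constant value of lam |om|^2.\<close>
    define R where "R = 4 * Re (lam q0) / (cmod (rho q0))\<^sup>2"
    have R: "0 < R" using lam_pos[OF q0] rn[OF q0] by (simp add: R_def)
    have so: "sm W om" unfolding om_def[abs_def] using rn by (intro sm_divide) auto
    have d: "\<delta> om q = 2 * \<i> * \<delta> rho q / (rho q)\<^sup>2" if "derpair \<delta> \<delta>'" "q \<in> W" for \<delta> \<delta>' q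
      unfolding om_def[abs_def] using rn that by (subst d_divide[OF that]) (auto simp: d_const[OF that])
    have "gauge om 1 (sqrt R)"
      unfolding gauge_def
    proof (intro conjI ballI allI)
      fix q assume q: "q \<in> W"
      show "om q \<noteq> 0" using rn[OF q] by (simp add: om_def)
      show "T om q = 1" unfolding d[OF derpair_ddir q] T_rho[OF q] using rn[OF q] by (simp add: power2_eq_square)
      show "rho q = - 2 * \<i> * 1 / om q" using rn[OF q] by (simp add: om_def)
      show "Zb x om q = 0" for x unfolding d[OF derpair_Zb q] Zb_rho[OF q] by simp
      show "Z x om q = - om q * mu x q" for x
        unfolding d[OF derpair_Z q] Z_rho[OF q] om_def using rn[OF q] by (simp add: power2_eq_square)
      have "om q * cnj (om q) = 4 / (rho q * cnj (rho q))" by (simp add: om_def)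
      then have "lam q * (om q * cnj (om q)) = 4 / K" unfolding K[OF q] using q False by simp
      also have "\<dots> = of_real R" unfolding K_def' R_def by simp
      finally show "lam q * (om q * cnj (om q)) = of_real ((sqrt R)\<^sup>2)" using R by simp
    qed (use so R in auto)
    then show ?thesis by blast
  qed
qed

end

section \<open>Affine CR functions\<close>

lemma ip_axis: "ip bl j (axis \<alpha> 1) V = (if bl \<alpha> = j then cnj (V $ \<alpha>) else 0)"
  and ip_axis': "ip bl j V (axis \<alpha> 1) = (if bl \<alpha> = j then V $ \<alpha> else 0)"
proof -
  have "ip bl j (axis \<alpha> 1) V = (\<Sum>\<mu> | bl \<mu> = j. if \<mu> = \<alpha> then cnj (V $ \<mu>) else 0)"
    "ip bl j V (axis \<alpha> 1) = (\<Sum>\<mu> | bl \<mu> = j. if \<mu> = \<alpha> then V $ \<mu> else 0)"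
    unfolding ip_def by (rule sum.cong[OF refl], simp add: axis_def)+
  then show "ip bl j (axis \<alpha> 1) V = (if bl \<alpha> = j then cnj (V $ \<alpha>) else 0)"
    "ip bl j V (axis \<alpha> 1) = (if bl \<alpha> = j then V $ \<alpha> else 0)"
    by (simp_all add: sum.delta)
qed

locale cr_gauged = cr_map bl s m W F G
  for bl :: "'n::finite \<Rightarrow> nat" and s m and W :: "((complex^'n) \<times> real) set" and F G +
  fixes \<tau> :: "nat \<Rightarrow> nat" and om :: "(complex^'n) \<times> real \<Rightarrow> complex" and \<epsilon> :: complex and r :: real
  assumes bij_\<tau>: "bij_betw \<tau> {1..<s} {1..<s}" and \<tau>_s: "\<tau> s = s"
    and m_\<tau>: "\<And>k. k \<in> {1..<s} \<Longrightarrow> m (\<tau> k) = m k"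
    and match: "\<And>q k x. q \<in> W \<Longrightarrow> k \<in> {1..s} \<Longrightarrow> PJ (\<tau> k) (F q) (A x q) = A (PJ k (fst q) x) q"
    and norm_F: "\<And>q k. q \<in> W \<Longrightarrow> k \<in> {1..<s} \<Longrightarrow>
       ipb (\<tau> k) (F q) (F q) ^ m k = lam q * ipb k (fst q) (fst q) ^ m k"
    and gau: "gauge om \<epsilon> r"
begin

abbreviation e :: "'n \<Rightarrow> complex^'n" where "e \<alpha> \<equiv> axis \<alpha> 1"

lemma om: "sm W om" "0 < r" "\<epsilon> = 1 \<or> (\<epsilon> = 0 \<and> om = (\<lambda>_. 1))"
  and om': "q \<in> W \<Longrightarrow> om q \<noteq> 0" "q \<in> W \<Longrightarrow> T om q = \<epsilon>"
     "q \<in> W \<Longrightarrow> lam q * (om q * cnj (om q)) = of_real (r\<^sup>2)" "q \<in> W \<Longrightarrow> rho q = - 2 * \<i> * \<epsilon> / om q"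
     "q \<in> W \<Longrightarrow> Zb x om q = 0" "q \<in> W \<Longrightarrow> Z x om q = - om q * mu x q"
  using gau unfolding gauge_def by auto

lemmas [simp] = om(1)

lemma \<tau>_in: "k \<in> {1..<s} \<Longrightarrow> \<tau> k \<in> {1..<s}"
  using bij_\<tau> bij_betwE by blast

lemma sum_axis: "x = (\<Sum>\<alpha>\<in>UNIV. x $ \<alpha> *s e \<alpha>)"
  by (simp add: vec_eq_iff axis_def if_distrib cong: if_cong)

lemma Z_zero: "q \<in> W \<Longrightarrow> sm W f \<Longrightarrow> Z 0 f q = 0"
  using Z_scale[of q f 0 0] by simp

lemma Z_sum: "q \<in> W \<Longrightarrow> sm W f \<Longrightarrow> Z (\<Sum>i\<in>I. x i) f q = (\<Sum>i\<in>I. Z (x i) f q)"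
  by (induction I rule: infinite_finite_induct) (auto simp: Z_zero Z_add)

lemma Z_expand: "q \<in> W \<Longrightarrow> sm W f \<Longrightarrow> Z x f q = (\<Sum>\<alpha>\<in>UNIV. x $ \<alpha> * Z (e \<alpha>) f q)"
  by (subst sum_axis[of x]) (simp add: Z_sum Z_scale)

lemma h_expand: "h P x y = (\<Sum>\<alpha>\<in>UNIV. x $ \<alpha> * h P (e \<alpha>) y)"
  by (subst sum_axis[of x]) (simp add: h_sum_left h_scale_left)

lemma mu_expand: "q \<in> W \<Longrightarrow> mu x q = (\<Sum>\<alpha>\<in>UNIV. x $ \<alpha> * mu (e \<alpha>) q)"
  unfolding mu_def by (subst Z_expand) (simp_all add: sum_divide_distrib)

lemma sm_coord [simp]: "sm W (\<lambda>q. fst q $ \<mu>)"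
  using smv_fst unfolding smv_def by blast

lemma Z_coord: "q \<in> W \<Longrightarrow> Z x (\<lambda>q. fst q $ \<mu>) q = x $ \<mu>"
  and Zb_coord: "q \<in> W \<Longrightarrow> Zb x (\<lambda>q. fst q $ \<mu>) q = 0"
  and T_coord: "q \<in> W \<Longrightarrow> T (\<lambda>q. fst q $ \<mu>) q = 0"
  using Z_fst[of q x] Zb_fst[of q x] T_fst[of q] by (metis vd_nth zero_index)+

lemma mu_blocks:
  assumes "q \<in> W" "k \<in> {1..<s}"
  shows "mu x q = of_nat (m k) * (ipb (\<tau> k) (A x q) (F q) / ipb (\<tau> k) (F q) (F q) - ipb k x (fst q) / ipb k (fst q) (fst q))"
proof -
  have "ipb (\<tau> k) (F q) (F q) ^ m (\<tau> k) = 1 * (lam q * ipb k (fst q) (fst q) ^ m k)" if "q \<in> W" for q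
    using norm_F[OF that assms(2)] m_\<tau>[OF assms(2)] by simp
  from log_derivative[OF \<tau>_in[OF assms(2)] assms(2) this assms(1)] show ?thesis
    unfolding m_\<tau>[OF assms(2)] by (simp add: algebra_simps)
qed

text \<open>The vectors in question lie in one curved block and are orthogonal to z. By
  \<open>match\<close> their images lie in block \<tau> k and are orthogonal to F, so all Euler
  pairings in the derivatives of G and lam vanish.\<close>

lemma horizontal:
  assumes q: "q \<in> W" and k: "k \<in> {1..<s}" and x: "PJ k (fst q) x = x"
  shows "bl \<mu> \<noteq> \<tau> k \<Longrightarrow> A x q $ \<mu> = 0" "Z x G q = 0" "mu x q = 0"
proof -
  have ks: "k < s" "k \<in> {1..s}" "\<tau> k < s" using k \<tau>_in[OF k] by auto
  have Ax: "A x q = PJ (\<tau> k) (F q) (A x q)" using match[OF q ks(2), of x] x by simp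
  show "A x q $ \<mu> = 0" if "bl \<mu> \<noteq> \<tau> k"
    by (subst Ax) (use that ks in \<open>simp add: PJ_def del: vd_nth\<close>)
  have t: "ipb (\<tau> k) (F q) (F q) \<noteq> 0" "ipb k (fst q) (fst q) \<noteq> 0" using q k \<tau>_in[OF k] by auto
  have i0: "ipb j (A x q) (F q) = 0" for j
    by (subst Ax) (use t in \<open>simp add: ip_PJ[OF ks(3)] del: vd_nth\<close>)
  have "ipb k x (fst q) = 0"
    by (subst x[symmetric]) (use t in \<open>simp add: ip_PJ[OF ks(1)]\<close>)
  then show "mu x q = 0" unfolding mu_blocks[OF q k] i0 by simp
  show "Z x G q = 0" unfolding Z_G[OF q] pd_def i0 by simp
qed

text \<open>\<open>PJ k\<close> kills z, so the derivative of F along z is radial in block \<tau> k,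
  with coefficient 1 + mu / m by \<open>mu_blocks\<close>. A further \<open>Zb\<close> derivative
  along z trades both sides for h z z times TF and rho.\<close>

lemma TF_block:
  assumes q: "q \<in> W" and k: "k \<in> {1..<s}" and \<mu>: "bl \<mu> = \<tau> k"
  shows "TF q $ \<mu> = rho q / (2 * \<i> * of_nat (m k)) * F q $ \<mu>"
proof -
  let ?f = "\<lambda>q. F q $ \<mu>"
  have ks: "k < s" "k \<in> {1..s}" "\<tau> k < s" using k \<tau>_in[OF k] by auto
  have m0: "(of_nat (m k) :: complex) \<noteq> 0" using m_ge[OF k] by simp
  \<comment> \<open>The vector z depends on q, while \<open>Z\<close> takes constant vectors; after
    expansion in axis vectors the relation can be differentiated.\<close>
  have *: "(\<Sum>\<alpha>\<in>UNIV. fst q $ \<alpha> * Z (e \<alpha>) ?f q) = F q $ \<mu> + (1 / of_nat (m k)) * ((\<Sum>\<alpha>\<in>UNIV. fst q $ \<alpha> * mu (e \<alpha>) q) * F q $ \<mu>)"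
    if q: "q \<in> W" for q
  proof -
    have t: "ipb k (fst q) (fst q) \<noteq> 0" using q k by auto
    have "PJ k (fst q) (fst q) = 0" using ks t by (simp add: PJ_def vec_eq_iff)
    then have "PJ (\<tau> k) (F q) (A (fst q) q) = 0" using match[OF q ks(2), of "fst q"] A_scale[OF q, of 0 0] by simp
    then have "PJ (\<tau> k) (F q) (A (fst q) q) $ \<mu> = 0" by simp
    then have a: "A (fst q) q $ \<mu> = ipb (\<tau> k) (A (fst q) q) (F q) / ipb (\<tau> k) (F q) (F q) * F q $ \<mu>"
      using ks \<mu> by (simp add: PJ_def)
    have "ipb (\<tau> k) (A (fst q) q) (F q) / ipb (\<tau> k) (F q) (F q) = 1 + mu (fst q) q / of_nat (m k)"
      using mu_blocks[OF q k, of "fst q"] t m0 by simp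
    then have "A (fst q) q $ \<mu> = F q $ \<mu> + (1 / of_nat (m k)) * (mu (fst q) q * F q $ \<mu>)"
      unfolding a by (simp add: algebra_simps)
    then show ?thesis using Z_expand[OF q sm_F_nth, of "fst q" \<mu>] mu_expand[OF q, of "fst q"] by simp
  qed
  have h0: "h (fst q) (fst q) (fst q) \<noteq> 0"
  proof -
    have "ipb k (fst q) (fst q) \<noteq> 0" using q k by auto
    then have "fst q \<noteq> 0" by (metis ip_zero_left)
    then show ?thesis using h_self_nonzero[OF nondeg_z[OF q]] by blast
  qed
  let ?y = "fst q"
  have "Zb ?y (\<lambda>q. \<Sum>\<alpha>\<in>UNIV. fst q $ \<alpha> * Z (e \<alpha>) ?f q) q
     = Zb ?y (\<lambda>q. F q $ \<mu> + (1 / of_nat (m k)) * ((\<Sum>\<alpha>\<in>UNIV. fst q $ \<alpha> * mu (e \<alpha>) q) * F q $ \<mu>)) q"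
    by (rule d_cong[OF derpair_Zb q]) (auto simp: *)
  moreover have "Zb ?y (\<lambda>q. \<Sum>\<alpha>\<in>UNIV. fst q $ \<alpha> * Z (e \<alpha>) ?f q) q = (\<Sum>\<alpha>\<in>UNIV. ?y $ \<alpha> * (2 * \<i> * h ?y (e \<alpha>) ?y * TF q $ \<mu>))"
    by (simp add: d_sum[OF derpair_Zb q] d_mult[OF derpair_Zb q] Zb_coord[OF q] CR_comm[OF q] CR_F_nth)
  moreover have "Zb ?y (\<lambda>q. F q $ \<mu> + (1 / of_nat (m k)) * ((\<Sum>\<alpha>\<in>UNIV. fst q $ \<alpha> * mu (e \<alpha>) q) * F q $ \<mu>)) q
     = (1 / of_nat (m k)) * ((\<Sum>\<alpha>\<in>UNIV. ?y $ \<alpha> * (rho q * h ?y (e \<alpha>) ?y)) * F q $ \<mu>)"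
    by (simp only: d_add[OF derpair_Zb q] d_cmult[OF derpair_Zb q] d_mult[OF derpair_Zb q] d_sum[OF derpair_Zb q]
       Zb_coord[OF q] CR_F_nth[OF q] Zb_mu_rho[OF q] sm_F_nth sm_mult sm_sum sm_coord sm_mu sm_const) simp
  moreover have "(\<Sum>\<alpha>\<in>UNIV. ?y $ \<alpha> * (2 * \<i> * h ?y (e \<alpha>) ?y * TF q $ \<mu>)) = h ?y ?y ?y * (2 * \<i> * TF q $ \<mu>)"
    unfolding h_expand[of ?y ?y ?y] sum_distrib_right by (intro sum.cong refl) (simp only: mult_ac)
  moreover have "(\<Sum>\<alpha>\<in>UNIV. ?y $ \<alpha> * (rho q * h ?y (e \<alpha>) ?y)) = h ?y ?y ?y * rho q"
    unfolding h_expand[of ?y ?y ?y] sum_distrib_right by (intro sum.cong refl) (simp only: mult_ac)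
  ultimately have "h ?y ?y ?y * (2 * \<i> * TF q $ \<mu>) = h ?y ?y ?y * (rho q / of_nat (m k) * F q $ \<mu>)"
    by (simp add: mult.assoc)
  from mult_left_cancel[OF h0, THEN iffD1, OF this] have a: "2 * \<i> * TF q $ \<mu> = rho q / of_nat (m k) * F q $ \<mu>" .
  have "TF q $ \<mu> = (2 * \<i> * TF q $ \<mu>) / (2 * \<i>)" by simp
  also have "\<dots> = rho q / (2 * \<i> * of_nat (m k)) * F q $ \<mu>"
    unfolding a by (simp only: divide_divide_eq_left times_divide_eq_left times_divide_eq_right mult_ac)
  finally show ?thesis .
qed

text \<open>Vanishing along the vectors of curved blocks orthogonal to z, written through pairs of
  coordinates so that the condition has smooth coefficients and can be differentiated.\<close>

definition hor :: "((complex^'n) \<times> real \<Rightarrow> complex) \<Rightarrow> bool"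
  where "hor f \<longleftrightarrow> (\<forall>q\<in>W. \<forall>\<alpha> \<beta>. bl \<alpha> = bl \<beta> \<and> bl \<alpha> \<noteq> s \<longrightarrow>
    cnj (fst q $ \<beta>) * Z (e \<alpha>) f q = cnj (fst q $ \<alpha>) * Z (e \<beta>) f q)"

lemma horI:
  assumes "sm W f" "\<And>q x k. q \<in> W \<Longrightarrow> k \<in> {1..<s} \<Longrightarrow> PJ k (fst q) x = x \<Longrightarrow> Z x f q = 0"
  shows "hor f"
  unfolding hor_def
proof (intro ballI allI impI)
  fix q \<alpha> \<beta> assume q: "q \<in> W" and b: "bl \<alpha> = bl \<beta> \<and> bl \<alpha> \<noteq> s"
  define k where "k = bl \<alpha>"
  have k: "k \<in> {1..<s}" "bl \<beta> = k" "k < s" using bl_in[of \<alpha>] b by (auto simp: k_def)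
  let ?x = "cnj (fst q $ \<beta>) *s e \<alpha> + (- cnj (fst q $ \<alpha>)) *s e \<beta>"
  have "ipb k ?x (fst q) = 0"
    by (simp only: ip_add_left ip_scale_left ip_axis k(2) k_def[symmetric]) simp
  moreover have "?x $ \<mu> = 0" if "bl \<mu> \<noteq> k" for \<mu> using that k by (auto simp: axis_def k_def)
  ultimately have "PJ k (fst q) ?x = ?x" using k by (auto simp: PJ_def vec_eq_iff)
  from assms(2)[OF q k(1) this]
  show "cnj (fst q $ \<beta>) * Z (e \<alpha>) f q = cnj (fst q $ \<alpha>) * Z (e \<beta>) f q"
    by (simp only: Z_add[OF q assms(1)] Z_scale[OF q assms(1)]) simp
qed

lemma hor_functions:
  "hor om" "bl i = s \<Longrightarrow> hor (\<lambda>q. om q * F q $ i)" "hor (\<lambda>q. om q * G q)"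
proof -
  have o: "Z x om q = 0" if "q \<in> W" "k \<in> {1..<s}" "PJ k (fst q) x = x" for q x k
    using om'(6)[OF that(1)] horizontal(3)[OF that] by simp
  show "hor om" using o by (intro horI) auto
  show "hor (\<lambda>q. om q * G q)"
    using o horizontal(2) by (intro horI) (auto simp: d_mult[OF derpair_Z])
  show "hor (\<lambda>q. om q * F q $ i)" if i: "bl i = s"
  proof (intro horI)
    fix q x k assume as: "q \<in> W" "k \<in> {1..<s}" "PJ k (fst q) x = x"
    have "\<tau> k \<noteq> s" using \<tau>_in[OF as(2)] by auto
    then have "Z x (\<lambda>q. F q $ i) q = 0" using horizontal(1)[OF as, of i] i by simp
    then show "Z x (\<lambda>q. om q * F q $ i) q = 0" using o[OF as] as by (simp add: d_mult[OF derpair_Z])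
  qed simp
qed

section \<open>Functions with vanishing covariant Hessian\<close>

definition wf :: "(complex^'n) \<times> real \<Rightarrow> complex" where "wf q = of_real (snd q) + \<i> * pp (fst q)"

lemma sm_snd [simp]: "sm W (\<lambda>q. complex_of_real (snd q))"
  by (rule sm_linear) (rule bounded_linear_compose[OF bounded_linear_of_real bounded_linear_snd])

lemma sm_wf [simp]: "sm W wf"
  unfolding wf_def[abs_def] by simp

lemma wf_derivs:
  assumes q: "q \<in> W"
  shows "Z x wf q = 2 * \<i> * pd (fst q) x" "Zb x wf q = 0" "T wf q = 1"
proof -
  have d: "ddir v (\<lambda>q. complex_of_real (snd q)) q = of_real (snd v)" for v
    by (rule ddir_eqI) (auto intro!: bounded_linear_imp_has_derivative bounded_linear_compose[OF bounded_linear_of_real bounded_linear_snd])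
  have "Z x (\<lambda>q. complex_of_real (snd q)) q = \<i> * pd (fst q) x" "Zb x (\<lambda>q. complex_of_real (snd q)) q = - \<i> * cnj (pd (fst q) x)"
    unfolding Z_def Zb_def d by simp_all
  then show "Z x wf q = 2 * \<i> * pd (fst q) x" "Zb x wf q = 0" "T wf q = 1"
    unfolding wf_def[abs_def] using q d[of "(0, 1)"]
    by (simp_all add: d_add[OF derpair_Z] d_add[OF derpair_Zb] d_add[OF derpair_ddir] d_cmult[OF derpair_Z] d_cmult[OF derpair_Zb] d_cmult[OF derpair_ddir]
      d_pp[OF derpair_Z] d_pp[OF derpair_Zb] d_pp[OF derpair_ddir] Z_fst Zb_fst T_fst)
qed

text \<open>The (2,0) Hessian with respect to \<open>Gam\<close> is zero. Multiplication by om
  reduces the projective equations of the flat components of F and of G to this condition.\<close>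

definition hess :: "((complex^'n) \<times> real \<Rightarrow> complex) \<Rightarrow> bool"
  where "hess f \<longleftrightarrow> (\<forall>q\<in>W. \<forall>x y. Z x (Z y f) q = Z (Gam (fst q) x y) f q)"

text \<open>By homogeneity of the summands the (2,0) Hessian of p itself vanishes for
  \<open>Gam\<close>; this is why \<open>wf\<close> counts as an affine function.\<close>

lemma pd_Gam:
  assumes "nondeg P" shows "pd P (Gam P X Y) = A2 P X Y"
  unfolding pd_def A2_def
proof (rule sum.cong[OF refl])
  fix j assume j: "j \<in> {1..s}"
  define t where "t = ipb j P P"
  define d :: complex where "d = of_nat (m j) - 1"
  let ?a = "ipb j X P" and ?b = "ipb j Y P"
  have z: "d * (?a * ?b + ?b * ?a - ?a * ?b / t * t) / t = d / t * (?a * ?b)"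
    using assms j by (cases rule: blk_cases) (auto simp: t_def d_def field_simps)
  have 1: "ipb j (Gam P X Y) P = d / t * (?a * ?b)"
    unfolding ip_Gam using z by (simp add: t_def[symmetric] d_def[symmetric] mult.commute)
  show "cc j 1 (ipb j P P) * ipb j (Gam P X Y) P = cc j 2 (ipb j P P) * ipb j X P * ipb j Y P"
    unfolding 1 cc_rel(1)[OF assms j, symmetric] t_def d_def by (simp only: mult.assoc)
qed

lemma hess_wf: "hess wf"
  unfolding hess_def
proof (intro ballI allI)
  fix q x y assume q: "q \<in> W"
  have "Z x (Z y wf) q = Z x (\<lambda>q. 2 * \<i> * pd (fst q) y) q"
    by (rule d_cong[OF derpair_Z q]) (simp_all add: wf_derivs)
  also have "\<dots> = 2 * \<i> * A2 (fst q) x y"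
    using q by (simp add: d_cmult[OF derpair_Z] sm_pd_fst Z_pd_fst)
  finally show "Z x (Z y wf) q = Z (Gam (fst q) x y) wf q"
    using q by (simp add: wf_derivs pd_Gam[OF nondeg_z])
qed

lemma hess_affine:
  assumes "\<And>q. q \<in> W \<Longrightarrow> f q = c0 + c1 * wf q + (\<Sum>\<alpha> | bl \<alpha> = s. c \<alpha> * fst q $ \<alpha>)" "sm W f"
  shows "hess f"
  unfolding hess_def
proof (intro ballI allI)
  fix q x y assume q: "q \<in> W"
  have 1: "Z y f q = c1 * Z y wf q + (\<Sum>\<alpha> | bl \<alpha> = s. c \<alpha> * y $ \<alpha>)" if q: "q \<in> W" for q y
  proof -
    have "Z y f q = Z y (\<lambda>q. c0 + c1 * wf q + (\<Sum>\<alpha> | bl \<alpha> = s. c \<alpha> * fst q $ \<alpha>)) q"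
      by (rule d_cong[OF derpair_Z q]) (use assms in auto)
    then show ?thesis
      using q by (simp add: d_add[OF derpair_Z] d_cmult[OF derpair_Z] d_sum[OF derpair_Z] d_const[OF derpair_Z] Z_coord)
  qed
  have "Z x (Z y f) q = Z x (\<lambda>q. c1 * Z y wf q + (\<Sum>\<alpha> | bl \<alpha> = s. c \<alpha> * y $ \<alpha>)) q"
    by (rule d_cong[OF derpair_Z q]) (use 1 assms(2) in auto)
  also have "\<dots> = c1 * Z (Gam (fst q) x y) wf q"
    using q hess_wf by (simp add: d_add[OF derpair_Z] d_cmult[OF derpair_Z] d_const[OF derpair_Z] hess_def)
  also have "\<dots> = Z (Gam (fst q) x y) f q"
    unfolding 1[OF q] by (simp add: Gam_def m_s)
  finally show "Z x (Z y f) q = Z (Gam (fst q) x y) f q" .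
qed

text \<open>Because \<open>Z x om\<close> is -om mu x, the cross terms of the product rule cancel
  the two mu terms of the projective equation.\<close>

lemma hess_mult:
  assumes "hess om" "sm W f"
    and "\<And>q x y. q \<in> W \<Longrightarrow> Z x (Z y f) q = Z (Gam (fst q) x y) f q + mu x q * Z y f q + mu y q * Z x f q"
  shows "hess (\<lambda>q. om q * f q)"
  unfolding hess_def
proof (intro ballI allI)
  fix q x y assume q: "q \<in> W"
  have 1: "Z y (\<lambda>q. om q * f q) q = Z y om q * f q + om q * Z y f q" if "q \<in> W" for q y
    using that assms(2) by (simp add: d_mult[OF derpair_Z])
  have "Z x (Z y (\<lambda>q. om q * f q)) q = Z x (\<lambda>q. Z y om q * f q + om q * Z y f q) q"
    by (rule d_cong[OF derpair_Z q]) (use 1 assms(2) in auto)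
  also have "\<dots> = Z x (Z y om) q * f q + Z y om q * Z x f q + Z x om q * Z y f q + om q * Z x (Z y f) q"
    using q assms(2) by (simp add: d_add[OF derpair_Z] d_mult[OF derpair_Z])
  also have "\<dots> = Z (Gam (fst q) x y) (\<lambda>q. om q * f q) q"
    unfolding 1[OF q] assms(3)[OF q] using assms(1) q unfolding hess_def by (simp add: om' algebra_simps)
  finally show "Z x (Z y (\<lambda>q. om q * f q)) q = Z (Gam (fst q) x y) (\<lambda>q. om q * f q) q" .
qed

lemma hess_F:
  assumes q: "q \<in> W" and i: "bl i = s"
  shows "Z x (Z y (\<lambda>q. F q $ i)) q = Z (Gam (fst q) x y) (\<lambda>q. F q $ i) q
     + mu x q * Z y (\<lambda>q. F q $ i) q + mu y q * Z x (\<lambda>q. F q $ i) q"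
proof -
  have "Gam (F q) (A x q) (A y q) $ i = 0" by (simp add: Gam_def i m_s)
  then show ?thesis using arg_cong[OF projective[OF q, of x y], of "\<lambda>v. v $ i"] by (simp add: mu_def)
qed

lemma hess_G:
  assumes q: "q \<in> W"
  shows "Z x (Z y G) q = Z (Gam (fst q) x y) G q + mu x q * Z y G q + mu y q * Z x G q"
proof -
  have "Z x (Z y G) q = Z x (\<lambda>q. 2 * \<i> * pd (F q) (A y q)) q"
    by (rule d_cong[OF derpair_Z q]) (simp_all add: Z_G)
  also have "\<dots> = 2 * \<i> * (pd (F q) (vd (Z x) (A y) q) + A2 (F q) (A x q) (A y q))"
    by (simp add: d_cmult[OF derpair_Z q] d_pd[OF derpair_Z q] CR_F[OF q] del: vd_nth)
  also have "\<dots> = 2 * \<i> * pd (F q) (vd (Z x) (A y) q + Gam (F q) (A x q) (A y q))"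
    unfolding pd_add pd_Gam[OF nondeg_F[OF q]] ..
  also have "\<dots> = Z (Gam (fst q) x y) G q + mu x q * Z y G q + mu y q * Z x G q"
    unfolding projective[OF q] Z_G[OF q] by (simp add: pd_add pd_scale mu_def algebra_simps)
  finally show ?thesis .
qed

lemma Z_mu_sym: "q \<in> W \<Longrightarrow> Z x (mu y) q = Z y (mu x) q"
  unfolding mu_def[abs_def] by (subst (1 2) d_divide[OF derpair_Z]) (simp_all add: Z_Z mult.commute)

text \<open>For \<open>s = 1\<close> this is the symmetry of the third derivatives of \<open>F\<close>; for \<open>s \<ge> 2\<close> the component of the
  projective equation in a curved block is an equation for \<open>mu\<close>, since \<open>F\<close> moves radially there.\<close>

lemma Z_mu_flat:
  assumes q: "q \<in> W" and \<alpha>: "bl \<alpha> = s" and \<beta>: "bl \<beta> = s"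
  shows "Z (e \<alpha>) (mu (e \<beta>)) q = mu (e \<alpha>) q * mu (e \<beta>) q"
proof (cases "s = 1")
  case True
  have bls: "bl \<mu> = s" for \<mu> using bl_in[of \<mu>] True by simp
  have G0: "Gam P X Y = 0" for P X Y by (simp add: Gam_def vec_eq_iff bls m_s)
  have A0: "A 0 p = 0" if "p \<in> W" for p using A_scale[OF that, of 0 0] by simp
  have FF: "Z x (\<lambda>q. A y q $ \<mu>) p = mu x p * A y p $ \<mu> + mu y p * A x p $ \<mu>" if "p \<in> W" for p x y \<mu>
    using arg_cong[OF projective[OF that, of x y], of "\<lambda>v. v $ \<mu>"] A0[OF that] by (simp add: G0 mu_def)
  obtain w where w: "w \<noteq> 0" "h (fst q) (e \<alpha>) w = 0" "h (fst q) w (e \<alpha>) = 0" using ex_orthogonal by blast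
  \<comment> \<open>The defect in the claim. Exchanging two derivatives of A shows that E w times
    \<open>e \<alpha>\<close> equals E (e \<alpha>) times w; these vectors are orthogonal, so E (e
    \<alpha>) is 0.\<close>
  define E where "E x = Z x (mu (e \<beta>)) q - mu x q * mu (e \<beta>) q" for x
  have ZZ: "Z v (Z x (\<lambda>q. A (e \<beta>) q $ \<mu>)) q = Z v (mu x) q * A (e \<beta>) q $ \<mu> + Z v (mu (e \<beta>)) q * A x q $ \<mu>
      + mu x q * (mu v q * A (e \<beta>) q $ \<mu> + mu (e \<beta>) q * A v q $ \<mu>)
      + mu (e \<beta>) q * (mu v q * A x q $ \<mu> + mu x q * A v q $ \<mu>)" for v x \<mu>
  proof -
    have "Z v (Z x (\<lambda>q. A (e \<beta>) q $ \<mu>)) q = Z v (\<lambda>q. mu x q * A (e \<beta>) q $ \<mu> + mu (e \<beta>) q * A x q $ \<mu>) q"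
      by (rule d_cong[OF derpair_Z q]) (use FF in simp_all)
    also have "\<dots> = Z v (mu x) q * A (e \<beta>) q $ \<mu> + mu x q * Z v (\<lambda>q. A (e \<beta>) q $ \<mu>) q
       + (Z v (mu (e \<beta>)) q * A x q $ \<mu> + mu (e \<beta>) q * Z v (\<lambda>q. A x q $ \<mu>) q)"
      by (simp add: d_add[OF derpair_Z q] d_mult[OF derpair_Z q])
    finally show ?thesis unfolding FF[OF q] by (simp add: algebra_simps)
  qed
  have "E w * A (e \<alpha>) q $ \<mu> = E (e \<alpha>) * A w q $ \<mu>" for \<mu>
  proof -
    have "Z w (Z (e \<alpha>) (\<lambda>q. A (e \<beta>) q $ \<mu>)) q = Z (e \<alpha>) (Z w (\<lambda>q. A (e \<beta>) q $ \<mu>)) q"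
      by (rule Z_Z[OF q]) simp
    then show ?thesis
      unfolding ZZ Z_mu_sym[OF q, of w "e \<alpha>"] E_def by algebra
  qed
  then have "A (E w *s e \<alpha>) q = A (E (e \<alpha>) *s w) q"
    unfolding A_scale[OF q] vec_eq_iff by (simp del: vd_nth)
  then have "E w *s e \<alpha> = E (e \<alpha>) *s w" by (rule A_eq[OF q])
  then have "h (fst q) (E w *s e \<alpha>) w = h (fst q) (E (e \<alpha>) *s w) w" by simp
  then have "E (e \<alpha>) * h (fst q) w w = 0" using w by (simp add: h_scale_left)
  then have "E (e \<alpha>) = 0" using h_self_nonzero[OF nondeg_z[OF q] w(1)] by simp
  then show ?thesis by (simp add: E_def)
next
  case False
  then have k: "1 \<in> {1..<s}" "1 \<in> {1..s}" "1 < s" using s_pos by auto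
  have ks: "\<tau> 1 < s" using \<tau>_in[OF k(1)] by auto
  define M where "M = (of_nat (m 1) :: complex)"
  have M0: "M \<noteq> 0" using m_ge[OF k(1)] by (simp add: M_def)
  have a: "ipb (\<tau> 1) (A (e \<gamma>) p) (F p) / ipb (\<tau> 1) (F p) (F p) = mu (e \<gamma>) p / M" if "p \<in> W" "bl \<gamma> = s" for p \<gamma>
    using mu_blocks[OF that(1) k(1), of "e \<gamma>"] that(2) k(3) M0 by (simp add: ip_axis M_def)
  have rad: "A (e \<gamma>) p $ \<mu> = mu (e \<gamma>) p / M * F p $ \<mu>" if p: "p \<in> W" and "bl \<gamma> = s" "bl \<mu> = \<tau> 1" for p \<gamma> \<mu>
  proof -
    have "e \<gamma> $ \<nu> = 0" if "bl \<nu> = 1" for \<nu> using that \<open>bl \<gamma> = s\<close> k(3) by (auto simp: axis_def)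
    then have "PJ 1 (fst p) (e \<gamma>) = 0" using that(2) k(3) by (auto simp: PJ_def vec_eq_iff ip_axis)
    then have "PJ (\<tau> 1) (F p) (A (e \<gamma>) p) = 0" using match[OF p k(2), of "e \<gamma>"] A_scale[OF p, of 0 0] by simp
    then have "PJ (\<tau> 1) (F p) (A (e \<gamma>) p) $ \<mu> = 0" by simp
    then have "A (e \<gamma>) p $ \<mu> = ipb (\<tau> 1) (A (e \<gamma>) p) (F p) / ipb (\<tau> 1) (F p) (F p) * F p $ \<mu>"
      using ks that(3) by (simp add: PJ_def)
    then show ?thesis unfolding a[OF p that(2)] .
  qed
  have t: "ipb (\<tau> 1) (F q) (F q) \<noteq> 0" using q \<tau>_in[OF k(1)] by auto
  obtain \<mu> where \<mu>: "bl \<mu> = \<tau> 1" "F q $ \<mu> \<noteq> 0"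
  proof (rule ccontr)
    assume "\<not> thesis"
    then have "F q $ \<mu> = 0" if "bl \<mu> = \<tau> 1" for \<mu> using that \<open>\<And>\<mu>. bl \<mu> = \<tau> 1 \<Longrightarrow> F q $ \<mu> \<noteq> 0 \<Longrightarrow> thesis\<close> by blast
    then show False using t by (simp add: ip_def)
  qed
  define x y where "x = mu (e \<alpha>) q" and "y = mu (e \<beta>) q"
  have "Gam (fst q) (e \<alpha>) (e \<beta>) $ \<nu> = 0" for \<nu>
    using \<alpha> \<beta> m_s by (cases "bl \<nu> = s") (auto simp: Gam_def ip_axis)
  then have G0: "Gam (fst q) (e \<alpha>) (e \<beta>) = 0" by (simp add: vec_eq_iff)
  have 1: "Z (e \<alpha>) (\<lambda>q. A (e \<beta>) q $ \<mu>) q = (Z (e \<alpha>) (mu (e \<beta>)) q * F q $ \<mu> + y * (x / M * F q $ \<mu>)) / M"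
  proof -
    have "Z (e \<alpha>) (\<lambda>q. A (e \<beta>) q $ \<mu>) q = Z (e \<alpha>) (\<lambda>q. (1 / M) * (mu (e \<beta>) q * F q $ \<mu>)) q"
      by (rule d_cong[OF derpair_Z q]) (use rad \<beta> \<mu> in \<open>simp_all del: vd_nth\<close>, simp)
    also have "\<dots> = (1 / M) * (Z (e \<alpha>) (mu (e \<beta>)) q * F q $ \<mu> + mu (e \<beta>) q * A (e \<alpha>) q $ \<mu>)"
      by (simp only: d_cmult[OF derpair_Z q] d_mult[OF derpair_Z q] sm_mult sm_mu sm_F_nth vd_nth)
    finally show ?thesis unfolding rad[OF q \<alpha> \<mu>(1)] by (simp add: x_def y_def)
  qed
  have mt: "m (\<tau> 1) = m 1" by (rule m_\<tau>[OF k(1)])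
  have 2: "Gam (F q) (A (e \<alpha>) q) (A (e \<beta>) q) $ \<mu> = (M - 1) * (x / M) * (y / M) * F q $ \<mu>"
  proof -
    let ?t = "ipb (\<tau> 1) (F q) (F q)"
    have "Gam (F q) (A (e \<alpha>) q) (A (e \<beta>) q) $ \<mu> = (M - 1) * (ipb (\<tau> 1) (A (e \<alpha>) q) (F q) / ?t * A (e \<beta>) q $ \<mu>
      + ipb (\<tau> 1) (A (e \<beta>) q) (F q) / ?t * A (e \<alpha>) q $ \<mu>
      - ipb (\<tau> 1) (A (e \<alpha>) q) (F q) / ?t * (ipb (\<tau> 1) (A (e \<beta>) q) (F q) / ?t) * F q $ \<mu>)"
      unfolding Gam_def vec_lambda_beta \<mu>(1) mt M_def using t by (simp add: field_simps del: vd_nth)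
    then show ?thesis unfolding a[OF q \<alpha>] a[OF q \<beta>] rad[OF q \<alpha> \<mu>(1)] rad[OF q \<beta> \<mu>(1)]
      using M0 by (simp add: x_def y_def field_simps)
  qed
  have "Z (e \<alpha>) (\<lambda>q. A (e \<beta>) q $ \<mu>) q + Gam (F q) (A (e \<alpha>) q) (A (e \<beta>) q) $ \<mu>
     = x * A (e \<beta>) q $ \<mu> + y * A (e \<alpha>) q $ \<mu>"
    using arg_cong[OF projective[OF q, of "e \<alpha>" "e \<beta>"], of "\<lambda>v. v $ \<mu>"] Z_zero[OF q sm_F_nth, of \<mu>]
    by (simp add: G0 mu_def x_def y_def)
  then have "(Z (e \<alpha>) (mu (e \<beta>)) q * F q $ \<mu> + y * (x / M * F q $ \<mu>)) / M + (M - 1) * (x / M) * (y / M) * F q $ \<mu>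
    = x * (y / M * F q $ \<mu>) + y * (x / M * F q $ \<mu>)"
    unfolding 1 2 rad[OF q \<alpha> \<mu>(1)] rad[OF q \<beta> \<mu>(1)] by (simp only: x_def y_def)
  then have "F q $ \<mu> / M * (Z (e \<alpha>) (mu (e \<beta>)) q - x * y) = 0"
    using M0 by (simp add: field_simps)
  then show ?thesis using \<mu>(2) M0 by (simp add: x_def y_def)
qed

lemma Z_Z_om_flat:
  assumes q: "q \<in> W" and \<alpha>: "bl \<alpha> = s" and \<beta>: "bl \<beta> = s"
  shows "Z (e \<alpha>) (Z (e \<beta>) om) q = 0"
proof -
  have "Z (e \<alpha>) (Z (e \<beta>) om) q = Z (e \<alpha>) (\<lambda>q. - (om q * mu (e \<beta>) q)) q"
    by (rule d_cong[OF derpair_Z q]) (simp_all add: om')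
  then show ?thesis
    by (simp add: d_uminus[OF derpair_Z q] d_mult[OF derpair_Z q] om'(6)[OF q] Z_mu_flat[OF assms])
qed

lemma hess_flat:
  assumes "hess f" "q \<in> W" "bl \<alpha> = s" "bl \<beta> = s" "sm W f"
  shows "Z (e \<alpha>) (Z (e \<beta>) f) q = 0"
proof -
  have "Gam (fst q) (e \<alpha>) (e \<beta>) $ \<nu> = 0" for \<nu>
    using assms(3,4) m_s by (cases "bl \<nu> = s") (auto simp: Gam_def ip_axis)
  then have "Gam (fst q) (e \<alpha>) (e \<beta>) = 0" by (simp add: vec_eq_iff)
  then show ?thesis using assms Z_zero unfolding hess_def by metis
qed

text \<open>After subtracting c1 times \<open>wf\<close> nothing depends on \<open>T\<close>, so the
  Z derivatives of the rest g are CR again. The horizontal relation then forces the derivatives of g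
  in the curved blocks to vanish, and those in the flat block are constant.\<close>

lemma affine:
  assumes f: "sm W f" "\<And>q x. q \<in> W \<Longrightarrow> Zb x f q = 0" "hor f" "\<And>q. q \<in> W \<Longrightarrow> T f q = c1"
    and flat: "\<And>q \<alpha> \<beta>. q \<in> W \<Longrightarrow> bl \<alpha> = s \<Longrightarrow> bl \<beta> = s \<Longrightarrow> Z (e \<alpha>) (Z (e \<beta>) f) q = 0"
  obtains c0 c where "\<And>q. q \<in> W \<Longrightarrow> f q = c0 + c1 * wf q + (\<Sum>\<alpha> | bl \<alpha> = s. c \<alpha> * fst q $ \<alpha>)"
proof (cases "W = {}")
  case True
  then show ?thesis using that by auto
next
  case False
  then obtain q0 where q0: "q0 \<in> W" by blast
  define g where "g q = f q - c1 * wf q" for q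
  have sg [simp]: "sm W g" unfolding g_def[abs_def] using f by simp
  have Zg: "Z x g q = Z x f q - c1 * Z x wf q" "Zb x g q = 0" "T g q = 0" if "q \<in> W" for q x
    unfolding g_def[abs_def] using that f
    by (simp_all add: d_diff[OF derpair_Z] d_diff[OF derpair_Zb] d_diff[OF derpair_ddir] d_cmult[OF derpair_Z] d_cmult[OF derpair_Zb] d_cmult[OF derpair_ddir] wf_derivs)
  have Zbg: "Zb y (Z x g) q = 0" if "q \<in> W" for q x y
    using CR_comm(1)[OF that sg Zg(2)] Zg(3)[OF that] by simp
  have horg: "cnj (fst q $ \<beta>) * Z (e \<alpha>) g q = cnj (fst q $ \<alpha>) * Z (e \<beta>) g q"
    if q: "q \<in> W" and b: "bl \<alpha> = bl \<beta>" "bl \<alpha> \<noteq> s" for q \<alpha> \<beta>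
  proof -
    have w: "Z (e \<gamma>) wf q = 2 * \<i> * (cc (bl \<alpha>) 1 (ipb (bl \<alpha>) (fst q) (fst q)) * cnj (fst q $ \<gamma>))" if "bl \<gamma> = bl \<alpha>" for \<gamma>
      unfolding wf_derivs[OF q] pd_def ip_axis that using bl_in[of \<alpha>] by (simp add: if_distrib sum.delta cong: if_cong)
    show ?thesis
      using f(3) q b unfolding hor_def Zg(1)[OF q] w[OF refl] w[OF b(1)[symmetric]] by (simp add: algebra_simps)
  qed
  have Zg0: "Z (e \<alpha>) g q = 0" if q: "q \<in> W" and \<alpha>: "bl \<alpha> \<noteq> s" for q \<alpha>
  proof -
    define k where "k = bl \<alpha>"
    have k: "k \<in> {1..<s}" using bl_in[of \<alpha>] \<alpha> by (auto simp: k_def)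
    obtain \<beta> where \<beta>: "\<beta> \<noteq> \<alpha>" "bl \<beta> = k"
    proof -
      have "\<not> {\<mu>. bl \<mu> = k} \<subseteq> {\<alpha>}"
      proof
        assume "{\<mu>. bl \<mu> = k} \<subseteq> {\<alpha>}"
        then have "card {\<mu>. bl \<mu> = k} \<le> 1" using card_mono[of "{\<alpha>}"] by simp
        then show False using card_blk[OF k] by simp
      qed
      then show ?thesis using that by blast
    qed
    \<comment> \<open>\<open>Zb (e \<beta>)\<close> acts on the factor
      \<open>cnj (fst q $ \<beta>)\<close> alone: the derivatives of g are CR and \<alpha> differs
      from \<beta>. The second coordinate \<beta> exists since n_j >= 2.\<close>
    have "Zb (e \<beta>) (\<lambda>q. cnj (fst q $ \<beta>) * Z (e \<alpha>) g q) q = Zb (e \<beta>) (\<lambda>q. cnj (fst q $ \<alpha>) * Z (e \<beta>) g q) q"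
      by (rule d_cong[OF derpair_Zb q]) (use horg \<beta> \<alpha> in \<open>auto simp: k_def\<close>)
    then show ?thesis
      using \<beta> by (simp add: d_mult[OF derpair_Zb q] d_cnj[OF derpair_Zb q] Zbg[OF q] Z_coord[OF q] axis_def)
  qed
  define c where "c \<alpha> = Z (e \<alpha>) g q0" for \<alpha>
  have flat_wf: "Z (e \<beta>) (Z (e \<alpha>) wf) q = 0" if "q \<in> W" "bl \<alpha> = s" "bl \<beta> = s" for q \<alpha> \<beta>
    using hess_flat[OF hess_wf] that by simp
  have cc: "Z (e \<alpha>) g q = c \<alpha>" if q: "q \<in> W" and \<alpha>: "bl \<alpha> = s" for q \<alpha>
    unfolding c_def
  proof (rule zero_derivs_const[OF conn_W _ _ _ _ q q0])
    fix p assume p: "p \<in> W"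
    show "Zb x (Z (e \<alpha>) g) p = 0" for x by (rule Zbg[OF p])
    have "Z (e \<alpha>) (T g) p = Z (e \<alpha>) (\<lambda>_. 0) p" by (rule d_cong[OF derpair_Z p]) (simp_all add: Zg)
    then show "T (Z (e \<alpha>) g) p = 0" using T_Z[OF p sg] d_const[OF derpair_Z p] by simp
    have ax: "Z (e \<beta>) (Z (e \<alpha>) g) p = 0" for \<beta>
    proof (cases "bl \<beta> = s")
      case True
      have "Z (e \<beta>) (Z (e \<alpha>) g) p = Z (e \<beta>) (\<lambda>q. Z (e \<alpha>) f q - c1 * Z (e \<alpha>) wf q) p"
        by (rule d_cong[OF derpair_Z p]) (simp_all add: Zg)
      then show ?thesis
        using flat[OF p True \<alpha>] flat_wf[OF p \<alpha> True] f by (simp add: d_diff[OF derpair_Z p] d_cmult[OF derpair_Z p])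
    next
      case False
      have "Z (e \<alpha>) (Z (e \<beta>) g) p = Z (e \<alpha>) (\<lambda>_. 0) p" by (rule d_cong[OF derpair_Z p]) (simp_all add: Zg0 False)
      then show ?thesis using Z_Z[OF p sg] d_const[OF derpair_Z p] by simp
    qed
    show "Z x (Z (e \<alpha>) g) p = 0" for x
      by (subst Z_expand[OF p]) (simp_all add: ax)
  qed simp
  define d where "d q = g q - (\<Sum>\<alpha> | bl \<alpha> = s. c \<alpha> * fst q $ \<alpha>)" for q
  have sd [simp]: "sm W d" unfolding d_def[abs_def] by simp
  have "d q = d q0" if q: "q \<in> W" for q
  proof (rule zero_derivs_const[OF conn_W sd _ _ _ q q0])
    fix p assume p: "p \<in> W"
    show "Zb x d p = 0" for x unfolding d_def[abs_def]
      by (simp add: d_diff[OF derpair_Zb p] d_sum[OF derpair_Zb p] d_cmult[OF derpair_Zb p] Zb_coord[OF p] Zg(2)[OF p])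
    show "T d p = 0" unfolding d_def[abs_def]
      by (simp add: d_diff[OF derpair_ddir p] d_sum[OF derpair_ddir p] d_cmult[OF derpair_ddir p] T_coord[OF p] Zg(3)[OF p])
    have "Z (e \<beta>) d p = 0" for \<beta>
    proof -
      have "Z (e \<beta>) d p = Z (e \<beta>) g p - (\<Sum>\<alpha> | bl \<alpha> = s. c \<alpha> * e \<beta> $ \<alpha>)"
        unfolding d_def[abs_def]
        by (simp add: d_diff[OF derpair_Z p] d_sum[OF derpair_Z p] d_cmult[OF derpair_Z p] Z_coord[OF p])
      also have "(\<Sum>\<alpha> | bl \<alpha> = s. c \<alpha> * e \<beta> $ \<alpha>) = (\<Sum>\<alpha> | bl \<alpha> = s. if \<alpha> = \<beta> then c \<beta> else 0)"
        by (intro sum.cong refl) (auto simp: axis_def)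
      also have "\<dots> = (if bl \<beta> = s then c \<beta> else 0)" by (simp add: sum.delta)
      finally show ?thesis using cc[OF p, of \<beta>] Zg0[OF p, of \<beta>] by auto
    qed
    then show "Z x d p = 0" for x
      by (subst Z_expand[OF p]) simp_all
  qed
  then have "f q = d q0 + c1 * wf q + (\<Sum>\<alpha> | bl \<alpha> = s. c \<alpha> * fst q $ \<alpha>)" if "q \<in> W" for q
    using that unfolding d_def g_def by (simp add: algebra_simps)
  then show ?thesis by (rule that)
qed

text \<open>Without curved blocks, \<open>Z x (Z y f) = 0\<close> and the commutator give
  \<open>Z x (T f) = 0\<close> by choosing y orthogonal to x. With a curved block, f has there the
  derivatives of \<open>wf\<close> times \<open>T f\<close>, and comparing the two vanishing
  Hessians isolates \<open>Z x (T f)\<close>.\<close>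

lemma T_const:
  assumes f: "sm W f" "\<And>q x. q \<in> W \<Longrightarrow> Zb x f q = 0" "hor f" "hess f" and qq: "q \<in> W" "q' \<in> W"
  shows "T f q = T f q'"
proof (rule zero_derivs_const[OF conn_W _ _ _ _ qq])
  show "sm W (T f)" using f by simp
  show ZbT: "Zb x (T f) q = 0" if "q \<in> W" for q x
    using CR_comm(2)[OF that f(1,2)] .
  show ZT: "Z x (T f) q = 0" if q: "q \<in> W" for q x
  proof (cases "s = 1")
    case True
    have bls: "bl \<mu> = s" for \<mu> using bl_in[of \<mu>] True by simp
    have G0: "Gam P X Y = 0" for P X Y by (simp add: Gam_def vec_eq_iff bls m_s)
    have C0: "C P X Y V = 0" for P X Y V
    proof -
      have "m j = 1" if "j \<in> {1..s}" for j using that True m_s by (metis atLeastAtMost_singleton singletonD)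
      then have "cc j 2 t = 0 \<and> cc j 3 t = 0" if "j \<in> {1..s}" for j t
        using that by (simp add: cc_def numeral_2_eq_2 numeral_3_eq_3)
      then show ?thesis unfolding C_def by (intro sum.neutral) auto
    qed
    obtain y where y: "y \<noteq> 0" "h (fst q) x y = 0" "h (fst q) y x = 0" using ex_orthogonal by blast
    have ZZ0: "Z x (Z y f) p = 0" if "p \<in> W" for p
      using f(4) that Z_zero[OF that f(1)] unfolding hess_def G0 by simp
    have "Zb y (Z x (Z y f)) q = Zb y (\<lambda>_. 0) q"
      by (rule d_cong[OF derpair_Zb q]) (use ZZ0 f in auto)
    then have 0: "Zb y (Z x (Z y f)) q = 0" using d_const[OF derpair_Zb q] by simp
    have "Z x (Zb y (Z y f)) q = Z x (\<lambda>q. 2 * \<i> * (h (fst q) y y * T f q)) q"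
      by (rule d_cong[OF derpair_Z q]) (use CR_comm(1)[OF _ f(1,2)] f in \<open>auto simp: mult.assoc\<close>)
    then have "Z x (Zb y (Z y f)) q = 2 * \<i> * (h (fst q) y y * Z x (T f) q)"
      using f by (simp add: d_cmult[OF derpair_Z q] d_mult[OF derpair_Z q] Z_h_z[OF q] C0)
    then have "h (fst q) y y * Z x (T f) q = 0"
      using 0 Zb_Z[OF q, of "Z y f" y x] f y by simp
    then show ?thesis using h_self_nonzero[OF nondeg_z[OF q] y(1)] by simp
  next
    case False
    then have k: "1 \<in> {1..<s}" "1 \<in> {1..s}" "1 < s" using s_pos by auto
    let ?c1 = "\<lambda>q. cc 1 1 (ipb 1 (fst q) (fst q))" and ?c2 = "\<lambda>q. cc 1 2 (ipb 1 (fst q) (fst q))"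
    have w: "Z (e \<alpha>) wf p = 2 * \<i> * (?c1 p * cnj (fst p $ \<alpha>))" if "bl \<alpha> = 1" "p \<in> W" for p \<alpha>
    proof -
      have "pd (fst p) (e \<alpha>) = (\<Sum>j\<in>{1..s}. if j = 1 then ?c1 p * cnj (fst p $ \<alpha>) else 0)"
        unfolding pd_def ip_axis that by (intro sum.cong) auto
      then show ?thesis using k wf_derivs(1)[OF that(2)] by (simp add: sum.delta)
    qed
    \<comment> \<open>The horizontal relation for \<alpha> and another coordinate \<beta> of block 1
      is differentiated by \<open>Zb (e \<beta>)\<close>; the commutators bring in
      \<open>T f\<close>.\<close>
    have fw: "Z (e \<alpha>) f p = T f p * Z (e \<alpha>) wf p" if \<alpha>: "bl \<alpha> = 1" and p: "p \<in> W" for \<alpha> p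
    proof -
      obtain \<beta> where \<beta>: "\<beta> \<noteq> \<alpha>" "bl \<beta> = 1"
      proof -
        have "\<not> {\<mu>. bl \<mu> = 1} \<subseteq> {\<alpha>}"
        proof
          assume "{\<mu>. bl \<mu> = 1} \<subseteq> {\<alpha>}"
          then have "card {\<mu>. bl \<mu> = 1} \<le> 1" using card_mono[of "{\<alpha>}"] by simp
          then show False using card_blk[OF k(1)] by simp
        qed
        then show ?thesis using that by blast
      qed
      have hh: "h (fst p) (e \<gamma>) (e \<beta>) = (if \<gamma> = \<beta> then ?c1 p else 0) + ?c2 p * cnj (fst p $ \<gamma>) * fst p $ \<beta>"
        if "bl \<gamma> = 1" for \<gamma>
      proof -
        have "h (fst p) (e \<gamma>) (e \<beta>) = (\<Sum>j\<in>{1..s}. if j = 1 then (if \<gamma> = \<beta> then ?c1 p else 0) + ?c2 p * cnj (fst p $ \<gamma>) * fst p $ \<beta> else 0)"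
          unfolding h_def ip_axis ip_axis' that \<beta>(2) by (intro sum.cong) (auto simp: axis_def)
        then show ?thesis using k by (simp add: sum.delta)
      qed
      have "Zb (e \<beta>) (\<lambda>q. cnj (fst q $ \<beta>) * Z (e \<alpha>) f q) p = Zb (e \<beta>) (\<lambda>q. cnj (fst q $ \<alpha>) * Z (e \<beta>) f q) p"
        by (rule d_cong[OF derpair_Zb p]) (use f \<beta> \<alpha> k in \<open>auto simp: hor_def\<close>)
      then have "Z (e \<alpha>) f p + cnj (fst p $ \<beta>) * (2 * \<i> * h (fst p) (e \<alpha>) (e \<beta>) * T f p)
         = cnj (fst p $ \<alpha>) * (2 * \<i> * h (fst p) (e \<beta>) (e \<beta>) * T f p)"
        using \<beta> f(1) CR_comm(1)[OF p f(1,2)]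
        by (simp add: d_mult[OF derpair_Zb p] d_cnj[OF derpair_Zb p] Z_coord[OF p] axis_def)
      then show ?thesis unfolding hh[OF \<alpha>] hh[OF \<beta>(2)] w[OF \<alpha> p] using \<beta>(1) by (simp add: algebra_simps)
    qed
    have t: "ipb 1 (fst q) (fst q) \<noteq> 0" using q k by auto
    obtain \<alpha> where \<alpha>: "bl \<alpha> = 1" "fst q $ \<alpha> \<noteq> 0"
    proof (rule ccontr)
      assume "\<not> thesis"
      then have "fst q $ \<mu> = 0" if "bl \<mu> = 1" for \<mu> using that \<open>\<And>\<alpha>. bl \<alpha> = 1 \<Longrightarrow> fst q $ \<alpha> \<noteq> 0 \<Longrightarrow> thesis\<close> by blast
      then show False using t by (simp add: ip_def)
    qed
    have "Z x (Z (e \<alpha>) f) q = Z x (\<lambda>q. T f q * Z (e \<alpha>) wf q) q"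
      by (rule d_cong[OF derpair_Z q]) (use fw \<alpha> f in auto)
    also have "\<dots> = Z x (T f) q * Z (e \<alpha>) wf q + T f q * Z x (Z (e \<alpha>) wf) q"
      using f by (simp add: d_mult[OF derpair_Z q])
    finally have E: "Z (Gam (fst q) x (e \<alpha>)) f q = Z x (T f) q * Z (e \<alpha>) wf q + T f q * Z (Gam (fst q) x (e \<alpha>)) wf q"
      using f(4) hess_wf q unfolding hess_def by simp
    have "Z (Gam (fst q) x (e \<alpha>)) f q = T f q * Z (Gam (fst q) x (e \<alpha>)) wf q"
    proof -
      have g: "Gam (fst q) x (e \<alpha>) $ \<beta> = 0" if "bl \<beta> \<noteq> 1" for \<beta>
      proof -
        have "e \<alpha> $ \<beta> = 0" using that \<alpha> by (auto simp: axis_def)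
        then show ?thesis using that \<alpha> by (simp add: Gam_def ip_axis)
      qed
      show ?thesis
        unfolding Z_expand[OF q f(1), of "Gam _ _ _"] Z_expand[OF q sm_wf, of "Gam _ _ _"] sum_distrib_left
      proof (intro sum.cong refl)
        fix \<beta>
        show "Gam (fst q) x (e \<alpha>) $ \<beta> * Z (e \<beta>) f q = T f q * (Gam (fst q) x (e \<alpha>) $ \<beta> * Z (e \<beta>) wf q)"
          using fw[OF _ q, of \<beta>] g[of \<beta>] by (cases "bl \<beta> = 1") auto
      qed
    qed
    then have "Z x (T f) q * Z (e \<alpha>) wf q = 0" using E by simp
    moreover have "Z (e \<alpha>) wf q \<noteq> 0"
      unfolding w[OF \<alpha>(1) q] using \<alpha> t m_ge[OF k(1)] by (simp add: cc_def)
    ultimately show ?thesis by simp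
  qed
  show "T (T f) q = 0" if q: "q \<in> W" for q
  proof -
    obtain x where x: "h (fst q) x x \<noteq> 0" using ex_h_nonzero[OF q] by blast
    have "Zb x (Z x (T f)) q = Zb x (\<lambda>_. 0) q" by (rule d_cong[OF derpair_Zb q]) (use ZT f in auto)
    then have "2 * \<i> * h (fst q) x x * T (T f) q = 0"
      using CR_comm(1)[OF q, of "T f" x x] ZbT f d_const[OF derpair_Zb q] by simp
    then show ?thesis using x by simp
  qed
qed

end

section \<open>The normal form\<close>

lemma sum_cnj_eq_0:
  fixes w :: "'a \<Rightarrow> complex"
  assumes "finite J" "(\<Sum>\<mu>\<in>J. w \<mu> * cnj (w \<mu>)) = 0" "\<mu> \<in> J"
  shows "w \<mu> = 0"
proof -
  have "complex_of_real (\<Sum>\<mu>\<in>J. (cmod (w \<mu>))\<^sup>2) = (\<Sum>\<mu>\<in>J. w \<mu> * cnj (w \<mu>))"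
    unfolding of_real_sum by (intro sum.cong refl complex_norm_square)
  then have "(\<Sum>\<mu>\<in>J. (cmod (w \<mu>))\<^sup>2) = 0" using assms(2) by (simp only: of_real_eq_0_iff)
  then show ?thesis using assms(1,3) by (simp add: sum_nonneg_eq_0_iff)
qed

text \<open>The orthogonal columns are as many as the rows, so they span, and a vector orthogonal to
  all of them is 0. Extending by the identity off S makes the matrix an endomorphism, for which
  injective implies surjective.\<close>

lemma isometry_surj:
  fixes a :: "'n::finite \<Rightarrow> 'n \<Rightarrow> complex" and c :: "'n \<Rightarrow> complex" and S :: "'n set"
  assumes r: "0 < (r::real)"
    and iso: "\<And>\<alpha> \<beta>. \<alpha> \<in> S \<Longrightarrow> \<beta> \<in> S \<Longrightarrow> (\<Sum>i\<in>S. a i \<alpha> * cnj (a i \<beta>)) = (if \<alpha> = \<beta> then of_real r else 0)"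
    and orth: "\<And>\<alpha>. \<alpha> \<in> S \<Longrightarrow> (\<Sum>i\<in>S. a i \<alpha> * cnj (c i)) = 0"
    and i: "i \<in> S"
  shows "c i = 0"
proof -
  define L where "L x = (\<chi> i. if i \<in> S then (\<Sum>\<alpha>\<in>S. a i \<alpha> * x $ \<alpha>) else x $ i)" for x :: "complex^'n"
  have nrm: "(\<Sum>i\<in>S. (\<Sum>\<alpha>\<in>S. a i \<alpha> * x $ \<alpha>) * cnj (\<Sum>\<beta>\<in>S. a i \<beta> * x $ \<beta>)) = of_real r * (\<Sum>\<alpha>\<in>S. x $ \<alpha> * cnj (x $ \<alpha>))" for x
  proof -
    have "(\<Sum>i\<in>S. (\<Sum>\<alpha>\<in>S. a i \<alpha> * x $ \<alpha>) * cnj (\<Sum>\<beta>\<in>S. a i \<beta> * x $ \<beta>))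
       = (\<Sum>i\<in>S. \<Sum>\<alpha>\<in>S. \<Sum>\<beta>\<in>S. x $ \<alpha> * cnj (x $ \<beta>) * (a i \<alpha> * cnj (a i \<beta>)))"
      by (simp add: sum_product cnj_sum mult_ac)
    also have "\<dots> = (\<Sum>\<alpha>\<in>S. \<Sum>i\<in>S. \<Sum>\<beta>\<in>S. x $ \<alpha> * cnj (x $ \<beta>) * (a i \<alpha> * cnj (a i \<beta>)))"
      by (rule sum.swap)
    also have "\<dots> = (\<Sum>\<alpha>\<in>S. \<Sum>\<beta>\<in>S. \<Sum>i\<in>S. x $ \<alpha> * cnj (x $ \<beta>) * (a i \<alpha> * cnj (a i \<beta>)))"
      by (intro sum.cong refl sum.swap)
    also have "\<dots> = (\<Sum>\<alpha>\<in>S. \<Sum>\<beta>\<in>S. if \<beta> = \<alpha> then of_real r * (x $ \<alpha> * cnj (x $ \<alpha>)) else 0)"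
      unfolding sum_distrib_left[symmetric] using iso by (intro sum.cong refl) auto
    also have "\<dots> = of_real r * (\<Sum>\<alpha>\<in>S. x $ \<alpha> * cnj (x $ \<alpha>))"
      by (simp add: sum.delta' sum_distrib_left)
    finally show ?thesis .
  qed
  have lin: "linear L"
  proof (rule linearI)
    show "L (x + y) = L x + L y" for x y
      by (simp add: L_def vec_eq_iff distrib_left sum.distrib)
    show "L (t *\<^sub>R x) = t *\<^sub>R L x" for t x
      by (simp add: L_def vec_eq_iff scaleR_sum_right)
  qed
  have "x = 0" if "L x = 0" for x
  proof -
    have Li: "L x $ i = 0" for i using that by simp
    have z: "i \<notin> S \<Longrightarrow> x $ i = 0" "i \<in> S \<Longrightarrow> (\<Sum>\<alpha>\<in>S. a i \<alpha> * x $ \<alpha>) = 0" for i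
      using Li[of i] by (simp_all add: L_def)
    have "of_real r * (\<Sum>\<alpha>\<in>S. x $ \<alpha> * cnj (x $ \<alpha>)) = 0"
      unfolding nrm[symmetric] using z(2) by (intro sum.neutral) simp
    then have "(\<Sum>\<alpha>\<in>S. x $ \<alpha> * cnj (x $ \<alpha>)) = 0" using r by simp
    then have "x $ \<alpha> = 0" if "\<alpha> \<in> S" for \<alpha> using that sum_cnj_eq_0[of S "\<lambda>\<alpha>. x $ \<alpha>"] by simp
    then show ?thesis using z(1) by (metis vec_eq_iff zero_index)
  qed
  then have "inj L" using linear_injective_0[OF lin] by blast
  from linear_injective_imp_surjective[OF lin this]
  obtain x where x: "L x = (\<chi> i. c i)" unfolding surj_def by metis
  have cx: "c i = (\<Sum>\<alpha>\<in>S. a i \<alpha> * x $ \<alpha>)" if "i \<in> S" for i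
    using arg_cong[OF x, of "\<lambda>v. v $ i"] that by (simp add: L_def)
  have "(\<Sum>i\<in>S. c i * cnj (c i)) = (\<Sum>i\<in>S. \<Sum>\<alpha>\<in>S. x $ \<alpha> * (a i \<alpha> * cnj (c i)))"
    using cx by (intro sum.cong refl) (simp add: sum_distrib_right mult_ac)
  also have "\<dots> = (\<Sum>\<alpha>\<in>S. x $ \<alpha> * (\<Sum>i\<in>S. a i \<alpha> * cnj (c i)))"
    by (subst sum.swap) (simp add: sum_distrib_left)
  also have "\<dots> = 0" using orth by simp
  finally show ?thesis using sum_cnj_eq_0[of S c i] i by simp
qed

context cr_gauged
begin

abbreviation S :: "'n set" where "S \<equiv> {\<alpha>. bl \<alpha> = s}"

lemma ip_s: "ipb s X Y = (\<Sum>\<alpha>\<in>S. X $ \<alpha> * cnj (Y $ \<alpha>))"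
  by (simp add: ip_def)

lemma pp_F: "q \<in> W \<Longrightarrow> pp (F q) = ipb s (F q) (F q) + lam q * (pp (fst q) - ipb s (fst q) (fst q))"
proof -
  assume q: "q \<in> W"
  have 1: "pp P = ipb s P P + (\<Sum>k\<in>{1..<s}. ipb k P P ^ m k)" for P
    unfolding pp_def split_s by (simp add: cc_def m_s)
  have "(\<Sum>k\<in>{1..<s}. ipb k (F q) (F q) ^ m k) = (\<Sum>k\<in>{1..<s}. ipb (\<tau> k) (F q) (F q) ^ m (\<tau> k))"
    by (rule sum.reindex_bij_betw[OF bij_\<tau>, symmetric])
  also have "\<dots> = (\<Sum>k\<in>{1..<s}. lam q * ipb k (fst q) (fst q) ^ m k)"
    using norm_F[OF q] m_\<tau> by (intro sum.cong) auto
  finally show ?thesis unfolding 1[of "F q"] 1[of "fst q"] by (simp add: sum_distrib_left)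
qed

lemma wf_cnj: "wf q - cnj (wf q) = 2 * \<i> * pp (fst q)"
  by (simp add: wf_def)

abbreviation U :: "'n \<Rightarrow> (complex^'n) \<times> real \<Rightarrow> complex" where "U i \<equiv> \<lambda>q. om q * F q $ i"
abbreviation V :: "(complex^'n) \<times> real \<Rightarrow> complex" where "V \<equiv> \<lambda>q. om q * G q"

text \<open>The equation of the hypersurface at F times |om|^2. In the curved blocks
  \<open>norm_F\<close> and the constancy of lam |om|^2 reproduce the potential of the source up to
  r^2.\<close>

lemma identity1:
  assumes q: "q \<in> W"
  shows "V q * cnj (om q) - cnj (V q) * om q
     = 2 * \<i> * (\<Sum>i\<in>S. U i q * cnj (U i q)) + of_real (r\<^sup>2) * (wf q - cnj (wf q) - 2 * \<i> * (\<Sum>\<alpha>\<in>S. fst q $ \<alpha> * cnj (fst q $ \<alpha>)))"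
proof -
  have "V q * cnj (om q) - cnj (V q) * om q = om q * cnj (om q) * (G q - cnj (G q))"
    by (simp add: algebra_simps)
  also have "G q - cnj (G q) = 2 * \<i> * pp (F q)" by (subst im_G[OF q]) simp
  also have "om q * cnj (om q) * (2 * \<i> * pp (F q)) = 2 * \<i> * (om q * cnj (om q) * ipb s (F q) (F q))
      + 2 * \<i> * (lam q * (om q * cnj (om q))) * (pp (fst q) - ipb s (fst q) (fst q))"
    unfolding pp_F[OF q] by (simp add: algebra_simps)
  also have "om q * cnj (om q) * ipb s (F q) (F q) = (\<Sum>i\<in>S. U i q * cnj (U i q))"
    unfolding ip_s sum_distrib_left by (intro sum.cong refl) simp
  finally show ?thesis unfolding om'(3)[OF q] wf_cnj ip_s by (simp add: algebra_simps)
qed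

text \<open>The definition of lam times |om|^2. The contribution R of the curved blocks acquires, by
  \<open>TF_block\<close>, the factor 2 i \<epsilon> + om rho, which is 0.\<close>

lemma identity2:
  assumes q: "q \<in> W"
  shows "cnj (om q) * T V q - 2 * \<i> * (\<Sum>i\<in>S. T (U i) q * cnj (U i q)) - \<epsilon> * cnj (V q) = of_real (r\<^sup>2)"
proof -
  define R where "R = (\<Sum>k\<in>{1..<s}. ipb k (F q) (F q) ^ m k)"
  have p: "pp (F q) = ipb s (F q) (F q) + R"
    unfolding pp_def split_s R_def by (simp add: cc_def m_s)
  have blkp: "cc j 1 (ipb j (F q) (F q)) * ipb j (TF q) (F q) = rho q / (2 * \<i>) * ipb j (F q) (F q) ^ m j" if j: "j \<in> {1..<s}" for j
  proof -
    obtain k where k: "k \<in> {1..<s}" "\<tau> k = j" using bij_\<tau> j by (metis bij_betw_def imageE)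
    have mk: "m k = m j" using m_\<tau>[OF k(1)] k(2) by simp
    have t: "ipb j (F q) (F q) \<noteq> 0" using q j by auto
    obtain n where n: "m j = Suc n" using m_ge[OF j] by (cases "m j") auto
    have "ipb j (TF q) (F q) = rho q / (2 * \<i> * of_nat (m j)) * ipb j (F q) (F q)"
      unfolding ip_def sum_distrib_left
      by (intro sum.cong refl) (use TF_block[OF q k(1)] k mk in \<open>simp del: vd_nth\<close>)
    moreover have "cc j 1 (ipb j (F q) (F q)) = of_nat (m j) * ipb j (F q) (F q) ^ n" by (simp add: cc_def n)
    moreover have "ipb j (F q) (F q) ^ m j = ipb j (F q) (F q) * ipb j (F q) (F q) ^ n" by (simp add: n)
    moreover have "(of_nat (m j) :: complex) \<noteq> 0" using m_ge[OF j] by simp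
    ultimately show ?thesis by (simp del: vd_nth)
  qed
  have pdT: "pd (F q) (TF q) = ipb s (TF q) (F q) + rho q / (2 * \<i>) * R"
  proof -
    have "(\<Sum>j\<in>{1..<s}. cc j 1 (ipb j (F q) (F q)) * ipb j (TF q) (F q)) = rho q / (2 * \<i>) * R"
      unfolding R_def sum_distrib_left using blkp by (intro sum.cong refl)
    then show ?thesis unfolding pd_def split_s by (simp add: cc_def m_s)
  qed
  have TV: "T V q = \<epsilon> * G q + om q * T G q" and TU: "T (U i) q = \<epsilon> * F q $ i + om q * TF q $ i" for i
    using q by (simp_all add: d_mult[OF derpair_ddir] om')
  have G: "G q = cnj (G q) + 2 * \<i> * (ipb s (F q) (F q) + R)" using im_G[OF q] unfolding p .
  have TG: "T G q = lam q + 2 * \<i> * ipb s (TF q) (F q) + rho q * R"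
  proof -
    have "T G q = lam q + 2 * \<i> * pd (F q) (TF q)" by (simp add: lam_def)
    then show ?thesis unfolding pdT by (simp add: algebra_simps)
  qed
  have sU: "(\<Sum>i\<in>S. T (U i) q * cnj (U i q)) = cnj (om q) * (\<epsilon> * ipb s (F q) (F q) + om q * ipb s (TF q) (F q))"
    unfolding TU ip_s sum_distrib_left sum.distrib[symmetric] by (intro sum.cong refl) (simp add: algebra_simps)
  have ro: "om q * rho q = - 2 * \<i> * \<epsilon>" using om'(1,4)[OF q] by simp
  have "cnj (om q) * T V q - 2 * \<i> * (\<Sum>i\<in>S. T (U i) q * cnj (U i q)) - \<epsilon> * cnj (V q)
     = cnj (om q) * (\<epsilon> * (G q - cnj (G q) - 2 * \<i> * ipb s (F q) (F q)) + om q * (T G q - 2 * \<i> * ipb s (TF q) (F q)))"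
    unfolding TV sU by (simp add: algebra_simps)
  also have "G q - cnj (G q) - 2 * \<i> * ipb s (F q) (F q) = 2 * \<i> * R" by (subst G) (simp add: algebra_simps)
  also have "T G q - 2 * \<i> * ipb s (TF q) (F q) = lam q + rho q * R" unfolding TG by simp
  also have "cnj (om q) * (\<epsilon> * (2 * \<i> * R) + om q * (lam q + rho q * R))
      = lam q * (om q * cnj (om q)) + cnj (om q) * R * (2 * \<i> * \<epsilon> + om q * rho q)" by (simp add: algebra_simps)
  finally show ?thesis unfolding ro om'(3)[OF q] by simp
qed

lemma om_affine: "\<exists>c0 c. \<forall>q\<in>W. om q = c0 + \<epsilon> * wf q + (\<Sum>\<alpha>\<in>S. c \<alpha> * fst q $ \<alpha>)"
proof (rule affine[OF om(1) om'(5) hor_functions(1) om'(2) Z_Z_om_flat])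
  fix c0 c assume "\<And>q. q \<in> W \<Longrightarrow> om q = c0 + \<epsilon> * wf q + (\<Sum>\<alpha>\<in>S. c \<alpha> * fst q $ \<alpha>)"
  then show "\<exists>c0 c. \<forall>q\<in>W. om q = c0 + \<epsilon> * wf q + (\<Sum>\<alpha>\<in>S. c \<alpha> * fst q $ \<alpha>)"
    by (intro exI ballI)
qed

lemma hess_om: "hess om"
proof -
  obtain c0 c where "\<And>q. q \<in> W \<Longrightarrow> om q = c0 + \<epsilon> * wf q + (\<Sum>\<alpha>\<in>S. c \<alpha> * fst q $ \<alpha>)"
    using om_affine by blast
  then show ?thesis by (rule hess_affine[OF _ om(1)])
qed

lemma U_affine:
  assumes i: "bl i = s"
  shows "\<exists>c0 c1 c. \<forall>q\<in>W. U i q = c0 + c1 * wf q + (\<Sum>\<alpha>\<in>S. c \<alpha> * fst q $ \<alpha>)"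
proof (cases "W = {}")
  case False
  then obtain q0 where q0: "q0 \<in> W" by blast
  have h: "hess (U i)" by (rule hess_mult[OF hess_om]) (use hess_F[OF _ i] in simp_all)
  have sU: "sm W (U i)" by simp
  have z: "Zb x (U i) q = 0" if "q \<in> W" for q x
    using that by (simp add: d_mult[OF derpair_Zb] om' CR_F_nth)
  have t: "T (U i) q = T (U i) q0" if "q \<in> W" for q
    by (rule T_const[OF sU z hor_functions(2)[OF i] h that q0])
  show ?thesis
  proof (rule affine[OF sU z hor_functions(2)[OF i] t hess_flat[OF h _ _ _ sU]])
    fix c0 c assume "\<And>q. q \<in> W \<Longrightarrow> U i q = c0 + T (U i) q0 * wf q + (\<Sum>\<alpha>\<in>S. c \<alpha> * fst q $ \<alpha>)"
    then show ?thesis by (intro exI ballI)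
  qed
qed simp

lemma T_V_const:
  assumes "q \<in> W" "q' \<in> W" shows "T V q = T V q'"
proof -
  have h: "hess V" by (rule hess_mult[OF hess_om]) (use hess_G in simp_all)
  have z: "Zb x V q = 0" if "q \<in> W" for q x
    using that by (simp add: d_mult[OF derpair_Zb] om' CR_G)
  show ?thesis by (rule T_const[OF _ z hor_functions(3) h assms]) simp
qed

lemma V_affine:
  assumes "\<And>q. q \<in> W \<Longrightarrow> T V q = c1"
  shows "\<exists>c0 c. \<forall>q\<in>W. V q = c0 + c1 * wf q + (\<Sum>\<alpha>\<in>S. c \<alpha> * fst q $ \<alpha>)"
proof -
  have h: "hess V" by (rule hess_mult[OF hess_om]) (use hess_G in simp_all)
  have sV: "sm W V" by simp
  have z: "Zb x V q = 0" if "q \<in> W" for q x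
    using that by (simp add: d_mult[OF derpair_Zb] om' CR_G)
  show ?thesis
  proof (rule affine[OF sV z hor_functions(3) assms hess_flat[OF h _ _ _ sV]])
    fix c0 c assume "\<And>q. q \<in> W \<Longrightarrow> V q = c0 + c1 * wf q + (\<Sum>\<alpha>\<in>S. c \<alpha> * fst q $ \<alpha>)"
    then show ?thesis by (intro exI ballI)
  qed
qed

lemma affine_derivs:
  assumes f: "\<And>q. q \<in> W \<Longrightarrow> f q = c0 + c1 * wf q + (\<Sum>\<alpha>\<in>S. c \<alpha> * fst q $ \<alpha>)" and sf: "sm W f" and q: "q \<in> W"
  shows "T f q = c1" "Zb x f q = 0" "bl \<beta> = s \<Longrightarrow> Z (e \<beta>) f q = c1 * Z (e \<beta>) wf q + c \<beta>"
proof -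
  have d: "\<delta> f q = \<delta> (\<lambda>q. c0 + c1 * wf q + (\<Sum>\<alpha>\<in>S. c \<alpha> * fst q $ \<alpha>)) q" if "derpair \<delta> \<delta>'" for \<delta> \<delta>'
    by (rule d_cong[OF that q sf f])
  show "T f q = c1" unfolding d[OF derpair_ddir]
    by (simp add: d_add[OF derpair_ddir q] d_cmult[OF derpair_ddir q] d_sum[OF derpair_ddir q] d_const[OF derpair_ddir q] wf_derivs[OF q] T_coord[OF q])
  show "Zb x f q = 0" unfolding d[OF derpair_Zb]
    by (simp add: d_add[OF derpair_Zb q] d_cmult[OF derpair_Zb q] d_sum[OF derpair_Zb q] d_const[OF derpair_Zb q] wf_derivs[OF q] Zb_coord[OF q])
  assume b: "bl \<beta> = s"
  have "(\<Sum>\<alpha>\<in>S. c \<alpha> * e \<beta> $ \<alpha>) = (\<Sum>\<alpha>\<in>S. if \<alpha> = \<beta> then c \<beta> else 0)"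
    by (intro sum.cong refl) (auto simp: axis_def)
  then show "Z (e \<beta>) f q = c1 * Z (e \<beta>) wf q + c \<beta>" unfolding d[OF derpair_Z] using b
    by (simp add: d_add[OF derpair_Z q] d_cmult[OF derpair_Z q] d_sum[OF derpair_Z q] d_const[OF derpair_Z q] Z_coord[OF q] sum.delta)
qed

text \<open>Comparison of coefficients by differentiation: a \<open>Z\<close> and a
  \<open>Zb\<close> derivative isolate the quadratic part, one \<open>Z\<close> derivative the
  linear part, and the value at a point the constant.\<close>

lemma flat_isometry:
  fixes u0 :: "'n \<Rightarrow> complex" and a :: "'n \<Rightarrow> 'n \<Rightarrow> complex" and v z0 :: "'n \<Rightarrow> complex"
  defines "u \<equiv> \<lambda>i q. u0 i + (\<Sum>\<alpha>\<in>S. a i \<alpha> * (fst q $ \<alpha> + z0 \<alpha>))"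
  assumes q: "q \<in> W"
    and id: "\<And>q. q \<in> W \<Longrightarrow> (\<Sum>i\<in>S. u i q * cnj (u i q)) = of_real R * (\<Sum>\<alpha>\<in>S. (fst q $ \<alpha> + z0 \<alpha>) * cnj (fst q $ \<alpha> + z0 \<alpha>)) + d
       + (\<Sum>\<alpha>\<in>S. v \<alpha> * (fst q $ \<alpha> + z0 \<alpha>)) + (\<Sum>\<alpha>\<in>S. cnj (v \<alpha> * (fst q $ \<alpha> + z0 \<alpha>)))"
  shows "bl \<alpha> = s \<Longrightarrow> bl \<beta> = s \<Longrightarrow> (\<Sum>i\<in>S. a i \<alpha> * cnj (a i \<beta>)) = (if \<alpha> = \<beta> then of_real R else 0)"
    and "bl \<alpha> = s \<Longrightarrow> (\<Sum>i\<in>S. a i \<alpha> * cnj (u0 i)) = v \<alpha>"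
    and "(\<Sum>i\<in>S. u0 i * cnj (u0 i)) = d"
proof -
  define \<zeta> where "\<zeta> \<alpha> q = fst q $ \<alpha> + z0 \<alpha>" for \<alpha> and q :: "(complex^'n) \<times> real"
  have su [simp]: "sm W (u i)" for i unfolding u_def by simp
  have s\<zeta> [simp]: "sm W (\<zeta> \<alpha>)" for \<alpha> unfolding \<zeta>_def[abs_def] by simp
  have d\<zeta>: "Z (e \<beta>) (\<zeta> \<alpha>) q = (if \<alpha> = \<beta> then 1 else 0)" "Zb x (\<zeta> \<alpha>) q = 0" if "q \<in> W" for q \<alpha> \<beta> x
    unfolding \<zeta>_def[abs_def] using that
    by (simp_all add: d_add[OF derpair_Z] d_add[OF derpair_Zb] d_const[OF derpair_Z] d_const[OF derpair_Zb] Z_coord Zb_coord axis_def)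
  have u: "u i q = u0 i + (\<Sum>\<alpha>\<in>S. a i \<alpha> * \<zeta> \<alpha> q)" for i q by (simp add: u_def \<zeta>_def)
  have delta: "(\<Sum>\<alpha>\<in>S. c \<alpha> * (if \<alpha> = \<beta> then 1 else 0)) = c \<beta>" if "bl \<beta> = s" for c :: "'n \<Rightarrow> complex" and \<beta>
    using that by (simp add: if_distrib sum.delta cong: if_cong)
  have du: "Z (e \<beta>) (u i) q = a i \<beta>" "Zb x (u i) q = 0" if "q \<in> W" "bl \<beta> = s" for q i \<beta> x
    unfolding u[abs_def] using that delta[OF that(2)]
    by (simp_all add: d_add[OF derpair_Z] d_add[OF derpair_Zb] d_sum[OF derpair_Z] d_sum[OF derpair_Zb]
       d_cmult[OF derpair_Z] d_cmult[OF derpair_Zb] d_const[OF derpair_Z] d_const[OF derpair_Zb] d\<zeta>)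
  note id' = id[folded \<zeta>_def]
  have E: "(\<Sum>i\<in>S. a i \<alpha> * cnj (u i q)) = of_real R * cnj (\<zeta> \<alpha> q) + v \<alpha>" if q: "q \<in> W" and \<alpha>: "bl \<alpha> = s" for q \<alpha>
  proof -
    have "Z (e \<alpha>) (\<lambda>q. \<Sum>i\<in>S. u i q * cnj (u i q)) q = Z (e \<alpha>) (\<lambda>q. of_real R * (\<Sum>\<alpha>\<in>S. \<zeta> \<alpha> q * cnj (\<zeta> \<alpha> q)) + d
       + (\<Sum>\<alpha>\<in>S. v \<alpha> * \<zeta> \<alpha> q) + (\<Sum>\<alpha>\<in>S. cnj (v \<alpha> * \<zeta> \<alpha> q))) q"
      by (rule d_cong[OF derpair_Z q]) (use id' in \<open>simp_all only: su sm_sum sm_mult sm_cnj\<close>)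
    moreover have "Z (e \<alpha>) (\<lambda>q. \<Sum>i\<in>S. u i q * cnj (u i q)) q = (\<Sum>i\<in>S. a i \<alpha> * cnj (u i q))"
      by (simp add: d_sum[OF derpair_Z q] d_mult[OF derpair_Z q] d_cnj[OF derpair_Z q] du[OF q \<alpha>])
    moreover have "Z (e \<alpha>) (\<lambda>q. of_real R * (\<Sum>\<alpha>\<in>S. \<zeta> \<alpha> q * cnj (\<zeta> \<alpha> q)) + d
       + (\<Sum>\<alpha>\<in>S. v \<alpha> * \<zeta> \<alpha> q) + (\<Sum>\<alpha>\<in>S. cnj (v \<alpha> * \<zeta> \<alpha> q))) q
      = of_real R * (\<Sum>\<beta>\<in>S. cnj (\<zeta> \<beta> q) * (if \<beta> = \<alpha> then 1 else 0)) + (\<Sum>\<beta>\<in>S. v \<beta> * (if \<beta> = \<alpha> then 1 else 0))"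
      by (simp add: d_add[OF derpair_Z q] d_sum[OF derpair_Z q] d_mult[OF derpair_Z q] d_cmult[OF derpair_Z q] d_cnj[OF derpair_Z q]
         d_const[OF derpair_Z q] d\<zeta>[OF q] mult.commute cong: if_cong)
    ultimately show ?thesis unfolding delta[OF \<alpha>] by simp
  qed
  have I: "(\<Sum>i\<in>S. a i \<alpha> * cnj (a i \<beta>)) = (if \<alpha> = \<beta> then of_real R else 0)" if \<alpha>: "bl \<alpha> = s" and \<beta>: "bl \<beta> = s" for \<alpha> \<beta>
  proof -
    have "Zb (e \<beta>) (\<lambda>q. \<Sum>i\<in>S. a i \<alpha> * cnj (u i q)) q = Zb (e \<beta>) (\<lambda>q. of_real R * cnj (\<zeta> \<alpha> q) + v \<alpha>) q"
      by (rule d_cong[OF derpair_Zb q]) (use E[OF _ \<alpha>] in auto)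
    then show ?thesis
      by (simp add: d_sum[OF derpair_Zb q] d_add[OF derpair_Zb q] d_cmult[OF derpair_Zb q] d_cnj[OF derpair_Zb q] d_const[OF derpair_Zb q] du[OF q \<beta>] d\<zeta>[OF q] split: if_splits)
  qed
  have sumI: "(\<Sum>i\<in>S. a i \<alpha> * cnj (\<Sum>\<beta>\<in>S. a i \<beta> * \<zeta> \<beta> q)) = of_real R * cnj (\<zeta> \<alpha> q)" if \<alpha>: "bl \<alpha> = s" for \<alpha>
  proof -
    have "(\<Sum>i\<in>S. a i \<alpha> * cnj (\<Sum>\<beta>\<in>S. a i \<beta> * \<zeta> \<beta> q)) = (\<Sum>i\<in>S. \<Sum>\<beta>\<in>S. cnj (\<zeta> \<beta> q) * (a i \<alpha> * cnj (a i \<beta>)))"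
      by (simp add: sum_distrib_left mult_ac)
    also have "\<dots> = (\<Sum>\<beta>\<in>S. cnj (\<zeta> \<beta> q) * (\<Sum>i\<in>S. a i \<alpha> * cnj (a i \<beta>)))"
      by (subst sum.swap) (simp add: sum_distrib_left)
    also have "\<dots> = (\<Sum>\<beta>\<in>S. if \<beta> = \<alpha> then of_real R * cnj (\<zeta> \<alpha> q) else 0)"
      using I[OF \<alpha>] by (intro sum.cong refl) auto
    finally show ?thesis using \<alpha> by (simp add: sum.delta)
  qed
  have II: "(\<Sum>i\<in>S. a i \<alpha> * cnj (u0 i)) = v \<alpha>" if \<alpha>: "bl \<alpha> = s" for \<alpha>
  proof -
    have "(\<Sum>i\<in>S. a i \<alpha> * cnj (u i q)) = (\<Sum>i\<in>S. a i \<alpha> * cnj (u0 i)) + (\<Sum>i\<in>S. a i \<alpha> * cnj (\<Sum>\<beta>\<in>S. a i \<beta> * \<zeta> \<beta> q))"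
      unfolding u sum.distrib[symmetric] by (intro sum.cong refl) (simp add: algebra_simps)
    then show ?thesis using E[OF q \<alpha>] unfolding sumI[OF \<alpha>] by (simp add: add.commute)
  qed
  show "bl \<alpha> = s \<Longrightarrow> bl \<beta> = s \<Longrightarrow> (\<Sum>i\<in>S. a i \<alpha> * cnj (a i \<beta>)) = (if \<alpha> = \<beta> then of_real R else 0)" by (rule I)
  show "bl \<alpha> = s \<Longrightarrow> (\<Sum>i\<in>S. a i \<alpha> * cnj (u0 i)) = v \<alpha>" by (rule II)
  have "(\<Sum>i\<in>S. u i q * cnj (u i q)) = (\<Sum>i\<in>S. u0 i * cnj (u i q)) + (\<Sum>i\<in>S. (\<Sum>\<alpha>\<in>S. a i \<alpha> * \<zeta> \<alpha> q) * cnj (u i q))"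
    unfolding sum.distrib[symmetric] by (intro sum.cong refl) (subst u, simp add: algebra_simps)
  also have "(\<Sum>i\<in>S. (\<Sum>\<alpha>\<in>S. a i \<alpha> * \<zeta> \<alpha> q) * cnj (u i q)) = (\<Sum>\<alpha>\<in>S. \<zeta> \<alpha> q * (\<Sum>i\<in>S. a i \<alpha> * cnj (u i q)))"
    unfolding sum_distrib_left sum_distrib_right by (subst sum.swap) (simp add: mult_ac)
  also have "\<dots> = (\<Sum>\<alpha>\<in>S. \<zeta> \<alpha> q * (of_real R * cnj (\<zeta> \<alpha> q) + v \<alpha>))"
    using E[OF q] by (intro sum.cong refl) auto
  also have "\<dots> = of_real R * (\<Sum>\<alpha>\<in>S. \<zeta> \<alpha> q * cnj (\<zeta> \<alpha> q)) + (\<Sum>\<alpha>\<in>S. v \<alpha> * \<zeta> \<alpha> q)"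
    unfolding sum_distrib_left sum.distrib[symmetric] by (intro sum.cong refl) (simp add: algebra_simps)
  also have "(\<Sum>i\<in>S. u0 i * cnj (u i q)) = (\<Sum>i\<in>S. u0 i * cnj (u0 i)) + (\<Sum>\<alpha>\<in>S. cnj (v \<alpha> * \<zeta> \<alpha> q))"
  proof -
    have "(\<Sum>i\<in>S. u0 i * cnj (u i q)) = (\<Sum>i\<in>S. u0 i * cnj (u0 i)) + (\<Sum>i\<in>S. u0 i * cnj (\<Sum>\<alpha>\<in>S. a i \<alpha> * \<zeta> \<alpha> q))"
      unfolding u sum.distrib[symmetric] by (intro sum.cong refl) (simp add: algebra_simps)
    also have "(\<Sum>i\<in>S. u0 i * cnj (\<Sum>\<alpha>\<in>S. a i \<alpha> * \<zeta> \<alpha> q)) = (\<Sum>i\<in>S. \<Sum>\<alpha>\<in>S. cnj (\<zeta> \<alpha> q) * cnj (a i \<alpha> * cnj (u0 i)))"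
      by (simp add: sum_distrib_left mult_ac)
    also have "\<dots> = (\<Sum>\<alpha>\<in>S. cnj (\<zeta> \<alpha> q) * cnj (\<Sum>i\<in>S. a i \<alpha> * cnj (u0 i)))"
      unfolding cnj_sum sum_distrib_left by (rule sum.swap)
    also have "\<dots> = (\<Sum>\<alpha>\<in>S. cnj (v \<alpha> * \<zeta> \<alpha> q))"
      using II by (intro sum.cong refl) simp
    finally show ?thesis .
  qed
  finally show "(\<Sum>i\<in>S. u0 i * cnj (u0 i)) = d" using id'[OF q] by simp
qed

lemma flat_case_inversion:
  assumes q0: "q0 \<in> W" and \<epsilon>: "\<epsilon> = 1"
  obtains a b :: "'n \<Rightarrow> complex" and L :: "'n \<Rightarrow> 'n \<Rightarrow> complex" and t0 t1 :: real where
    "\<And>q. q \<in> W \<Longrightarrow> om q = wf q + (of_real t0 + \<i> * (\<Sum>\<alpha>\<in>S. a \<alpha> * cnj (a \<alpha>))) + 2 * \<i> * (\<Sum>\<alpha>\<in>S. fst q $ \<alpha> * cnj (a \<alpha>))"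
    "\<And>\<alpha> \<beta>. bl \<alpha> = s \<Longrightarrow> bl \<beta> = s \<Longrightarrow> (\<Sum>i\<in>S. cnj (L i \<alpha>) * L i \<beta>) = (if \<alpha> = \<beta> then 1 else 0)"
    "\<And>q i. q \<in> W \<Longrightarrow> bl i = s \<Longrightarrow> F q $ i = (\<Sum>\<alpha>\<in>S. L i \<alpha> * (of_real r * ((fst q $ \<alpha> + a \<alpha>) / om q))) + b i"
    "\<And>q. q \<in> W \<Longrightarrow> G q = of_real t1 + \<i> * (\<Sum>\<alpha>\<in>S. b \<alpha> * cnj (b \<alpha>)) + of_real (r\<^sup>2) * (- (1 / om q))
       + 2 * \<i> * (\<Sum>i\<in>S. (\<Sum>\<alpha>\<in>S. L i \<alpha> * (of_real r * ((fst q $ \<alpha> + a \<alpha>) / om q))) * cnj (b i))"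
proof -
  obtain \<omega> oc where oq: "\<And>q. q \<in> W \<Longrightarrow> om q = \<omega> + \<epsilon> * wf q + (\<Sum>\<alpha>\<in>S. oc \<alpha> * fst q $ \<alpha>)"
    using om_affine by blast
  have ex: "\<forall>i. \<exists>c0. \<exists>c1 c. bl i = s \<longrightarrow> (\<forall>q\<in>W. U i q = c0 + c1 * wf q + (\<Sum>\<alpha>\<in>S. c \<alpha> * fst q $ \<alpha>))"
    using U_affine by blast
  from choice[OF ex] obtain u0 where ex1: "\<forall>i. \<exists>c1. \<exists>c. bl i = s \<longrightarrow> (\<forall>q\<in>W. U i q = u0 i + c1 * wf q + (\<Sum>\<alpha>\<in>S. c \<alpha> * fst q $ \<alpha>))" ..
  from choice[OF ex1] obtain b where ex2: "\<forall>i. \<exists>c. bl i = s \<longrightarrow> (\<forall>q\<in>W. U i q = u0 i + b i * wf q + (\<Sum>\<alpha>\<in>S. c \<alpha> * fst q $ \<alpha>))" ..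
  from choice[OF ex2] obtain ua where "\<forall>i. bl i = s \<longrightarrow> (\<forall>q\<in>W. U i q = u0 i + b i * wf q + (\<Sum>\<alpha>\<in>S. ua i \<alpha> * fst q $ \<alpha>))" ..
  then have Ui: "U i q = u0 i + b i * wf q + (\<Sum>\<alpha>\<in>S. ua i \<alpha> * fst q $ \<alpha>)" if "bl i = s" "q \<in> W" for i q
    using that by blast
  \<comment> \<open>Chosen so that the linear part of om is 2 i times the product of z with a, as in
    the last component of \<open>phi_map\<close>.\<close>
  define a where "a \<alpha> = cnj (oc \<alpha> / (2 * \<i>))" for \<alpha>
  define \<zeta> where "\<zeta> \<alpha> q = fst q $ \<alpha> + a \<alpha>" for \<alpha> and q :: "(complex^'n) \<times> real"
  \<comment> \<open>Splitting b i om off from \<open>U i\<close> removes \<open>wf\<close>; the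
    remainder is affine in the translated variable \<zeta>.\<close>
  define AA where "AA i \<alpha> = ua i \<alpha> - b i * oc \<alpha>" for i \<alpha>
  define c where "c i = u0 i - b i * \<omega> - (\<Sum>\<alpha>\<in>S. AA i \<alpha> * a \<alpha>)" for i
  define uu where "uu i q = c i + (\<Sum>\<alpha>\<in>S. AA i \<alpha> * \<zeta> \<alpha> q)" for i and q :: "(complex^'n) \<times> real"
  have U: "U i q = uu i q + b i * om q" if "bl i = s" "q \<in> W" for i q
  proof -
    have "u0 i + b i * wf q + (\<Sum>\<alpha>\<in>S. ua i \<alpha> * fst q $ \<alpha>) = uu i q + b i * (\<omega> + \<epsilon> * wf q + (\<Sum>\<alpha>\<in>S. oc \<alpha> * fst q $ \<alpha>))"
      unfolding uu_def c_def AA_def \<zeta>_def \<epsilon>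
      by (simp add: algebra_simps sum.distrib sum_subtractf sum_distrib_left)
    also have "\<omega> + \<epsilon> * wf q + (\<Sum>\<alpha>\<in>S. oc \<alpha> * fst q $ \<alpha>) = om q" using oq[OF that(2)] by simp
    finally show ?thesis using Ui[OF that] by simp
  qed
  have TU: "T (U i) q = b i" if "bl i = s" "q \<in> W" for i q
    by (rule affine_derivs(1)[OF Ui[OF that(1)] _ that(2)]) simp_all
  define g where "g = T V q0"
  have TV: "T V q = g" if "q \<in> W" for q unfolding g_def by (rule T_V_const[OF that q0])
  define N where "N = (\<Sum>i\<in>S. b i * cnj (b i))"
  define QQ where "QQ q = (\<Sum>i\<in>S. cnj (b i) * uu i q)" for q
  have N_real: "cnj N = N" by (simp add: N_def mult.commute)
  \<comment> \<open>The conjugate of \<open>identity2\<close>. Since \<open>T V\<close> and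
    \<open>T (U i)\<close> are constants, it expresses V through om and U.\<close>
  have id2: "cnj g * om q + 2 * \<i> * (\<Sum>i\<in>S. cnj (b i) * U i q) - V q = of_real (r\<^sup>2)" if q: "q \<in> W" for q
  proof -
    have "(\<Sum>i\<in>S. T (U i) q * cnj (U i q)) = (\<Sum>i\<in>S. b i * cnj (U i q))"
      using TU[OF _ q] by (intro sum.cong) auto
    then have "cnj (cnj (om q) * g - 2 * \<i> * (\<Sum>i\<in>S. b i * cnj (U i q)) - cnj (V q)) = of_real (r\<^sup>2)"
      using identity2[OF q] unfolding TV[OF q] \<epsilon> by simp
    then show ?thesis by (simp add: cnj_sum algebra_simps)
  qed
  have gN: "g - cnj g = 2 * \<i> * N"
  proof -
    have "T (\<lambda>q. cnj g * om q + 2 * \<i> * (\<Sum>i\<in>S. cnj (b i) * U i q) - V q) q0 = T (\<lambda>_. of_real (r\<^sup>2)) q0"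
      by (rule d_cong[OF derpair_ddir q0]) (use id2 in auto)
    moreover have "T (\<lambda>q. cnj g * om q + 2 * \<i> * (\<Sum>i\<in>S. cnj (b i) * U i q) - V q) q0
      = cnj g * T om q0 + 2 * \<i> * (\<Sum>i\<in>S. cnj (b i) * T (U i) q0) - T V q0"
      by (simp only: d_add[OF derpair_ddir q0] d_diff[OF derpair_ddir q0] d_cmult[OF derpair_ddir q0] d_sum[OF derpair_ddir q0]
         sm_add sm_diff sm_mult sm_sum sm_const sm_F_nth sm_G' om(1))
    moreover have "(\<Sum>i\<in>S. cnj (b i) * T (U i) q0) = N"
      unfolding N_def using TU[OF _ q0] by (intro sum.cong) (auto simp: mult.commute)
    ultimately have "cnj g + 2 * \<i> * N - g = 0"
      using om'(2)[OF q0] TV[OF q0] d_const[OF derpair_ddir q0] by (simp add: \<epsilon>)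
    then show ?thesis by (simp add: algebra_simps)
  qed
  have bU: "(\<Sum>i\<in>S. cnj (b i) * U i q) = QQ q + N * om q" if q: "q \<in> W" for q
    unfolding QQ_def N_def sum_distrib_right sum.distrib[symmetric]
    by (intro sum.cong refl) (use U[OF _ q] in \<open>simp add: algebra_simps\<close>)
  have V: "V q = g * om q - of_real (r\<^sup>2) + 2 * \<i> * QQ q" if q: "q \<in> W" for q
  proof -
    have "V q = cnj g * om q + 2 * \<i> * (QQ q + N * om q) - of_real (r\<^sup>2)"
      using id2[OF q] unfolding bU[OF q] by (simp add: algebra_simps)
    also have "\<dots> = (cnj g + 2 * \<i> * N) * om q - of_real (r\<^sup>2) + 2 * \<i> * QQ q" by (simp add: algebra_simps)
    also have "cnj g + 2 * \<i> * N = g" unfolding gN[symmetric] by simp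
    finally show ?thesis .
  qed
  define Na where "Na = (\<Sum>\<alpha>\<in>S. a \<alpha> * cnj (a \<alpha>))"
  define X where "X q = (\<Sum>\<alpha>\<in>S. fst q $ \<alpha> * cnj (a \<alpha>))" for q :: "(complex^'n) \<times> real"
  define Z2 where "Z2 q = (\<Sum>\<alpha>\<in>S. fst q $ \<alpha> * cnj (fst q $ \<alpha>))" for q :: "(complex^'n) \<times> real"
  have oca: "oc \<alpha> = 2 * \<i> * cnj (a \<alpha>)" for \<alpha> by (simp add: a_def)
  have ow: "om q = \<omega> + wf q + 2 * \<i> * X q" if "q \<in> W" for q
    unfolding oq[OF that] oca \<epsilon> X_def by (simp add: sum_distrib_left mult_ac)
  define P where "P q = (\<Sum>i\<in>S. uu i q * cnj (uu i q))" for q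
  define w2 where "w2 = (\<omega> - cnj \<omega>) / (2 * \<i>)"
  define d where "d = of_real (r\<^sup>2) * (w2 - Na)"
  \<comment> \<open>\<open>identity1\<close> with U and V inserted: the terms containing om cancel
    by \<open>gN\<close>, and completing the square to z + a leaves the constant d.\<close>
  have P: "P q = of_real (r\<^sup>2) * (\<Sum>\<alpha>\<in>S. \<zeta> \<alpha> q * cnj (\<zeta> \<alpha> q)) + d" if q: "q \<in> W" for q
  proof -
    define o' V' w' where "o' = cnj (om q)" and "V' = cnj (V q)" and "w' = cnj (wf q)"
    define Q' where "Q' = cnj (QQ q)"
    have UU: "(\<Sum>i\<in>S. U i q * cnj (U i q)) = P q + QQ q * o' + Q' * om q + N * (om q * o')"
      unfolding P_def QQ_def N_def Q'_def o'_def cnj_sum sum_distrib_right sum.distrib[symmetric]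
      by (intro sum.cong refl) (use U[OF _ q] in \<open>simp add: algebra_simps\<close>)
    have \<zeta>\<zeta>: "(\<Sum>\<alpha>\<in>S. \<zeta> \<alpha> q * cnj (\<zeta> \<alpha> q)) = Z2 q + X q + cnj (X q) + Na"
      unfolding Z2_def X_def Na_def cnj_sum sum.distrib[symmetric] \<zeta>_def
      by (intro sum.cong refl) (simp add: algebra_simps)
    have V': "V' = cnj g * o' - of_real (r\<^sup>2) - 2 * \<i> * Q'" unfolding V'_def V[OF q] o'_def Q'_def by simp
    have o': "o' = cnj \<omega> + w' - 2 * \<i> * cnj (X q)" unfolding o'_def ow[OF q] w'_def by simp
    have I: "V q * o' - V' * om q = 2 * \<i> * (P q + QQ q * o' + Q' * om q + N * (om q * o')) + of_real (r\<^sup>2) * (wf q - w' - 2 * \<i> * Z2 q)"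
      using identity1[OF q] unfolding UU Z2_def o'_def V'_def w'_def .
    have "V q * o' - V' * om q = (g - cnj g) * (om q * o') + of_real (r\<^sup>2) * (om q - o') + 2 * \<i> * (QQ q * o' + Q' * om q)"
      unfolding V[OF q] V' by (simp add: algebra_simps)
    then have "2 * \<i> * P q = of_real (r\<^sup>2) * (om q - o' - (wf q - w' - 2 * \<i> * Z2 q))"
      using I unfolding gN by algebra
    also have "om q - o' - (wf q - w' - 2 * \<i> * Z2 q) = (\<omega> - cnj \<omega>) + 2 * \<i> * (X q + cnj (X q) + Z2 q)"
      unfolding o' ow[OF q] by (simp add: algebra_simps)
    also have "\<omega> - cnj \<omega> = 2 * \<i> * w2" by (simp add: w2_def)
    also have "of_real (r\<^sup>2) * (2 * \<i> * w2 + 2 * \<i> * (X q + cnj (X q) + Z2 q))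
       = 2 * \<i> * (of_real (r\<^sup>2) * (Z2 q + X q + cnj (X q) + Na) + d)"
      unfolding d_def by (simp add: algebra_simps)
    finally show ?thesis unfolding \<zeta>\<zeta> by simp
  qed
  have idq: "(\<Sum>i\<in>S. (c i + (\<Sum>\<alpha>\<in>S. AA i \<alpha> * (fst q $ \<alpha> + a \<alpha>))) * cnj (c i + (\<Sum>\<alpha>\<in>S. AA i \<alpha> * (fst q $ \<alpha> + a \<alpha>))))
     = of_real (r\<^sup>2) * (\<Sum>\<alpha>\<in>S. (fst q $ \<alpha> + a \<alpha>) * cnj (fst q $ \<alpha> + a \<alpha>)) + d
       + (\<Sum>\<alpha>\<in>S. 0 * (fst q $ \<alpha> + a \<alpha>)) + (\<Sum>\<alpha>\<in>S. cnj (0 * (fst q $ \<alpha> + a \<alpha>)))" if "q \<in> W" for q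
    using P[OF that] unfolding P_def uu_def \<zeta>_def by simp
  note fi = flat_isometry[OF q0 idq]
  have r2: "0 < r\<^sup>2" using om(2) by simp
  \<comment> \<open>The norm identity has no linear term in \<zeta>, so c is orthogonal to all
    columns. Then d = 0, which says Im \<omega> = |a|^2.\<close>
  have c0: "c i = 0" if "bl i = s" for i
    using isometry_surj[OF r2, of S AA c i] fi(1,2) that by simp
  then have "d = 0" using fi(3) by simp
  then have "(\<omega> - cnj \<omega>) / (2 * \<i>) = Na" using om(2) by (simp add: d_def w2_def)
  then have \<omega>: "\<omega> = of_real (Re \<omega>) + \<i> * Na"
  proof -
    have "(\<omega> - cnj \<omega>) = 2 * \<i> * Na" unfolding \<open>_ = Na\<close>[symmetric] by simp
    moreover have "\<omega> - cnj \<omega> = of_real (2 * Im \<omega>) * \<i>" by (rule complex_diff_cnj)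
    ultimately have "of_real (Im \<omega>) = Na" by simp
    then show ?thesis using complex_eq[of \<omega>] by simp
  qed
  have g: "g = of_real (Re g) + \<i> * N"
  proof -
    have "g - cnj g = of_real (2 * Im g) * \<i>" by (rule complex_diff_cnj)
    then have "of_real (Im g) = N" using gN by simp
    then show ?thesis using complex_eq[of g] by simp
  qed
  define L where "L i \<alpha> = AA i \<alpha> / of_real r" for i \<alpha>
  have rL: "(\<Sum>\<alpha>\<in>S. L i \<alpha> * (of_real r * ((fst q $ \<alpha> + a \<alpha>) / om q))) = uu i q / om q" if "bl i = s" for i q
    unfolding uu_def c0[OF that] L_def \<zeta>_def using om(2) by (simp add: sum_divide_distrib)
  show ?thesis
  proof (rule that[of "Re \<omega>" a L b "Re g"])
    show "om q = wf q + (of_real (Re \<omega>) + \<i> * (\<Sum>\<alpha>\<in>S. a \<alpha> * cnj (a \<alpha>))) + 2 * \<i> * (\<Sum>\<alpha>\<in>S. fst q $ \<alpha> * cnj (a \<alpha>))"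
      if "q \<in> W" for q
      unfolding ow[OF that] X_def Na_def[symmetric] \<omega>[symmetric] by (simp add: add.commute)
    show "(\<Sum>i\<in>S. cnj (L i \<alpha>) * L i \<beta>) = (if \<alpha> = \<beta> then 1 else 0)" if ab: "bl \<alpha> = s" "bl \<beta> = s" for \<alpha> \<beta>
    proof -
      have "(\<Sum>i\<in>S. cnj (L i \<alpha>) * L i \<beta>) = (\<Sum>i\<in>S. AA i \<beta> * cnj (AA i \<alpha>)) / of_real (r\<^sup>2)"
        unfolding sum_divide_distrib by (intro sum.cong refl) (simp add: L_def power2_eq_square)
      then show ?thesis using fi(1)[OF _ ab(2,1)] om(2) by auto
    qed
    show "F q $ i = (\<Sum>\<alpha>\<in>S. L i \<alpha> * (of_real r * ((fst q $ \<alpha> + a \<alpha>) / om q))) + b i"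
      if "q \<in> W" "bl i = s" for q i
      unfolding rL[OF that(2)] using U[OF that(2,1)] om'(1)[OF that(1)] by (simp add: field_simps)
    show "G q = of_real (Re g) + \<i> * (\<Sum>\<alpha>\<in>S. b \<alpha> * cnj (b \<alpha>)) + of_real (r\<^sup>2) * (- (1 / om q))
       + 2 * \<i> * (\<Sum>i\<in>S. (\<Sum>\<alpha>\<in>S. L i \<alpha> * (of_real r * ((fst q $ \<alpha> + a \<alpha>) / om q))) * cnj (b i))"
      if q: "q \<in> W" for q
    proof -
      have "(\<Sum>i\<in>S. (\<Sum>\<alpha>\<in>S. L i \<alpha> * (of_real r * ((fst q $ \<alpha> + a \<alpha>) / om q))) * cnj (b i)) = QQ q / om q"
        unfolding QQ_def sum_divide_distrib by (intro sum.cong refl) (simp only: mem_Collect_eq rL, simp)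
      moreover have "G q = V q / om q" using om'(1)[OF q] by simp
      ultimately show ?thesis
        unfolding V[OF q] N_def[symmetric] g[symmetric] using om'(1)[OF q] by (simp add: field_simps)
    qed
  qed
qed

text \<open>For \<epsilon> = 0 the gauge gives rho = 0, hence TF = 0; so F has no term in
  \<open>wf\<close>, and \<open>identity2\<close> reduces to \<open>T V\<close> = r^2.\<close>

lemma flat_case_affine:
  assumes q0: "q0 \<in> W" and \<epsilon>: "\<epsilon> = 0"
  obtains b :: "'n \<Rightarrow> complex" and L :: "'n \<Rightarrow> 'n \<Rightarrow> complex" and t1 :: real where
    "\<And>\<alpha> \<beta>. bl \<alpha> = s \<Longrightarrow> bl \<beta> = s \<Longrightarrow> (\<Sum>i\<in>S. cnj (L i \<alpha>) * L i \<beta>) = (if \<alpha> = \<beta> then 1 else 0)"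
    "\<And>q i. q \<in> W \<Longrightarrow> bl i = s \<Longrightarrow> F q $ i = (\<Sum>\<alpha>\<in>S. L i \<alpha> * (of_real r * fst q $ \<alpha>)) + b i"
    "\<And>q. q \<in> W \<Longrightarrow> G q = of_real t1 + \<i> * (\<Sum>\<alpha>\<in>S. b \<alpha> * cnj (b \<alpha>)) + of_real (r\<^sup>2) * wf q
       + 2 * \<i> * (\<Sum>i\<in>S. (\<Sum>\<alpha>\<in>S. L i \<alpha> * (of_real r * fst q $ \<alpha>)) * cnj (b i))"
proof -
  have o1: "om q = 1" for q using om(3) \<epsilon> by auto
  have TF0: "TF q = 0" if q: "q \<in> W" for q
  proof (rule ccontr)
    assume "TF q \<noteq> 0"
    then have "0 < Re (nTF q)" using nTF_pos q by blast
    moreover have "rho q = 0" using om'(4)[OF q] \<epsilon> by simp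
    then have "nTF q = 0" using rho_real_part[OF q] q by simp
    ultimately show False by simp
  qed
  have TFi: "T (\<lambda>q. F q $ i) q = 0" if "q \<in> W" for q i using TF0[OF that] by (metis vd_nth zero_index)
  have ex: "\<forall>i. \<exists>c0. \<exists>c1 c. bl i = s \<longrightarrow> (\<forall>q\<in>W. U i q = c0 + c1 * wf q + (\<Sum>\<alpha>\<in>S. c \<alpha> * fst q $ \<alpha>))"
    using U_affine by blast
  from choice[OF ex] obtain b where ex1: "\<forall>i. \<exists>c1. \<exists>c. bl i = s \<longrightarrow> (\<forall>q\<in>W. U i q = b i + c1 * wf q + (\<Sum>\<alpha>\<in>S. c \<alpha> * fst q $ \<alpha>))" ..
  from choice[OF ex1] obtain u1 where ex2: "\<forall>i. \<exists>c. bl i = s \<longrightarrow> (\<forall>q\<in>W. U i q = b i + u1 i * wf q + (\<Sum>\<alpha>\<in>S. c \<alpha> * fst q $ \<alpha>))" ..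
  from choice[OF ex2] obtain AA where "\<forall>i. bl i = s \<longrightarrow> (\<forall>q\<in>W. U i q = b i + u1 i * wf q + (\<Sum>\<alpha>\<in>S. AA i \<alpha> * fst q $ \<alpha>))" ..
  then have Ui: "U i q = b i + u1 i * wf q + (\<Sum>\<alpha>\<in>S. AA i \<alpha> * fst q $ \<alpha>)" if "bl i = s" "q \<in> W" for i q
    using that by blast
  have u1: "u1 i = 0" if i: "bl i = s" for i
    using affine_derivs(1)[OF Ui[OF i] _ q0] TFi[OF q0, of i] by (simp add: o1)
  have Fi: "F q $ i = b i + (\<Sum>\<alpha>\<in>S. AA i \<alpha> * fst q $ \<alpha>)" if "bl i = s" "q \<in> W" for i q
    using Ui[OF that] u1[OF that(1)] by (simp add: o1)
  have "T V q = of_real (r\<^sup>2)" if q: "q \<in> W" for q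
  proof -
    have "T (U i) q = 0" for i using TFi[OF q] by (simp add: o1)
    then show ?thesis using identity2[OF q] by (simp add: o1 \<epsilon>)
  qed
  then obtain g va where Vq: "\<And>q. q \<in> W \<Longrightarrow> V q = g + of_real (r\<^sup>2) * wf q + (\<Sum>\<alpha>\<in>S. va \<alpha> * fst q $ \<alpha>)"
    using V_affine by blast
  define v where "v \<alpha> = va \<alpha> / (2 * \<i>)" for \<alpha>
  define d where "d = (g - cnj g) / (2 * \<i>)"
  have vv: "(\<Sum>\<alpha>\<in>S. va \<alpha> * fst q $ \<alpha>) = 2 * \<i> * (\<Sum>\<alpha>\<in>S. v \<alpha> * fst q $ \<alpha>)" for q :: "(complex^'n) \<times> real"
    unfolding sum_distrib_left by (intro sum.cong refl) (simp add: v_def)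
  have idq: "(\<Sum>i\<in>S. (b i + (\<Sum>\<alpha>\<in>S. AA i \<alpha> * (fst q $ \<alpha> + 0))) * cnj (b i + (\<Sum>\<alpha>\<in>S. AA i \<alpha> * (fst q $ \<alpha> + 0))))
     = of_real (r\<^sup>2) * (\<Sum>\<alpha>\<in>S. (fst q $ \<alpha> + 0) * cnj (fst q $ \<alpha> + 0)) + d
       + (\<Sum>\<alpha>\<in>S. v \<alpha> * (fst q $ \<alpha> + 0)) + (\<Sum>\<alpha>\<in>S. cnj (v \<alpha> * (fst q $ \<alpha> + 0)))" (is "?P = ?R") if q: "q \<in> W" for q
  proof -
    define x y z where "x = (\<Sum>\<alpha>\<in>S. v \<alpha> * fst q $ \<alpha>)" and "y = (\<Sum>\<alpha>\<in>S. fst q $ \<alpha> * cnj (fst q $ \<alpha>))" and "z = cnj (wf q)"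
    define p where "p = ?P"
    have P: "p = (\<Sum>i\<in>S. U i q * cnj (U i q))" unfolding p_def
      using Fi[OF _ q] by (intro sum.cong) (auto simp: o1)
    have R: "?R = of_real (r\<^sup>2) * y + d + x + cnj x" by (simp add: x_def y_def)
    have V: "V q = g + of_real (r\<^sup>2) * wf q + 2 * \<i> * x" unfolding Vq[OF q] vv x_def ..
    then have V': "cnj (V q) = cnj g + of_real (r\<^sup>2) * z - 2 * \<i> * cnj x" by (simp add: z_def)
    have "V q - cnj (V q) = 2 * \<i> * p + of_real (r\<^sup>2) * (wf q - z - 2 * \<i> * y)"
      using identity1[OF q] unfolding P[symmetric] y_def z_def by (simp add: o1)
    then have "2 * \<i> * p = (g - cnj g) + 2 * \<i> * (of_real (r\<^sup>2) * y + x + cnj x)"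
      unfolding V V' by (simp add: algebra_simps z_def)
    also have "g - cnj g = 2 * \<i> * d" by (simp add: d_def)
    also have "2 * \<i> * d + 2 * \<i> * (of_real (r\<^sup>2) * y + x + cnj x) = 2 * \<i> * (of_real (r\<^sup>2) * y + d + x + cnj x)"
      by (simp only: algebra_simps)
    also have "\<dots> = 2 * \<i> * ?R" by (simp only: R)
    finally show ?thesis unfolding p_def[symmetric] by (subst (asm) mult_left_cancel) simp_all
  qed
  note fi = flat_isometry[OF q0 idq]
  define L where "L i \<alpha> = AA i \<alpha> / of_real r" for i \<alpha>
  have rL: "(\<Sum>\<alpha>\<in>S. L i \<alpha> * (of_real r * fst q $ \<alpha>)) = (\<Sum>\<alpha>\<in>S. AA i \<alpha> * fst q $ \<alpha>)" for i and q :: "(complex^'n) \<times> real"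
    unfolding L_def using om(2) by simp
  have g: "g = of_real (Re g) + \<i> * (\<Sum>\<alpha>\<in>S. b \<alpha> * cnj (b \<alpha>))"
  proof -
    have "d = of_real (Im g)" unfolding d_def complex_diff_cnj by (simp add: complex_eq_iff)
    then show ?thesis using complex_eq[of g] fi(3) by metis
  qed
  show ?thesis
  proof (rule that[of L b "Re g"])
    show "(\<Sum>i\<in>S. cnj (L i \<alpha>) * L i \<beta>) = (if \<alpha> = \<beta> then 1 else 0)" if ab: "bl \<alpha> = s" "bl \<beta> = s" for \<alpha> \<beta>
    proof -
      have "(\<Sum>i\<in>S. cnj (L i \<alpha>) * L i \<beta>) = (\<Sum>i\<in>S. AA i \<beta> * cnj (AA i \<alpha>)) / of_real (r\<^sup>2)"
        unfolding sum_divide_distrib by (intro sum.cong refl) (simp add: L_def power2_eq_square)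
      then show ?thesis using fi(1)[OF _ ab(2,1)] om(2) by auto
    qed
    show "F q $ i = (\<Sum>\<alpha>\<in>S. L i \<alpha> * (of_real r * fst q $ \<alpha>)) + b i" if "q \<in> W" "bl i = s" for q i
      unfolding rL Fi[OF that(2,1)] by simp
    show "G q = of_real (Re g) + \<i> * (\<Sum>\<alpha>\<in>S. b \<alpha> * cnj (b \<alpha>)) + of_real (r\<^sup>2) * wf q
       + 2 * \<i> * (\<Sum>i\<in>S. (\<Sum>\<alpha>\<in>S. L i \<alpha> * (of_real r * fst q $ \<alpha>)) * cnj (b i))" if q: "q \<in> W" for q
    proof -
      have "(\<Sum>i\<in>S. (\<Sum>\<alpha>\<in>S. AA i \<alpha> * fst q $ \<alpha>) * cnj (b i)) = (\<Sum>\<alpha>\<in>S. (\<Sum>i\<in>S. AA i \<alpha> * cnj (b i)) * fst q $ \<alpha>)"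
        unfolding sum_distrib_right by (subst sum.swap) (simp add: mult_ac)
      also have "\<dots> = (\<Sum>\<alpha>\<in>S. v \<alpha> * fst q $ \<alpha>)" using fi(2) by (intro sum.cong) auto
      finally have "V q = g + of_real (r\<^sup>2) * wf q + 2 * \<i> * (\<Sum>i\<in>S. (\<Sum>\<alpha>\<in>S. AA i \<alpha> * fst q $ \<alpha>) * cnj (b i))"
        unfolding Vq[OF q] vv by simp
      then show ?thesis unfolding rL g[symmetric] by (simp add: o1)
    qed
  qed
qed

end

text \<open>If \<open>L\<close> has orthogonal columns of norm \<open>sqrt R\<close> then \<open>L L\<^sup>* / R\<close> is an orthogonal projection, so its diagonal
  entries are at most 1 while its trace is the number of columns.\<close>

lemma orthogonal_columns_card:
  fixes L :: "'a \<Rightarrow> 'b \<Rightarrow> complex" and R :: real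
  assumes fin: "finite J" "finite I" and R: "0 < R"
    and orth: "\<And>\<alpha> \<beta>. \<alpha> \<in> I \<Longrightarrow> \<beta> \<in> I \<Longrightarrow> (\<Sum>\<mu>\<in>J. L \<mu> \<alpha> * cnj (L \<mu> \<beta>)) = (if \<alpha> = \<beta> then of_real R else 0)"
  shows "card I \<le> card J"
proof -
  define P where "P \<mu> \<nu> = (\<Sum>\<alpha>\<in>I. L \<mu> \<alpha> * cnj (L \<nu> \<alpha>))" for \<mu> \<nu>
  define p where "p \<mu> = (\<Sum>\<alpha>\<in>I. (cmod (L \<mu> \<alpha>))\<^sup>2)" for \<mu>
  have Pp: "P \<mu> \<mu> = of_real (p \<mu>)" for \<mu> by (simp add: P_def p_def complex_norm_square[symmetric])
  have sq: "of_real R * P \<mu> \<mu> = (\<Sum>\<nu>\<in>J. P \<mu> \<nu> * cnj (P \<mu> \<nu>))" for \<mu>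
  proof -
    have "(\<Sum>\<nu>\<in>J. P \<mu> \<nu> * cnj (P \<mu> \<nu>)) = (\<Sum>\<nu>\<in>J. \<Sum>\<alpha>\<in>I. \<Sum>\<beta>\<in>I. L \<mu> \<alpha> * cnj (L \<mu> \<beta>) * (L \<nu> \<beta> * cnj (L \<nu> \<alpha>)))"
      unfolding P_def cnj_sum sum_product by (intro sum.cong refl) (simp add: mult_ac)
    also have "\<dots> = (\<Sum>\<alpha>\<in>I. \<Sum>\<nu>\<in>J. \<Sum>\<beta>\<in>I. L \<mu> \<alpha> * cnj (L \<mu> \<beta>) * (L \<nu> \<beta> * cnj (L \<nu> \<alpha>)))"
      by (rule sum.swap)
    also have "\<dots> = (\<Sum>\<alpha>\<in>I. \<Sum>\<beta>\<in>I. \<Sum>\<nu>\<in>J. L \<mu> \<alpha> * cnj (L \<mu> \<beta>) * (L \<nu> \<beta> * cnj (L \<nu> \<alpha>)))"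
      by (intro sum.cong refl sum.swap)
    also have "\<dots> = (\<Sum>\<alpha>\<in>I. \<Sum>\<beta>\<in>I. if \<beta> = \<alpha> then of_real R * (L \<mu> \<alpha> * cnj (L \<mu> \<alpha>)) else 0)"
      unfolding sum_distrib_left[symmetric] using orth by (intro sum.cong refl) auto
    finally show ?thesis using fin by (simp add: sum.delta P_def sum_distrib_left)
  qed
  have "p \<mu> \<le> R" if \<mu>: "\<mu> \<in> J" for \<mu>
  proof -
    have "complex_of_real (R * p \<mu>) = of_real (\<Sum>\<nu>\<in>J. (cmod (P \<mu> \<nu>))\<^sup>2)"
      using sq[of \<mu>] by (simp add: Pp complex_norm_square[symmetric])
    then have "R * p \<mu> = (\<Sum>\<nu>\<in>J. (cmod (P \<mu> \<nu>))\<^sup>2)" by (simp only: of_real_eq_iff)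
    moreover have "(cmod (P \<mu> \<mu>))\<^sup>2 \<le> (\<Sum>\<nu>\<in>J. (cmod (P \<mu> \<nu>))\<^sup>2)"
      by (rule member_le_sum[OF \<mu>]) (use fin in auto)
    ultimately have "(p \<mu>)\<^sup>2 \<le> R * p \<mu>" by (simp add: Pp)
    then show ?thesis
    proof (cases "p \<mu> \<le> 0")
      case False
      with \<open>(p \<mu>)\<^sup>2 \<le> R * p \<mu>\<close> show ?thesis by (simp add: power2_eq_square)
    qed (use R in simp)
  qed
  then have "(\<Sum>\<mu>\<in>J. p \<mu>) \<le> of_nat (card J) * R" by (rule sum_bounded_above)
  moreover have "(\<Sum>\<mu>\<in>J. p \<mu>) = of_nat (card I) * R"
  proof -
    have "complex_of_real (\<Sum>\<mu>\<in>J. p \<mu>) = (\<Sum>\<alpha>\<in>I. \<Sum>\<mu>\<in>J. L \<mu> \<alpha> * cnj (L \<mu> \<alpha>))"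
      by (subst sum.swap) (simp add: p_def complex_norm_square[symmetric])
    also have "\<dots> = (\<Sum>\<alpha>\<in>I. of_real R)" using orth by (intro sum.cong) auto
    also have "\<dots> = of_real (of_nat (card I) * R)" by simp
    finally show ?thesis by (simp only: of_real_eq_iff)
  qed
  ultimately show ?thesis using R by simp
qed

section \<open>The curved blocks as unitary images\<close>

context cr_gauged
begin

text \<open>For \<epsilon> = 1 the vector TF is nonzero in a curved block, and its Levi norm divided
  by lam equals Im om / |om|^2, so om is not real.\<close>

lemma om_slit:
  assumes q: "q \<in> W" and s: "1 < s"
  shows "om q \<notin> \<real>\<^sub>\<le>\<^sub>0"
proof (cases "\<epsilon> = 1")
  case True
  have k: "1 \<in> {1..<s}" using s by simp
  obtain \<mu> where \<mu>: "bl \<mu> = \<tau> 1" "F q $ \<mu> \<noteq> 0"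
  proof (rule ccontr)
    assume "\<not> thesis"
    then have "F q $ \<mu> = 0" if "bl \<mu> = \<tau> 1" for \<mu>
      using that \<open>\<And>\<mu>. bl \<mu> = \<tau> 1 \<Longrightarrow> F q $ \<mu> \<noteq> 0 \<Longrightarrow> thesis\<close> by blast
    then have "ipb (\<tau> 1) (F q) (F q) = 0" by (simp add: ip_def)
    then show False using q \<tau>_in[OF k] by simp
  qed
  have rho: "rho q = - 2 * \<i> / om q" using om'(4)[OF q] True by simp
  have "TF q $ \<mu> \<noteq> 0"
    unfolding TF_block[OF q k \<mu>(1)] rho using \<mu>(2) om'(1)[OF q] m_ge[OF k] by simp
  then have "TF q \<noteq> 0" by (metis zero_index)
  then have pos: "0 < Re (nTF q)" by (rule nTF_pos[OF q])
  have "- 4 * nTF q / lam q = - 2 * \<i> * (cnj (om q) - om q) / (om q * cnj (om q))"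
    unfolding rho_real_part[OF q, symmetric] rho using om'(1)[OF q] by (simp add: field_simps)
  also have "cnj (om q) - om q = - 2 * \<i> * of_real (Im (om q))" by (simp add: complex_eq_iff)
  finally have "4 * (nTF q / lam q) = 4 * (of_real (Im (om q)) / (om q * cnj (om q)))" by simp
  then have "nTF q / lam q = of_real (Im (om q)) / (om q * cnj (om q))" by (subst (asm) mult_left_cancel) simp_all
  then have "Im (om q) \<noteq> 0" using pos q by auto
  then show ?thesis by (simp add: complex_nonpos_Reals_iff)
next
  case False
  then have "om q = 1" using om(3) by auto
  then show ?thesis by (simp add: complex_nonpos_Reals_iff)
qed

lemma ddir_om_powr:
  assumes q: "q \<in> W" and s: "1 < s"
  shows "ddir v (\<lambda>q. om q powr a) q = a * om q powr (a - 1) * ddir v om q"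
proof -
  have "((\<lambda>z. z powr a) has_field_derivative a * om q powr (a - 1)) (at (om q))"
    using om_slit[OF assms] by (auto intro!: derivative_eq_intros)
  then have "((\<lambda>q. om q powr a) has_derivative (\<lambda>v. a * om q powr (a - 1) * ddir v om q)) (at q)"
    using diff_chain_at[OF sm_has_derivative[OF om(1) q], of "\<lambda>z. z powr a"]
    unfolding has_field_derivative_def by (simp add: o_def)
  then show ?thesis by (rule ddir_eqI)
qed

text \<open>Multiplied by the root p of om, the block of F loses its derivative along
  \<open>T\<close> and has norm r^(1/m) |z_k|. Differentiating this norm identity until it becomes a
  vanishing sum of squares shows that the product u is linear in z_k.\<close>

lemma curved_block:
  assumes q0: "q0 \<in> W" and k: "k \<in> {1..<s}"
  obtains L :: "'n \<Rightarrow> 'n \<Rightarrow> complex" where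
    "\<And>\<alpha> \<beta>. bl \<alpha> = k \<Longrightarrow> bl \<beta> = k \<Longrightarrow> (\<Sum>\<mu> | bl \<mu> = \<tau> k. L \<mu> \<alpha> * cnj (L \<mu> \<beta>)) = (if \<alpha> = \<beta> then 1 else 0)"
    "\<And>q \<mu>. q \<in> W \<Longrightarrow> bl \<mu> = \<tau> k \<Longrightarrow> F q $ \<mu> = (\<Sum>\<alpha> | bl \<alpha> = k. L \<mu> \<alpha> *
       (of_real (r powr (1 / m k)) * (fst q $ \<alpha> / om q powr of_real (1 / m k))))"
proof -
  have s: "1 < s" using k by simp
  define a where "a = complex_of_real (1 / m k)"
  define p where "p q = om q powr a" for q
  define R where "R = (r powr (1 / m k))\<^sup>2"
  define J where "J = {\<mu>. bl \<mu> = \<tau> k}"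
  have mk: "0 < m k" using m_ge[OF k] by simp
  have R: "0 < R" using om(2) by (simp add: R_def)
  have sp [simp]: "sm W p"
    unfolding p_def[abs_def] sm_def using Ck_on_powr[OF open_W _ om_slit[OF _ s]] om(1) by (simp add: sm_def)
  have p0: "p q \<noteq> 0" if "q \<in> W" for q using om'(1)[OF that] by (simp add: p_def)
  have p_m: "p q ^ m k = om q" if "q \<in> W" for q
  proof -
    have "p q ^ m k = exp (of_nat (m k) * (a * Ln (om q)))"
      using om'(1)[OF that] by (simp add: p_def powr_def exp_of_nat_mult)
    also have "of_nat (m k) * (a * Ln (om q)) = Ln (om q)" using mk by (simp add: a_def)
    finally show ?thesis using om'(1)[OF that] by simp
  qed
  have dp: "Zb x p q = 0" "T p q = a * (p q / om q) * \<epsilon>" if "q \<in> W" for q x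
  proof -
    define c where "c = a * om q powr (a - 1)"
    have d: "ddir v p q = c * ddir v om q" for v
      unfolding p_def[abs_def] c_def by (rule ddir_om_powr[OF that s])
    have "Zb x p q = c * Zb x om q" unfolding Zb_def d by (simp add: algebra_simps)
    then show "Zb x p q = 0" using om'(5)[OF that] by simp
    have "c = a * (p q / om q)" unfolding c_def p_def by (simp add: powr_diff)
    then show "T p q = a * (p q / om q) * \<epsilon>" unfolding d om'(2)[OF that] by simp
  qed
  define u where "u \<mu> q = p q * F q $ \<mu>" for \<mu> q
  have su [simp]: "sm W (u \<mu>)" for \<mu> unfolding u_def[abs_def] by simp
  have Zbu: "Zb x (u \<mu>) q = 0" if "q \<in> W" for q x \<mu>
    unfolding u_def[abs_def] using that dp by (simp add: d_mult[OF derpair_Zb] CR_F_nth)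
  have Tu: "T (u \<mu>) q = 0" if "q \<in> W" "\<mu> \<in> J" for q \<mu>
  proof -
    have TF: "T (\<lambda>q. F q $ \<mu>) q = - 2 * \<i> * \<epsilon> / om q / (2 * \<i> * of_nat (m k)) * F q $ \<mu>"
      using TF_block[OF that(1) k, of \<mu>] that(2) om'(4)[OF that(1)] by (simp add: J_def)
    have "T (u \<mu>) q = T p q * F q $ \<mu> + p q * T (\<lambda>q. F q $ \<mu>) q"
      unfolding u_def[abs_def] using that by (simp add: d_mult[OF derpair_ddir])
    then show ?thesis unfolding TF dp(2)[OF that(1)] a_def using mk om'(1)[OF that(1)] by (simp add: field_simps)
  qed
  have Zbu': "Zb y (Z x (u \<mu>)) q = 0" if "q \<in> W" "\<mu> \<in> J" for q x y \<mu>
    using CR_comm(1)[OF that(1) su Zbu] Tu[OF that] by simp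
  have TZu: "T (Z x (u \<mu>)) q = 0" if "q \<in> W" "\<mu> \<in> J" for q x \<mu>
  proof -
    have "Z x (T (u \<mu>)) q = Z x (\<lambda>_. 0) q" by (rule d_cong[OF derpair_Z that(1)]) (use Tu that in auto)
    then show ?thesis using T_Z[OF that(1) su] d_const[OF derpair_Z that(1)] by simp
  qed
  \<comment> \<open>The two sides are nonnegative reals whose m-th powers agree by
    \<open>norm_F\<close> and the gauge condition.\<close>
  have norm_u: "(\<Sum>\<mu>\<in>J. u \<mu> q * cnj (u \<mu> q)) = of_real R * ipb k (fst q) (fst q)" if q: "q \<in> W" for q
  proof -
    define t t' where "t = (\<Sum>\<mu> | bl \<mu> = k. (cmod (fst q $ \<mu>))\<^sup>2)" and "t' = (\<Sum>\<mu> | bl \<mu> = \<tau> k. (cmod (F q $ \<mu>))\<^sup>2)"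
    have tt: "ipb k (fst q) (fst q) = of_real t" "ipb (\<tau> k) (F q) (F q) = of_real t'"
      by (simp_all add: ip_self_real t_def t'_def)
    have nn: "0 \<le> t" "0 \<le> t'" by (simp_all add: t_def t'_def sum_nonneg)
    have "complex_of_real (((cmod (p q))\<^sup>2 * t') ^ m k) = (p q * cnj (p q)) ^ m k * of_real t' ^ m k"
      by (subst complex_norm_square[symmetric]) (simp add: power_mult_distrib)
    also have "\<dots> = p q ^ m k * cnj (p q ^ m k) * (lam q * of_real t ^ m k)"
      using norm_F[OF q k] unfolding tt by (simp add: power_mult_distrib)
    also have "\<dots> = of_real (r\<^sup>2 * t ^ m k)"
      unfolding p_m[OF q] using om'(3)[OF q] by (simp add: mult_ac)
    also have "r = (r powr (1 / m k)) ^ m k"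
      using om(2) mk by (simp add: powr_powr flip: powr_realpow)
    then have "r\<^sup>2 * t ^ m k = (R * t) ^ m k"
      unfolding R_def power_mult_distrib by (metis mult.commute power_mult)
    finally have "((cmod (p q))\<^sup>2 * t') ^ m k = (R * t) ^ m k" by (simp only: of_real_eq_iff)
    then have "(cmod (p q))\<^sup>2 * t' = R * t"
      by (rule power_eq_imp_eq_base[OF _ mult_nonneg_nonneg mult_nonneg_nonneg mk]) (use nn R in simp_all)
    then have "complex_of_real ((cmod (p q))\<^sup>2 * t') = of_real (R * t)" by simp
    then have "p q * cnj (p q) * ipb (\<tau> k) (F q) (F q) = of_real R * ipb k (fst q) (fst q)"
      unfolding tt complex_norm_square[symmetric] of_real_mult[symmetric] .
    moreover have "(\<Sum>\<mu>\<in>J. u \<mu> q * cnj (u \<mu> q)) = p q * cnj (p q) * ipb (\<tau> k) (F q) (F q)"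
      unfolding ip_def sum_distrib_left J_def u_def by (intro sum.cong refl) simp
    ultimately show ?thesis by simp
  qed
  have first: "(\<Sum>\<mu>\<in>J. u \<mu> q * cnj (Z y (u \<mu>) q)) = of_real R * ipb k (fst q) y" if q: "q \<in> W" for q y
  proof -
    have "Zb y (\<lambda>q. \<Sum>\<mu>\<in>J. u \<mu> q * cnj (u \<mu> q)) q = Zb y (\<lambda>q. of_real R * ipb k (fst q) (fst q)) q"
      by (rule d_cong[OF derpair_Zb q]) (use norm_u in simp_all)
    then show ?thesis
      by (simp add: d_sum[OF derpair_Zb q] d_mult[OF derpair_Zb q] d_cnj[OF derpair_Zb q] Zbu[OF q]
         d_const[OF derpair_Zb q] d_ip[OF derpair_Zb q] Zb_fst[OF q] Z_fst[OF q] del: vd_nth)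
  qed
  have second: "(\<Sum>\<mu>\<in>J. Z x (u \<mu>) q * cnj (Z y (u \<mu>) q)) = of_real R * ipb k x y" if q: "q \<in> W" for q x y
  proof -
    have "Z x (\<lambda>q. \<Sum>\<mu>\<in>J. u \<mu> q * cnj (Z y (u \<mu>) q)) q = Z x (\<lambda>q. of_real R * ipb k (fst q) y) q"
      by (rule d_cong[OF derpair_Z q]) (use first in simp_all)
    then show ?thesis
      by (simp add: d_sum[OF derpair_Z q] d_mult[OF derpair_Z q] d_cnj[OF derpair_Z q] Zbu'[OF q]
         d_const[OF derpair_Z q] d_ip[OF derpair_Z q] Z_fst[OF q] vd_const[OF derpair_Zb q] del: vd_nth)
  qed
  have third: "(\<Sum>\<mu>\<in>J. Z w (Z x (u \<mu>)) q * cnj (Z y (u \<mu>) q)) = 0" if q: "q \<in> W" for q x y w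
  proof -
    have "Z w (\<lambda>q. \<Sum>\<mu>\<in>J. Z x (u \<mu>) q * cnj (Z y (u \<mu>) q)) q = Z w (\<lambda>q. of_real R * ipb k x y) q"
      by (rule d_cong[OF derpair_Z q]) (use second in simp_all)
    then show ?thesis
      by (simp add: d_sum[OF derpair_Z q] d_mult[OF derpair_Z q] d_cnj[OF derpair_Z q] Zbu'[OF q] d_const[OF derpair_Z q])
  qed
  have Zb3: "Zb y (Z w (Z x (u \<mu>))) q = 0" if "q \<in> W" "\<mu> \<in> J" for q x y w \<mu>
    using CR_comm(1)[OF that(1) sm_Z[OF su] Zbu'[OF _ that(2)]] TZu[OF that] by simp
  \<comment> \<open>A further \<open>Zb\<close> derivative of \<open>third\<close> produces the sum
    of squared moduli of the second derivatives.\<close>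
  have ZZu: "Z w (Z x (u \<mu>)) q = 0" if q: "q \<in> W" and \<mu>: "\<mu> \<in> J" for q x w \<mu>
  proof -
    have "Zb w (\<lambda>q. \<Sum>\<mu>\<in>J. Z w (Z x (u \<mu>)) q * cnj (Z x (u \<mu>) q)) q = Zb w (\<lambda>q. 0) q"
      by (rule d_cong[OF derpair_Zb q]) (use third in simp_all)
    then have "(\<Sum>\<mu>\<in>J. Z w (Z x (u \<mu>)) q * cnj (Z w (Z x (u \<mu>)) q)) = 0"
      by (simp add: d_sum[OF derpair_Zb q] d_mult[OF derpair_Zb q] d_cnj[OF derpair_Zb q] Zb3[OF q] d_const[OF derpair_Zb q])
    from sum_cnj_eq_0[OF _ this \<mu>] show ?thesis by simp
  qed
  have const: "Z x (u \<mu>) q = Z x (u \<mu>) q0" if "q \<in> W" "\<mu> \<in> J" for q x \<mu>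
    by (rule zero_derivs_const[OF conn_W _ _ _ _ that(1) q0]) (use that Zbu' ZZu TZu in simp_all)
  define L where "L \<mu> \<alpha> = Z (e \<alpha>) (u \<mu>) q0" for \<mu> \<alpha>
  have LL: "(\<Sum>\<mu>\<in>J. L \<mu> \<alpha> * cnj (L \<mu> \<beta>)) = of_real R * ipb k (e \<alpha>) (e \<beta>)" for \<alpha> \<beta>
    unfolding L_def by (rule second[OF q0])
  have L0: "L \<mu> \<alpha> = 0" if "bl \<alpha> \<noteq> k" "\<mu> \<in> J" for \<alpha> \<mu>
  proof -
    have "(\<Sum>\<mu>\<in>J. L \<mu> \<alpha> * cnj (L \<mu> \<alpha>)) = 0" using LL[of \<alpha> \<alpha>] that(1) by (simp add: ip_axis)
    from sum_cnj_eq_0[OF _ this that(2)] show ?thesis by simp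
  qed
  have uL: "u \<mu> q = (\<Sum>\<alpha> | bl \<alpha> = k. L \<mu> \<alpha> * fst q $ \<alpha>)" if q: "q \<in> W" and \<mu>: "\<mu> \<in> J" for q \<mu>
  proof -
    \<comment> \<open>The derivative of u along z is the candidate for u itself. All four inner
      products among u and v equal E, so u - v has norm 0.\<close>
    define v where "v \<mu> = Z (fst q) (u \<mu>) q" for \<mu>
    define E where "E = of_real R * ipb k (fst q) (fst q)"
    have uv: "(\<Sum>\<mu>\<in>J. u \<mu> q * cnj (v \<mu>)) = E" unfolding v_def E_def by (rule first[OF q])
    have vv: "(\<Sum>\<mu>\<in>J. v \<mu> * cnj (v \<mu>)) = E" unfolding v_def E_def by (rule second[OF q])
    have vu: "(\<Sum>\<mu>\<in>J. v \<mu> * cnj (u \<mu> q)) = E"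
      using arg_cong[OF uv, of cnj] unfolding cnj_sum complex_cnj_mult complex_cnj_cnj E_def ip_cnj complex_cnj_complex_of_real
      by (simp only: mult.commute)
    have "(\<Sum>\<mu>\<in>J. (u \<mu> q - v \<mu>) * cnj (u \<mu> q - v \<mu>)) = (\<Sum>\<mu>\<in>J. u \<mu> q * cnj (u \<mu> q))
       - (\<Sum>\<mu>\<in>J. u \<mu> q * cnj (v \<mu>)) - (\<Sum>\<mu>\<in>J. v \<mu> * cnj (u \<mu> q)) + (\<Sum>\<mu>\<in>J. v \<mu> * cnj (v \<mu>))"
      unfolding sum_subtractf[symmetric] sum.distrib[symmetric] by (intro sum.cong refl) (simp add: algebra_simps)
    then have "(\<Sum>\<mu>\<in>J. (u \<mu> q - v \<mu>) * cnj (u \<mu> q - v \<mu>)) = 0"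
      unfolding uv vu vv norm_u[OF q, folded E_def] by simp
    from sum_cnj_eq_0[OF _ this \<mu>] have "u \<mu> q = v \<mu>" by simp
    also have "v \<mu> = (\<Sum>\<alpha>\<in>UNIV. fst q $ \<alpha> * L \<mu> \<alpha>)"
      unfolding v_def L_def const[OF q \<mu>, symmetric] by (rule Z_expand[OF q su])
    also have "\<dots> = (\<Sum>\<alpha> | bl \<alpha> = k. L \<mu> \<alpha> * fst q $ \<alpha>)"
      by (rule sum.mono_neutral_cong_right) (use L0 \<mu> in auto)
    finally show ?thesis .
  qed
  define \<rho> where "\<rho> = complex_of_real (r powr (1 / m k))"
  have \<rho>: "\<rho> \<noteq> 0" "of_real R = \<rho> * \<rho>" "cnj \<rho> = \<rho>"
    using om(2) by (simp_all add: \<rho>_def R_def power2_eq_square)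
  show ?thesis
  proof (rule that[of "\<lambda>\<mu> \<alpha>. L \<mu> \<alpha> / \<rho>"])
    fix \<alpha> \<beta> assume b: "bl \<alpha> = k" "bl \<beta> = k"
    have "(\<Sum>\<mu> | bl \<mu> = \<tau> k. L \<mu> \<alpha> / \<rho> * cnj (L \<mu> \<beta> / \<rho>)) = (\<Sum>\<mu>\<in>J. L \<mu> \<alpha> * cnj (L \<mu> \<beta>)) / (\<rho> * \<rho>)"
      unfolding sum_divide_distrib J_def using \<rho>(3) by (intro sum.cong refl) simp
    then show "(\<Sum>\<mu> | bl \<mu> = \<tau> k. L \<mu> \<alpha> / \<rho> * cnj (L \<mu> \<beta> / \<rho>)) = (if \<alpha> = \<beta> then 1 else 0)"
      unfolding LL \<rho>(2) using b \<rho>(1) by (simp add: ip_axis) (simp add: axis_def)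
  next
    fix q \<mu> assume q: "q \<in> W" and \<mu>: "bl \<mu> = \<tau> k"
    have "F q $ \<mu> = u \<mu> q / p q" using p0[OF q] by (simp add: u_def)
    also have "\<dots> = (\<Sum>\<alpha> | bl \<alpha> = k. L \<mu> \<alpha> / \<rho> * (\<rho> * (fst q $ \<alpha> / p q)))"
      using uL[OF q, of \<mu>] \<mu> \<rho>(1) by (simp add: J_def sum_divide_distrib)
    finally show "F q $ \<mu> = (\<Sum>\<alpha> | bl \<alpha> = k. L \<mu> \<alpha> / \<rho> *
       (of_real (r powr (1 / m k)) * (fst q $ \<alpha> / om q powr of_real (1 / m k))))"
      by (simp only: \<rho>_def p_def a_def)
  qed
qed

text \<open>Orthonormal columns give one inequality for every k. The totals agree because \<tau>
  permutes the blocks, so each inequality is an equality.\<close>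

lemma card_blocks:
  assumes q0: "q0 \<in> W" and k: "k \<in> {1..<s}"
  shows "card {\<mu>. bl \<mu> = \<tau> k} = card {\<mu>. bl \<mu> = k}"
proof -
  have le: "card {\<mu>. bl \<mu> = k} \<le> card {\<mu>. bl \<mu> = \<tau> k}" if kk: "k \<in> {1..<s}" for k
  proof -
    obtain L :: "'n \<Rightarrow> 'n \<Rightarrow> complex" where
      "\<And>\<alpha> \<beta>. bl \<alpha> = k \<Longrightarrow> bl \<beta> = k \<Longrightarrow> (\<Sum>\<mu> | bl \<mu> = \<tau> k. L \<mu> \<alpha> * cnj (L \<mu> \<beta>)) = (if \<alpha> = \<beta> then 1 else 0)"
      "\<And>q \<mu>. q \<in> W \<Longrightarrow> bl \<mu> = \<tau> k \<Longrightarrow> F q $ \<mu> = (\<Sum>\<alpha> | bl \<alpha> = k. L \<mu> \<alpha> *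
       (of_real (r powr (1 / m k)) * (fst q $ \<alpha> / om q powr of_real (1 / m k))))"
      by (rule curved_block[OF q0 kk]) (rule that)
    then show ?thesis by (intro orthogonal_columns_card[of _ _ 1 L]) auto
  qed
  have "(\<Sum>k\<in>{1..<s}. card {\<mu>. bl \<mu> = \<tau> k}) = (\<Sum>k\<in>{1..<s}. card {\<mu>. bl \<mu> = k})"
    by (rule sum.reindex_bij_betw[OF bij_\<tau>])
  from sum_mono_inv[OF this[symmetric] le k] show ?thesis by simp
qed

end

section \<open>Assembly of the normal form\<close>

context cr_map
begin

text \<open>\<open>X\<close> and \<open>Y\<close> are the components of \<open>J \<circ> \<phi>\<^sub>a\<close> in the parametrization.\<close>

lemma normal_form:
  assumes q0: "q0 \<in> W"
  obtains \<tau> and L :: "'n \<Rightarrow> 'n \<Rightarrow> complex" and b :: "'n \<Rightarrow> complex" and r t1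
    and X :: "(complex^'n) \<times> real \<Rightarrow> 'n \<Rightarrow> complex" and Y :: "(complex^'n) \<times> real \<Rightarrow> complex"
    and a :: "'n \<Rightarrow> complex" and t0 om
  where "bij_betw \<tau> {1..<s} {1..<s}" "\<tau> s = s"
    "\<And>k. k \<in> {1..<s} \<Longrightarrow> m (\<tau> k) = m k" "\<And>k. k \<in> {1..<s} \<Longrightarrow> card {\<mu>. bl \<mu> = \<tau> k} = card {\<mu>. bl \<mu> = k}"
    "0 < r"
    "\<And>k \<alpha> \<beta>. k \<in> {1..s} \<Longrightarrow> bl \<alpha> = k \<Longrightarrow> bl \<beta> = k \<Longrightarrow>
       (\<Sum>\<mu> | bl \<mu> = \<tau> k. cnj (L \<mu> \<alpha>) * L \<mu> \<beta>) = (if \<alpha> = \<beta> then 1 else 0)"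
    "\<And>q k \<mu>. q \<in> W \<Longrightarrow> k \<in> {1..<s} \<Longrightarrow> bl \<mu> = \<tau> k \<Longrightarrow>
       F q $ \<mu> = (\<Sum>\<alpha> | bl \<alpha> = k. L \<mu> \<alpha> * (of_real (r powr (1 / m k)) * X q \<alpha>))"
    "\<And>q \<mu>. q \<in> W \<Longrightarrow> bl \<mu> = s \<Longrightarrow> F q $ \<mu> = (\<Sum>\<alpha> | bl \<alpha> = s. L \<mu> \<alpha> * (of_real r * X q \<alpha>)) + b \<mu>"
    "\<And>q. q \<in> W \<Longrightarrow> G q = of_real t1 + \<i> * (\<Sum>\<alpha> | bl \<alpha> = s. b \<alpha> * cnj (b \<alpha>)) + of_real (r\<^sup>2) * Y q
       + 2 * \<i> * (\<Sum>\<mu> | bl \<mu> = s. (\<Sum>\<alpha> | bl \<alpha> = s. L \<mu> \<alpha> * (of_real r * X q \<alpha>)) * cnj (b \<mu>))"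
    "(\<forall>\<alpha>. a \<alpha> = 0) \<and> t0 = 0 \<and> (\<forall>q\<in>W. (\<forall>\<alpha>. X q \<alpha> = fst q $ \<alpha>) \<and> Y q = of_real (snd q) + \<i> * pp (fst q)) \<or>
     (\<forall>q\<in>W. om q \<noteq> 0 \<and> om q = (of_real (snd q) + \<i> * pp (fst q)) + (of_real t0 + \<i> * (\<Sum>\<alpha> | bl \<alpha> = s. a \<alpha> * cnj (a \<alpha>)))
         + 2 * \<i> * (\<Sum>\<alpha> | bl \<alpha> = s. fst q $ \<alpha> * cnj (a \<alpha>)) \<and>
       Y q = - (1 / om q) \<and> (\<forall>\<alpha>. X q \<alpha> = (if bl \<alpha> = s then (fst q $ \<alpha> + a \<alpha>) / om q
         else fst q $ \<alpha> / om q powr of_real (1 / m (bl \<alpha>)))))"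
proof -
  obtain \<tau> where \<tau>: "bij_betw \<tau> {1..<s} {1..<s}" "\<tau> s = s" "\<And>k. k \<in> {1..<s} \<Longrightarrow> m (\<tau> k) = m k"
    "\<And>q k x. q \<in> W \<Longrightarrow> k \<in> {1..s} \<Longrightarrow> PJ (\<tau> k) (F q) (A x q) = A (PJ k (fst q) x) q"
    "\<And>q k. q \<in> W \<Longrightarrow> k \<in> {1..<s} \<Longrightarrow> ipb (\<tau> k) (F q) (F q) ^ m k = lam q * ipb k (fst q) (fst q) ^ m k"
    by (rule matched_blocks) (rule that)
  obtain om \<epsilon> r where g: "gauge om \<epsilon> r" using ex_gauge by blast
  interpret cr_gauged bl s m W F G \<tau> om \<epsilon> r
    by unfold_locales (use \<tau> g in auto)
  note om_cases = om(3)
  have "\<exists>L. (\<forall>\<alpha> \<beta>. bl \<alpha> = k \<longrightarrow> bl \<beta> = k \<longrightarrow> (\<Sum>\<mu> | bl \<mu> = \<tau> k. L \<mu> \<alpha> * cnj (L \<mu> \<beta>)) = (if \<alpha> = \<beta> then 1 else 0)) \<and>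
    (\<forall>q\<in>W. \<forall>\<mu>. bl \<mu> = \<tau> k \<longrightarrow> F q $ \<mu> = (\<Sum>\<alpha> | bl \<alpha> = k. L \<mu> \<alpha> *
       (of_real (r powr (1 / m k)) * (fst q $ \<alpha> / om q powr of_real (1 / m k)))))" (is "\<exists>L. ?P k L")
    if k: "k \<in> {1..<s}" for k
  proof (rule curved_block[OF q0 k])
    fix L :: "'n \<Rightarrow> 'n \<Rightarrow> complex"
    assume "\<And>\<alpha> \<beta>. bl \<alpha> = k \<Longrightarrow> bl \<beta> = k \<Longrightarrow> (\<Sum>\<mu> | bl \<mu> = \<tau> k. L \<mu> \<alpha> * cnj (L \<mu> \<beta>)) = (if \<alpha> = \<beta> then 1 else 0)"
      "\<And>q \<mu>. q \<in> W \<Longrightarrow> bl \<mu> = \<tau> k \<Longrightarrow> F q $ \<mu> = (\<Sum>\<alpha> | bl \<alpha> = k. L \<mu> \<alpha> *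
       (of_real (r powr (1 / m k)) * (fst q $ \<alpha> / om q powr of_real (1 / m k))))"
    then show ?thesis by (intro exI[of _ L]) simp
  qed
  then have "\<forall>k\<in>{1..<s}. \<exists>L. ?P k L" by (rule ballI)
  from bchoice[OF this] obtain Lc where "\<forall>k\<in>{1..<s}. ?P k (Lc k)" ..
  then have Lc: "k \<in> {1..<s} \<Longrightarrow> ?P k (Lc k)" for k by (rule bspec)
  have uni: "(\<Sum>\<mu> | bl \<mu> = \<tau> k. cnj (Lc k \<mu> \<alpha>) * Lc k \<mu> \<beta>) = (if \<alpha> = \<beta> then 1 else 0)"
    if "k \<in> {1..<s}" "bl \<alpha> = k" "bl \<beta> = k" for k \<alpha> \<beta>
  proof -
    have "(\<Sum>\<mu> | bl \<mu> = \<tau> k. Lc k \<mu> \<beta> * cnj (Lc k \<mu> \<alpha>)) = (if \<beta> = \<alpha> then 1 else 0)"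
      using Lc[OF that(1)] that(2,3) by blast
    then show ?thesis by (simp add: mult.commute)
  qed
  have FLc: "F q $ \<mu> = (\<Sum>\<alpha> | bl \<alpha> = k. Lc k \<mu> \<alpha> *
       (of_real (r powr (1 / m k)) * (fst q $ \<alpha> / om q powr of_real (1 / m k))))"
    if "q \<in> W" "k \<in> {1..<s}" "bl \<mu> = \<tau> k" for q k \<mu>
    using Lc[OF that(2)] that(1,3) by blast
  \<comment> \<open>Columns are indexed by source coordinates, so the matrices of different blocks
    fit into one L without overlap.\<close>
  define LL where "LL L \<mu> \<alpha> = (if bl \<alpha> = s then L \<mu> \<alpha> else Lc (bl \<alpha>) \<mu> \<alpha>)" for L \<mu> \<alpha>
  have LL: "LL L \<mu> \<alpha> = Lc k \<mu> \<alpha>" if "k \<in> {1..<s}" "bl \<alpha> = k" for L \<mu> \<alpha> k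
    using that by (auto simp: LL_def)
  have LLs: "LL L \<mu> \<alpha> = L \<mu> \<alpha>" if "bl \<alpha> = s" for L \<mu> \<alpha>
    using that by (simp add: LL_def)
  have uniL: "(\<Sum>\<mu> | bl \<mu> = \<tau> k. cnj (LL L \<mu> \<alpha>) * LL L \<mu> \<beta>) = (if \<alpha> = \<beta> then 1 else 0)"
    if "\<And>\<alpha> \<beta>. bl \<alpha> = s \<Longrightarrow> bl \<beta> = s \<Longrightarrow> (\<Sum>i\<in>S. cnj (L i \<alpha>) * L i \<beta>) = (if \<alpha> = \<beta> then 1 else 0)"
      "k \<in> {1..s}" "bl \<alpha> = k" "bl \<beta> = k" for L k \<alpha> \<beta>
  proof (cases "k = s")
    case True
    then show ?thesis using that \<tau>_s LLs by simp
  next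
    case False
    then have "k \<in> {1..<s}" using that(2) by simp
    then show ?thesis using uni that(3,4) LL by simp
  qed
  consider "\<epsilon> = 1" | "\<epsilon> = 0" "om = (\<lambda>_. 1)" using om_cases by blast
  then show ?thesis
  proof cases
    case 1
    obtain a b :: "'n \<Rightarrow> complex" and L :: "'n \<Rightarrow> 'n \<Rightarrow> complex" and t0 t1 :: real where I:
      "\<And>q. q \<in> W \<Longrightarrow> om q = wf q + (of_real t0 + \<i> * (\<Sum>\<alpha>\<in>S. a \<alpha> * cnj (a \<alpha>))) + 2 * \<i> * (\<Sum>\<alpha>\<in>S. fst q $ \<alpha> * cnj (a \<alpha>))"
      "\<And>\<alpha> \<beta>. bl \<alpha> = s \<Longrightarrow> bl \<beta> = s \<Longrightarrow> (\<Sum>i\<in>S. cnj (L i \<alpha>) * L i \<beta>) = (if \<alpha> = \<beta> then 1 else 0)"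
      "\<And>q i. q \<in> W \<Longrightarrow> bl i = s \<Longrightarrow> F q $ i = (\<Sum>\<alpha>\<in>S. L i \<alpha> * (of_real r * ((fst q $ \<alpha> + a \<alpha>) / om q))) + b i"
      "\<And>q. q \<in> W \<Longrightarrow> G q = of_real t1 + \<i> * (\<Sum>\<alpha>\<in>S. b \<alpha> * cnj (b \<alpha>)) + of_real (r\<^sup>2) * (- (1 / om q))
       + 2 * \<i> * (\<Sum>i\<in>S. (\<Sum>\<alpha>\<in>S. L i \<alpha> * (of_real r * ((fst q $ \<alpha> + a \<alpha>) / om q))) * cnj (b i))"
      by (rule flat_case_inversion[OF q0 1]) (rule that)
    define X where "X q \<alpha> = (if bl \<alpha> = s then (fst q $ \<alpha> + a \<alpha>) / om q
         else fst q $ \<alpha> / om q powr of_real (1 / m (bl \<alpha>)))" for q :: "(complex^'n) \<times> real" and \<alpha>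
    have sX: "(\<Sum>\<alpha>\<in>S. L i \<alpha> * (of_real r * ((fst q $ \<alpha> + a \<alpha>) / om q))) = (\<Sum>\<alpha>\<in>S. LL L i \<alpha> * (of_real r * X q \<alpha>))" for i q
      by (intro sum.cong refl) (simp add: X_def LLs)
    show ?thesis
    proof (rule that[of \<tau> r "LL L" X b t1 "\<lambda>q. - (1 / om q)" a t0 om])
      show "F q $ \<mu> = (\<Sum>\<alpha> | bl \<alpha> = k. LL L \<mu> \<alpha> * (of_real (r powr (1 / m k)) * X q \<alpha>))"
        if "q \<in> W" "k \<in> {1..<s}" "bl \<mu> = \<tau> k" for q k \<mu>
        unfolding FLc[OF that] using that(2) by (intro sum.cong refl) (auto simp: X_def LL)
      show "F q $ \<mu> = (\<Sum>\<alpha>\<in>S. LL L \<mu> \<alpha> * (of_real r * X q \<alpha>)) + b \<mu>" if "q \<in> W" "bl \<mu> = s" for q \<mu>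
        using I(3)[OF that] unfolding sX .
      show "G q = of_real t1 + \<i> * (\<Sum>\<alpha>\<in>S. b \<alpha> * cnj (b \<alpha>)) + of_real (r\<^sup>2) * (- (1 / om q))
         + 2 * \<i> * (\<Sum>i\<in>S. (\<Sum>\<alpha>\<in>S. LL L i \<alpha> * (of_real r * X q \<alpha>)) * cnj (b i))" if "q \<in> W" for q
        using I(4)[OF that] unfolding sX .
      show "(\<Sum>\<mu> | bl \<mu> = \<tau> k. cnj (LL L \<mu> \<alpha>) * LL L \<mu> \<beta>) = (if \<alpha> = \<beta> then 1 else 0)"
        if "k \<in> {1..s}" "bl \<alpha> = k" "bl \<beta> = k" for k \<alpha> \<beta>
        by (rule uniL[OF I(2) that])
      show "(\<forall>\<alpha>. a \<alpha> = 0) \<and> t0 = 0 \<and> (\<forall>q\<in>W. (\<forall>\<alpha>. X q \<alpha> = fst q $ \<alpha>) \<and> - (1 / om q) = of_real (snd q) + \<i> * pp (fst q)) \<or>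
         (\<forall>q\<in>W. om q \<noteq> 0 \<and> om q = (of_real (snd q) + \<i> * pp (fst q)) + (of_real t0 + \<i> * (\<Sum>\<alpha>\<in>S. a \<alpha> * cnj (a \<alpha>)))
             + 2 * \<i> * (\<Sum>\<alpha>\<in>S. fst q $ \<alpha> * cnj (a \<alpha>)) \<and>
           - (1 / om q) = - (1 / om q) \<and> (\<forall>\<alpha>. X q \<alpha> = (if bl \<alpha> = s then (fst q $ \<alpha> + a \<alpha>) / om q
             else fst q $ \<alpha> / om q powr of_real (1 / m (bl \<alpha>)))))"
        using I(1)[unfolded wf_def] om'(1) by (intro disjI2 ballI conjI refl allI X_def) blast+
    qed (rule \<tau> om card_blocks[OF q0]; assumption)+
  next
    case 2
    obtain b :: "'n \<Rightarrow> complex" and L :: "'n \<Rightarrow> 'n \<Rightarrow> complex" and t1 :: real where I: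
      "\<And>\<alpha> \<beta>. bl \<alpha> = s \<Longrightarrow> bl \<beta> = s \<Longrightarrow> (\<Sum>i\<in>S. cnj (L i \<alpha>) * L i \<beta>) = (if \<alpha> = \<beta> then 1 else 0)"
      "\<And>q i. q \<in> W \<Longrightarrow> bl i = s \<Longrightarrow> F q $ i = (\<Sum>\<alpha>\<in>S. L i \<alpha> * (of_real r * fst q $ \<alpha>)) + b i"
      "\<And>q. q \<in> W \<Longrightarrow> G q = of_real t1 + \<i> * (\<Sum>\<alpha>\<in>S. b \<alpha> * cnj (b \<alpha>)) + of_real (r\<^sup>2) * wf q
       + 2 * \<i> * (\<Sum>i\<in>S. (\<Sum>\<alpha>\<in>S. L i \<alpha> * (of_real r * fst q $ \<alpha>)) * cnj (b i))"
      by (rule flat_case_affine[OF q0 2(1)]) (rule that)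
    have sX: "(\<Sum>\<alpha>\<in>S. L i \<alpha> * (of_real r * fst q $ \<alpha>)) = (\<Sum>\<alpha>\<in>S. LL L i \<alpha> * (of_real r * fst q $ \<alpha>))"
      for i and q :: "(complex^'n) \<times> real"
      by (intro sum.cong refl) (simp add: LLs)
    show ?thesis
    proof (rule that[of \<tau> r "LL L" "\<lambda>q \<alpha>. fst q $ \<alpha>" b t1 wf "\<lambda>_. 0" 0 om])
      show "F q $ \<mu> = (\<Sum>\<alpha> | bl \<alpha> = k. LL L \<mu> \<alpha> * (of_real (r powr (1 / m k)) * fst q $ \<alpha>))"
        if "q \<in> W" "k \<in> {1..<s}" "bl \<mu> = \<tau> k" for q k \<mu>
        unfolding FLc[OF that] using that(2) by (intro sum.cong refl) (auto simp: LL 2)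
      show "F q $ \<mu> = (\<Sum>\<alpha>\<in>S. LL L \<mu> \<alpha> * (of_real r * fst q $ \<alpha>)) + b \<mu>" if "q \<in> W" "bl \<mu> = s" for q \<mu>
        using I(2)[OF that] unfolding sX .
      show "G q = of_real t1 + \<i> * (\<Sum>\<alpha>\<in>S. b \<alpha> * cnj (b \<alpha>)) + of_real (r\<^sup>2) * wf q
         + 2 * \<i> * (\<Sum>i\<in>S. (\<Sum>\<alpha>\<in>S. LL L i \<alpha> * (of_real r * fst q $ \<alpha>)) * cnj (b i))" if "q \<in> W" for q
        using I(3)[OF that] unfolding sX .
      show "(\<Sum>\<mu> | bl \<mu> = \<tau> k. cnj (LL L \<mu> \<alpha>) * LL L \<mu> \<beta>) = (if \<alpha> = \<beta> then 1 else 0)"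
        if "k \<in> {1..s}" "bl \<alpha> = k" "bl \<beta> = k" for k \<alpha> \<beta>
        by (rule uniL[OF I(1) that])
    qed (rule \<tau> om card_blocks[OF q0] disjI1, (assumption | simp add: wf_def)?)+
  qed
qed

end

section \<open>Parametrization of the hypersurface\<close>

lemma Ck_on_locally:
  assumes "\<And>x. x \<in> W \<Longrightarrow> \<exists>V. open V \<and> x \<in> V \<and> Ck_on k f V"
  shows "Ck_on k f W"
  using assms
proof (induction k arbitrary: f)
  case 0
  have "isCont f x" if "x \<in> W" for x
    using 0[OF that] by (auto simp: continuous_on_eq_continuous_at)
  then show ?case by (simp add: continuous_at_imp_continuous_on)
next
  case (Suc k)
  have "f differentiable (at x)" if "x \<in> W" for x using Suc.prems[OF that] by auto
  moreover have "Ck_on k (\<lambda>x. frechet_derivative f (at x) v) W" for v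
    by (rule Suc.IH) (use Suc.prems in fastforce)
  ultimately show ?case by simp
qed

locale blocked_coords =
  fixes s :: nat and m n :: "nat \<Rightarrow> nat" and e :: "'n::finite \<Rightarrow> nat \<times> nat"
  assumes s_ge: "1 \<le> s" and mn: "\<forall>j\<in>{1..<s}. 2 \<le> m j \<and> 2 \<le> n j" and ms: "m s = 1"
    and dim: "2 \<le> (\<Sum>j\<in>{1..s}. n j)"
    and bij_e: "bij_betw e UNIV (SIGMA j:{1..s}. {..<n j})"
begin

abbreviation bl :: "'n \<Rightarrow> nat" where "bl \<equiv> \<lambda>i. fst (e i)"

lemma inv_e [simp]: "inv e (e i) = i"
  using bij_e by (simp add: bij_betw_def)

lemma e_inv: "j \<in> {1..s} \<Longrightarrow> k < n j \<Longrightarrow> e (inv e (j, k)) = (j, k)"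
  using bij_betw_inv_into_right[OF bij_e, of "(j, k)"] by simp

lemma e_range: "fst (e i) \<in> {1..s}" "snd (e i) < n (fst (e i))"
proof -
  have "e i \<in> (SIGMA j:{1..s}. {..<n j})" using bij_betwE[OF bij_e] by blast
  then show "fst (e i) \<in> {1..s}" "snd (e i) < n (fst (e i))" by (cases "e i"; simp)+
qed

lemma bij_block: "j \<in> {1..s} \<Longrightarrow> bij_betw (\<lambda>k. inv e (j, k)) {..<n j} {\<mu>. bl \<mu> = j}"
proof (rule bij_betwI[where g = "\<lambda>i. snd (e i)"])
  assume j: "j \<in> {1..s}"
  show "(\<lambda>k. inv e (j, k)) \<in> {..<n j} \<rightarrow> {\<mu>. bl \<mu> = j}" using e_inv[OF j] by simp
  show "(\<lambda>i. snd (e i)) \<in> {\<mu>. bl \<mu> = j} \<rightarrow> {..<n j}" using e_range(2) by auto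
  show "snd (e (inv e (j, k))) = k" if "k \<in> {..<n j}" for k using e_inv[OF j] that by simp
  show "inv e (j, snd (e i)) = i" if "i \<in> {\<mu>. bl \<mu> = j}" for i using that by auto
qed

lemma sum_block: "j \<in> {1..s} \<Longrightarrow> (\<Sum>k<n j. f (inv e (j, k))) = (\<Sum>\<mu> | bl \<mu> = j. f \<mu>)"
  by (rule sum.reindex_bij_betw[OF bij_block])

lemma card_block: "j \<in> {1..s} \<Longrightarrow> card {\<mu>. bl \<mu> = j} = n j"
  using bij_betw_same_card[OF bij_block] by simp

sublocale cr_blocks bl s m
proof
  show "2 \<le> CARD('n)" using dim bij_betw_same_card[OF bij_e] by (simp add: card_SigmaI)
  show "2 \<le> card {\<mu>. bl \<mu> = j}" if "j \<in> {1..<s}" for j using card_block[of j] mn that by simp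
qed (use s_ge ms mn e_range in auto)

lemma ip_cdot: "j \<in> {1..s} \<Longrightarrow> ipb j x y = cdot (n j) (blk e x j) (blk e y j)"
  unfolding ip_def cdot_def blk_def by (rule sum_block[symmetric])

lemma cnorm_sq: "complex_of_real ((cnorm d v)\<^sup>2) = (\<Sum>k<d. v k * cnj (v k))"
  by (simp add: cnorm_def L2_set_def sum_nonneg complex_norm_square[symmetric])

lemma ip_cnorm: "j \<in> {1..s} \<Longrightarrow> ipb j x x = of_real ((cnorm (n j) (blk e x j))\<^sup>2)"
  unfolding cnorm_sq ip_cdot cdot_def ..

lemma pp_pfun: "pp z = of_real (pfun s m n e z)"
proof -
  have "pp z = (\<Sum>j\<in>{1..s}. ipb j z z ^ m j)" by (simp add: pp_def cc_def)
  also have "\<dots> = (\<Sum>j\<in>{1..s}. of_real (cnorm (n j) (blk e z j) ^ (2 * m j)))"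
    by (intro sum.cong refl) (simp add: ip_cnorm power_mult)
  also have "{1..s} = insert s {1..<s}" using s_ge by auto
  finally show ?thesis by (simp add: pfun_def ms)
qed

lemma nondeg_iff: "nondeg z \<longleftrightarrow> (\<Prod>j\<in>{1..<s}. cnorm (n j) (blk e z j)) \<noteq> 0"
  by (auto simp: nondeg_def ip_cnorm)

sublocale U: cr_dom bl s m UNIV
  by unfold_locales simp

lemma sm_pp_fst: "sm UNIV (\<lambda>q :: (complex^'n) \<times> real. pp (fst q))"
  by (rule U.sm_forms(1)[OF U.derpair_ddir U.sm_lin_fst])

lemma vd_fst: "vd (ddir v) fst q = fst v"
proof -
  have "ddir v (\<lambda>q. fst q $ \<mu>) q = fst v $ \<mu>" for \<mu>
    by (rule ddir_eqI, rule bounded_linear_imp_has_derivative)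
      (rule bounded_linear_compose[OF bounded_linear_vec_nth bounded_linear_fst])
  then show ?thesis by (simp add: vec_eq_iff)
qed

lemma pp_fst_has_derivative:
  "((\<lambda>q. pp (fst q)) has_derivative (\<lambda>v. of_real (2 * Re (pd (fst q) (fst v))))) (at (q :: (complex^'n) \<times> real))"
proof -
  have "ddir v (\<lambda>q. pp (fst q)) q = of_real (2 * Re (pd (fst q) (fst v)))" for v
    using U.d_pp[OF U.derpair_ddir UNIV_I U.sm_lin_fst, of v q] unfolding vd_fst by (simp add: complex_add_cnj)
  then show ?thesis using sm_has_derivative[OF sm_pp_fst UNIV_I, of q] by simp
qed

lemma pfun_has_derivative: "(pfun s m n e has_derivative (\<lambda>\<xi>. 2 * Re (pd z \<xi>))) (at z)"
proof -
  have "((\<lambda>z::complex^'n. (z, 0::real)) has_derivative (\<lambda>\<xi>. (\<xi>, 0))) (at z)"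
    by (auto intro!: derivative_eq_intros)
  from diff_chain_at[OF this pp_fst_has_derivative]
  have "(pp has_derivative (\<lambda>\<xi>. of_real (2 * Re (pd z \<xi>)))) (at z)"
    by (simp add: o_def)
  from bounded_linear.has_derivative[OF bounded_linear_Re this]
  show ?thesis by (simp add: pp_pfun)
qed

lemma tangent_iff: "X \<in> tangent s m n e x \<longleftrightarrow> Im (snd X) = 2 * Re (pd (fst x) (fst X))"
proof -
  have "((\<lambda>x. Im (snd x) - pfun s m n e (fst x)) has_derivative (\<lambda>X. Im (snd X) - 2 * Re (pd (fst x) (fst X)))) (at x)"
  proof (rule has_derivative_diff)
    show "((\<lambda>x. Im (snd x)) has_derivative (\<lambda>X. Im (snd X))) (at x)"
      by (intro bounded_linear_imp_has_derivative bounded_linear_compose[OF bounded_linear_Im bounded_linear_snd])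
    show "((\<lambda>x. pfun s m n e (fst x)) has_derivative (\<lambda>X. 2 * Re (pd (fst x) (fst X)))) (at x)"
      using diff_chain_at[OF bounded_linear_imp_has_derivative[OF bounded_linear_fst] pfun_has_derivative]
      by (simp add: o_def)
  qed
  then show ?thesis
    unfolding tangent_def by (simp add: case_prod_beta' frechet_derivative_at[symmetric])
qed

lemma pd_axis: "pd z x = (\<Sum>\<alpha>\<in>UNIV. pd z (axis \<alpha> 1) * x $ \<alpha>)"
proof -
  have 1: "pd z (\<Sum>\<alpha>\<in>I. x $ \<alpha> *s axis \<alpha> 1) = (\<Sum>\<alpha>\<in>I. pd z (axis \<alpha> 1) * x $ \<alpha>)" for I :: "'n set"
    by (induction I rule: infinite_finite_induct) (simp_all add: pd_add pd_scale mult.commute)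
  have 2: "(\<Sum>\<alpha>\<in>UNIV. x $ \<alpha> *s axis \<alpha> 1) = x"
    by (simp add: vec_eq_iff axis_def if_distrib cong: if_cong)
  show ?thesis using 1[of UNIV] unfolding 2 .
qed

text \<open>The sum in the contact form is pd minus its conjugate, that is 2 i Im pd, so the form is
  real on real vectors.\<close>

lemma theta_eq: "theta s m n e x X = of_real (Re (snd X) + 2 * Im (pd (fst x) (fst X)))"
proof -
  have ax: "axis \<alpha> \<i> = \<i> *s axis \<alpha> (1::complex)" for \<alpha> :: 'n by (simp add: vec_eq_iff axis_def)
  have fd: "frechet_derivative (pfun s m n e) (at z) v = 2 * Re (pd z v)" for z v
    by (simp add: frechet_derivative_at[OF pfun_has_derivative, symmetric])
  have d: "d_dz (pfun s m n e) z \<alpha> = pd z (axis \<alpha> 1)" "d_dzbar (pfun s m n e) z \<alpha> = cnj (pd z (axis \<alpha> 1))" for z \<alpha>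
    unfolding d_dz_def d_dzbar_def fd ax pd_scale by (simp_all add: complex_eq_iff)
  have "(\<Sum>\<alpha>\<in>UNIV. pd z (axis \<alpha> 1) * v $ \<alpha> - cnj (pd z (axis \<alpha> 1)) * cnj (v $ \<alpha>)) = pd z v - cnj (pd z v)" for z v
    unfolding sum_subtractf pd_axis[of z v] by simp
  then show ?thesis
    unfolding theta_def d by (simp add: complex_eq_iff)
qed

text \<open>A graph chart, inverted on \<open>hypM\<close> by taking the real part of the last
  coordinate; openness and connectedness of N thereby pass to W.\<close>

definition \<Phi> :: "(complex^'n) \<times> real \<Rightarrow> 'n amb"
  where "\<Phi> q = (fst q, of_real (snd q) + \<i> * pp (fst q))"

definition D\<Phi> :: "(complex^'n) \<times> real \<Rightarrow> (complex^'n) \<times> real \<Rightarrow> 'n amb"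
  where "D\<Phi> q v = (fst v, of_real (snd v) + \<i> * of_real (2 * Re (pd (fst q) (fst v))))"

lemma sm_\<Phi>: "sm UNIV \<Phi>"
proof -
  have "bounded_linear (\<lambda>q::(complex^'n) \<times> real. (fst q, complex_of_real (snd q)))"
    by (intro bounded_linear_Pair bounded_linear_fst bounded_linear_compose[OF bounded_linear_of_real bounded_linear_snd])
  then have 1: "sm UNIV (\<lambda>q::(complex^'n) \<times> real. (fst q, complex_of_real (snd q)))"
    by (rule U.sm_linear)
  have "bounded_linear (\<lambda>w::complex. (0::complex^'n, \<i> * w))"
    by (intro bounded_linear_Pair bounded_linear_zero bounded_linear_mult_right)
  then have 2: "sm UNIV (\<lambda>q::(complex^'n) \<times> real. (0::complex^'n, \<i> * pp (fst q)))"
    by (rule U.sm_linear_comp) (rule sm_pp_fst)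
  have "\<Phi> = (\<lambda>q. (fst q, complex_of_real (snd q)) + (0, \<i> * pp (fst q)))"
    by (simp add: \<Phi>_def fun_eq_iff)
  then show ?thesis using U.sm_add[OF 1 2] by simp
qed

lemma \<Phi>_has_derivative: "(\<Phi> has_derivative D\<Phi> q) (at q)"
proof -
  have "((\<lambda>q. (fst q, complex_of_real (snd q) + \<i> * pp (fst q))) has_derivative
      (\<lambda>v. (fst v, of_real (snd v) + \<i> * of_real (2 * Re (pd (fst q) (fst v)))))) (at q)"
    by (intro has_derivative_Pair has_derivative_add has_derivative_mult_right pp_fst_has_derivative
      bounded_linear_imp_has_derivative[OF bounded_linear_fst]
      bounded_linear_imp_has_derivative[OF bounded_linear_compose[OF bounded_linear_of_real bounded_linear_snd]])
  then show ?thesis unfolding \<Phi>_def[abs_def] D\<Phi>_def[abs_def] .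
qed

lemma \<Phi>_hypM: "\<Phi> q \<in> hypM s m n e \<longleftrightarrow> nondeg (fst q)"
  by (auto simp: hypM_def M0_def \<Phi>_def pp_pfun nondeg_iff)

lemma hypM_\<Phi>:
  assumes "x \<in> hypM s m n e" shows "\<Phi> (fst x, Re (snd x)) = x"
proof -
  have "Im (snd x) = pfun s m n e (fst x)" using assms by (auto simp: hypM_def M0_def)
  then have "of_real (Re (snd x)) + \<i> * pp (fst x) = snd x" by (simp add: pp_pfun complex_eq_iff)
  then show ?thesis by (simp add: \<Phi>_def prod_eq_iff)
qed

lemma open_nondeg: "open {q :: (complex^'n) \<times> real. nondeg (fst q)}"
proof -
  have "open {q :: (complex^'n) \<times> real. ipb j (fst q) (fst q) \<noteq> 0}" for j
  proof -
    have "sm UNIV (\<lambda>q :: (complex^'n) \<times> real. ipb j (fst q) (fst q))"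
      by (rule U.sm_ip[OF U.derpair_ddir U.sm_lin_fst U.sm_lin_fst])
    then have "continuous_on UNIV (\<lambda>q :: (complex^'n) \<times> real. ipb j (fst q) (fst q))"
      unfolding sm_def using Ck_on.simps(1) by blast
    then show ?thesis by (rule open_Collect_neq) simp
  qed
  moreover have "{q :: (complex^'n) \<times> real. nondeg (fst q)} = (\<Inter>j\<in>{1..<s}. {q. ipb j (fst q) (fst q) \<noteq> 0})"
    by (auto simp: nondeg_def)
  ultimately show ?thesis by auto
qed

end

section \<open>A CR mapping in the parametrization\<close>

locale cr_mapping = blocked_coords s m n e
  for s and m n :: "nat \<Rightarrow> nat" and e :: "'n::finite \<Rightarrow> nat \<times> nat" +
  fixes N N' :: "'n amb set" and f :: "'n amb \<Rightarrow> 'n amb"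
  assumes open_N: "openin (top_of_set (hypM s m n e)) N" and connected_N: "connected N"
    and open_N': "openin (top_of_set (hypM s m n e)) N'"
    and CR: "CR_mapping s m n e N N' f"
begin

definition W :: "((complex^'n) \<times> real) set" where "W = {q. \<Phi> q \<in> N}"
definition H :: "(complex^'n) \<times> real \<Rightarrow> 'n amb" where "H q = f (\<Phi> q)"

lemma N_hypM: "x \<in> N \<Longrightarrow> x \<in> hypM s m n e"
  using openin_subset[OF open_N] by auto

lemma N_\<Phi>: "x \<in> N \<Longrightarrow> \<Phi> (fst x, Re (snd x)) = x"
  using hypM_\<Phi>[OF N_hypM] .

lemma \<Phi>_W: "q \<in> W \<longleftrightarrow> \<Phi> q \<in> N"
  by (simp add: W_def)

lemma H_hypM: "q \<in> W \<Longrightarrow> H q \<in> hypM s m n e"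
  using CR bij_betwE openin_subset[OF open_N']
  unfolding CR_mapping_def diffeo_def H_def \<Phi>_W by fastforce

lemma open_W: "open W"
proof -
  obtain T where T: "open T" "N = hypM s m n e \<inter> T" using open_N by (auto simp: openin_open)
  have "continuous_on UNIV \<Phi>" using sm_\<Phi> unfolding sm_def using Ck_on.simps(1) by blast
  then have "open (\<Phi> -` T)" using T(1) by (simp add: open_vimage)
  moreover have "\<Phi> q \<in> N \<longleftrightarrow> nondeg (fst q) \<and> \<Phi> q \<in> T" for q
    by (subst T(2)) (simp add: \<Phi>_hypM)
  then have "W = {q. nondeg (fst q)} \<inter> \<Phi> -` T" unfolding W_def by blast
  ultimately show ?thesis using open_nondeg by auto
qed

lemma connected_W: "connected W"
proof -
  have "W = (\<lambda>x. (fst x, Re (snd x))) ` N"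
  proof (intro set_eqI iffI)
    fix q assume "q \<in> W"
    moreover have "q = (fst (\<Phi> q), Re (snd (\<Phi> q)))" by (simp add: \<Phi>_def pp_pfun prod_eq_iff)
    ultimately show "q \<in> (\<lambda>x. (fst x, Re (snd x))) ` N" unfolding \<Phi>_W by blast
  next
    fix q assume "q \<in> (\<lambda>x. (fst x, Re (snd x))) ` N"
    then obtain x where "x \<in> N" "q = (fst x, Re (snd x))" by blast
    then show "q \<in> W" using N_\<Phi>[of x] by (simp only: \<Phi>_W)
  qed
  moreover have "continuous_on N (\<lambda>x. (fst x, Re (snd x)))" by (intro continuous_intros)
  from connected_continuous_image[OF this connected_N] have "connected ((\<lambda>x. (fst x, Re (snd x))) ` N)" .
  ultimately show ?thesis by (rule ssubst)
qed

lemma local_extension: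
  assumes "x \<in> N"
  obtains U g where "open U" "x \<in> U" "sm U g" "\<And>y. y \<in> N \<Longrightarrow> y \<in> U \<Longrightarrow> g y = f y"
proof -
  have "smooth_map_on f N" using CR by (simp add: CR_mapping_def diffeo_def)
  then obtain U g where "open U" "x \<in> U" "\<forall>k. Ck_on k g U" "\<forall>y\<in>N \<inter> U. g y = f y"
    unfolding smooth_map_on_def using assms by metis
  then show ?thesis using that[of U g] by (simp add: sm_def)
qed

text \<open>Smoothness on N supplies ambient extensions only locally; composed with \<Phi> they
  agree with H on open subsets of W.\<close>

lemma sm_H: "sm W H"
  unfolding sm_def
proof (intro allI Ck_on_locally)
  fix k q assume q: "q \<in> W"
  obtain U g where U: "open U" "\<Phi> q \<in> U" "sm U g" "\<And>y. y \<in> N \<Longrightarrow> y \<in> U \<Longrightarrow> g y = f y"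
    using local_extension[of "\<Phi> q"] q unfolding \<Phi>_W by metis
  have c: "continuous_on UNIV \<Phi>" using sm_\<Phi> unfolding sm_def using Ck_on.simps(1) by blast
  define V where "V = W \<inter> \<Phi> -` U"
  have oV: "open V" unfolding V_def using c U(1) open_W by (simp add: open_vimage open_Int)
  have "Ck_on k \<Phi> V" using sm_\<Phi> Ck_on_subset unfolding sm_def by blast
  then have "Ck_on k (\<lambda>q. g (\<Phi> q)) V"
    by (rule Ck_on_compose[OF oV U(1)]) (use U(3) in \<open>auto simp: V_def sm_def\<close>)
  moreover have "g (\<Phi> q) = H q" if "q \<in> V" for q using that U(4) by (simp add: H_def V_def \<Phi>_W)
  ultimately have "Ck_on k H V" by (subst Ck_on_cong[OF oV, symmetric])
  then show "\<exists>V. open V \<and> q \<in> V \<and> Ck_on k H V" using oV q U(2) by (auto simp: V_def)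
qed

text \<open>A derivative within N is a chosen one. A local extension of f shows that it exists, and
  the chain rule through \<Phi> determines it on the vectors \<open>D\<Phi> q v\<close>.\<close>

lemma pushfwd:
  assumes q: "q \<in> W"
  shows "linear (pushfwd f N (\<Phi> q))" "pushfwd f N (\<Phi> q) (D\<Phi> q v) = ddir v H q"
proof -
  obtain U g where U: "open U" "\<Phi> q \<in> U" "sm U g" "\<And>y. y \<in> N \<Longrightarrow> y \<in> U \<Longrightarrow> g y = f y"
    using local_extension[of "\<Phi> q"] q unfolding \<Phi>_W by metis
  obtain d where d: "0 < d" "ball (\<Phi> q) d \<subseteq> U" using openE[OF U(1,2)] by blast
  have "(g has_derivative (\<lambda>v. ddir v g (\<Phi> q))) (at (\<Phi> q) within N)"
    using sm_has_derivative[OF U(3,2)] has_derivative_at_withinI by blast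
  then have "(f has_derivative (\<lambda>v. ddir v g (\<Phi> q))) (at (\<Phi> q) within N)"
    by (rule has_derivative_transform_within[OF _ d(1)]) (use q d(2) U(4) in \<open>auto simp: \<Phi>_W dist_commute\<close>)
  then have D: "(f has_derivative pushfwd f N (\<Phi> q)) (at (\<Phi> q) within N)"
    unfolding pushfwd_def using frechet_derivative_works differentiable_def by blast
  show "linear (pushfwd f N (\<Phi> q))" using has_derivative_linear[OF D] .
  have "(f has_derivative pushfwd f N (\<Phi> q)) (at (\<Phi> q) within \<Phi> ` W)"
    by (rule has_derivative_subset[OF D]) (auto simp: \<Phi>_W)
  from diff_chain_within[OF has_derivative_at_withinI[OF \<Phi>_has_derivative] this]
  have "(H has_derivative (\<lambda>v. pushfwd f N (\<Phi> q) (D\<Phi> q v))) (at q)"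
    using at_within_open[OF q open_W] by (simp add: o_def H_def[abs_def])
  from ddir_eqI[OF this] show "pushfwd f N (\<Phi> q) (D\<Phi> q v) = ddir v H q" by simp
qed

definition F :: "(complex^'n) \<times> real \<Rightarrow> complex^'n" where "F q = fst (H q)"
definition G :: "(complex^'n) \<times> real \<Rightarrow> complex" where "G q = snd (H q)"

sublocale P: cr_dom bl s m W
  by unfold_locales (rule open_W)

lemma sm_comps: "sm W (\<lambda>q. F q $ \<mu>)" "sm W G"
  unfolding F_def G_def[abs_def]
  by (rule P.sm_linear_comp[OF _ sm_H], rule bounded_linear_compose[OF bounded_linear_vec_nth bounded_linear_fst]
    bounded_linear_snd)+

lemma ddir_comps:
  assumes "q \<in> W"
  shows "ddir v (\<lambda>q. F q $ \<mu>) q = fst (ddir v H q) $ \<mu>" "ddir v G q = snd (ddir v H q)"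
  using ddir_eqI[OF bounded_linear.has_derivative[OF _ sm_has_derivative[OF sm_H assms]], where v = v]
    bounded_linear_compose[OF bounded_linear_vec_nth bounded_linear_fst] bounded_linear_snd
  unfolding F_def G_def[abs_def] by blast+

text \<open>\<open>(\<xi>, 2 i pd z \<xi>)\<close> and its multiple by \<open>i\<close> are both tangent; they are the images under \<open>D\<Phi>\<close> of the two
  vectors below.\<close>

lemma complex_linear:
  assumes q: "q \<in> W"
  shows "ddir (\<i> *s \<xi>, - 2 * Re (pd (fst q) \<xi>)) H q = iJ (ddir (\<xi>, - 2 * Im (pd (fst q) \<xi>)) H q)"
proof -
  let ?p = "pd (fst q) \<xi>" and ?D = "pushfwd f N (\<Phi> q)"
  define u where "u = D\<Phi> q (\<xi>, - 2 * Im ?p)"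
  have u: "u = (\<xi>, 2 * \<i> * ?p)" by (simp add: u_def D\<Phi>_def complex_eq_iff)
  have iu: "iJ u = D\<Phi> q (\<i> *s \<xi>, - 2 * Re ?p)" by (simp add: u iJ_def D\<Phi>_def pd_scale complex_eq_iff)
  have f\<Phi>: "fst (\<Phi> q) = fst q" by (simp add: \<Phi>_def)
  have "u \<in> tangent s m n e (\<Phi> q)" "- iJ u \<in> tangent s m n e (\<Phi> q)"
    unfolding tangent_iff f\<Phi> u iJ_def
    using pd_scale[of "fst q" "- 1" "\<i> *s \<xi>"] by (simp_all add: pd_scale)
  then have "(u, - iJ u) \<in> T10 s m n e (\<Phi> q)" by (simp add: T10_def)
  from imageI[OF this, of "\<lambda>(u, v). (?D u, ?D v)"]
  have "(?D u, ?D (- iJ u)) \<in> (\<lambda>(u, v). (?D u, ?D v)) ` T10 s m n e (\<Phi> q)" by simp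
  also have "\<dots> = T10 s m n e (f (\<Phi> q))"
    using CR q by (simp only: CR_mapping_def \<Phi>_W)
  finally have "?D (- iJ u) = - iJ (?D u)" by (simp add: T10_def)
  then have "?D (iJ u) = iJ (?D u)" using linear_neg[OF pushfwd(1)[OF q]] by simp
  then show ?thesis unfolding iu unfolding u_def pushfwd(2)[OF q] .
qed

lemma ddir_combine: "q \<in> W \<Longrightarrow> sm W (g :: _ \<Rightarrow> complex) \<Longrightarrow> ddir (\<xi>, t) g q = ddir (\<xi>, 0) g q + of_real t * ddir (0, 1) g q"
proof -
  assume "q \<in> W" "sm W g"
  then have l: "linear (\<lambda>v. ddir v g q)" using sm_has_derivative has_derivative_linear by blast
  have "(\<xi>, t) = (\<xi>, 0) + t *\<^sub>R (0, 1)" by simp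
  then have "ddir (\<xi>, t) g q = ddir ((\<xi>, 0) + t *\<^sub>R (0, 1)) g q" by simp
  also have "\<dots> = ddir (\<xi>, 0) g q + t *\<^sub>R ddir (0, 1) g q" unfolding linear_add[OF l] linear_scale[OF l] ..
  finally show ?thesis by (simp add: scaleR_conv_of_real)
qed

text \<open>Complex linearity on the tangent lift of \<xi> is the CR equation once the parts along
  \<open>T\<close> are separated.\<close>

lemma CR_component:
  assumes q: "q \<in> W" and g: "sm W g"
    and J: "ddir (\<i> *s \<xi>, - 2 * Re (pd (fst q) \<xi>)) g q = \<i> * ddir (\<xi>, - 2 * Im (pd (fst q) \<xi>)) g q"
  shows "P.Zb \<xi> g q = 0"
proof -
  define p a b t where "p = pd (fst q) \<xi>" and "a = ddir (\<xi>, 0) g q" and "b = ddir (\<i> *s \<xi>, 0) g q" and "t = ddir (0, 1) g q"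
  have "b - 2 * of_real (Re p) * t = \<i> * (a - 2 * of_real (Im p) * t)"
    using J unfolding ddir_combine[OF q g, of _ "- 2 * Re _"] ddir_combine[OF q g, of _ "- 2 * Im _"]
    by (simp add: p_def a_def b_def t_def)
  then have b: "b = \<i> * (a - 2 * of_real (Im p) * t) + 2 * of_real (Re p) * t" by (simp add: algebra_simps)
  have c: "cnj p = of_real (Re p) - \<i> * of_real (Im p)" by (simp add: complex_eq_iff)
  show ?thesis
    unfolding P.Zb_def p_def[symmetric] a_def[symmetric] b_def[symmetric] t_def[symmetric] b c
    by (simp add: algebra_simps)
qed

sublocale cr_map bl s m W F G
proof
  show "connected W" by (rule connected_W)
  show "smv W F" "sm W G" using sm_comps by (auto simp: smv_def)
  show "vd (P.Zb x) F q = 0" if q: "q \<in> W" for q x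
    unfolding vec_eq_iff vd_nth zero_index
    by (intro allI CR_component[OF q sm_comps(1)]) (simp add: ddir_comps[OF q] complex_linear[OF q, simplified] iJ_def)
  show "P.Zb x G q = 0" if q: "q \<in> W" for q x
    by (rule CR_component[OF q sm_comps(2)]) (simp add: ddir_comps[OF q] complex_linear[OF q, simplified] iJ_def)
  show "nondeg (fst q)" if "q \<in> W" for q
    using that N_hypM \<Phi>_hypM unfolding \<Phi>_W by blast
  show "G q = cnj (G q) + 2 * \<i> * pp (F q)" if "q \<in> W" for q
    using H_hypM[OF that] by (auto simp: hypM_def M0_def F_def G_def pp_pfun complex_eq_iff)
  show "nondeg (F q)" if "q \<in> W" for q
    using H_hypM[OF that] by (auto simp: hypM_def nondeg_iff F_def)
  show "0 < Re (ddir (0, 1) G q - 2 * \<i> * pd (F q) (vd (ddir (0, 1)) F q))" if q: "q \<in> W" for q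
  proof -
    \<comment> \<open>(0, 1) is the image of \<open>T\<close> under the chart, and the contact form
      takes the value 1 on it, so the factor in \<open>CR_mapping\<close> can be read off
      there.\<close>
    have X: "D\<Phi> q (0, 1) = (0, 1)" by (simp add: D\<Phi>_def)
    have "(0, 1) \<in> tangent s m n e (\<Phi> q)" by (simp add: tangent_iff)
    then obtain l where l: "0 < l"
      "theta s m n e (f (\<Phi> q)) (pushfwd f N (\<Phi> q) (0, 1)) = complex_of_real l * theta s m n e (\<Phi> q) (0, 1)"
      using CR q unfolding CR_mapping_def \<Phi>_W by metis
    have "pushfwd f N (\<Phi> q) (0, 1) = ddir (0, 1) H q" using pushfwd(2)[OF q, of "(0, 1)"] by (simp add: X)
    moreover have "fst (ddir (0, 1) H q) = vd (ddir (0, 1)) F q" by (simp add: vec_eq_iff ddir_comps[OF q])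
    ultimately have "complex_of_real (Re (ddir (0, 1) G q) + 2 * Im (pd (F q) (vd (ddir (0, 1)) F q))) = of_real l"
      using l(2) unfolding theta_eq by (simp add: ddir_comps[OF q] F_def H_def)
    then have "Re (ddir (0, 1) G q) + 2 * Im (pd (F q) (vd (ddir (0, 1)) F q)) = l" by (simp only: of_real_eq_iff)
    then show ?thesis using l(1) by simp
  qed
qed

end

section \<open>Return to block coordinates\<close>

context cr_mapping
begin

lemma blk_at [simp]: "blk e z (fst (e i)) (snd (e i)) = z $ i"
  by (simp add: blk_def)

lemma of_blks_nth: "of_blks e V $ i = V (fst (e i)) (snd (e i))"
  by (simp add: of_blks_def)

lemma last_comp_eq: "last_comp (n s) t (\<lambda>k. a (inv e (s, k))) = of_real t + \<i> * (\<Sum>\<alpha> | bl \<alpha> = s. a \<alpha> * cnj (a \<alpha>))"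
  unfolding last_comp_def cnorm_sq using sum_block[of s "\<lambda>\<alpha>. a \<alpha> * cnj (a \<alpha>)"] s_ge by simp

lemma cdot_eq: "cdot (n s) v (\<lambda>k. a (inv e (s, k))) = (\<Sum>\<alpha> | bl \<alpha> = s. v (snd (e \<alpha>)) * cnj (a \<alpha>))"
proof -
  have "v k = v (snd (e (inv e (s, k))))" if "k < n s" for k using e_inv[of s k] that s_ge by simp
  then have "cdot (n s) v (\<lambda>k. a (inv e (s, k))) = (\<Sum>k<n s. v (snd (e (inv e (s, k)))) * cnj (a (inv e (s, k))))"
    unfolding cdot_def by (intro sum.cong) auto
  also have "\<dots> = (\<Sum>\<alpha> | bl \<alpha> = s. v (snd (e \<alpha>)) * cnj (a \<alpha>))"
    using sum_block[of s "\<lambda>\<alpha>. v (snd (e \<alpha>)) * cnj (a \<alpha>)"] s_ge by simp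
  finally show ?thesis .
qed

lemma blk_s: "bl \<alpha> = s \<Longrightarrow> blk e z s (snd (e \<alpha>)) = z $ \<alpha>"
  using blk_at[of z \<alpha>] by simp

lemma phi_nth:
  "fst (phi_map s n e (\<lambda>k. a (inv e (s, k))) t (z, w)) $ \<alpha> = (if bl \<alpha> = s then z $ \<alpha> + a \<alpha> else z $ \<alpha>)"
  using blk_at[of z \<alpha>] inv_e[of \<alpha>] by (auto simp: phi_map_def of_blks_nth simp del: inv_e)

lemma phi_snd:
  "snd (phi_map s n e (\<lambda>k. a (inv e (s, k))) t (z, w)) = w + (of_real t + \<i> * (\<Sum>\<alpha> | bl \<alpha> = s. a \<alpha> * cnj (a \<alpha>)))
     + 2 * \<i> * (\<Sum>\<alpha> | bl \<alpha> = s. z $ \<alpha> * cnj (a \<alpha>))"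
proof -
  have "cdot (n s) (blk e z s) (\<lambda>k. a (inv e (s, k))) = (\<Sum>\<alpha> | bl \<alpha> = s. z $ \<alpha> * cnj (a \<alpha>))"
    unfolding cdot_eq by (intro sum.cong) (simp_all add: blk_s)
  then show ?thesis by (simp add: phi_map_def last_comp_eq)
qed

lemma inversion_nth:
  "fst (inversion s m e P) $ \<alpha> = (if bl \<alpha> = s then fst P $ \<alpha> / snd P else fst P $ \<alpha> / snd P powr of_real (1 / m (bl \<alpha>)))"
  "snd (inversion s m e P) = - (1 / snd P)"
  using blk_at[of "fst P" \<alpha>] by (auto simp: inversion_def of_blks_nth case_prod_beta)

lemma delta_nth:
  "fst (delta_map s m e r P) $ \<alpha> = (if bl \<alpha> = s then of_real r * fst P $ \<alpha> else of_real (r powr (1 / m (bl \<alpha>))) * fst P $ \<alpha>)"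
  "snd (delta_map s m e r P) = of_real (r\<^sup>2) * snd P"
  using blk_at[of "fst P" \<alpha>] by (auto simp: delta_map_def of_blks_nth case_prod_beta)

context
  fixes L :: "'n \<Rightarrow> 'n \<Rightarrow> complex" and \<sigma> :: "nat \<Rightarrow> nat"
  assumes \<sigma>_s: "\<sigma> s = s" and \<sigma>_in: "\<And>j. j \<in> {1..s} \<Longrightarrow> \<sigma> j \<in> {1..s}" and n_\<sigma>: "\<And>j. j \<in> {1..s} \<Longrightarrow> n (\<sigma> j) = n j"
begin

text \<open>Rows belong to the target block j and columns to the source block \<sigma> j; the sizes
  agree because n is invariant under \<sigma>.\<close>

definition block_matrix :: "nat \<Rightarrow> nat \<Rightarrow> nat \<Rightarrow> complex"
  where "block_matrix j k l = L (inv e (j, k)) (inv e (\<sigma> j, l))"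

lemma mat_vec_block:
  "mat_vec (n (bl i)) (block_matrix (bl i)) (blk e z (\<sigma> (bl i))) (snd (e i)) = (\<Sum>\<alpha> | bl \<alpha> = \<sigma> (bl i). L i \<alpha> * z $ \<alpha>)"
proof -
  have "mat_vec (n (bl i)) (block_matrix (bl i)) (blk e z (\<sigma> (bl i))) (snd (e i))
     = (\<Sum>l<n (\<sigma> (bl i)). L i (inv e (\<sigma> (bl i), l)) * z $ inv e (\<sigma> (bl i), l))"
    unfolding mat_vec_def block_matrix_def blk_def n_\<sigma>[OF e_range(1)] by simp
  then show ?thesis using sum_block[OF \<sigma>_in[OF e_range(1)], of "\<lambda>\<alpha>. L i \<alpha> * z $ \<alpha>" i] by simp
qed

lemma unitary_block:
  assumes j: "j \<in> {1..s}"
    and L: "\<And>\<alpha> \<beta>. bl \<alpha> = \<sigma> j \<Longrightarrow> bl \<beta> = \<sigma> j \<Longrightarrow> (\<Sum>\<mu> | bl \<mu> = j. cnj (L \<mu> \<alpha>) * L \<mu> \<beta>) = (if \<alpha> = \<beta> then 1 else 0)"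
  shows "is_unitary (n j) (block_matrix j)"
  unfolding is_unitary_def
proof (intro allI impI)
  fix k l assume kl: "k < n j" "l < n j"
  let ?a = "inv e (\<sigma> j, k)" and ?b = "inv e (\<sigma> j, l)"
  have ab: "e ?a = (\<sigma> j, k)" "e ?b = (\<sigma> j, l)" using e_inv[OF \<sigma>_in[OF j]] kl n_\<sigma>[OF j] by simp_all
  have "(\<Sum>i<n j. cnj (block_matrix j i k) * block_matrix j i l) = (\<Sum>\<mu> | bl \<mu> = j. cnj (L \<mu> ?a) * L \<mu> ?b)"
    unfolding block_matrix_def using sum_block[OF j] .
  also have "\<dots> = (if ?a = ?b then 1 else 0)" using ab by (intro L) simp_all
  also have "?a = ?b \<longleftrightarrow> k = l" using ab by (metis prod.inject)
  finally show "(\<Sum>i<n j. cnj (block_matrix j i k) * block_matrix j i l) = (if k = l then 1 else 0)" .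
qed

lemma psi_nth:
  "fst (psi_map s n e \<sigma> block_matrix (\<lambda>k. b (inv e (s, k))) t P) $ i
     = (\<Sum>\<alpha> | bl \<alpha> = \<sigma> (bl i). L i \<alpha> * fst P $ \<alpha>) + (if bl i = s then b i else 0)"
proof -
  have "b (inv e (s, snd (e i))) = b i" if "bl i = s" using inv_e[of i] that by (metis prod.collapse)
  then show ?thesis
    using mat_vec_block[of i "fst P"] \<sigma>_s by (auto simp: psi_map_def of_blks_nth case_prod_beta)
qed

lemma psi_snd:
  "snd (psi_map s n e \<sigma> block_matrix (\<lambda>k. b (inv e (s, k))) t P) = of_real t + \<i> * (\<Sum>\<alpha> | bl \<alpha> = s. b \<alpha> * cnj (b \<alpha>)) + snd P
     + 2 * \<i> * (\<Sum>\<mu> | bl \<mu> = s. (\<Sum>\<alpha> | bl \<alpha> = s. L \<mu> \<alpha> * fst P $ \<alpha>) * cnj (b \<mu>))"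
proof -
  have "mat_vec (n s) (block_matrix s) (blk e (fst P) s) (snd (e \<mu>)) = (\<Sum>\<alpha> | bl \<alpha> = s. L \<mu> \<alpha> * fst P $ \<alpha>)" if "bl \<mu> = s" for \<mu>
    using mat_vec_block[of \<mu> "fst P"] that \<sigma>_s by simp
  then have "cdot (n s) (mat_vec (n s) (block_matrix s) (blk e (fst P) s)) (\<lambda>k. b (inv e (s, k)))
     = (\<Sum>\<mu> | bl \<mu> = s. (\<Sum>\<alpha> | bl \<alpha> = s. L \<mu> \<alpha> * fst P $ \<alpha>) * cnj (b \<mu>))"
    unfolding cdot_eq by (intro sum.cong) simp_all
  then show ?thesis by (simp add: psi_map_def case_prod_beta last_comp_eq)
qed

end

lemma factorization:
  "\<exists>\<sigma> (B :: nat \<Rightarrow> nat \<Rightarrow> nat \<Rightarrow> complex) (b :: nat \<Rightarrow> complex) (t1 :: real)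
      (r :: real) (a :: nat \<Rightarrow> complex) (t0 :: real) (J :: 'n amb \<Rightarrow> 'n amb).
      \<sigma> permutes {1..<s}
    \<and> (\<forall>j\<in>{1..<s}. m (\<sigma> j) = m j \<and> n (\<sigma> j) = n j)
    \<and> (\<forall>j\<in>{1..s}. is_unitary (n j) (B j))
    \<and> r > 0
    \<and> (J = id \<or> (J = inversion s m e \<and> (\<forall>x\<in>N. snd (phi_map s n e a t0 x) \<noteq> 0)))
    \<and> (\<forall>x\<in>N. f x = (psi_map s n e \<sigma> B b t1 \<circ> delta_map s m e r \<circ> J \<circ> phi_map s n e a t0) x)"
proof (cases "N = {}")
  case True
  \<comment> \<open>For empty N the conditions on points are vacuous, and identity matrices satisfy
    the others.\<close>
  have "is_unitary d (\<lambda>k l. if k = l then 1 else 0)" for d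
    unfolding is_unitary_def
  proof (intro allI impI)
    fix k l assume "k < d" "l < d"
    have "(\<Sum>i<d. cnj (if i = k then 1 else 0) * (if i = l then 1 else (0::complex))) = (\<Sum>i<d. if i = k then (if k = l then 1 else 0) else 0)"
      by (intro sum.cong refl) simp
    then show "(\<Sum>i<d. cnj (if i = k then 1 else 0) * (if i = l then 1 else (0::complex))) = (if k = l then 1 else 0)"
      using \<open>k < d\<close> by simp
  qed
  then show ?thesis
    using True permutes_id[of "{1..<s}"]
    by (intro exI[of _ id] exI[of _ "\<lambda>_ k l. if k = l then 1 else 0"] exI[of _ "\<lambda>_. 0"] exI[of _ "1::real"]) auto
next
  case False
  then obtain x0 where "x0 \<in> N" by blast
  then have q0: "(fst x0, Re (snd x0)) \<in> W" by (simp only: \<Phi>_W N_\<Phi>)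
  obtain \<tau> and L :: "'n \<Rightarrow> 'n \<Rightarrow> complex" and b :: "'n \<Rightarrow> complex" and r t1
    and X :: "(complex^'n) \<times> real \<Rightarrow> 'n \<Rightarrow> complex" and Y :: "(complex^'n) \<times> real \<Rightarrow> complex"
    and a :: "'n \<Rightarrow> complex" and t0 om
  where \<tau>: "bij_betw \<tau> {1..<s} {1..<s}" "\<tau> s = s"
    "\<And>k. k \<in> {1..<s} \<Longrightarrow> m (\<tau> k) = m k" "\<And>k. k \<in> {1..<s} \<Longrightarrow> card {\<mu>. bl \<mu> = \<tau> k} = card {\<mu>. bl \<mu> = k}"
    and r: "0 < r"
    and L: "\<And>k \<alpha> \<beta>. k \<in> {1..s} \<Longrightarrow> bl \<alpha> = k \<Longrightarrow> bl \<beta> = k \<Longrightarrow>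
       (\<Sum>\<mu> | bl \<mu> = \<tau> k. cnj (L \<mu> \<alpha>) * L \<mu> \<beta>) = (if \<alpha> = \<beta> then 1 else 0)"
    and F: "\<And>q k \<mu>. q \<in> W \<Longrightarrow> k \<in> {1..<s} \<Longrightarrow> bl \<mu> = \<tau> k \<Longrightarrow>
       F q $ \<mu> = (\<Sum>\<alpha> | bl \<alpha> = k. L \<mu> \<alpha> * (of_real (r powr (1 / m k)) * X q \<alpha>))"
    and Fs: "\<And>q \<mu>. q \<in> W \<Longrightarrow> bl \<mu> = s \<Longrightarrow> F q $ \<mu> = (\<Sum>\<alpha> | bl \<alpha> = s. L \<mu> \<alpha> * (of_real r * X q \<alpha>)) + b \<mu>"
    and G: "\<And>q. q \<in> W \<Longrightarrow> G q = of_real t1 + \<i> * (\<Sum>\<alpha> | bl \<alpha> = s. b \<alpha> * cnj (b \<alpha>)) + of_real (r\<^sup>2) * Y q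
       + 2 * \<i> * (\<Sum>\<mu> | bl \<mu> = s. (\<Sum>\<alpha> | bl \<alpha> = s. L \<mu> \<alpha> * (of_real r * X q \<alpha>)) * cnj (b \<mu>))"
    and XY: "(\<forall>\<alpha>. a \<alpha> = 0) \<and> t0 = 0 \<and> (\<forall>q\<in>W. (\<forall>\<alpha>. X q \<alpha> = fst q $ \<alpha>) \<and> Y q = of_real (snd q) + \<i> * pp (fst q)) \<or>
     (\<forall>q\<in>W. om q \<noteq> 0 \<and> om q = (of_real (snd q) + \<i> * pp (fst q)) + (of_real t0 + \<i> * (\<Sum>\<alpha> | bl \<alpha> = s. a \<alpha> * cnj (a \<alpha>)))
         + 2 * \<i> * (\<Sum>\<alpha> | bl \<alpha> = s. fst q $ \<alpha> * cnj (a \<alpha>)) \<and>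
       Y q = - (1 / om q) \<and> (\<forall>\<alpha>. X q \<alpha> = (if bl \<alpha> = s then (fst q $ \<alpha> + a \<alpha>) / om q
         else fst q $ \<alpha> / om q powr of_real (1 / m (bl \<alpha>)))))"
    by (rule normal_form[OF q0]) (rule that)
  \<comment> \<open>\<tau> maps source blocks to target blocks, whereas \<open>psi_map\<close> names
    the source of the target block j. So \<sigma> inverts \<tau> on the curved indices and is the
    identity elsewhere, as a permutation of them requires.\<close>
  define \<sigma> where "\<sigma> j = (if j \<in> {1..<s} then inv_into {1..<s} \<tau> j else j)" for j
  have "bij_betw \<sigma> {1..<s} {1..<s} \<longleftrightarrow> bij_betw (inv_into {1..<s} \<tau>) {1..<s} {1..<s}"
    by (rule bij_betw_cong) (simp add: \<sigma>_def)
  then have bij_\<sigma>: "bij_betw \<sigma> {1..<s} {1..<s}" using bij_betw_inv_into[OF \<tau>(1)] by simp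
  have perm: "\<sigma> permutes {1..<s}"
    by (rule bij_imp_permutes[OF bij_\<sigma>]) (auto simp: \<sigma>_def)
  have \<sigma>_in': "\<sigma> j \<in> {1..<s}" if "j \<in> {1..<s}" for j using bij_betwE[OF bij_\<sigma>] that by blast
  have \<sigma>_s: "\<sigma> s = s" by (simp add: \<sigma>_def)
  have \<sigma>_in: "\<sigma> j \<in> {1..s}" if "j \<in> {1..s}" for j
    using \<sigma>_in'[of j] that \<sigma>_s by (cases "j = s") auto
  have \<tau>\<sigma>: "\<tau> (\<sigma> j) = j" if "j \<in> {1..s}" for j
    using bij_betw_inv_into_right[OF \<tau>(1), of j] that \<tau>(2) \<sigma>_s by (cases "j = s") (auto simp: \<sigma>_def)
  have m_\<sigma>: "m (\<sigma> j) = m j" if "j \<in> {1..<s}" for j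
    using \<tau>(3)[OF \<sigma>_in'[OF that]] \<tau>\<sigma>[of j] that by simp
  have n_\<sigma>: "n (\<sigma> j) = n j" if "j \<in> {1..s}" for j
  proof (cases "j = s")
    case False
    then have j: "j \<in> {1..<s}" using that by simp
    have "card {\<mu>. bl \<mu> = j} = card {\<mu>. bl \<mu> = \<sigma> j}"
      using \<tau>(4)[OF \<sigma>_in'[OF j]] unfolding \<tau>\<sigma>[OF that] .
    then show ?thesis unfolding card_block[OF that] card_block[OF \<sigma>_in[OF that]] by simp
  qed (simp add: \<sigma>_s)
  have psi: "fst (psi_map s n e \<sigma> (block_matrix L \<sigma>) (\<lambda>k. b (inv e (s, k))) t1 P) $ i
       = (\<Sum>\<alpha> | bl \<alpha> = \<sigma> (bl i). L i \<alpha> * fst P $ \<alpha>) + (if bl i = s then b i else 0)"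
    "snd (psi_map s n e \<sigma> (block_matrix L \<sigma>) (\<lambda>k. b (inv e (s, k))) t1 P) = of_real t1 + \<i> * (\<Sum>\<alpha> | bl \<alpha> = s. b \<alpha> * cnj (b \<alpha>)) + snd P
       + 2 * \<i> * (\<Sum>\<mu> | bl \<mu> = s. (\<Sum>\<alpha> | bl \<alpha> = s. L \<mu> \<alpha> * fst P $ \<alpha>) * cnj (b \<mu>))" for P i
    by (rule psi_nth psi_snd; use \<sigma>_s \<sigma>_in n_\<sigma> in simp)+
  define B where "B = block_matrix L \<sigma>"
  have unit: "is_unitary (n j) (B j)" if "j \<in> {1..s}" for j
    unfolding B_def
  proof (rule unitary_block[OF \<sigma>_s \<sigma>_in n_\<sigma> that])
    show "(\<Sum>\<mu> | bl \<mu> = j. cnj (L \<mu> \<alpha>) * L \<mu> \<beta>) = (if \<alpha> = \<beta> then 1 else 0)" if "bl \<alpha> = \<sigma> j" "bl \<beta> = \<sigma> j" for \<alpha> \<beta>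
      using L[OF \<sigma>_in[OF \<open>j \<in> {1..s}\<close>] that] unfolding \<tau>\<sigma>[OF \<open>j \<in> {1..s}\<close>] .
  qed
  define b' a' where "b' k = b (inv e (s, k))" and "a' k = a (inv e (s, k))" for k
  have f: "f (\<Phi> q) = psi_map s n e \<sigma> B b' t1 (delta_map s m e r P)"
    if q: "q \<in> W" and P: "\<And>\<alpha>. fst P $ \<alpha> = X q \<alpha>" "snd P = Y q" for q and P :: "'n amb"
  proof -
    have d: "fst (delta_map s m e r P) $ \<alpha> = of_real r * X q \<alpha>" if "bl \<alpha> = s" for \<alpha>
      using that by (simp add: delta_nth P)
    have "F q $ i = fst (psi_map s n e \<sigma> B b' t1 (delta_map s m e r P)) $ i" for i
    proof (cases "bl i = s")
      case True
      have "(\<Sum>\<alpha> | bl \<alpha> = s. L i \<alpha> * (of_real r * X q \<alpha>)) = (\<Sum>\<alpha> | bl \<alpha> = s. L i \<alpha> * fst (delta_map s m e r P) $ \<alpha>)"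
        by (intro sum.cong refl) (simp add: d)
      then show ?thesis
        unfolding Fs[OF q True] B_def b'_def psi(1) True \<sigma>_s by simp
    next
      case False
      then have j: "bl i \<in> {1..<s}" using e_range(1)[of i] by auto
      have "F q $ i = (\<Sum>\<alpha> | bl \<alpha> = \<sigma> (bl i). L i \<alpha> * (of_real (r powr (1 / m (\<sigma> (bl i)))) * X q \<alpha>))"
        by (rule F[OF q \<sigma>_in'[OF j]]) (rule \<tau>\<sigma>[OF e_range(1), symmetric])
      also have "\<dots> = (\<Sum>\<alpha> | bl \<alpha> = \<sigma> (bl i). L i \<alpha> * fst (delta_map s m e r P) $ \<alpha>)"
        using \<sigma>_in'[OF j] by (intro sum.cong refl) (auto simp: delta_nth P)
      finally show ?thesis unfolding B_def b'_def psi(1) using False by simp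
    qed
    moreover have "G q = snd (psi_map s n e \<sigma> B b' t1 (delta_map s m e r P))"
    proof -
      have "(\<Sum>\<alpha> | bl \<alpha> = s. L \<mu> \<alpha> * (of_real r * X q \<alpha>)) = (\<Sum>\<alpha> | bl \<alpha> = s. L \<mu> \<alpha> * fst (delta_map s m e r P) $ \<alpha>)" for \<mu>
        by (intro sum.cong refl) (simp add: d)
      then show ?thesis unfolding G[OF q] B_def b'_def psi(2) delta_nth(2) P(2) by simp
    qed
    ultimately have "H q = psi_map s n e \<sigma> B b' t1 (delta_map s m e r P)"
      by (simp add: prod_eq_iff vec_eq_iff F_def G_def)
    then show ?thesis by (simp add: H_def)
  qed
  have ex: "\<exists>J. (J = id \<or> (J = inversion s m e \<and> (\<forall>x\<in>N. snd (phi_map s n e a' t0 x) \<noteq> 0)))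
     \<and> (\<forall>q\<in>W. (\<forall>\<alpha>. fst (J (phi_map s n e a' t0 (\<Phi> q))) $ \<alpha> = X q \<alpha>) \<and> snd (J (phi_map s n e a' t0 (\<Phi> q))) = Y q)"
    using XY
  proof (elim disjE)
    assume 1: "(\<forall>\<alpha>. a \<alpha> = 0) \<and> t0 = 0 \<and> (\<forall>q\<in>W. (\<forall>\<alpha>. X q \<alpha> = fst q $ \<alpha>) \<and> Y q = of_real (snd q) + \<i> * pp (fst q))"
    have "fst (phi_map s n e a' t0 (\<Phi> q)) $ \<alpha> = fst q $ \<alpha>"
      "snd (phi_map s n e a' t0 (\<Phi> q)) = of_real (snd q) + \<i> * pp (fst q)" for q \<alpha>
      unfolding a'_def[abs_def] \<Phi>_def phi_nth phi_snd using 1 by simp_all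
    then show ?thesis by (intro exI[of _ id]) (use 1 in simp)
  next
    assume 2: "\<forall>q\<in>W. om q \<noteq> 0 \<and> om q = (of_real (snd q) + \<i> * pp (fst q)) + (of_real t0 + \<i> * (\<Sum>\<alpha> | bl \<alpha> = s. a \<alpha> * cnj (a \<alpha>)))
         + 2 * \<i> * (\<Sum>\<alpha> | bl \<alpha> = s. fst q $ \<alpha> * cnj (a \<alpha>)) \<and>
       Y q = - (1 / om q) \<and> (\<forall>\<alpha>. X q \<alpha> = (if bl \<alpha> = s then (fst q $ \<alpha> + a \<alpha>) / om q
         else fst q $ \<alpha> / om q powr of_real (1 / m (bl \<alpha>))))"
    have om: "snd (phi_map s n e a' t0 (\<Phi> q)) = om q" if "q \<in> W" for q
      unfolding a'_def[abs_def] \<Phi>_def phi_snd using bspec[OF 2 that] by (elim conjE) (rule sym)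
    have fs: "fst (phi_map s n e a' t0 (\<Phi> q)) $ \<alpha> = (if bl \<alpha> = s then fst q $ \<alpha> + a \<alpha> else fst q $ \<alpha>)" for q \<alpha>
      unfolding a'_def[abs_def] \<Phi>_def phi_nth ..
    have "snd (phi_map s n e a' t0 x) \<noteq> 0" if "x \<in> N" for x
    proof -
      have "(fst x, Re (snd x)) \<in> W" using that by (simp only: \<Phi>_W N_\<Phi>)
      then show ?thesis using om 2 N_\<Phi>[OF that] by metis
    qed
    moreover have "fst (inversion s m e (phi_map s n e a' t0 (\<Phi> q))) $ \<alpha> = X q \<alpha>"
      "snd (inversion s m e (phi_map s n e a' t0 (\<Phi> q))) = Y q" if "q \<in> W" for q \<alpha>
      unfolding inversion_nth om[OF that] fs using 2 that by simp_all
    ultimately show ?thesis by (intro exI[of _ "inversion s m e"]) blast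
  qed
  then obtain J where J: "J = id \<or> (J = inversion s m e \<and> (\<forall>x\<in>N. snd (phi_map s n e a' t0 x) \<noteq> 0))"
    "\<And>q \<alpha>. q \<in> W \<Longrightarrow> fst (J (phi_map s n e a' t0 (\<Phi> q))) $ \<alpha> = X q \<alpha>"
    "\<And>q. q \<in> W \<Longrightarrow> snd (J (phi_map s n e a' t0 (\<Phi> q))) = Y q" by blast
  have "f x = (psi_map s n e \<sigma> B b' t1 \<circ> delta_map s m e r \<circ> J \<circ> phi_map s n e a' t0) x" if "x \<in> N" for x
  proof -
    define q where "q = (fst x, Re (snd x))"
    have x: "\<Phi> q = x" unfolding q_def by (rule N_\<Phi>[OF that])
    then have q: "q \<in> W" using that by (simp add: \<Phi>_W)
    show ?thesis using f[OF q J(2,3)[OF q]] by (simp add: x)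
  qed
  then show ?thesis
    using perm m_\<sigma> n_\<sigma> unit r J(1)
    by (intro exI[of _ \<sigma>] exI[of _ B] exI[of _ b'] exI[of _ t1] exI[of _ r] exI[of _ a'] exI[of _ t0] exI[of _ J] conjI) auto
qed

end

theorem theorem2p2:
  fixes s :: nat and m n :: "nat \<Rightarrow> nat" and e :: "'n::finite \<Rightarrow> nat \<times> nat"
    and N N' :: "'n amb set" and f :: "'n amb \<Rightarrow> 'n amb"
  assumes "1 \<le> s"
    and "\<forall>j\<in>{1..<s}. 2 \<le> m j \<and> 2 \<le> n j"
    and "m s = 1"
    and "2 \<le> (\<Sum>j\<in>{1..s}. n j)"
    and "bij_betw e UNIV (SIGMA j:{1..s}. {..<n j})"
    and "openin (top_of_set (hypM s m n e)) N" and "connected N"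
    and "openin (top_of_set (hypM s m n e)) N'" and "connected N'"
    and "CR_mapping s m n e N N' f"
  shows "\<exists>\<sigma> (B :: nat \<Rightarrow> nat \<Rightarrow> nat \<Rightarrow> complex) (b :: nat \<Rightarrow> complex) (t1 :: real)
            (r :: real) (a :: nat \<Rightarrow> complex) (t0 :: real) (J :: 'n amb \<Rightarrow> 'n amb).
      \<sigma> permutes {1..<s}
    \<and> (\<forall>j\<in>{1..<s}. m (\<sigma> j) = m j \<and> n (\<sigma> j) = n j)
    \<and> (\<forall>j\<in>{1..s}. is_unitary (n j) (B j))
    \<and> r > 0
    \<and> (J = id \<or> (J = inversion s m e \<and> (\<forall>x\<in>N. snd (phi_map s n e a t0 x) \<noteq> 0)))
    \<and> (\<forall>x\<in>N. f x = (psi_map s n e \<sigma> B b t1 \<circ> delta_map s m e r \<circ> J \<circ> phi_map s n e a t0) x)"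
proof -
  interpret cr_mapping s m n e N N' f
    by unfold_locales (use assms in auto)
  show ?thesis by (rule factorization)
qed

end
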